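(* Let $X_1,\dots,X_n$ be i.i.d. with density $f_0\in\mathcal{C}^s$ on $[0,1]$, $\frac12<s\le1$, with $c_-\le f_0\le c_+$ for some $c_-,c_+>0$. Let $T:[0,1]\times\mathbb{R}\to\mathbb{R}$ be continuous, twice differentiable in its second argument, and such that for some fixed $C,\eta>0$ and $\gamma>1/2$, $$\left|\frac{\partial T}{\partial f}(x,f)-\frac{\partial T}{\partial f}(y,f)\right|\vee|T(x,f)-T(y,f)|\le C|x-y|^\gamma,\qquad|T(x,f)|\vee\left|\frac{\partial T}{\partial f}(x,f)\right|\vee\left|\frac{\partial^2T}{\partial f^2}(x,f)\right|\le C$$ for all $x,y\in[0,1]$ and $f\in(\inf_{[0,1]}f_0-\eta,\sup_{[0,1]}f_0+\eta)$. Let $$\hat\Psi_0=\int_0^1T(x,f_0(x))dx+(\mathbb{P}_n-\mathbb{P}_0)\left[\frac{\partial T}{\partial f}(\cdot,f_0(\cdot))\right],\quad\sigma^2=\int_0^1\left(\frac{\partial T}{\partial f}(x,f_0(x))-\int_0^1\frac{\partial T}{\partial f}(y,f_0(y))f_0(y)dy\right)^2f_0(x)dx,$$ and assume $\sigma^2>0$. Let $p=2^{J+1}$ be the largest power of two not exceeding $\sqrt n/\ln^2n$, and let $Z_n=\sqrt n\left(\int_0^1T(x,f(x))dx-\hat\Psi_0\right)$. 1. If $\Pi$ is the Haar series prior $\Pi(d\theta)\propto\prod_{0\le j\le J,\,1\le k\le2^j}\exp(-H(\theta^{jk}/\sigma_j))d\theta^{jk}$ with $\sigma_j>0$, $H:\mathbb{R}\to\mathbb{R}$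 differentiable, $\|H'\|_\infty<\infty$ and $\sigma_-:=\min_{0\le j\le J}\sigma_j\gg\frac1{\sqrt p\ln^2n}$, then $$d_{BL}\left(\Pi_n\circ Z_n^{-1},\mathcal{N}(0,\sigma^2)\right)=O_p\left(p^{-(s\wedge\gamma)}\sqrt{p\ln n}+\frac{p\ln n}{\sqrt n}+\sqrt np^{-2s}+\sqrt np^{-(s+\gamma)}+\sigma_-^{-1}\sqrt{\frac pn}\right),$$ and $d_{BL}(\Pi_n\circ Z_n^{-1},\mathcal{N}(0,\sigma^2))=O_p\left(\frac1{\ln n}\right)=o_p(1)$; in particular the BvM phenomenon with centring $\hat\Psi_0$ and asymptotic variance $\sigma^2$ holds for the functional $f\mapsto\int_0^1T(x,f(x))dx$. 2. If $\Pi$ is the Dirichlet prior with parameter $m\in(0,\infty)^p$ on $\omega$, with $\|m\|_\infty=O(1)$, then $$d_{BL}\left(\Pi_n\circ Z_n^{-1},\mathcal{N}(0,\sigma^2)\right)=O_p\left(p^{-(s\wedge\gamma)}\sqrt{p\ln n}+\frac{p\ln n}{\sqrt n}+\sqrt np^{-2s}+\sqrt np^{-(s+\gamma)}\right)=O_p\left(\frac1{\ln n}\right)=o_p(1),$$ and in particular the BvM phenomenon with centring $\hat\Psi_0$ and asymptotic variance $\sigma^2$ holds for the functional $f\mapsto\int_0^1T(x,f(x))dx$.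
   Context: Histogram model. $p=2^{J+1}$; $I_\mu=[\frac{\mu-1}p,\frac\mu p)$ for $1\le\mu\le p-1$, $I_p=[\frac{p-1}p,1]$. $\mathcal{F}_p=\mathrm{span}\{\mathbf{1}_{I_\mu}\}$, with $L^2[0,1]$-orthonormal basis $\{1\}\cup\{\psi_{jk}:0\le j\le J,1\le k\le2^j\}$, where $\psi_{jk}$ are the $L^2$-normalised Haar wavelets on $[0,1]$ ($\psi_{jk}=2^{j/2}$ on the left half and $-2^{j/2}$ on the right half of the $k$-th dyadic interval of length $2^{-j}$, and $0$ elsewhere). The model is the set of strictly positive histogram densities in $\mathcal{F}_p$, parametrised either by $\theta=(\theta^{jk})\in\mathbb{R}^{p-1}$, $f_\theta=\exp(\sum_{j,k}\theta^{jk}\psi_{jk}-\psi(\theta))$ with $\psi(\theta)$ the log-normaliser, or by bin probabilities $\omega$, $h_\omega=p\sum_{\mu=1}^p\omega_\mu\mathbf{1}_{I_\mu}$, $\omega_\mu>0$, $\sum_\mu\omega_\mu=1$. The Dirichlet prior with parameter $m$ has density proportional to $\prod_{\mu=1}^p\omega_\mu^{m_\mu-1}$ in $(\omega_1,\dots,\omega_{p-1})$. Posterior: $\Pi_n(df)\propto\prod_{i=1}^nf(X_i)\,\Pi(df)$, assumed well-defined (finite normalising constant). $f$ denotes a generic histogram distributed according to $\Pi_n$, and $\Pi_n\circ Z_n^{-1}$ is the law of $Z_n(f)$ with data fixed. $\mathbb{P}_n=\frac1n\sum_{i=1}^n\delta_{X_i}$, $\mathbb{P}_0$ is the law with density $f_0$,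 and $\mu[g]=\int g\,d\mu$. Asymptotics: $n\to\infty$, with $\sigma_j$, $m$ allowed to depend on $n$ ($f_0,T,H,s,\gamma$ fixed); $a_n\ll b_n$ (equivalently $b_n\gg a_n$) means $a_n/b_n\to0$; $O_p,o_p$ are under $X^n\sim f_0^{\otimes n}$. $\mathcal{C}^s$ is the classical Hölder space on $[0,1]$. For probability measures $\mu,\nu$ on $\mathbb{R}$, $d_{BL}(\mu,\nu)=\sup\{|\int h\,d(\mu-\nu)|:\ h:\mathbb{R}\to[-1,1],\ |h(x)-h(y)|\le|x-y|\}$. The BvM phenomenon with centring $\hat\Psi_0$ and asymptotic variance $\sigma^2>0$ holds for functionals $\Phi_n$ if $d_{BL}(\Pi_n\circ(\sqrt n(\Phi_n-\hat\Psi_0))^{-1},\mathcal{N}(0,\sigma^2))=o_p(1)$. *)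

theory Defs
  imports "HOL-Probability.Probability" "HOL-Library.Landau_Symbols"
begin

text \<open>The Hoelder class of order \<open>0 < s \<le> 1\<close> on \<open>[0,1]\<close>; for \<open>s = 1\<close> it consists of the
  Lipschitz functions and hence contains all continuously differentiable ones.\<close>

definition holder_class :: "real \<Rightarrow> (real \<Rightarrow> real) set" where
  "holder_class s =
     {f. \<exists>L. \<forall>x\<in>{0..1}. \<forall>y\<in>{0..1}. \<bar>f x - f y\<bar> \<le> L * \<bar>x - y\<bar> powr s}"

definition density_law :: "(real \<Rightarrow> real) \<Rightarrow> real measure" where
  "density_law f = density (restrict_space lborel {0..1}) (\<lambda>x. ennreal (f x))"

definition sample_law :: "(real \<Rightarrow> real) \<Rightarrow> nat \<Rightarrow> (nat \<Rightarrow> real) measure" where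
  "sample_law f n = Pi\<^sub>M {1..n} (\<lambda>_. density_law f)"


text \<open>Stochastic order symbols are phrased with outer probabilities, so that no statement can
  become true merely because a non-measurable set has \<^const>\<open>measure\<close> zero by convention. For
  measurable \<open>Y n\<close> they are the usual notions.\<close>

definition outer_prob :: "'a measure \<Rightarrow> 'a set \<Rightarrow> real" where
  "outer_prob M A = (INF B\<in>{B \<in> sets M. A \<subseteq> B}. measure M B)"

definition big_Op :: "(nat \<Rightarrow> 'a measure) \<Rightarrow> (nat \<Rightarrow> 'a \<Rightarrow> real) \<Rightarrow> (nat \<Rightarrow> real) \<Rightarrow> bool" where
  "big_Op M Y r \<longleftrightarrow>
     (\<forall>\<epsilon>>0. \<exists>K. \<forall>\<^sub>F n in sequentially.
        outer_prob (M n) {x \<in> space (M n). \<bar>Y n x\<bar> > K * r n} \<le> \<epsilon>)"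

definition small_op :: "(nat \<Rightarrow> 'a measure) \<Rightarrow> (nat \<Rightarrow> 'a \<Rightarrow> real) \<Rightarrow> (nat \<Rightarrow> real) \<Rightarrow> bool" where
  "small_op M Y r \<longleftrightarrow>
     (\<forall>\<delta>>0. (\<lambda>n. outer_prob (M n) {x \<in> space (M n). \<bar>Y n x\<bar> > \<delta> * r n}) \<longlonglongrightarrow> 0)"

definition d_BL :: "real measure \<Rightarrow> real measure \<Rightarrow> real" where
  "d_BL \<mu> \<nu> =
     (SUP h\<in>{h :: real \<Rightarrow> real. (\<forall>x. h x \<in> {-1..1}) \<and> (\<forall>x y. \<bar>h x - h y\<bar> \<le> \<bar>x - y\<bar>)}.
        \<bar>(\<integral>x. h x \<partial>\<mu>) - (\<integral>x. h x \<partial>\<nu>)\<bar>)"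

definition normal_law :: "real \<Rightarrow> real \<Rightarrow> real measure" where
  "normal_law m v = density lborel (\<lambda>x. ennreal (normal_density m (sqrt v) x))"


definition bin :: "nat \<Rightarrow> nat \<Rightarrow> real set" where
  "bin p \<mu> = (if \<mu> = p then {(real p - 1) / real p .. 1}
              else {(real \<mu> - 1) / real p ..< real \<mu> / real p})"

text \<open>The two halves of the \<open>k\<close>-th dyadic interval of length \<open>2^-j\<close> are the bins number
  \<open>2k - 1\<close> and \<open>2k\<close> of the partition into \<open>2^(j+1)\<close> bins.\<close>

definition haar :: "nat \<Rightarrow> nat \<Rightarrow> real \<Rightarrow> real" where
  "haar j k x = sqrt (2 ^ j) *
     (indicat_real (bin (2 ^ (j + 1)) (2 * k - 1)) x - indicat_real (bin (2 ^ (j + 1)) (2 * k)) x)"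

definition haar_index :: "nat \<Rightarrow> (nat \<times> nat) set" where
  "haar_index J = (SIGMA j:{..J}. {1..2 ^ j})"

definition haar_series :: "nat \<Rightarrow> (nat \<times> nat \<Rightarrow> real) \<Rightarrow> real \<Rightarrow> real" where
  "haar_series J \<theta> x = (\<Sum>(j, k)\<in>haar_index J. \<theta> (j, k) * haar j k x)"

definition haar_log_normaliser :: "nat \<Rightarrow> (nat \<times> nat \<Rightarrow> real) \<Rightarrow> real" where
  "haar_log_normaliser J \<theta> = ln (LBINT x:{0..1}. exp (haar_series J \<theta> x))"

definition haar_density :: "nat \<Rightarrow> (nat \<times> nat \<Rightarrow> real) \<Rightarrow> real \<Rightarrow> real" where
  "haar_density J \<theta> x = exp (haar_series J \<theta> x - haar_log_normaliser J \<theta>)"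

text \<open>Bin probabilities are parametrised by their first \<open>p - 1\<close> coordinates.\<close>

definition bin_probs :: "nat \<Rightarrow> (nat \<Rightarrow> real) \<Rightarrow> nat \<Rightarrow> real" where
  "bin_probs p w \<mu> = (if \<mu> = p then 1 - (\<Sum>\<nu>=1..<p. w \<nu>) else w \<mu>)"

definition hist_density :: "nat \<Rightarrow> (nat \<Rightarrow> real) \<Rightarrow> real \<Rightarrow> real" where
  "hist_density p w x = real p * (\<Sum>\<mu>=1..p. bin_probs p w \<mu> * indicat_real (bin p \<mu>) x)"


text \<open>Both priors are left unnormalised (the series prior need not even be a finite measure): a
  constant factor cancels in the posterior.\<close>

definition haar_prior :: "nat \<Rightarrow> (real \<Rightarrow> real) \<Rightarrow> (nat \<Rightarrow> real) \<Rightarrow> (nat \<times> nat \<Rightarrow> real) measure" where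
  "haar_prior J H \<sigma> = density (Pi\<^sub>M (haar_index J) (\<lambda>_. lborel))
     (\<lambda>\<theta>. ennreal (\<Prod>(j, k)\<in>haar_index J. exp (- H (\<theta> (j, k) / \<sigma> j))))"

definition dirichlet_prior :: "nat \<Rightarrow> (nat \<Rightarrow> real) \<Rightarrow> (nat \<Rightarrow> real) measure" where
  "dirichlet_prior p m = density (Pi\<^sub>M {1..<p} (\<lambda>_. lborel))
     (\<lambda>w. indicator {w. \<forall>\<mu>\<in>{1..p}. bin_probs p w \<mu> > 0} w *
          ennreal (\<Prod>\<mu>=1..p. bin_probs p w \<mu> powr (m \<mu> - 1)))"

definition likelihood :: "nat \<Rightarrow> (nat \<Rightarrow> real) \<Rightarrow> (real \<Rightarrow> real) \<Rightarrow> real" where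
  "likelihood n X f = (\<Prod>i=1..n. f (X i))"

text \<open>A prior on densities is given by a measure \<open>prior\<close> on a parameter space together with the map
  \<open>dens\<close> sending a parameter to its density.\<close>

definition evidence ::
    "'a measure \<Rightarrow> ('a \<Rightarrow> real \<Rightarrow> real) \<Rightarrow> nat \<Rightarrow> (nat \<Rightarrow> real) \<Rightarrow> ennreal" where
  "evidence prior dens n X = (\<integral>\<^sup>+\<theta>. ennreal (likelihood n X (dens \<theta>)) \<partial>prior)"

definition posterior ::
    "'a measure \<Rightarrow> ('a \<Rightarrow> real \<Rightarrow> real) \<Rightarrow> nat \<Rightarrow> (nat \<Rightarrow> real) \<Rightarrow> 'a measure" where
  "posterior prior dens n X =
     density prior (\<lambda>\<theta>. ennreal (likelihood n X (dens \<theta>)) / evidence prior dens n X)"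

definition posterior_law ::
    "'a measure \<Rightarrow> ('a \<Rightarrow> real \<Rightarrow> real) \<Rightarrow> nat \<Rightarrow> (nat \<Rightarrow> real) \<Rightarrow> ((real \<Rightarrow> real) \<Rightarrow> real)
      \<Rightarrow> real measure" where
  "posterior_law prior dens n X Z = distr (posterior prior dens n X) borel (\<lambda>\<theta>. Z (dens \<theta>))"

text \<open>The normalising constant is finite with probability tending to one. Asking for almost
  sure finiteness would exclude improper priors, whose posterior can be improper when a bin is empty.\<close>

definition posterior_well_defined ::
    "(real \<Rightarrow> real) \<Rightarrow> (nat \<Rightarrow> 'a measure) \<Rightarrow> (nat \<Rightarrow> 'a \<Rightarrow> real \<Rightarrow> real) \<Rightarrow> bool" where
  "posterior_well_defined f0 prior dens \<longleftrightarrow>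
     (\<lambda>n. outer_prob (sample_law f0 n)
        {X \<in> space (sample_law f0 n). evidence (prior n) (dens n) n X = \<infinity>}) \<longlonglongrightarrow> 0"

definition bvm_phenomenon ::
    "(real \<Rightarrow> real) \<Rightarrow> (nat \<Rightarrow> 'a measure) \<Rightarrow> (nat \<Rightarrow> 'a \<Rightarrow> real \<Rightarrow> real)
      \<Rightarrow> (nat \<Rightarrow> (real \<Rightarrow> real) \<Rightarrow> real) \<Rightarrow> (nat \<Rightarrow> (nat \<Rightarrow> real) \<Rightarrow> real) \<Rightarrow> real \<Rightarrow> bool" where
  "bvm_phenomenon f0 prior dens \<Phi> \<Psi> v \<longleftrightarrow>
     small_op (sample_law f0)
       (\<lambda>n X. d_BL (posterior_law (prior n) (dens n) n X (\<lambda>f. sqrt (real n) * (\<Phi> n f - \<Psi> n X)))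
                   (normal_law 0 v))
       (\<lambda>_. 1)"


definition int_functional :: "(real \<Rightarrow> real \<Rightarrow> real) \<Rightarrow> (real \<Rightarrow> real) \<Rightarrow> real" where
  "int_functional T f = (LBINT x:{0..1}. T x (f x))"

text \<open>In the next two definitions \<open>T'\<close> is the derivative of \<open>T\<close> in its second argument.\<close>

definition efficient_centring ::
    "(real \<Rightarrow> real \<Rightarrow> real) \<Rightarrow> (real \<Rightarrow> real \<Rightarrow> real) \<Rightarrow> (real \<Rightarrow> real) \<Rightarrow> nat \<Rightarrow> (nat \<Rightarrow> real) \<Rightarrow> real" where
  "efficient_centring T T' f0 n X =
     int_functional T f0 +
     ((\<Sum>i=1..n. T' (X i) (f0 (X i))) / real n - (\<integral>x. T' x (f0 x) \<partial>density_law f0))"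

definition efficient_variance :: "(real \<Rightarrow> real \<Rightarrow> real) \<Rightarrow> (real \<Rightarrow> real) \<Rightarrow> real" where
  "efficient_variance T' f0 =
     (LBINT x:{0..1}. (T' x (f0 x) - (LBINT y:{0..1}. T' y (f0 y) * f0 y))\<^sup>2 * f0 x)"

end

theory Submission
  imports Defs "HOL-Real_Asymp.Real_Asymp"
begin

text \<open>
  Since \<open>p\<close> is within a factor two of \<open>sqrt n / (ln n)^2\<close>, the term \<open>p ln n / sqrt n\<close> is of the exact
  order \<open>1 / ln n\<close> and all claims follow from the rate \<open>1 / ln n\<close>.

  Both posteriors are quasi-invariant under the exponential tilts \<open>f \<mapsto> f exp (t e) / const\<close> with \<open>e\<close>
  constant on bins: for the Haar prior a tilt is a translation of \<open>\<theta>\<close>, for the Dirichlet prior it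
  comes from rescaling the coordinates of independent Gamma variables. Differentiating at \<open>t = 0\<close> gives an
  integration by parts (score) identity. Taking \<open>e\<close> to be the indicator of a bin bounds the
  posterior second moments of the bin probabilities by \<open>O(1 / n)\<close> in total, which by Chebyshev's
  inequality controls both the sup-norm and the \<open>L\<^sup>2\<close>-distance of \<open>f\<close> to \<open>f0\<close>. Taking \<open>e\<close> to be the bin averages of
  the score \<open>T'(x, f0 x)\<close> turns the identity into Stein's equation, up to small errors, for the
  linearised functional; its prior term is small because the Haar coefficients of a Hoelder function of
  order above \<open>1/2\<close> have uniformly bounded \<open>l\<^sup>1\<close>-norm on each level. The data enter
  only through the empirical bin frequencies and the discretisation error of the centring,
  whose second moments are elementary.
\<close>

section \<open>The Stein equation for a centred normal law\<close>

text \<open>\<open>H\<close> is merely Lipschitz and the prior may be improper, so log-concavity and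
  Laplace expansions are out of reach. The score identity sees the prior through a single
  first-order term \<open>b\<close>, and Stein's equation has a solution with bounded derivative for
  each bounded continuous test function; hence \<open>b\<close> and the fluctuation of the bin
  variance are the only errors in the normal limit of the linear part. Since the sum over bins of
  \<open>w * (1 - w)\<close> is at most 1, the second moments add up without a factor
  \<open>p\<close>. Sup-norm localisation then costs \<open>p^2 / n\<close> and the quadratic
  remainder \<open>p / sqrt n\<close>, both at most \<open>1 / (ln n)^2\<close> up to constants by
  the choice of \<open>p\<close>. A full \<open>1 / ln n\<close> is lost on the variance, through
  the parameter \<open>\<delta> = 1 / ln n\<close> of an arithmetic-geometric mean inequality.
  \<open>d_BL\<close> is a supremum over uncountably many test functions, so rather than cutting out
  events of bad data, every data-dependent term is put under one integrable envelope for Markov's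
  inequality; likewise bad parameters are paid for pointwise by the squared distance. Only samples
  of infinite evidence are set aside.\<close>

lemma gauss_kernel_integrable:
  fixes v :: real
  assumes "v > 0"
  shows "integrable lborel (\<lambda>y. exp (- y\<^sup>2 / (2 * v)))"
    and "(\<integral>y. exp (- y\<^sup>2 / (2 * v)) \<partial>lborel) = sqrt (2 * pi * v)"
proof -
  have eq: "(\<lambda>y. exp (- y\<^sup>2 / (2 * v))) = (\<lambda>y. sqrt (2 * pi * v) * normal_density 0 (sqrt v) y)"
    using assms by (auto simp: normal_density_def fun_eq_iff real_sqrt_mult)
  show "integrable lborel (\<lambda>y. exp (- y\<^sup>2 / (2 * v)))"
    unfolding eq by (intro integrable_mult_right integrable_normal_density) (use assms in auto)
  show "(\<integral>y. exp (- y\<^sup>2 / (2 * v)) \<partial>lborel) = sqrt (2 * pi * v)"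
    unfolding eq using assms by simp
qed

text \<open>Both bounds compare with the Gaussian weight at \<open>x\<close>: the first because
  \<open>(x + y)^2\<close> is at least \<open>x^2 + y^2\<close> for nonnegative \<open>x\<close> and
  \<open>y\<close>, the second because the factor \<open>x\<close> may be replaced by the larger
  \<open>y\<close> under the integral, which makes the integrand an exact derivative. In the Stein
  solution the first controls \<open>\<phi>\<close> and the second \<open>x * \<phi> x\<close>,
  hence the derivative.\<close>

lemma gauss_tail:
  fixes v x :: real
  assumes v: "v > 0" and x: "x \<ge> 0"
  shows "(LBINT y:{x..}. exp (- y\<^sup>2 / (2 * v))) \<le> sqrt (2 * pi * v) * exp (- x\<^sup>2 / (2 * v))"
    and "x * (LBINT y:{x..}. exp (- y\<^sup>2 / (2 * v))) \<le> v * exp (- x\<^sup>2 / (2 * v))"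
proof -
  define q where "q = (\<lambda>y::real. exp (- y\<^sup>2 / (2 * v)))"
  note int = gauss_kernel_integrable(1)[OF v, folded q_def]
  have [measurable]: "q \<in> borel_measurable borel" unfolding q_def by measurable
  have "(LBINT y:{x..}. q y) = (LBINT y. indicator {x..} (x + 1 * y) * q (x + 1 * y))"
    unfolding set_lebesgue_integral_def
    by (subst lborel_integral_real_affine[where c=1 and t=x]) auto
  also have "\<dots> \<le> (LBINT y. exp (- x\<^sup>2 / (2 * v)) * q y)"
  proof (rule integral_mono)
    have "integrable lborel (\<lambda>y. q (x + 1 * y))"
      by (rule lborel_integrable_real_affine[OF int]) simp
    then show "integrable lborel (\<lambda>y. indicator {x..} (x + 1 * y) * q (x + 1 * y))"
      by (rule Bochner_Integration.integrable_bound) (auto simp: indicator_def)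
    show "integrable lborel (\<lambda>y. exp (- x\<^sup>2 / (2 * v)) * q y)" using int by simp
    fix y :: real
    show "indicator {x..} (x + 1 * y) * q (x + 1 * y) \<le> exp (- x\<^sup>2 / (2 * v)) * q y"
    proof (cases "y \<ge> 0")
      case True
      have "- (x + y)\<^sup>2 / (2 * v) \<le> - x\<^sup>2 / (2 * v) + - y\<^sup>2 / (2 * v)"
        using v x True by (simp add: field_simps power2_eq_square)
      then show ?thesis using True by (simp add: q_def flip: exp_add)
    next
      case False then show ?thesis by (simp add: q_def)
    qed
  qed
  also have "\<dots> = sqrt (2 * pi * v) * exp (- x\<^sup>2 / (2 * v))"
    using gauss_kernel_integrable(2)[OF v] by (simp add: q_def)
  finally show "(LBINT y:{x..}. exp (- y\<^sup>2 / (2 * v))) \<le> sqrt (2 * pi * v) * exp (- x\<^sup>2 / (2 * v))"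
    by (simp add: q_def)
  have "(\<integral>\<^sup>+y. ennreal (y * q y) * indicator {x..} y \<partial>lborel) = ennreal (0 - (- v * q x))"
  proof (rule nn_integral_FTC_atLeast)
    show "((\<lambda>y. - v * q y) has_real_derivative y * q y) (at y)" for y
      unfolding q_def using v by (auto intro!: derivative_eq_intros simp: field_simps)
    have "filterlim (\<lambda>y::real. - 1 / (2 * v) * y\<^sup>2) at_bot at_top"
      using v by (intro filterlim_tendsto_neg_mult_at_bot[OF tendsto_const] filterlim_pow_at_top filterlim_ident) auto
    then have "(q \<longlongrightarrow> 0) at_top"
      unfolding q_def by (intro filterlim_compose[OF exp_at_bot]) simp
    then show "((\<lambda>y. - v * q y) \<longlongrightarrow> 0) at_top"
      using tendsto_mult_right_zero by blast
  qed (use x in \<open>auto simp: q_def\<close>)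
  then have nn: "(\<integral>\<^sup>+y. ennreal (y * q y) * indicator {x..} y \<partial>lborel) = ennreal (v * q x)" by simp
  have int': "integrable lborel (\<lambda>y. indicator {x..} y * q y)"
    using int by (rule Bochner_Integration.integrable_bound) (auto simp: indicator_def)
  have "ennreal (x * (LBINT y:{x..}. q y)) = (\<integral>\<^sup>+y. ennreal (x * (indicator {x..} y * q y)) \<partial>lborel)"
    using int' x unfolding set_lebesgue_integral_def
    by (subst nn_integral_eq_integral) (auto simp: q_def)
  also have "\<dots> \<le> (\<integral>\<^sup>+y. ennreal (y * q y) * indicator {x..} y \<partial>lborel)"
    using x by (intro nn_integral_mono) (auto simp: indicator_def q_def intro!: ennreal_leI mult_right_mono)
  finally show "x * (LBINT y:{x..}. exp (- y\<^sup>2 / (2 * v))) \<le> v * exp (- x\<^sup>2 / (2 * v))"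
    using v unfolding nn by (simp add: q_def ennreal_le_iff)
qed

lemma set_integral_reflect:
  fixes f :: "real \<Rightarrow> real"
  shows "(LBINT y:{..x}. f y) = (LBINT y:{- x..}. f (- y))"
  unfolding set_lebesgue_integral_def
  by (subst lborel_integral_real_affine[where c="-1" and t=0])
     (auto intro!: Bochner_Integration.integral_cong simp: indicator_def)

text \<open>Near \<open>x\<close> the integral up to \<open>x - 1\<close> is a constant summand,
  which reduces the claim to the fundamental theorem of calculus on a compact interval.\<close>

lemma has_derivative_integral_atMost:
  fixes f :: "real \<Rightarrow> real"
  assumes int: "integrable lborel f" and cont: "continuous_on UNIV f"
  shows "((\<lambda>x. LBINT y:{..x}. f y) has_real_derivative f x) (at x)"
proof -
  have si: "set_integrable lborel A f" if "A \<in> sets borel" for A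
    using integrable_mult_indicator[of A lborel f] int that unfolding set_integrable_def by simp
  have "((\<lambda>u. integral {x - 1..u} f) has_real_derivative f x) (at x within {x - 1..x + 1})"
    by (rule integral_has_real_derivative) (auto intro: continuous_on_subset[OF cont])
  then have "((\<lambda>u. integral {x - 1..u} f) has_real_derivative f x) (at x)"
    by (simp add: at_within_Icc_at)
  then have *: "((\<lambda>u. (LBINT y:{..<x - 1}. f y) + integral {x - 1..u} f) has_real_derivative f x) (at x)"
    by (auto intro!: derivative_eq_intros)
  show ?thesis
  proof (rule has_field_derivative_transform_within[OF *, of 1])
    fix u assume "dist u x < 1"
    then have u: "x - 1 \<le> u" by (auto simp: dist_real_def)
    then have "{..u} = {..<x - 1} \<union> {x - 1..u}" by auto
    then have "(LBINT y:{..u}. f y) = (LBINT y:{..<x - 1}. f y) + (LBINT y:{x - 1..u}. f y)"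
      using set_integral_Un[OF _ si si, of "{..<x-1}" "{x-1..u}"] by fastforce
    also have "(LBINT y:{x - 1..u}. f y) = integral {x - 1..u} f"
      by (rule set_borel_integral_eq_integral) (auto intro: si)
    finally show "(LBINT y:{..<x - 1}. f y) + integral {x - 1..u} f = (LBINT y:{..u}. f y)" by simp
  qed auto
qed

text \<open>Variation of constants: the solution is \<open>exp (x^2 / (2 v)) / v\<close> times the
  Gaussian-weighted integral of \<open>h - m\<close> over \<open>{..x}\<close>, and subtracting the
  mean \<open>m\<close> keeps it bounded at plus infinity. The bounds involve \<open>h\<close>
  through its sup norm; continuity of \<open>h\<close> makes the solution continuously
  differentiable, as the test functions of \<open>score_identity\<close> have to be.\<close>

lemma stein_solution:
  fixes h :: "real \<Rightarrow> real" and v :: real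
  assumes v: "v > 0" and hb: "\<And>x. \<bar>h x\<bar> \<le> 1" and hc: "continuous_on UNIV h"
  defines "m \<equiv> \<integral>x. h x \<partial>normal_law 0 v"
  obtains \<phi> \<phi>' where "\<And>x. (\<phi> has_real_derivative \<phi>' x) (at x)" "continuous_on UNIV \<phi>'"
    "\<And>x. v * \<phi>' x - x * \<phi> x = h x - m"
    "\<And>x. \<bar>\<phi> x\<bar> \<le> 2 * sqrt (2 * pi * v) / v" "\<And>x. \<bar>\<phi>' x\<bar> \<le> 4 / v"
proof -
  define q where "q = (\<lambda>y::real. exp (- y\<^sup>2 / (2 * v)))"
  have qint: "integrable lborel q" unfolding q_def by (rule gauss_kernel_integrable[OF v])
  have [measurable]: "h \<in> borel_measurable borel" "q \<in> borel_measurable borel"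
    using borel_measurable_continuous_onI[OF hc] unfolding q_def by auto
  have hq: "integrable lborel (\<lambda>y. h y * q y)"
    using qint by (rule Bochner_Integration.integrable_bound)
       (use hb in \<open>auto simp: abs_mult intro!: mult_left_le_one_le\<close>)
  have m: "m * sqrt (2 * pi * v) = (\<integral>y. h y * q y \<partial>lborel)"
  proof -
    have "m = (\<integral>x. normal_density 0 (sqrt v) x * h x \<partial>lborel)"
      unfolding m_def normal_law_def by (subst integral_density) auto
    also have "\<dots> = (\<integral>x. (1 / sqrt (2 * pi * v)) * (h x * q x) \<partial>lborel)"
      using v by (intro Bochner_Integration.integral_cong) (auto simp: normal_density_def q_def)
    finally show ?thesis using v by simp
  qed
  have mb: "\<bar>m\<bar> \<le> 1"
  proof -
    have "\<bar>\<integral>y. h y * q y \<partial>lborel\<bar> \<le> (\<integral>y. \<bar>h y * q y\<bar> \<partial>lborel)" by (rule integral_abs_bound)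
    also have "\<dots> \<le> (\<integral>y. q y \<partial>lborel)"
      by (intro integral_mono qint integrable_abs hq)
         (use hb in \<open>auto simp: abs_mult q_def intro!: mult_left_le_one_le\<close>)
    also have "\<dots> = sqrt (2 * pi * v)" unfolding q_def by (rule gauss_kernel_integrable[OF v])
    finally have "\<bar>m\<bar> * sqrt (2 * pi * v) \<le> 1 * sqrt (2 * pi * v)"
      using v unfolding m[symmetric] by (simp add: abs_mult)
    then show ?thesis using v by (subst (asm) mult_le_cancel_right) auto
  qed
  define k where "k = (\<lambda>y. (h y - m) * q y)"
  have [measurable]: "k \<in> borel_measurable borel" unfolding k_def by measurable
  have kint: "integrable lborel k" unfolding k_def left_diff_distrib using hq qint by simp
  have k0: "(\<integral>y. k y \<partial>lborel) = 0"
  proof -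
    have "(\<integral>y. k y \<partial>lborel) = (\<integral>y. h y * q y \<partial>lborel) - m * (\<integral>y. q y \<partial>lborel)"
      unfolding k_def left_diff_distrib using hq qint by simp
    also have "(\<integral>y. q y \<partial>lborel) = sqrt (2 * pi * v)" unfolding q_def by (rule gauss_kernel_integrable[OF v])
    finally show ?thesis using m by simp
  qed
  have kb: "\<bar>k y\<bar> \<le> 2 * q y" for y
    using hb[of y] mb unfolding k_def by (auto simp: abs_mult q_def)
  have kc: "continuous_on UNIV k"
    unfolding k_def q_def using hc v by (auto intro!: continuous_intros)
  have si: "set_integrable lborel A f" if "A \<in> sets borel" "integrable lborel f" for A and f :: "real \<Rightarrow> real"
    using integrable_mult_indicator[of A lborel f] that unfolding set_integrable_def by simp
  define \<Phi> where "\<Phi> = (\<lambda>x. LBINT y:{..x}. k y)"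
  have bound: "\<bar>LBINT y:A. k y\<bar> \<le> 2 * (LBINT y:A. q y)" if "A \<in> sets borel" for A
  proof -
    have "\<bar>LBINT y:A. k y\<bar> \<le> (LBINT y:A. \<bar>k y\<bar>)"
      using set_integral_norm_bound[OF si[OF that kint]] by simp
    also have "\<dots> \<le> (LBINT y:A. 2 * q y)"
      by (intro set_integral_mono si that) (use kint qint kb in auto)
    finally show ?thesis by simp
  qed
  \<comment> \<open>Since \<open>k\<close> integrates to zero, the integral over
    \<open>{..x}\<close> may be traded for the one over \<open>{x<..}\<close>. For each sign of
    \<open>x\<close> the half-line pointing away from the origin is used, so the Gaussian tail
    beyond \<open>\<bar>x\<bar>\<close> controls both.\<close>
  have \<Phi>b: "\<bar>\<Phi> x\<bar> \<le> 2 * (LBINT y:{\<bar>x\<bar>..}. q y)" for x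
  proof (cases "x \<ge> 0")
    case True
    have "UNIV = {..x} \<union> {x<..}" by auto
    then have "(LBINT y:UNIV. k y) = \<Phi> x + (LBINT y:{x<..}. k y)"
      unfolding \<Phi>_def using set_integral_Un[OF _ si si, of "{..x}" "{x<..}" k] kint by force
    moreover have "(LBINT y:UNIV. k y) = 0" using k0 by (simp add: set_lebesgue_integral_def)
    ultimately have "\<bar>\<Phi> x\<bar> = \<bar>LBINT y:{x<..}. k y\<bar>" by simp
    also have "\<dots> \<le> 2 * (LBINT y:{x<..}. q y)" by (rule bound) auto
    also have "(LBINT y:{x<..}. q y) \<le> (LBINT y:{x..}. q y)"
      using si[OF _ qint, of "{x<..}"] si[OF _ qint, of "{x..}"]
      unfolding set_lebesgue_integral_def set_integrable_def
      by (intro integral_mono) (auto simp: q_def indicator_def)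
    finally show ?thesis using True by simp
  next
    case False
    have "\<bar>\<Phi> x\<bar> \<le> 2 * (LBINT y:{..x}. q y)" unfolding \<Phi>_def by (rule bound) auto
    also have "(LBINT y:{..x}. q y) = (LBINT y:{- x..}. q (- y))" by (rule set_integral_reflect)
    finally show ?thesis using False by (simp add: q_def)
  qed
  define e where "e = (\<lambda>x::real. exp (x\<^sup>2 / (2 * v)))"
  have eq1: "e x * q x = 1" for x unfolding e_def q_def by (simp flip: exp_add)
  define \<phi> where "\<phi> = (\<lambda>x. e x * \<Phi> x / v)"
  \<comment> \<open>Read off from the equation; that it is the derivative of \<open>\<phi>\<close>
    is verified in \<open>d\<phi>\<close>. The later bound \<open>4 / v\<close> consists of 2 for
    \<open>x * \<phi> x\<close> and 1 each for \<open>h\<close> and \<open>m\<close>.\<close>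
  define \<phi>' where "\<phi>' = (\<lambda>x. (x * \<phi> x + h x - m) / v)"
  have \<phi>b: "\<bar>\<phi> x\<bar> \<le> 2 * sqrt (2 * pi * v) / v" for x
  proof -
    have "(LBINT y:{\<bar>x\<bar>..}. q y) \<le> sqrt (2 * pi * v) * q x"
      using gauss_tail(1)[OF v, of "\<bar>x\<bar>"] by (simp add: q_def)
    then have "\<bar>\<Phi> x\<bar> \<le> 2 * sqrt (2 * pi * v) * q x" using \<Phi>b[of x] by simp
    then have "e x * \<bar>\<Phi> x\<bar> \<le> e x * (2 * sqrt (2 * pi * v) * q x)" by (rule mult_left_mono) (simp add: e_def)
    also have "\<dots> = 2 * sqrt (2 * pi * v)" using eq1[of x] by (simp add: mult.left_commute)
    finally show ?thesis using v by (simp add: \<phi>_def abs_mult e_def divide_right_mono)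
  qed
  have x\<phi>b: "\<bar>x * \<phi> x\<bar> \<le> 2" for x
  proof -
    have "\<bar>x\<bar> * (LBINT y:{\<bar>x\<bar>..}. q y) \<le> v * q x"
      using gauss_tail(2)[OF v, of "\<bar>x\<bar>"] by (simp add: q_def)
    moreover have "\<bar>x\<bar> * \<bar>\<Phi> x\<bar> \<le> \<bar>x\<bar> * (2 * (LBINT y:{\<bar>x\<bar>..}. q y))"
      using \<Phi>b[of x] by (rule mult_left_mono) simp
    ultimately have "\<bar>x\<bar> * \<bar>\<Phi> x\<bar> \<le> 2 * v * q x" by linarith
    then have "e x * (\<bar>x\<bar> * \<bar>\<Phi> x\<bar>) \<le> e x * (2 * v * q x)" by (rule mult_left_mono) (simp add: e_def)
    also have "\<dots> = 2 * v" using eq1[of x] by (simp add: mult.left_commute)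
    finally show ?thesis using v by (simp add: \<phi>_def abs_mult e_def field_simps)
  qed
  have d\<Phi>: "(\<Phi> has_real_derivative k x) (at x)" for x
    unfolding \<Phi>_def by (rule has_derivative_integral_atMost[OF kint kc])
  have d\<phi>: "(\<phi> has_real_derivative \<phi>' x) (at x)" for x
  proof -
    have "(e has_real_derivative e x * (x / v)) (at x)"
      unfolding e_def using v by (auto intro!: derivative_eq_intros simp: field_simps)
    from DERIV_cdivide[OF DERIV_mult[OF this d\<Phi>], of v]
    have "(\<phi> has_real_derivative (e x * (x / v) * \<Phi> x + k x * e x) / v) (at x)"
      unfolding \<phi>_def .
    moreover have "k x * e x = (h x - m) * (e x * q x)" by (simp add: k_def)
    then have "(e x * (x / v) * \<Phi> x + k x * e x) / v = \<phi>' x"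
      unfolding eq1 \<phi>'_def \<phi>_def by simp
    ultimately show ?thesis by simp
  qed
  show thesis
  proof (rule that[of \<phi> \<phi>'])
    have "continuous_on UNIV \<phi>"
      using d\<phi> by (meson DERIV_isCont continuous_at_imp_continuous_on)
    then show "continuous_on UNIV \<phi>'" unfolding \<phi>'_def using hc v by (auto intro!: continuous_intros)
    show "v * \<phi>' x - x * \<phi> x = h x - m" for x using v by (simp add: \<phi>'_def)
    show "\<bar>\<phi>' x\<bar> \<le> 4 / v" for x
      using x\<phi>b[of x] hb[of x] mb v unfolding \<phi>'_def by (simp add: abs_divide divide_right_mono)
  qed (use d\<phi> \<phi>b in auto)
qed

section \<open>Stochastic order symbols and product measures\<close>

text \<open>In the expanded square the off-diagonal terms vanish by independence and centring, so
  only the \<open>card I\<close> diagonal ones remain.\<close>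

lemma expectation_square_sum_PiM:
  fixes h :: "'a \<Rightarrow> real" and I :: "'b set"
  assumes D: "prob_space D" and I: "finite I" and [measurable]: "h \<in> borel_measurable D"
    and B: "\<And>x. x \<in> space D \<Longrightarrow> \<bar>h x\<bar> \<le> B" and h0: "(\<integral>x. h x \<partial>D) = 0"
  shows "(\<integral>x. (\<Sum>i\<in>I. h (x i))\<^sup>2 \<partial>Pi\<^sub>M I (\<lambda>_. D)) = card I * (\<integral>x. (h x)\<^sup>2 \<partial>D)"
    and "integrable (Pi\<^sub>M I (\<lambda>_. D)) (\<lambda>x. (\<Sum>i\<in>I. h (x i))\<^sup>2)"
proof -
  interpret D: prob_space D by fact
  interpret product_prob_space "\<lambda>_. D" I by unfold_locales
  interpret P: prob_space "Pi\<^sub>M I (\<lambda>_. D)" by (intro prob_space_PiM D)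
  have hI: "integrable D h"
    by (rule D.integrable_const_bound[of _ B]) (use B in auto)
  have h2: "integrable D (\<lambda>x. h x * h x)"
  proof (rule D.integrable_const_bound[of _ "B * B"])
    have "\<bar>h x\<bar> * \<bar>h x\<bar> \<le> B * B" if "x \<in> space D" for x
      using B[OF that] by (intro mult_mono) auto
    then show "AE x in D. norm (h x * h x) \<le> B * B" by (auto simp: abs_mult)
  qed simp
  \<comment> \<open>Writes \<open>h (x i) * h (x j)\<close> as a product over all coordinates. For
    \<open>i = j\<close> the coordinate \<open>i\<close> carries both factors; otherwise a
    coordinate carrying one centred factor kills the product of integrals.\<close>
  define g where "g i j k y = (if k = i then h y else 1) * (if k = j then h y else 1)" for i j k :: 'b and y
  have gI: "integrable D (g i j k)" for i j k
    unfolding g_def using hI h2 by (cases "k = i"; cases "k = j") auto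
  have prod_g: "h (x i) * h (x j) = (\<Prod>k\<in>I. g i j k (x k))" if "i \<in> I" "j \<in> I" for i j x
    using that I by (simp add: g_def prod.distrib prod.delta)
  have int_ij: "integrable (Pi\<^sub>M I (\<lambda>_. D)) (\<lambda>x. h (x i) * h (x j))" if "i \<in> I" "j \<in> I" for i j
    unfolding prod_g[OF that] by (rule product_integrable_prod[OF I gI])
  have val_ij: "(\<integral>x. h (x i) * h (x j) \<partial>Pi\<^sub>M I (\<lambda>_. D)) = (if i = j then (\<integral>x. (h x)\<^sup>2 \<partial>D) else 0)"
    if "i \<in> I" "j \<in> I" for i j
  proof -
    have "(\<integral>x. h (x i) * h (x j) \<partial>Pi\<^sub>M I (\<lambda>_. D)) = (\<Prod>k\<in>I. \<integral>y. g i j k y \<partial>D)"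
      unfolding prod_g[OF that] by (rule product_integral_prod[OF I gI])
    also have "\<dots> = (if i = j then (\<integral>x. (h x)\<^sup>2 \<partial>D) else 0)"
    proof (cases "i = j")
      case True
      have "(\<integral>y. g i j k y \<partial>D) = (if k = i then (\<integral>x. (h x)\<^sup>2 \<partial>D) else 1)" for k
        using True by (auto simp: g_def power2_eq_square D.prob_space)
      then show ?thesis using True I that by (simp add: prod.delta)
    next
      case False
      then have "(\<integral>y. g i j i y \<partial>D) = 0" using h0 by (simp add: g_def)
      then show ?thesis using False I that by (auto intro!: prod_zero)
    qed
    finally show ?thesis .
  qed
  have eq: "(\<Sum>i\<in>I. h (x i))\<^sup>2 = (\<Sum>i\<in>I. \<Sum>j\<in>I. h (x i) * h (x j))" for x
    by (simp add: power2_eq_square sum_product)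
  show "integrable (Pi\<^sub>M I (\<lambda>_. D)) (\<lambda>x. (\<Sum>i\<in>I. h (x i))\<^sup>2)"
    unfolding eq by (intro Bochner_Integration.integrable_sum int_ij)
  have "(\<integral>x. (\<Sum>i\<in>I. h (x i))\<^sup>2 \<partial>Pi\<^sub>M I (\<lambda>_. D)) =
      (\<Sum>i\<in>I. \<Sum>j\<in>I. if i = j then (\<integral>x. (h x)\<^sup>2 \<partial>D) else 0)"
    unfolding eq by (simp add: int_ij val_ij)
  also have "\<dots> = card I * (\<integral>x. (h x)\<^sup>2 \<partial>D)" using I by simp
  finally show "(\<integral>x. (\<Sum>i\<in>I. h (x i))\<^sup>2 \<partial>Pi\<^sub>M I (\<lambda>_. D)) = card I * (\<integral>x. (h x)\<^sup>2 \<partial>D)" .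
qed

lemma outer_prob_le: "B \<in> sets M \<Longrightarrow> A \<subseteq> B \<Longrightarrow> outer_prob M A \<le> measure M B"
  unfolding outer_prob_def by (rule cINF_lower) (auto intro!: bdd_belowI[of _ 0])

lemma outer_prob_approx:
  assumes "A \<subseteq> space M" "e > 0"
  obtains B where "B \<in> sets M" "A \<subseteq> B" "measure M B < outer_prob M A + e"
proof -
  have "\<exists>x\<in>measure M ` {B \<in> sets M. A \<subseteq> B}. x < outer_prob M A + e"
    unfolding outer_prob_def using assms by (intro cInf_lessD) auto
  then show ?thesis using that by auto
qed

lemma outer_prob_mono: "A \<subseteq> B \<Longrightarrow> B \<subseteq> space M \<Longrightarrow> outer_prob M A \<le> outer_prob M B"
  unfolding outer_prob_def by (rule cINF_superset_mono) (auto intro!: bdd_belowI[of _ 0])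

lemma outer_prob_nonneg: "A \<subseteq> space M \<Longrightarrow> 0 \<le> outer_prob M A"
  unfolding outer_prob_def by (rule cINF_greatest) auto

text \<open>\<open>Y n\<close> is not assumed measurable, so Markov's inequality is applied to the
  measurable envelope \<open>R n\<close>, which is valid off a set \<open>Bad n\<close> that is
  itself treated by outer probability.\<close>

lemma big_OpI_expectation:
  fixes R :: "nat \<Rightarrow> 'a \<Rightarrow> real"
  assumes prob: "\<forall>\<^sub>F n in sequentially. prob_space (M n)"
    and Bad: "\<And>n. Bad n \<subseteq> space (M n)" "(\<lambda>n. outer_prob (M n) (Bad n)) \<longlonglongrightarrow> 0"
    and R: "\<forall>\<^sub>F n in sequentially. integrable (M n) (R n) \<and> (\<integral>x. R n x \<partial>M n) \<le> c \<and> (\<forall>x\<in>space (M n). 0 \<le> R n x)"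
    and bound: "\<forall>\<^sub>F n in sequentially. r n > 0 \<and> (\<forall>x\<in>space (M n) - Bad n. \<bar>Y n x\<bar> \<le> R n x * r n)"
  shows "big_Op M Y r"
  unfolding big_Op_def
proof (intro allI impI)
  fix \<epsilon> :: real assume \<epsilon>: "\<epsilon> > 0"
  \<comment> \<open>Makes the Markov bound \<open>c / K\<close> at most
    \<open>\<epsilon> / 2\<close>; the \<open>+ 1\<close> ensures \<open>K > 0\<close>. The other
    half is \<open>\<epsilon> / 4\<close> for the bad set and \<open>\<epsilon> / 4\<close> for the
    slack of its measurable cover \<open>B\<close>.\<close>
  define K where "K = 2 * (\<bar>c\<bar> + 1) / \<epsilon>"
  have K: "K > 0" using \<epsilon> by (simp add: K_def)
  have cK: "c / K \<le> \<epsilon> / 2" 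
  proof -
    have "c / K \<le> (\<bar>c\<bar> + 1) / K" using K by (intro divide_right_mono) auto
    also have "\<dots> = \<epsilon> / 2"
      using \<epsilon> add_nonneg_pos[of "\<bar>c\<bar>" 1] unfolding K_def by (subst divide_eq_eq) (auto simp: field_simps)
    finally show ?thesis .
  qed
  have "\<forall>\<^sub>F n in sequentially. outer_prob (M n) (Bad n) < \<epsilon> / 4"
    using Bad(2) \<epsilon> by (intro order_tendstoD) auto
  with prob R bound
  have "\<forall>\<^sub>F n in sequentially. outer_prob (M n) {x \<in> space (M n). \<bar>Y n x\<bar> > K * r n} \<le> \<epsilon>"
  proof eventually_elim
    case (elim n)
    interpret prob_space "M n" using elim by auto
    obtain B where B: "B \<in> sets (M n)" "Bad n \<subseteq> B" "measure (M n) B < outer_prob (M n) (Bad n) + \<epsilon> / 4"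
      using outer_prob_approx[OF Bad(1), of "\<epsilon> / 4" n] \<epsilon> by auto
    have [measurable]: "R n \<in> borel_measurable (M n)" using elim by auto
    have "measure (M n) {x \<in> space (M n). R n x \<ge> K} \<le> (\<integral>x. R n x \<partial>M n) / K"
      by (rule integral_Markov_inequality_measure[of _ _ "{}"]) (use elim K in auto)
    also have "\<dots> \<le> c / K" using elim K by (intro divide_right_mono) auto
    also note cK
    finally have m: "measure (M n) {x \<in> space (M n). R n x \<ge> K} \<le> \<epsilon> / 2" .
    have "outer_prob (M n) {x \<in> space (M n). \<bar>Y n x\<bar> > K * r n}
        \<le> measure (M n) (B \<union> {x \<in> space (M n). R n x \<ge> K})"
    proof (rule outer_prob_le)
      show "{x \<in> space (M n). \<bar>Y n x\<bar> > K * r n} \<subseteq> B \<union> {x \<in> space (M n). R n x \<ge> K}"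
      proof
        fix x assume x: "x \<in> {x \<in> space (M n). \<bar>Y n x\<bar> > K * r n}"
        show "x \<in> B \<union> {x \<in> space (M n). R n x \<ge> K}"
        proof (cases "x \<in> Bad n")
          case False
          then have "\<bar>Y n x\<bar> \<le> R n x * r n" using elim x by blast
          then have "K * r n < R n x * r n" using x by auto
          then show ?thesis using elim x by (auto simp: mult_less_cancel_right)
        qed (use B in auto)
      qed
    qed (use B in measurable)
    also have "\<dots> \<le> measure (M n) B + measure (M n) {x \<in> space (M n). R n x \<ge> K}"
      by (rule measure_Un_le) (use B in measurable)
    also have "\<dots> \<le> \<epsilon>" using B m elim by auto
    finally show ?case .
  qed
  then show "\<exists>K. \<forall>\<^sub>F n in sequentially. outer_prob (M n) {x \<in> space (M n). \<bar>Y n x\<bar> > K * r n} \<le> \<epsilon>"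
    by blast
qed

lemma big_Op_weaken:
  assumes Y: "big_Op M Y r" and r: "\<forall>\<^sub>F n in sequentially. 0 \<le> r n \<and> r n \<le> c * r' n" and c: "c > 0"
  shows "big_Op M Y r'"
  unfolding big_Op_def
proof (intro allI impI)
  fix \<epsilon> :: real assume "\<epsilon> > 0"
  then obtain K where K: "\<forall>\<^sub>F n in sequentially. outer_prob (M n) {x \<in> space (M n). \<bar>Y n x\<bar> > K * r n} \<le> \<epsilon>"
    using Y unfolding big_Op_def by blast
  \<comment> \<open>The constant obtained from \<open>big_Op\<close> may be negative, so its
    absolute value is the one to rescale.\<close>
  from K r have "\<forall>\<^sub>F n in sequentially. outer_prob (M n) {x \<in> space (M n). \<bar>Y n x\<bar> > \<bar>K\<bar> * c * r' n} \<le> \<epsilon>"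
  proof eventually_elim
    case (elim n)
    have "K * r n \<le> \<bar>K\<bar> * r n" using elim by (intro mult_right_mono) auto
    also have "\<dots> \<le> \<bar>K\<bar> * (c * r' n)" using elim by (intro mult_left_mono) auto
    finally have "outer_prob (M n) {x \<in> space (M n). \<bar>Y n x\<bar> > \<bar>K\<bar> * c * r' n}
        \<le> outer_prob (M n) {x \<in> space (M n). \<bar>Y n x\<bar> > K * r n}"
      by (intro outer_prob_mono) auto
    then show ?case using elim by simp
  qed
  then show "\<exists>K. \<forall>\<^sub>F n in sequentially. outer_prob (M n) {x \<in> space (M n). \<bar>Y n x\<bar> > K * r' n} \<le> \<epsilon>"
    by blast
qed

lemma small_op_of_big_Op:
  assumes Y: "big_Op M Y r" and r: "r \<longlonglongrightarrow> 0"
  shows "small_op M Y (\<lambda>_. 1)"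
  unfolding small_op_def
proof (intro allI impI)
  fix \<delta> :: real assume \<delta>: "\<delta> > 0"
  show "(\<lambda>n. outer_prob (M n) {x \<in> space (M n). \<bar>Y n x\<bar> > \<delta> * 1}) \<longlonglongrightarrow> 0"
  proof (rule order_tendstoI)
    fix a :: real assume "a < 0"
    then show "\<forall>\<^sub>F n in sequentially. a < outer_prob (M n) {x \<in> space (M n). \<bar>Y n x\<bar> > \<delta> * 1}"
      by (intro always_eventually allI less_le_trans[OF _ outer_prob_nonneg]) auto
  next
    fix a :: real assume a: "0 < a"
    then obtain K where K: "\<forall>\<^sub>F n in sequentially. outer_prob (M n) {x \<in> space (M n). \<bar>Y n x\<bar> > K * r n} \<le> a / 2"
      using Y unfolding big_Op_def by (meson half_gt_zero)
    have "(\<lambda>n. K * r n) \<longlonglongrightarrow> 0" using tendsto_mult_right_zero[OF r] .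
    then have "\<forall>\<^sub>F n in sequentially. K * r n < \<delta>" using \<delta> by (intro order_tendstoD) auto
    with K show "\<forall>\<^sub>F n in sequentially. outer_prob (M n) {x \<in> space (M n). \<bar>Y n x\<bar> > \<delta> * 1} < a"
    proof eventually_elim
      case (elim n)
      have "outer_prob (M n) {x \<in> space (M n). \<bar>Y n x\<bar> > \<delta> * 1}
        \<le> outer_prob (M n) {x \<in> space (M n). \<bar>Y n x\<bar> > K * r n}"
        using elim by (intro outer_prob_mono) auto
      then show ?case using elim a by simp
    qed
  qed
qed

text \<open>A real \<open>SUP\<close> is meaningful for a set bounded above; the hypothesis supplies
  that bound, and the zero test function gives nonnegativity, so the absolute value is controlled as
  well.\<close>

lemma d_BL_le:
  assumes "\<And>h :: real \<Rightarrow> real. (\<And>x. \<bar>h x\<bar> \<le> 1) \<Longrightarrow> (\<And>x y. \<bar>h x - h y\<bar> \<le> \<bar>x - y\<bar>) \<Longrightarrow>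
      \<bar>(\<integral>x. h x \<partial>\<mu>) - (\<integral>x. h x \<partial>\<nu>)\<bar> \<le> B"
  shows "\<bar>d_BL \<mu> \<nu>\<bar> \<le> B"
proof -
  let ?H = "{h :: real \<Rightarrow> real. (\<forall>x. h x \<in> {-1..1}) \<and> (\<forall>x y. \<bar>h x - h y\<bar> \<le> \<bar>x - y\<bar>)}"
  have b: "\<bar>(\<integral>x. h x \<partial>\<mu>) - (\<integral>x. h x \<partial>\<nu>)\<bar> \<le> B" if "h \<in> ?H" for h
    using that by (intro assms) (auto simp: abs_le_iff minus_le_iff)
  have z: "(\<lambda>_. 0) \<in> ?H" by auto
  have "d_BL \<mu> \<nu> \<le> B" unfolding d_BL_def 
  proof (rule cSUP_least)
    show "?H \<noteq> {}" using z by (metis empty_iff)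
  qed (rule b)
  moreover have "0 \<le> d_BL \<mu> \<nu>"
    unfolding d_BL_def by (rule cSUP_upper2[OF _ z]) (rule bdd_aboveI2[OF b], simp_all)
  ultimately show ?thesis by simp
qed

text \<open>Product Lebesgue measure is determined by its values on boxes, where the claim is the
  one-dimensional affine rule in each coordinate. It serves for translations (\<open>c = 1\<close>,
  Haar prior) and for coordinatewise scalings (\<open>a = 0\<close>, Dirichlet prior).\<close>

lemma nn_integral_PiM_affine:
  fixes a c :: "'i \<Rightarrow> real"
  assumes I: "finite I" and c: "\<And>i. i \<in> I \<Longrightarrow> c i > 0"
    and [measurable]: "f \<in> borel_measurable (Pi\<^sub>M I (\<lambda>_. lborel))"
  shows "(\<integral>\<^sup>+x. f x \<partial>Pi\<^sub>M I (\<lambda>_. lborel)) =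
    ennreal (\<Prod>i\<in>I. c i) * (\<integral>\<^sup>+x. f (\<lambda>i\<in>I. a i + c i * x i) \<partial>Pi\<^sub>M I (\<lambda>_. lborel))"
proof -
  let ?L = "Pi\<^sub>M I (\<lambda>_. lborel :: real measure)"
  interpret product_sigma_finite "\<lambda>_::'i. lborel :: real measure" by unfold_locales
  let ?T = "\<lambda>x. \<lambda>i\<in>I. a i + c i * x i"
  have T[measurable]: "?T \<in> ?L \<rightarrow>\<^sub>M ?L" by (intro measurable_restrict) measurable
  have "scale_measure (ennreal (\<Prod>i\<in>I. c i)) (distr ?L ?L ?T) = ?L"
  proof (rule PiM_eqI[OF I])
    fix A :: "'i \<Rightarrow> real set" assume A: "\<And>i. i \<in> I \<Longrightarrow> A i \<in> sets lborel"
    have m: "(\<lambda>x. a i + c i * x) -` A i \<in> sets lborel" if "i \<in> I" for i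
      using measurable_sets[of "\<lambda>x. a i + c i * x" borel borel "A i"] A[OF that] by simp
    have aff: "emeasure lborel (A i) = ennreal (c i) * emeasure lborel ((\<lambda>x. a i + c i * x) -` A i)"
      if "i \<in> I" for i
      using A[OF that] c[OF that]
      by (subst lborel_real_affine[of "c i" "a i"])
         (auto simp: emeasure_density emeasure_distr nn_integral_cmult simp del: nn_integral_indicator
           , simp add: emeasure_distr)
    have "emeasure (distr ?L ?L ?T) (Pi\<^sub>E I A) = emeasure ?L (?T -` (Pi\<^sub>E I A) \<inter> space ?L)"
      using A I by (intro emeasure_distr T sets_PiM_I_finite) auto
    also have "?T -` (Pi\<^sub>E I A) \<inter> space ?L = (\<Pi>\<^sub>E i\<in>I. (\<lambda>x. a i + c i * x) -` A i)"
      by (auto simp: space_PiM PiE_iff)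
    also have "emeasure ?L \<dots> = (\<Prod>i\<in>I. emeasure lborel ((\<lambda>x. a i + c i * x) -` A i))"
      by (rule emeasure_PiM[OF I m])
    finally have "emeasure (distr ?L ?L ?T) (Pi\<^sub>E I A) = \<dots>" .
    moreover have "ennreal (\<Prod>i\<in>I. c i) = (\<Prod>i\<in>I. ennreal (c i))"
      using c by (intro prod_ennreal[symmetric]) (auto simp: less_imp_le)
    ultimately show "emeasure (scale_measure (ennreal (\<Prod>i\<in>I. c i)) (distr ?L ?L ?T)) (Pi\<^sub>E I A) =
        (\<Prod>i\<in>I. emeasure lborel (A i))"
      using aff by (simp add: prod.distrib)
  qed simp
  then have "(\<integral>\<^sup>+x. f x \<partial>?L) = (\<integral>\<^sup>+x. f x \<partial>scale_measure (ennreal (\<Prod>i\<in>I. c i)) (distr ?L ?L ?T))" by simp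
  also have "\<dots> = ennreal (\<Prod>i\<in>I. c i) * (\<integral>\<^sup>+x. f x \<partial>distr ?L ?L ?T)"
    by (rule nn_integral_scale_measure) simp
  finally show ?thesis by (simp add: nn_integral_distr)
qed

section \<open>Bins and Haar wavelets\<close>

text \<open>Bins are counted from 1, and \<open>min p\<close> sends the right end point
  \<open>x = 1\<close>, where the floor already equals \<open>p\<close>, into the last, closed
  bin.\<close>

definition bin_index :: "nat \<Rightarrow> real \<Rightarrow> nat" where
  "bin_index p x = min p (nat \<lfloor>real p * x\<rfloor> + 1)"

definition bin_average :: "nat \<Rightarrow> (real \<Rightarrow> real) \<Rightarrow> nat \<Rightarrow> real" where
  "bin_average p g \<mu> = real p * (LBINT y:bin p \<mu>. g y)"

lemma bin_subset: "p > 0 \<Longrightarrow> \<mu> \<in> {1..p} \<Longrightarrow> bin p \<mu> \<subseteq> {0..1}"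
proof
  fix x assume p: "p > 0" and \<mu>: "\<mu> \<in> {1..p}" and x: "x \<in> bin p \<mu>"
  have "0 \<le> (real \<mu> - 1) / real p" "real \<mu> / real p \<le> 1" using p \<mu> by auto
  moreover have "(real \<mu> - 1) / real p \<le> x" "x \<le> 1" using x \<open>real \<mu> / real p \<le> 1\<close> by (auto simp: bin_def split: if_splits)
  ultimately show "x \<in> {0..1}" by auto
qed

lemma bin_sets[measurable]: "bin p \<mu> \<in> sets borel" "bin p \<mu> \<in> sets lborel"
  by (auto simp: bin_def)

lemma bin_index_range: "p > 0 \<Longrightarrow> bin_index p x \<in> {1..p}"
  by (auto simp: bin_index_def)

lemma mem_bin_iff:
  assumes p: "p > 0" and x: "x \<in> {0..1}" and \<mu>: "\<mu> \<in> {1..p}"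
  shows "x \<in> bin p \<mu> \<longleftrightarrow> \<mu> = bin_index p x"
proof -
  have f0: "0 \<le> \<lfloor>real p * x\<rfloor>" using x by auto
  have fp: "real p * x \<le> real p" using x by (simp add: mult_left_le)
  then have fp': "\<lfloor>real p * x\<rfloor> \<le> int p" by (simp add: floor_le_iff)
  show ?thesis
  proof (cases "\<mu> = p")
    case True
    have "x \<in> bin p \<mu> \<longleftrightarrow> real p - 1 \<le> real p * x"
      using True x p by (auto simp: bin_def field_simps)
    also have "\<dots> \<longleftrightarrow> int p - 1 \<le> \<lfloor>real p * x\<rfloor>" by (simp add: le_floor_iff)
    also have "\<dots> \<longleftrightarrow> \<mu> = bin_index p x"
    proof -
      have "(int p - 1 \<le> F) = (p = min p (nat F + 1))" if "0 \<le> F" for F :: int using that by arith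
      from this[OF f0] show ?thesis unfolding bin_index_def True .
    qed
    finally show ?thesis .
  next
    case False
    have "x \<in> bin p \<mu> \<longleftrightarrow> real \<mu> - 1 \<le> real p * x \<and> real p * x < real \<mu>"
      using False p by (auto simp: bin_def field_simps)
    also have "\<dots> \<longleftrightarrow> \<lfloor>real p * x\<rfloor> = int \<mu> - 1" by (simp add: floor_eq_iff)
    also have "\<dots> \<longleftrightarrow> \<mu> = bin_index p x"
    proof -
      have "(F = int \<mu> - 1) = (\<mu> = min p (nat F + 1))" if "0 \<le> F" "F \<le> int p" for F :: int
        using that False \<mu> by auto
      from this[OF f0 fp'] show ?thesis unfolding bin_index_def .
    qed
    finally show ?thesis .
  qed
qed

lemma indicator_bin:
  "p > 0 \<Longrightarrow> x \<in> {0..1} \<Longrightarrow> \<mu> \<in> {1..p} \<Longrightarrow>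
    indicat_real (bin p \<mu>) x = (if \<mu> = bin_index p x then 1 else 0)"
  using mem_bin_iff by (auto simp: indicator_def)

lemma sum_indicator_bin:
  assumes "p > 0" "x \<in> {0..1}"
  shows "(\<Sum>\<mu>=1..p. c \<mu> * indicat_real (bin p \<mu>) x) = c (bin_index p x)"
proof -
  have "(\<Sum>\<mu>=1..p. c \<mu> * indicat_real (bin p \<mu>) x) = (\<Sum>\<mu>=1..p. if \<mu> = bin_index p x then c \<mu> else 0)"
    using assms by (intro sum.cong) (auto simp: indicator_bin)
  also have "\<dots> = c (bin_index p x)" using bin_index_range[OF assms(1), of x] by (simp add: sum.delta)
  finally show ?thesis .
qed

text \<open>Doubling turns the floor \<open>k - 1\<close> into \<open>2 * (k - 1)\<close> or
  \<open>2 * (k - 1) + 1\<close>, that is, into the index \<open>2 * k - 1\<close> of the left half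
  or \<open>2 * k\<close> of the right half.\<close>

lemma bin_index_double:
  assumes q: "q > 0" and x: "x \<in> {0..1}"
  shows "bin_index (2 * q) x = 2 * bin_index q x - 1 \<or> bin_index (2 * q) x = 2 * bin_index q x"
proof -
  define z where "z = real q * x"
  have z: "0 \<le> z" "z \<le> real q" using x by (auto simp: z_def mult_left_le)
  have fl: "\<lfloor>2 * z\<rfloor> = 2 * \<lfloor>z\<rfloor> \<or> \<lfloor>2 * z\<rfloor> = 2 * \<lfloor>z\<rfloor> + 1" by linarith
  have f0: "0 \<le> \<lfloor>z\<rfloor>" "\<lfloor>z\<rfloor> \<le> int q" using z by (auto simp: floor_le_iff)
  have zz: "real (2 * q) * x = 2 * z" by (simp add: z_def)
  have "min (2 * q) (nat G + 1) = 2 * min q (nat F + 1) - 1 \<or> min (2 * q) (nat G + 1) = 2 * min q (nat F + 1)"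
    if G: "G = 2 * F \<or> G = 2 * F + 1" and F: "0 \<le> F" "F \<le> int q" for F G :: int
  proof -
    obtain a where a: "F = int a" by (rule nonneg_int_cases[OF F(1)])
    have "nat (2 * F) = 2 * a" "nat (2 * F + 1) = 2 * a + 1" "nat F = a" "a \<le> q" using F a by auto
    then show ?thesis using G by (auto simp: min_def)
  qed
  from this[OF fl f0] show ?thesis unfolding bin_index_def zz z_def[symmetric] .
qed

lemma emeasure_bin: "p > 0 \<Longrightarrow> emeasure lborel (bin p \<mu>) = ennreal (1 / real p)"
  by (auto simp: bin_def divide_right_mono diff_divide_distrib)

lemma measure_bin: "p > 0 \<Longrightarrow> measure lborel (bin p \<mu>) = 1 / real p"
  by (simp add: measure_def emeasure_bin)

lemma set_integrable_bin:
  fixes g :: "real \<Rightarrow> real"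
  shows "set_integrable lborel {0..1} g \<Longrightarrow> p > 0 \<Longrightarrow> \<mu> \<in> {1..p} \<Longrightarrow> set_integrable lborel (bin p \<mu>) g"
  by (rule set_integrable_subset) (use bin_subset[of p \<mu>] in auto)

lemma integral_split_bins:
  fixes g :: "real \<Rightarrow> real"
  assumes "set_integrable lborel {0..1} g" "p > 0"
  shows "(LBINT x:{0..1}. g x) = (\<Sum>\<mu>=1..p. LBINT x:bin p \<mu>. g x)"
proof -
  have ind: "indicat_real {0..1} x = (\<Sum>\<mu>=1..p. indicat_real (bin p \<mu>) x)" for x
  proof (cases "x \<in> {0..1}")
    case True
    then show ?thesis using sum_indicator_bin[OF assms(2) True, of "\<lambda>_. 1"] by simp
  next
    case False
    then have "x \<notin> bin p \<mu>" if "\<mu> \<in> {1..p}" for \<mu> using bin_subset[OF assms(2) that] by auto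
    then show ?thesis using False by simp
  qed
  have "integrable lborel (\<lambda>x. indicat_real (bin p \<mu>) x * g x)" if "\<mu> \<in> {1..p}" for \<mu>
    using set_integrable_bin[OF assms that] by (simp add: set_integrable_def)
  then show ?thesis
    unfolding set_lebesgue_integral_def real_scaleR_def ind sum_distrib_right
    by (intro Bochner_Integration.integral_sum) auto
qed

lemma bin_average_bound:
  assumes g: "set_integrable lborel (bin p \<mu>) g" and p: "p > 0"
    and d: "\<And>y. y \<in> bin p \<mu> \<Longrightarrow> \<bar>g y - c\<bar> \<le> d"
  shows "\<bar>bin_average p g \<mu> - c\<bar> \<le> d"
proof -
  have const: "set_integrable lborel (bin p \<mu>) (\<lambda>_. a)" for a :: real
    unfolding set_integrable_def using emeasure_bin[OF p, of \<mu>] by simp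
  have [simp]: "(LBINT y:bin p \<mu>. a) = a / real p" for a :: real
    using emeasure_bin[OF p, of \<mu>] p measure_bin[OF p, of \<mu>]
    by (subst set_integral_const) auto
  have "(LBINT y:bin p \<mu>. g y) \<le> (LBINT y:bin p \<mu>. c + d)"
    by (rule set_integral_mono[OF g const]) (use d in fastforce)
  moreover have "(LBINT y:bin p \<mu>. c - d) \<le> (LBINT y:bin p \<mu>. g y)"
    by (rule set_integral_mono[OF const g]) (use d in fastforce)
  ultimately show ?thesis
    using p unfolding bin_average_def by (simp add: field_simps abs_le_iff)
qed

section \<open>Dyadic averages and Haar coefficients\<close>

lemma bin_halves:
  assumes q: "q > 0" and k: "k \<in> {1..q}"
  shows "bin (2 * q) (2 * k - 1) \<union> bin (2 * q) (2 * k) = bin q k"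
    "bin (2 * q) (2 * k - 1) \<inter> bin (2 * q) (2 * k) = {}"
proof -
  have *: "x \<in> bin (2 * q) (2 * k - 1) \<or> x \<in> bin (2 * q) (2 * k) \<longleftrightarrow> x \<in> bin q k"
     "\<not> (x \<in> bin (2 * q) (2 * k - 1) \<and> x \<in> bin (2 * q) (2 * k))" for x
  proof -
    have sub: "bin (2 * q) (2 * k - 1) \<subseteq> {0..1}" "bin (2 * q) (2 * k) \<subseteq> {0..1}" "bin q k \<subseteq> {0..1}"
      using q k by (intro bin_subset; simp; linarith)+
    have r: "2 * k - 1 \<in> {1..2 * q}" "2 * k \<in> {1..2 * q}" using k by auto
    have nat: "((2 * k - 1 = i \<or> 2 * k = i) \<longleftrightarrow> k = l) \<and> \<not> (2 * k - 1 = i \<and> 2 * k = i)"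
      if "i = 2 * l - 1 \<or> i = 2 * l" "1 \<le> l" for i l :: nat using that k by auto
    have "(x \<in> bin (2 * q) (2 * k - 1) \<or> x \<in> bin (2 * q) (2 * k) \<longleftrightarrow> x \<in> bin q k) \<and>
       \<not> (x \<in> bin (2 * q) (2 * k - 1) \<and> x \<in> bin (2 * q) (2 * k))"
    proof (cases "x \<in> {0..1}")
      case True
      have l: "1 \<le> bin_index q x" using bin_index_range[OF q] by auto
      show ?thesis
        using nat[OF bin_index_double[OF q True] l] mem_bin_iff[OF _ True r(1)] mem_bin_iff[OF _ True r(2)]
          mem_bin_iff[OF q True k] q by simp
    next
      case False
      then show ?thesis using sub by blast
    qed
    then show "x \<in> bin (2 * q) (2 * k - 1) \<or> x \<in> bin (2 * q) (2 * k) \<longleftrightarrow> x \<in> bin q k"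
      "\<not> (x \<in> bin (2 * q) (2 * k - 1) \<and> x \<in> bin (2 * q) (2 * k))" by blast+
  qed
  from * show "bin (2 * q) (2 * k - 1) \<union> bin (2 * q) (2 * k) = bin q k"
    "bin (2 * q) (2 * k - 1) \<inter> bin (2 * q) (2 * k) = {}" by blast+
qed

text \<open>This is the martingale property of dyadic averages, on which the Haar expansion
  rests.\<close>

lemma bin_average_halves:
  assumes g: "set_integrable lborel {0..1} g" and q: "q > 0" and k: "k \<in> {1..q}"
  shows "bin_average q g k = (bin_average (2 * q) g (2 * k - 1) + bin_average (2 * q) g (2 * k)) / 2"
proof -
  have i: "set_integrable lborel (bin (2 * q) (2 * k - 1)) g" "set_integrable lborel (bin (2 * q) (2 * k)) g"
    using q k by (intro set_integrable_bin[OF g]; auto)+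
  show ?thesis
    unfolding bin_average_def bin_halves(1)[OF q k, symmetric]
    by (subst set_integral_Un[OF bin_halves(2)[OF q k] i]) (simp add: algebra_simps)
qed

text \<open>At a given point one wavelet per level is nonzero, and the parity of the finer bin index
  tells the left half (odd, positive value) from the right half.\<close>

lemma haar_eq:
  assumes x: "x \<in> {0..1}" and k: "k \<in> {1..2 ^ j}"
  shows "haar j k x = (if k = bin_index (2 ^ j) x
    then sqrt (2 ^ j) * (if odd (bin_index (2 ^ Suc j) x) then 1 else - 1) else 0)"
proof -
  let ?i = "bin_index (2 * 2 ^ j) x" and ?k = "bin_index (2 ^ j) x"
  have k1: "?k \<ge> 1" using bin_index_range[of "2 ^ j" x] by auto
  have "2 * k - 1 \<in> {1..2 * 2 ^ j}" "2 * k \<in> {1..2 * 2 ^ j}" using k by auto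
  then have "haar j k x = sqrt (2 ^ j) * ((if 2 * k - 1 = ?i then 1 else 0) - (if 2 * k = ?i then 1 else 0))"
    unfolding haar_def using x by (simp add: indicator_bin)
  moreover have "?i = 2 * ?k - 1 \<or> ?i = 2 * ?k" using bin_index_double[of "2 ^ j" x] x by simp
  then have "(if 2 * k - 1 = ?i then 1 else 0) - (if 2 * k = ?i then 1 else 0) =
      (if k = ?k then (if odd ?i then 1 else - 1) else (0 :: real))"
  proof
    assume i: "?i = 2 * ?k - 1"
    moreover have "odd (2 * ?k - 1)" "2 * k - 1 = 2 * ?k - 1 \<longleftrightarrow> k = ?k" "2 * k \<noteq> 2 * ?k - 1"
      using k1 k by (auto, presburger)
    ultimately show ?thesis unfolding i by simp
  next
    assume i: "?i = 2 * ?k"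
    moreover have "2 * k - 1 \<noteq> 2 * ?k" using k1 k by (auto, presburger)
    ultimately show ?thesis unfolding i by simp
  qed
  ultimately show ?thesis by simp
qed

text \<open>This is the inner product of \<open>g\<close> with \<open>haar j k\<close>: the integral
  over a half is the average there times \<open>2^-(j+1)\<close>, and the height
  \<open>sqrt (2^j)\<close> turns this factor into \<open>1 / (2 * sqrt (2^j))\<close>.\<close>

definition haar_coeff :: "(real \<Rightarrow> real) \<Rightarrow> nat \<times> nat \<Rightarrow> real" where
  "haar_coeff g = (\<lambda>(j, k). (bin_average (2 ^ Suc j) g (2 * k - 1) - bin_average (2 ^ Suc j) g (2 * k))
      / (2 * sqrt (2 ^ j)))"

text \<open>Each level contributes the martingale difference of consecutive dyadic averages, so the
  sum telescopes. Hence shifting \<open>\<theta>\<close> by \<open>t\<close> times the Haar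
  coefficients of \<open>g\<close> adds \<open>t\<close> times the bin averages of \<open>g\<close>
  to the log-density, up to a constant.\<close>

lemma haar_expansion:
  assumes g: "set_integrable lborel {0..1} g" and x: "x \<in> {0..1}"
  shows "haar_series J (haar_coeff g) x
    = bin_average (2 ^ Suc J) g (bin_index (2 ^ Suc J) x) - bin_average 1 g 1"
proof -
  define A where "A j = bin_average (2 ^ j) g (bin_index (2 ^ j) x)" for j
  have level: "(\<Sum>k=1..2 ^ j. haar_coeff g (j, k) * haar j k x) = A (Suc j) - A j" for j
  proof -
    let ?k = "bin_index (2 ^ j) x"
    have k: "?k \<in> {1..2 ^ j}" by (rule bin_index_range) simp
    have "(\<Sum>k=1..2 ^ j. haar_coeff g (j, k) * haar j k x) =
        (\<Sum>k=1..2 ^ j. if k = ?k then haar_coeff g (j, k) * (sqrt (2 ^ j) * (if odd (bin_index (2 ^ Suc j) x) then 1 else - 1)) else 0)"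
      using x by (intro sum.cong) (auto simp: haar_eq)
    also have "\<dots> = haar_coeff g (j, ?k) * (sqrt (2 ^ j) * (if odd (bin_index (2 ^ Suc j) x) then 1 else - 1))"
      using k by (simp add: sum.delta)
    also have "\<dots> = (bin_average (2 ^ Suc j) g (2 * ?k - 1) - bin_average (2 ^ Suc j) g (2 * ?k)) / 2 *
        (if odd (bin_index (2 ^ Suc j) x) then 1 else - 1)"
      by (simp add: haar_coeff_def)
    also have "\<dots> = A (Suc j) - A j"
    proof -
      have "A j = (bin_average (2 ^ Suc j) g (2 * ?k - 1) + bin_average (2 ^ Suc j) g (2 * ?k)) / 2"
        unfolding A_def using bin_average_halves[OF g _ k] by simp
      moreover have "bin_index (2 ^ Suc j) x = 2 * ?k - 1 \<or> bin_index (2 ^ Suc j) x = 2 * ?k"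
        using bin_index_double[of "2 ^ j" x] x by simp
      moreover have "odd (2 * ?k - 1)" using k by auto
      ultimately show ?thesis unfolding A_def by (auto simp: field_simps)
    qed
    finally show ?thesis .
  qed
  have "haar_series J (haar_coeff g) x = (\<Sum>j\<le>J. \<Sum>k=1..2 ^ j. haar_coeff g (j, k) * haar j k x)"
    unfolding haar_series_def haar_index_def by (subst sum.Sigma) auto
  also have "\<dots> = (\<Sum>j<Suc J. A (Suc j) - A j)" unfolding level lessThan_Suc_atMost ..
  also have "\<dots> = A (Suc J) - A 0" by (rule sum_lessThan_telescope)
  also have "A 0 = bin_average 1 g 1"
    using bin_index_range[of 1 x] by (simp add: A_def)
  finally show ?thesis unfolding A_def .
qed

text \<open>A coefficient is at most \<open>L * 2^(- j * a) / sqrt (2^j)\<close> and a level has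
  \<open>2^j\<close> of them, so \<open>a \<ge> 1/2\<close> makes the level sum bounded uniformly in
  \<open>j\<close>. This is where Hoelder orders above one half enter the control of the
  prior.\<close>

lemma haar_coeff_sum_holder:
  assumes g: "set_integrable lborel {0..1} g" and L: "L \<ge> 0" and a: "a \<ge> 1/2"
    and h: "\<And>x y. x \<in> {0..1} \<Longrightarrow> y \<in> {0..1} \<Longrightarrow> \<bar>g x - g y\<bar> \<le> L * \<bar>x - y\<bar> powr a"
  shows "(\<Sum>k=1..2 ^ j. \<bar>haar_coeff g (j, k)\<bar>) \<le> L"
proof -
  have le: "\<bar>haar_coeff g (j, k)\<bar> \<le> L / 2 ^ j" if k: "k \<in> {1..2 ^ j}" for k
  proof -
    \<comment> \<open>The left end point of the interval is the common reference value for the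
      averages over both halves.\<close>
    define x0 where "x0 = (real k - 1) / 2 ^ j"
    have "real k \<le> real (2 ^ j)" using k by (intro of_nat_mono) auto
    then have "real k \<le> 2 ^ j" by simp
    then have x0: "x0 \<in> bin (2 ^ j) k" using k by (auto simp: bin_def x0_def divide_strict_right_mono)
    have sub: "bin (2 ^ j) k \<subseteq> {0..1}" using k by (intro bin_subset) auto
    have close: "\<bar>g y - g x0\<bar> \<le> L * (1 / 2 ^ j) powr a" if y: "y \<in> bin (2 ^ j) k" for y
    proof -
      have "\<bar>y - x0\<bar> \<le> 1 / 2 ^ j"
        using y by (auto simp: bin_def x0_def field_simps split: if_splits)
      then have "\<bar>y - x0\<bar> powr a \<le> (1 / 2 ^ j) powr a" using a by (intro powr_mono2) auto
      then show ?thesis using h[of y x0] sub x0 y L by (meson mult_left_mono order_trans subsetD)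
    qed
    have half: "\<bar>bin_average (2 ^ Suc j) g i - g x0\<bar> \<le> L * (1 / 2 ^ j) powr a"
      if "i = 2 * k - 1 \<or> i = 2 * k" for i
    proof (rule bin_average_bound)
      have "i \<in> {1..2 ^ Suc j}" using that k by auto
      then show "set_integrable lborel (bin (2 ^ Suc j) i) g" by (intro set_integrable_bin[OF g]) auto
      show "\<bar>g y - g x0\<bar> \<le> L * (1 / 2 ^ j) powr a" if "y \<in> bin (2 ^ Suc j) i" for y
        using close bin_halves(1)[of "2 ^ j" k] k that \<open>i = 2 * k - 1 \<or> i = 2 * k\<close> by auto
    qed simp
    have s: "sqrt (2 ^ j) > (0 :: real)" by simp
    have "\<bar>bin_average (2 ^ Suc j) g (2 * k - 1) - bin_average (2 ^ Suc j) g (2 * k)\<bar> \<le> 2 * (L * (1 / 2 ^ j) powr a)"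
      using half[of "2 * k - 1"] half[of "2 * k"] by linarith
    moreover have "(1 / 2 ^ j) powr a \<le> (1 / 2 ^ j :: real) powr (1/2)"
      using a by (intro powr_mono') (auto simp: divide_le_eq)
    then have "(1 / 2 ^ j) powr a \<le> 1 / sqrt (2 ^ j)"
      by (simp add: powr_half_sqrt real_sqrt_divide)
    then have "2 * (L * (1 / 2 ^ j) powr a) \<le> 2 * (L * (1 / sqrt (2 ^ j)))" using L by (intro mult_left_mono) auto
    ultimately have "\<bar>bin_average (2 ^ Suc j) g (2 * k - 1) - bin_average (2 ^ Suc j) g (2 * k)\<bar> \<le> 2 * (L * (1 / sqrt (2 ^ j)))"
      by linarith
    then have "\<bar>bin_average (2 ^ Suc j) g (2 * k - 1) - bin_average (2 ^ Suc j) g (2 * k)\<bar> / (2 * sqrt (2 ^ j))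
        \<le> 2 * (L * (1 / sqrt (2 ^ j))) / (2 * sqrt (2 ^ j))"
      by (rule divide_right_mono) simp
    then have "\<bar>haar_coeff g (j, k)\<bar> \<le> 2 * (L * (1 / sqrt (2 ^ j))) / (2 * sqrt (2 ^ j))"
      unfolding haar_coeff_def by (simp add: abs_divide)
    also have "\<dots> = L / 2 ^ j" using s by (simp add: field_simps)
    finally show ?thesis .
  qed
  have "(\<Sum>k=1..2 ^ j. \<bar>haar_coeff g (j, k)\<bar>) \<le> (\<Sum>k\<in>{1..2 ^ j :: nat}. L / 2 ^ j)"
    by (intro sum_mono le)
  then show ?thesis by simp
qed

text \<open>For nonnegative averages the difference is at most the sum, which is twice the average
  over the whole interval, and these integrals add up to the total mass. For the indicator of a bin,
  of mass \<open>1 / p\<close>, this replaces the Hoelder bound and yields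
  \<open>sqrt (2^j) / p\<close>.\<close>

lemma haar_coeff_sum_nonneg:
  assumes g: "set_integrable lborel {0..1} g" and nn: "\<And>x. x \<in> {0..1} \<Longrightarrow> g x \<ge> 0"
  shows "(\<Sum>k=1..2 ^ j. \<bar>haar_coeff g (j, k)\<bar>) \<le> sqrt (2 ^ j) * (LBINT x:{0..1}. g x)"
proof -
  have le: "\<bar>haar_coeff g (j, k)\<bar> \<le> sqrt (2 ^ j) * (LBINT x:bin (2 ^ j) k. g x)" if k: "k \<in> {1..2 ^ j}" for k
  proof -
    have nn': "bin_average (2 ^ Suc j) g i \<ge> 0" if "i \<in> {1..2 ^ Suc j}" for i
      unfolding bin_average_def using bin_subset[of "2 ^ Suc j" i] that nn
      unfolding set_lebesgue_integral_def
      by (intro mult_nonneg_nonneg Bochner_Integration.integral_nonneg) (auto simp: indicator_def)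
    have "0 \<le> bin_average (2 ^ Suc j) g (2 * k - 1)" "0 \<le> bin_average (2 ^ Suc j) g (2 * k)"
      using k by (intro nn'; auto)+
    then have "\<bar>bin_average (2 ^ Suc j) g (2 * k - 1) - bin_average (2 ^ Suc j) g (2 * k)\<bar> \<le> 2 * bin_average (2 ^ j) g k"
      using bin_average_halves[OF g _ k] by simp
    then have "\<bar>bin_average (2 ^ Suc j) g (2 * k - 1) - bin_average (2 ^ Suc j) g (2 * k)\<bar> / (2 * sqrt (2 ^ j))
        \<le> 2 * bin_average (2 ^ j) g k / (2 * sqrt (2 ^ j))"
      by (rule divide_right_mono) simp
    then have "\<bar>haar_coeff g (j, k)\<bar> \<le> 2 * bin_average (2 ^ j) g k / (2 * sqrt (2 ^ j))"
      unfolding haar_coeff_def by (simp add: abs_divide)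
    also have "\<dots> = sqrt (2 ^ j) * (LBINT x:bin (2 ^ j) k. g x)"
      by (simp add: bin_average_def field_simps)
    finally show ?thesis .
  qed
  have "(\<Sum>k=1..2 ^ j. \<bar>haar_coeff g (j, k)\<bar>) \<le> (\<Sum>k=1..2 ^ j. sqrt (2 ^ j) * (LBINT x:bin (2 ^ j) k. g x))"
    by (intro sum_mono le) auto
  also have "\<dots> = sqrt (2 ^ j) * (LBINT x:{0..1}. g x)"
    by (subst integral_split_bins[OF g, of "2 ^ j"]) (auto simp: sum_distrib_left)
  finally show ?thesis .
qed

section \<open>Score identities\<close>

text \<open>Differentiation under the integral along \<open>t = 1 / (k + 1)\<close>: the difference
  quotients integrate to zero by invariance, are dominated by the Lipschitz constant
  \<open>K\<close>, and converge to \<open>D\<close>, which is measurable as their limit.\<close>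

lemma derivative_identity:
  fixes A :: "real \<Rightarrow> 'a \<Rightarrow> real"
  assumes M: "prob_space M"
    and meas: "\<And>t. 0 \<le> t \<Longrightarrow> t \<le> 1 \<Longrightarrow> A t \<in> borel_measurable M"
    and inv: "\<And>t. 0 < t \<Longrightarrow> t \<le> 1 \<Longrightarrow> (\<integral>x. A t x \<partial>M) = (\<integral>x. A 0 x \<partial>M)"
    and deriv: "\<And>x. x \<in> space M \<Longrightarrow> ((\<lambda>t. A t x) has_real_derivative D x) (at 0)"
    and lip: "\<And>t x. 0 \<le> t \<Longrightarrow> t \<le> 1 \<Longrightarrow> x \<in> space M \<Longrightarrow> \<bar>A t x - A 0 x\<bar> \<le> K * t"
    and bd: "\<And>x. x \<in> space M \<Longrightarrow> \<bar>A 0 x\<bar> \<le> K'"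
  shows "(\<integral>x. D x \<partial>M) = 0" "D \<in> borel_measurable M"
proof -
  interpret prob_space M by fact
  define t where "t k = inverse (real (Suc k))" for k
  have t: "0 < t k" "t k \<le> 1" for k by (auto simp: t_def field_simps)
  have t0: "t \<longlonglongrightarrow> 0" unfolding t_def by (rule LIMSEQ_inverse_real_of_nat)
  define G where "G k x = (A (t k) x - A 0 x) / t k" for k x
  have [measurable]: "A 0 \<in> borel_measurable M" "A (t k) \<in> borel_measurable M" for k
    using t[of k] by (auto intro!: meas)
  have Gm: "G k \<in> borel_measurable M" for k unfolding G_def by measurable
  have lim: "(\<lambda>k. G k x) \<longlonglongrightarrow> D x" if "x \<in> space M" for x
  proof -
    have "((\<lambda>h. (A (0 + h) x - A 0 x) / h) \<longlongrightarrow> D x) (at 0)"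
      using deriv[OF that] by (simp add: DERIV_def)
    moreover have "filterlim t (at 0) sequentially"
      unfolding filterlim_at using t0 t(1) by (auto simp: less_imp_neq[symmetric])
    ultimately show ?thesis unfolding G_def by (auto dest: filterlim_compose)
  qed
  show D: "D \<in> borel_measurable M" by (rule borel_measurable_LIMSEQ_real[OF lim Gm])
  have Gb: "\<bar>G k x\<bar> \<le> K" if "x \<in> space M" for k x
    using lip[of "t k" x] t[of k] that unfolding G_def by (simp add: abs_divide field_simps)
  have "(\<lambda>k. \<integral>x. G k x \<partial>M) \<longlonglongrightarrow> (\<integral>x. D x \<partial>M)"
    by (rule integral_dominated_convergence[where w = "\<lambda>_. K"]) (use D Gm lim Gb in auto)
  moreover have "(\<integral>x. G k x \<partial>M) = 0" for k
  proof -
    have i0: "integrable M (A 0)" by (rule integrable_const_bound[of _ K']) (use bd in auto)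
    have "\<bar>A (t k) x\<bar> \<le> K' + K * t k" if "x \<in> space M" for x
      using lip[of "t k" x] t[of k] bd[OF that] that by linarith
    then have "integrable M (A (t k))" by (intro integrable_const_bound[of _ "K' + K * t k"]) auto
    then show ?thesis unfolding G_def using i0 inv[OF t] by simp
  qed
  ultimately show "(\<integral>x. D x \<partial>M) = 0" by (simp add: LIMSEQ_const_iff)
qed

lemma abs_exp_minus_one_le: "\<bar>exp x - 1\<bar> \<le> \<bar>x\<bar> * exp \<bar>x\<bar>" for x :: real
proof (cases "x \<ge> 0")
  case True
  have "1 - x \<le> exp (- x)" using exp_ge_add_one_self[of "- x"] by simp
  then have "exp x * (1 - x) \<le> exp x * exp (- x)" by (rule mult_left_mono) simp
  then show ?thesis using True by (simp add: exp_minus algebra_simps)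
next
  case False
  have "1 - exp x \<le> - x" using exp_ge_add_one_self[of x] by linarith
  also have "\<dots> \<le> - x * exp (- x)" using False by (simp add: mult_le_cancel_left1)
  finally show ?thesis using False by simp
qed

definition bin_mean :: "nat \<Rightarrow> (nat \<Rightarrow> real) \<Rightarrow> (nat \<Rightarrow> real) \<Rightarrow> real" where
  "bin_mean p w e = (\<Sum>\<mu>=1..p. w \<mu> * e \<mu>)"

definition bin_probability :: "nat \<Rightarrow> (nat \<Rightarrow> real) \<Rightarrow> bool" where
  "bin_probability p w \<longleftrightarrow> (\<forall>\<mu>\<in>{1..p}. w \<mu> > 0) \<and> (\<Sum>\<mu>=1..p. w \<mu>) = 1"

definition tilt_normaliser :: "nat \<Rightarrow> (nat \<Rightarrow> real) \<Rightarrow> real \<Rightarrow> (nat \<Rightarrow> real) \<Rightarrow> real" where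
  "tilt_normaliser p e t w = (\<Sum>\<nu>=1..p. w \<nu> * exp (t * e \<nu>))"

lemma bin_probability_le_one: "bin_probability p w \<Longrightarrow> \<mu> \<in> {1..p} \<Longrightarrow> w \<mu> \<le> 1"
  using member_le_sum[of \<mu> "{1..p}" w] by (simp add: bin_probability_def less_imp_le)

lemma bin_mean_abs_le:
  assumes "bin_probability p w" "\<And>\<mu>. \<mu> \<in> {1..p} \<Longrightarrow> \<bar>e \<mu>\<bar> \<le> E"
  shows "\<bar>bin_mean p w e\<bar> \<le> E"
proof -
  have "\<bar>bin_mean p w e\<bar> \<le> (\<Sum>\<mu>=1..p. \<bar>w \<mu> * e \<mu>\<bar>)" unfolding bin_mean_def by (rule sum_abs)
  also have "\<dots> \<le> (\<Sum>\<mu>=1..p. w \<mu> * E)"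
    using assms by (intro sum_mono) (auto simp: bin_probability_def abs_mult less_imp_le intro!: mult_left_mono)
  also have "\<dots> = E" using assms by (simp add: bin_probability_def flip: sum_distrib_right)
  finally show ?thesis .
qed

lemma tilt_normaliser_bounds:
  assumes w: "bin_probability p w" and e: "\<And>\<mu>. \<mu> \<in> {1..p} \<Longrightarrow> \<bar>e \<mu>\<bar> \<le> E" and t: "t \<ge> 0"
  shows "tilt_normaliser p e t w > 0" "\<bar>ln (tilt_normaliser p e t w)\<bar> \<le> t * E"
proof -
  have te: "- (t * E) \<le> t * e \<mu> \<and> t * e \<mu> \<le> t * E" if "\<mu> \<in> {1..p}" for \<mu>
  proof -
    have "\<bar>t * e \<mu>\<bar> \<le> t * E" using mult_left_mono[OF e[OF that] t] t by (simp add: abs_mult)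
    then show ?thesis by linarith
  qed
  have "(\<Sum>\<nu>=1..p. w \<nu> * exp (- (t * E))) \<le> tilt_normaliser p e t w"
    unfolding tilt_normaliser_def using w te
    by (intro sum_mono mult_left_mono) (auto simp: bin_probability_def less_imp_le)
  then have l: "exp (- (t * E)) \<le> tilt_normaliser p e t w"
    using w by (simp add: bin_probability_def flip: sum_distrib_right)
  have "tilt_normaliser p e t w \<le> (\<Sum>\<nu>=1..p. w \<nu> * exp (t * E))"
    unfolding tilt_normaliser_def using w te
    by (intro sum_mono mult_left_mono) (auto simp: bin_probability_def less_imp_le)
  then have u: "tilt_normaliser p e t w \<le> exp (t * E)"
    using w by (simp add: bin_probability_def flip: sum_distrib_right)
  show pos: "tilt_normaliser p e t w > 0" using l exp_gt_zero less_le_trans by blast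
  have "- (t * E) \<le> ln (tilt_normaliser p e t w)" using l pos by (simp add: ln_ge_iff)
  moreover have "ln (tilt_normaliser p e t w) \<le> t * E" using u pos by (metis ln_exp ln_le_cancel_iff exp_gt_zero)
  ultimately show "\<bar>ln (tilt_normaliser p e t w)\<bar> \<le> t * E" by linarith
qed

text \<open>Integration by parts along the tilt in direction \<open>e\<close>, applied to
  \<open>\<phi>\<close> of the linear functional \<open>bin_mean p w c\<close>. Three derivatives at
  \<open>t = 0\<close> occur: that of the functional (the covariance of \<open>c\<close> and
  \<open>e\<close> under the bin probabilities), that of the log-likelihood with bin counts
  \<open>N\<close>, and that of the log-prior including the Jacobian of the tilt, called
  \<open>b\<close>. The quantifiers over \<open>c\<close> and \<open>\<phi>\<close> are inside
  because \<open>b\<close> depends on \<open>e\<close> alone. Measurability of \<open>b\<close> is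
  included as the identity is split into separate integrals later.\<close>

definition score_identity ::
    "'a measure \<Rightarrow> nat \<Rightarrow> ('a \<Rightarrow> nat \<Rightarrow> real) \<Rightarrow> (nat \<Rightarrow> real) \<Rightarrow> (nat \<Rightarrow> real) \<Rightarrow> ('a \<Rightarrow> real) \<Rightarrow> bool" where
  "score_identity M p \<omega> N e b \<longleftrightarrow> b \<in> borel_measurable M \<and>
    (\<forall>c \<phi> \<phi>'. (\<forall>x. (\<phi> has_real_derivative \<phi>' x) (at x)) \<and> continuous_on UNIV \<phi>' \<longrightarrow>
      (\<integral>\<theta>. \<phi>' (bin_mean p (\<omega> \<theta>) c) * (\<Sum>\<mu>=1..p. c \<mu> * (\<omega> \<theta> \<mu> * (e \<mu> - bin_mean p (\<omega> \<theta>) e)))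
         + \<phi> (bin_mean p (\<omega> \<theta>) c) * ((\<Sum>\<mu>=1..p. N \<mu> * (e \<mu> - bin_mean p (\<omega> \<theta>) e)) + b \<theta>) \<partial>M) = 0)"

text \<open>\<open>\<tau>\<close> is the flow realising the tilt on the parameter space,
  \<open>lr\<close> is the logarithm of the factor by which the prior changes, Jacobian included,
  and \<open>inv\<close> is quasi-invariance of the posterior. The bounds in the proof are crude:
  for \<open>derivative_identity\<close> they only have to be finite.\<close>

lemma score_identityI:
  fixes lr :: "real \<Rightarrow> 'a \<Rightarrow> real" and \<tau> :: "real \<Rightarrow> 'a \<Rightarrow> 'a"
  assumes M: "prob_space M"
    and \<omega>m: "\<And>\<mu>. \<mu> \<in> {1..p} \<Longrightarrow> (\<lambda>\<theta>. \<omega> \<theta> \<mu>) \<in> borel_measurable M"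
    and \<omega>: "\<And>\<theta>. \<theta> \<in> space M \<Longrightarrow> bin_probability p (\<omega> \<theta>)"
    and \<tau>: "\<And>t \<theta> \<mu>. 0 \<le> t \<Longrightarrow> t \<le> 1 \<Longrightarrow> \<theta> \<in> space M \<Longrightarrow> \<mu> \<in> {1..p} \<Longrightarrow>
        \<omega> (\<tau> t \<theta>) \<mu> = \<omega> \<theta> \<mu> * exp (t * e \<mu> - ln (tilt_normaliser p e t (\<omega> \<theta>)))"
    and lrm: "\<And>t. lr t \<in> borel_measurable M"
    and inv: "\<And>F t. 0 < t \<Longrightarrow> t \<le> 1 \<Longrightarrow> F \<in> borel_measurable M \<Longrightarrow> (\<exists>B. \<forall>\<theta>\<in>space M. \<bar>F \<theta>\<bar> \<le> B) \<Longrightarrow>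
        (\<integral>\<theta>. F (\<tau> t \<theta>) * exp ((\<Sum>\<mu>=1..p. N \<mu> * (t * e \<mu> - ln (tilt_normaliser p e t (\<omega> \<theta>)))) + lr t \<theta>) \<partial>M)
        = (\<integral>\<theta>. F \<theta> \<partial>M)"
    and lr0: "\<And>\<theta>. \<theta> \<in> space M \<Longrightarrow> lr 0 \<theta> = 0"
    and lrd: "\<And>\<theta>. \<theta> \<in> space M \<Longrightarrow> ((\<lambda>t. lr t \<theta>) has_real_derivative b \<theta>) (at 0)"
    and lrb: "\<And>t \<theta>. 0 \<le> t \<Longrightarrow> t \<le> 1 \<Longrightarrow> \<theta> \<in> space M \<Longrightarrow> \<bar>lr t \<theta>\<bar> \<le> B * t"
  shows "score_identity M p \<omega> N e b"
proof -
  interpret prob_space M by fact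
  note [measurable] = lrm
  define E where "E = (\<Sum>\<mu>=1..p. \<bar>e \<mu>\<bar>)"
  have E: "\<bar>e \<mu>\<bar> \<le> E" if "\<mu> \<in> {1..p}" for \<mu>
    using member_le_sum[of \<mu> "{1..p}" "\<lambda>\<mu>. \<bar>e \<mu>\<bar>"] that unfolding E_def by auto
  have E0: "E \<ge> 0" unfolding E_def by (intro sum_nonneg) auto
  \<comment> \<open>The logarithmic change of a bin probability under the tilt. Its derivative at 0
    is the centred direction, which is how the differences from \<open>bin_mean\<close> in the score
    identity arise.\<close>
  define x where "x t \<theta> \<mu> = t * e \<mu> - ln (tilt_normaliser p e t (\<omega> \<theta>))" for t \<theta> \<mu>
  have xb: "\<bar>x t \<theta> \<mu>\<bar> \<le> 2 * E * t" if "0 \<le> t" "\<theta> \<in> space M" "\<mu> \<in> {1..p}" for t \<theta> \<mu>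
  proof -
    have "\<bar>t * e \<mu>\<bar> \<le> t * E" using E[OF that(3)] that(1) by (simp add: abs_mult mult_left_mono)
    moreover have "\<bar>ln (tilt_normaliser p e t (\<omega> \<theta>))\<bar> \<le> t * E"
      by (rule tilt_normaliser_bounds(2)[OF \<omega>[OF that(2)] E that(1)])
    ultimately show ?thesis unfolding x_def by (simp add: algebra_simps)
  qed
  have x0: "x 0 \<theta> \<mu> = 0" if "\<theta> \<in> space M" for \<theta> \<mu>
    using \<omega>[OF that] by (simp add: x_def tilt_normaliser_def bin_probability_def)
  have xd: "((\<lambda>t. x t \<theta> \<mu>) has_real_derivative e \<mu> - bin_mean p (\<omega> \<theta>) e) (at 0)"
    if "\<theta> \<in> space M" for \<theta> \<mu>
  proof -
    have one: "tilt_normaliser p e 0 (\<omega> \<theta>) = 1"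
      using \<omega>[OF that] by (simp add: tilt_normaliser_def bin_probability_def)
    have "((\<lambda>t. tilt_normaliser p e t (\<omega> \<theta>)) has_real_derivative bin_mean p (\<omega> \<theta>) e) (at 0)"
      unfolding tilt_normaliser_def bin_mean_def
      by (auto intro!: derivative_eq_intros sum.cong)
    from DERIV_chain2[OF DERIV_ln this] have
      "((\<lambda>t. ln (tilt_normaliser p e t (\<omega> \<theta>))) has_real_derivative bin_mean p (\<omega> \<theta>) e) (at 0)"
      unfolding one by simp
    from DERIV_diff[OF DERIV_cmult_right[OF DERIV_ident, of "e \<mu>"] this] show ?thesis
      unfolding x_def by simp
  qed
  define l where "l t \<theta> = (\<Sum>\<mu>=1..p. N \<mu> * x t \<theta> \<mu>) + lr t \<theta>" for t \<theta>
  define Kl where "Kl = (\<Sum>\<mu>=1..p. \<bar>N \<mu>\<bar>) * (2 * E) + \<bar>B\<bar>"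
  have Kl: "Kl \<ge> 0" unfolding Kl_def using E0 by (intro add_nonneg_nonneg mult_nonneg_nonneg sum_nonneg) auto
  have lb: "\<bar>l t \<theta>\<bar> \<le> Kl * t" if "0 \<le> t" "t \<le> 1" "\<theta> \<in> space M" for t \<theta>
  proof -
    have "\<bar>\<Sum>\<mu>=1..p. N \<mu> * x t \<theta> \<mu>\<bar> \<le> (\<Sum>\<mu>=1..p. \<bar>N \<mu> * x t \<theta> \<mu>\<bar>)" by (rule sum_abs)
    also have "\<dots> \<le> (\<Sum>\<mu>=1..p. \<bar>N \<mu>\<bar> * (2 * E * t))"
      unfolding abs_mult using xb that by (intro sum_mono mult_left_mono) auto
    finally have "\<bar>\<Sum>\<mu>=1..p. N \<mu> * x t \<theta> \<mu>\<bar> \<le> (\<Sum>\<mu>=1..p. \<bar>N \<mu>\<bar>) * (2 * E * t)"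
      by (simp add: sum_distrib_right)
    moreover have "\<bar>lr t \<theta>\<bar> \<le> \<bar>B\<bar> * t"
      using lrb[OF that] mult_right_mono[OF abs_ge_self[of B] that(1)] by linarith
    ultimately show ?thesis unfolding l_def Kl_def by (simp add: algebra_simps)
  qed
  have l0: "l 0 \<theta> = 0" if "\<theta> \<in> space M" for \<theta> using that by (simp add: l_def x0 lr0)
  have ld: "((\<lambda>t. l t \<theta>) has_real_derivative (\<Sum>\<mu>=1..p. N \<mu> * (e \<mu> - bin_mean p (\<omega> \<theta>) e)) + b \<theta>) (at 0)"
    if "\<theta> \<in> space M" for \<theta>
    unfolding l_def by (intro DERIV_add DERIV_sum DERIV_cmult xd lrd that)
  have expl: "\<bar>exp (l t \<theta>) - 1\<bar> \<le> Kl * exp Kl * t" if t: "0 \<le> t" "t \<le> 1" "\<theta> \<in> space M" for t \<theta>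
  proof -
    have "Kl * t \<le> Kl" using t Kl by (simp add: mult_left_le)
    then have "\<bar>l t \<theta>\<bar> * exp \<bar>l t \<theta>\<bar> \<le> (Kl * t) * exp Kl"
      using lb[OF t] by (intro mult_mono) auto
    then show ?thesis using abs_exp_minus_one_le[of "l t \<theta>"] by (simp add: algebra_simps)
  qed
  have xm[measurable]: "(\<lambda>\<theta>. x t \<theta> \<mu>) \<in> borel_measurable M" for t \<mu>
    unfolding x_def tilt_normaliser_def using \<omega>m by measurable
  have lm[measurable]: "l t \<in> borel_measurable M" for t unfolding l_def by measurable
  have identity: "(\<integral>\<theta>. \<phi>' (bin_mean p (\<omega> \<theta>) c) * (\<Sum>\<mu>=1..p. c \<mu> * (\<omega> \<theta> \<mu> * (e \<mu> - bin_mean p (\<omega> \<theta>) e)))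
         + \<phi> (bin_mean p (\<omega> \<theta>) c) * ((\<Sum>\<mu>=1..p. N \<mu> * (e \<mu> - bin_mean p (\<omega> \<theta>) e)) + b \<theta>) \<partial>M) = 0"
    if d: "\<And>x. (\<phi> has_real_derivative \<phi>' x) (at x)" and cont: "continuous_on UNIV \<phi>'" for c \<phi> \<phi>'
  proof -
    define S where "S = (\<Sum>\<mu>=1..p. \<bar>c \<mu>\<bar>)"
    have S0: "S \<ge> 0" unfolding S_def by (intro sum_nonneg) auto
    have cS: "\<bar>c \<mu>\<bar> \<le> S" if "\<mu> \<in> {1..p}" for \<mu>
      using member_le_sum[of \<mu> "{1..p}" "\<lambda>\<mu>. \<bar>c \<mu>\<bar>"] that unfolding S_def by auto
    have \<phi>c: "continuous_on UNIV \<phi>" using d by (meson DERIV_isCont continuous_at_imp_continuous_on)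
    have [measurable]: "\<phi> \<in> borel_measurable borel" using \<phi>c by (rule borel_measurable_continuous_onI)
    \<comment> \<open>A radius that contains the functional along the whole flow for
      \<open>t\<close> in \<open>[0, 1]\<close>, so that \<open>\<phi>\<close> and
      \<open>\<phi>'\<close>, which may be unbounded on the line, are bounded where they are
      evaluated.\<close>
    define R where "R = S * (1 + 2 * E * exp (2 * E))"
    have R: "S \<le> R" using S0 E0 by (simp add: R_def mult_le_cancel_left1)
    have "compact (\<phi> ` {- R..R})" "compact (\<phi>' ` {- R..R})"
      by (intro compact_continuous_image continuous_on_subset[OF \<phi>c] continuous_on_subset[OF cont]; simp)+
    then obtain B1 B2 where "\<forall>y\<in>\<phi> ` {- R..R}. norm y \<le> B1" "\<forall>y\<in>\<phi>' ` {- R..R}. norm y \<le> B2"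
      by (meson compact_imp_bounded bounded_iff)
    then have B1: "\<And>y. \<bar>y\<bar> \<le> R \<Longrightarrow> \<bar>\<phi> y\<bar> \<le> B1" and B2: "\<And>y. \<bar>y\<bar> \<le> R \<Longrightarrow> \<bar>\<phi>' y\<bar> \<le> B2"
      by (auto simp: abs_le_iff)
    have B1': "B1 \<ge> 0" and B2': "B2 \<ge> 0" using B1[of 0] B2[of 0] R S0 by auto
    define u where "u t \<theta> = (\<Sum>\<mu>=1..p. \<omega> \<theta> \<mu> * exp (x t \<theta> \<mu>) * c \<mu>)" for t \<theta>
    have u0: "u 0 \<theta> = bin_mean p (\<omega> \<theta>) c" if "\<theta> \<in> space M" for \<theta>
      using that by (simp add: u_def bin_mean_def x0)
    have u\<tau>: "bin_mean p (\<omega> (\<tau> t \<theta>)) c = u t \<theta>" if "0 \<le> t" "t \<le> 1" "\<theta> \<in> space M" for t \<theta>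
      using \<tau>[OF that] by (simp add: u_def bin_mean_def x_def)
    have u0b: "\<bar>u 0 \<theta>\<bar> \<le> S" if "\<theta> \<in> space M" for \<theta>
      unfolding u0[OF that] by (rule bin_mean_abs_le[OF \<omega>[OF that] cS])
    have ud: "\<bar>u t \<theta> - u 0 \<theta>\<bar> \<le> S * (2 * E * exp (2 * E)) * t" if t: "0 \<le> t" "t \<le> 1" "\<theta> \<in> space M" for t \<theta>
    proof -
      have "u t \<theta> - u 0 \<theta> = (\<Sum>\<mu>=1..p. \<omega> \<theta> \<mu> * ((exp (x t \<theta> \<mu>) - 1) * c \<mu>))"
        unfolding u_def x0[OF that(3)] sum_subtractf[symmetric] by (intro sum.cong) (auto simp: algebra_simps)
      also have "\<bar>\<dots>\<bar> \<le> S * (2 * E * exp (2 * E)) * t"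
      proof (rule bin_mean_abs_le[OF \<omega>[OF t(3)], unfolded bin_mean_def])
        fix \<mu> assume \<mu>: "\<mu> \<in> {1..p}"
        have b1: "2 * E * t \<le> 2 * E" using t E0 by (simp add: mult_left_le)
        have "\<bar>x t \<theta> \<mu>\<bar> * exp \<bar>x t \<theta> \<mu>\<bar> \<le> (2 * E * t) * exp (2 * E)"
          using xb[OF t(1,3) \<mu>] b1 by (intro mult_mono) auto
        then have "\<bar>exp (x t \<theta> \<mu>) - 1\<bar> \<le> (2 * E * t) * exp (2 * E)"
          using abs_exp_minus_one_le[of "x t \<theta> \<mu>"] by linarith
        then have "\<bar>exp (x t \<theta> \<mu>) - 1\<bar> * \<bar>c \<mu>\<bar> \<le> ((2 * E * t) * exp (2 * E)) * S"
          using cS[OF \<mu>] S0 E0 t by (intro mult_mono) auto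
        also have "\<dots> = S * (2 * E * exp (2 * E)) * t" by simp
        finally show "\<bar>(exp (x t \<theta> \<mu>) - 1) * c \<mu>\<bar> \<le> S * (2 * E * exp (2 * E)) * t"
          unfolding abs_mult .
      qed
      finally show ?thesis .
    qed
    have uR: "\<bar>u t \<theta>\<bar> \<le> R" if t: "0 \<le> t" "t \<le> 1" "\<theta> \<in> space M" for t \<theta>
    proof -
      have "S * (2 * E * exp (2 * E)) * t \<le> S * (2 * E * exp (2 * E))"
        using t S0 E0 by (intro mult_left_le) auto
      then show ?thesis using ud[OF t] u0b[OF t(3)] unfolding R_def by (simp add: algebra_simps)
    qed
    define A where "A t \<theta> = \<phi> (u t \<theta>) * exp (l t \<theta>)" for t \<theta>
    show ?thesis
    proof (rule derivative_identity(1)[OF M, where A = A and K = "B1 * (Kl * exp Kl) + B2 * (S * (2 * E * exp (2 * E)))" and K' = B1])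
      have um[measurable]: "u t \<in> borel_measurable M" for t unfolding u_def using \<omega>m by measurable
      show "A t \<in> borel_measurable M" for t unfolding A_def by measurable
      show "(\<integral>\<theta>. A t \<theta> \<partial>M) = (\<integral>\<theta>. A 0 \<theta> \<partial>M)" if t: "0 < t" "t \<le> 1" for t
      proof -
        have "(\<integral>\<theta>. A t \<theta> \<partial>M) = (\<integral>\<theta>. \<phi> (bin_mean p (\<omega> (\<tau> t \<theta>)) c) * exp (l t \<theta>) \<partial>M)"
          unfolding A_def using t by (intro Bochner_Integration.integral_cong) (auto simp: u\<tau>)
        also have "\<dots> = (\<integral>\<theta>. \<phi> (bin_mean p (\<omega> \<theta>) c) \<partial>M)"
          unfolding l_def x_def
        proof (rule inv[OF t])
          show "(\<lambda>\<theta>. \<phi> (bin_mean p (\<omega> \<theta>) c)) \<in> borel_measurable M"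
            unfolding bin_mean_def using \<omega>m by measurable
          show "\<exists>B. \<forall>\<theta>\<in>space M. \<bar>\<phi> (bin_mean p (\<omega> \<theta>) c)\<bar> \<le> B"
            using B1 u0b R u0 by (metis order_trans)
        qed
        also have "\<dots> = (\<integral>\<theta>. A 0 \<theta> \<partial>M)"
          unfolding A_def by (intro Bochner_Integration.integral_cong) (auto simp: u0 l0)
        finally show ?thesis .
      qed
      show "\<bar>A t \<theta> - A 0 \<theta>\<bar> \<le> (B1 * (Kl * exp Kl) + B2 * (S * (2 * E * exp (2 * E)))) * t"
        if t: "0 \<le> t" "t \<le> 1" "\<theta> \<in> space M" for t \<theta>
      proof -
        have "\<bar>\<phi> (u t \<theta>) * (exp (l t \<theta>) - 1)\<bar> \<le> B1 * (Kl * exp Kl * t)"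
          unfolding abs_mult using B1[OF uR[OF t]] expl[OF t] B1' by (intro mult_mono) auto
        moreover have "\<bar>\<phi> (u t \<theta>) - \<phi> (u 0 \<theta>)\<bar> \<le> B2 * \<bar>u t \<theta> - u 0 \<theta>\<bar>"
        proof -
          have "norm (\<phi> (u t \<theta>) - \<phi> (u 0 \<theta>)) \<le> B2 * norm (u t \<theta> - u 0 \<theta>)"
            by (rule field_differentiable_bound[of "{- R..R}" \<phi> \<phi>'])
               (use d B2 uR[OF t] uR[of 0 \<theta>] t in \<open>auto simp: abs_le_iff intro: has_field_derivative_at_within\<close>)
          then show ?thesis by simp
        qed
        moreover have "B2 * \<bar>u t \<theta> - u 0 \<theta>\<bar> \<le> B2 * (S * (2 * E * exp (2 * E)) * t)"
          using ud[OF t] B2' by (rule mult_left_mono)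
        moreover have "A t \<theta> - A 0 \<theta> = \<phi> (u t \<theta>) * (exp (l t \<theta>) - 1) + (\<phi> (u t \<theta>) - \<phi> (u 0 \<theta>))"
          unfolding A_def l0[OF t(3)] by (simp add: algebra_simps)
        ultimately have "\<bar>A t \<theta> - A 0 \<theta>\<bar> \<le> B1 * (Kl * exp Kl * t) + B2 * (S * (2 * E * exp (2 * E)) * t)"
          by linarith
        then show ?thesis by (simp add: algebra_simps)
      qed
      show "\<bar>A 0 \<theta>\<bar> \<le> B1" if "\<theta> \<in> space M" for \<theta>
        unfolding A_def l0[OF that] using B1[OF uR[of 0 \<theta>]] that by simp
      show "((\<lambda>t. A t \<theta>) has_real_derivative
          \<phi>' (bin_mean p (\<omega> \<theta>) c) * (\<Sum>\<mu>=1..p. c \<mu> * (\<omega> \<theta> \<mu> * (e \<mu> - bin_mean p (\<omega> \<theta>) e)))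
         + \<phi> (bin_mean p (\<omega> \<theta>) c) * ((\<Sum>\<mu>=1..p. N \<mu> * (e \<mu> - bin_mean p (\<omega> \<theta>) e)) + b \<theta>)) (at 0)"
        if \<theta>: "\<theta> \<in> space M" for \<theta>
      proof -
        have "((\<lambda>t. \<omega> \<theta> \<mu> * exp (x t \<theta> \<mu>) * c \<mu>) has_real_derivative
            c \<mu> * (\<omega> \<theta> \<mu> * (e \<mu> - bin_mean p (\<omega> \<theta>) e))) (at 0)" for \<mu>
          using DERIV_cmult_right[OF DERIV_cmult[OF DERIV_chain2[OF DERIV_exp xd[OF \<theta>, of \<mu>]], of "\<omega> \<theta> \<mu>"], of "c \<mu>"]
          by (simp add: x0[OF \<theta>] algebra_simps)
        then have "((\<lambda>t. u t \<theta>) has_real_derivative (\<Sum>\<mu>=1..p. c \<mu> * (\<omega> \<theta> \<mu> * (e \<mu> - bin_mean p (\<omega> \<theta>) e)))) (at 0)"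
          unfolding u_def by (intro DERIV_sum) auto
        from DERIV_chain2[OF d this] have d1: "((\<lambda>t. \<phi> (u t \<theta>)) has_real_derivative
          \<phi>' (bin_mean p (\<omega> \<theta>) c) * (\<Sum>\<mu>=1..p. c \<mu> * (\<omega> \<theta> \<mu> * (e \<mu> - bin_mean p (\<omega> \<theta>) e)))) (at 0)"
          unfolding u0[OF \<theta>] .
        have d2: "((\<lambda>t. exp (l t \<theta>)) has_real_derivative (\<Sum>\<mu>=1..p. N \<mu> * (e \<mu> - bin_mean p (\<omega> \<theta>) e)) + b \<theta>) (at 0)"
          using DERIV_chain2[OF DERIV_exp ld[OF \<theta>]] by (simp add: l0[OF \<theta>])
        show ?thesis unfolding A_def
          using DERIV_mult[OF d1 d2] by (simp add: l0[OF \<theta>] u0[OF \<theta>] algebra_simps)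
      qed
    qed
  qed
  have bm: "b \<in> borel_measurable M"
  proof -
    define t where "t k = inverse (real (Suc k))" for k
    have "filterlim t (at 0) sequentially"
      unfolding filterlim_at t_def using LIMSEQ_inverse_real_of_nat by auto
    moreover have "((\<lambda>h. (lr (0 + h) \<theta> - lr 0 \<theta>) / h) \<longlongrightarrow> b \<theta>) (at 0)" if "\<theta> \<in> space M" for \<theta>
      using lrd[OF that] by (simp add: DERIV_def)
    ultimately have "(\<lambda>k. (lr (t k) \<theta> - lr 0 \<theta>) / t k) \<longlonglongrightarrow> b \<theta>" if "\<theta> \<in> space M" for \<theta>
      using that by (auto dest: filterlim_compose)
    then show ?thesis by (rule borel_measurable_LIMSEQ_real) measurable
  qed
  show ?thesis unfolding score_identity_def using bm identity by blast
qed

section \<open>Posterior second moments and the Stein bound\<close>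

lemma integrable_bounded:
  fixes f :: "'a \<Rightarrow> real"
  assumes "prob_space M" "f \<in> borel_measurable M" "\<And>x. x \<in> space M \<Longrightarrow> \<bar>f x\<bar> \<le> B"
  shows "integrable M f"
proof -
  interpret prob_space M by fact
  show ?thesis by (rule integrable_const_bound[of _ B]) (use assms in auto)
qed

text \<open>With the test function \<open>\<phi> x = x - N \<mu> / n\<close> and the indicator of
  bin \<open>\<mu>\<close> as direction, the identity says that \<open>n\<close> times the second
  moment is the mean of \<open>w * (1 - w)\<close> plus a prior cross term. Summed over bins the
  former is at most 1, and Young's inequality absorbs the latter into half of the second moments,
  whence \<open>(2 + K) / n\<close>.\<close>

lemma posterior_second_moment:
  fixes \<omega> :: "'a \<Rightarrow> nat \<Rightarrow> real" and n :: real
  assumes M: "prob_space M"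
    and \<omega>m: "\<And>\<mu>. \<mu> \<in> {1..p} \<Longrightarrow> (\<lambda>\<theta>. \<omega> \<theta> \<mu>) \<in> borel_measurable M"
    and \<omega>: "\<And>\<theta>. \<theta> \<in> space M \<Longrightarrow> bin_probability p (\<omega> \<theta>)"
    and n: "n > 0" and N: "(\<Sum>\<mu>=1..p. N \<mu>) = n" "\<And>\<mu>. \<mu> \<in> {1..p} \<Longrightarrow> N \<mu> \<ge> 0"
    and si: "\<And>\<mu>. \<mu> \<in> {1..p} \<Longrightarrow> score_identity M p \<omega> N (\<lambda>\<nu>. if \<nu> = \<mu> then 1 else 0) (b \<mu>)"
    and b: "\<And>\<theta>. \<theta> \<in> space M \<Longrightarrow> (\<Sum>\<mu>=1..p. (b \<mu> \<theta>)\<^sup>2) \<le> K * n"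
  shows "(\<integral>\<theta>. (\<Sum>\<mu>=1..p. (\<omega> \<theta> \<mu> - N \<mu> / n)\<^sup>2) \<partial>M) \<le> (2 + K) / n"
proof -
  interpret prob_space M by fact
  note [measurable] = \<omega>m
  have bm[measurable]: "b \<mu> \<in> borel_measurable M" if "\<mu> \<in> {1..p}" for \<mu>
    using si[OF that] by (simp add: score_identity_def)
  have Nn: "0 \<le> N \<mu> / n \<and> N \<mu> / n \<le> 1" if "\<mu> \<in> {1..p}" for \<mu>
  proof -
    have "N \<mu> \<le> n" using member_le_sum[of \<mu> "{1..p}" N] that N by auto
    then show ?thesis using n N(2)[OF that] by simp
  qed
  define F where "F \<mu> \<theta> = \<omega> \<theta> \<mu> - N \<mu> / n" for \<mu> \<theta>
  have [measurable]: "F \<mu> \<in> borel_measurable M" if "\<mu> \<in> {1..p}" for \<mu>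
    unfolding F_def using that by measurable
  have wb: "0 \<le> \<omega> \<theta> \<mu>" "\<omega> \<theta> \<mu> \<le> 1" if "\<theta> \<in> space M" "\<mu> \<in> {1..p}" for \<theta> \<mu>
    using \<omega>[OF that(1)] bin_probability_le_one[OF \<omega>[OF that(1)] that(2)] that
    by (auto simp: bin_probability_def less_imp_le)
  have Fb: "\<bar>F \<mu> \<theta>\<bar> \<le> 1" if "\<theta> \<in> space M" "\<mu> \<in> {1..p}" for \<theta> \<mu>
    using wb[OF that] Nn[OF that(2)] unfolding F_def by (simp only: abs_le_iff) linarith
  have b2: "(b \<mu> \<theta>)\<^sup>2 \<le> K * n" if "\<theta> \<in> space M" "\<mu> \<in> {1..p}" for \<theta> \<mu>
    using member_le_sum[of \<mu> "{1..p}" "\<lambda>\<mu>. (b \<mu> \<theta>)\<^sup>2"] b[OF that(1)] that(2) by auto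
  have bb: "\<bar>b \<mu> \<theta>\<bar> \<le> K * n + 1" if "\<theta> \<in> space M" "\<mu> \<in> {1..p}" for \<theta> \<mu>
  proof -
    have "2 * \<bar>b \<mu> \<theta>\<bar> \<le> (b \<mu> \<theta>)\<^sup>2 + 1" using sum_squares_bound[of "\<bar>b \<mu> \<theta>\<bar>" 1] by simp
    then show ?thesis using b2[OF that] zero_le_power2[of "b \<mu> \<theta>"] by linarith
  qed
  \<comment> \<open>The integrand of the score identity once its sums are evaluated;
    \<open>- n * F \<mu> \<theta>\<close> is the likelihood score in the direction of one
    bin.\<close>
  define X where "X \<mu> \<theta> = \<omega> \<theta> \<mu> * (1 - \<omega> \<theta> \<mu>) + F \<mu> \<theta> * (- n * F \<mu> \<theta> + b \<mu> \<theta>)" for \<mu> \<theta>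
  have X0: "(\<integral>\<theta>. X \<mu> \<theta> \<partial>M) = 0" if \<mu>: "\<mu> \<in> {1..p}" for \<mu>
  proof -
    let ?e = "\<lambda>\<nu>. if \<nu> = \<mu> then 1 else 0 :: real"
    have mean: "bin_mean p w ?e = w \<mu>" for w
    proof -
      have "bin_mean p w ?e = (\<Sum>\<nu>=1..p. if \<nu> = \<mu> then w \<nu> else 0)"
        unfolding bin_mean_def by (intro sum.cong) auto
      then show ?thesis using \<mu> by simp
    qed
    have "(\<integral>\<theta>. 1 * (\<Sum>\<nu>=1..p. ?e \<nu> * (\<omega> \<theta> \<nu> * (?e \<nu> - \<omega> \<theta> \<mu>)))
         + (\<omega> \<theta> \<mu> - N \<mu> / n) * ((\<Sum>\<nu>=1..p. N \<nu> * (?e \<nu> - \<omega> \<theta> \<mu>)) + b \<mu> \<theta>) \<partial>M) = 0"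
    proof -
      have "\<forall>x. ((\<lambda>x. x - N \<mu> / n) has_real_derivative 1) (at x)"
        by (auto intro!: derivative_eq_intros)
      then show ?thesis using si[OF \<mu>] unfolding score_identity_def mean[symmetric] by fastforce
    qed
    moreover have "(\<Sum>\<nu>=1..p. ?e \<nu> * (\<omega> \<theta> \<nu> * (?e \<nu> - \<omega> \<theta> \<mu>))) = \<omega> \<theta> \<mu> * (1 - \<omega> \<theta> \<mu>)" for \<theta>
    proof -
      have "(\<Sum>\<nu>=1..p. ?e \<nu> * (\<omega> \<theta> \<nu> * (?e \<nu> - \<omega> \<theta> \<mu>))) =
          (\<Sum>\<nu>=1..p. if \<nu> = \<mu> then \<omega> \<theta> \<nu> * (1 - \<omega> \<theta> \<mu>) else 0)"
        by (intro sum.cong) auto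
      then show ?thesis using \<mu> by simp
    qed
    moreover have "(\<Sum>\<nu>=1..p. N \<nu> * (?e \<nu> - \<omega> \<theta> \<mu>)) = - n * F \<mu> \<theta>" for \<theta>
    proof -
      have "(\<Sum>\<nu>=1..p. N \<nu> * (?e \<nu> - \<omega> \<theta> \<mu>)) = bin_mean p N ?e - (\<Sum>\<nu>=1..p. N \<nu>) * \<omega> \<theta> \<mu>"
        by (simp add: bin_mean_def right_diff_distrib sum_subtractf sum_distrib_right)
      also have "\<dots> = - n * F \<mu> \<theta>" unfolding mean N F_def using n by (simp add: field_simps)
      finally show ?thesis .
    qed
    ultimately show ?thesis unfolding X_def F_def by simp
  qed
  have XI: "integrable M (X \<mu>)" if \<mu>: "\<mu> \<in> {1..p}" for \<mu>
  proof (rule integrable_bounded[OF M])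
    show "X \<mu> \<in> borel_measurable M" unfolding X_def using \<mu> by measurable
    fix \<theta> assume \<theta>: "\<theta> \<in> space M"
    have "\<bar>\<omega> \<theta> \<mu> * (1 - \<omega> \<theta> \<mu>)\<bar> \<le> 1 * 1"
      unfolding abs_mult using wb[OF \<theta> \<mu>] by (intro mult_mono) auto
    moreover have "\<bar>F \<mu> \<theta> * (- n * F \<mu> \<theta> + b \<mu> \<theta>)\<bar> \<le> 1 * (n + (K * n + 1))"
    proof -
      have "\<bar>- n * F \<mu> \<theta>\<bar> \<le> n" using Fb[OF \<theta> \<mu>] n by (simp add: abs_mult mult_left_le)
      then have "\<bar>- n * F \<mu> \<theta> + b \<mu> \<theta>\<bar> \<le> n + (K * n + 1)" using bb[OF \<theta> \<mu>] by linarith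
      then show ?thesis unfolding abs_mult[of "F \<mu> \<theta>"] using Fb[OF \<theta> \<mu>] by (intro mult_mono) auto
    qed
    ultimately show "\<bar>X \<mu> \<theta>\<bar> \<le> 1 * 1 + 1 * (n + (K * n + 1))"
      unfolding X_def by (intro order_trans[OF abs_triangle_ineq] add_mono)
  qed
  have F2I: "integrable M (\<lambda>\<theta>. \<Sum>\<mu>=1..p. (F \<mu> \<theta>)\<^sup>2)"
  proof (intro Bochner_Integration.integrable_sum integrable_bounded[OF M, where B = 1])
    fix \<mu> \<theta> assume "\<mu> \<in> {1..p}" "\<theta> \<in> space M"
    then show "\<bar>(F \<mu> \<theta>)\<^sup>2\<bar> \<le> 1" using power_le_one[OF abs_ge_zero Fb[of \<theta> \<mu>], of 2] by simp
  qed measurable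
  have "0 = (\<integral>\<theta>. (\<Sum>\<mu>=1..p. X \<mu> \<theta>) \<partial>M)"
    by (subst Bochner_Integration.integral_sum) (auto simp: XI X0)
  also have "\<dots> \<le> (\<integral>\<theta>. 1 + K / 2 - n / 2 * (\<Sum>\<mu>=1..p. (F \<mu> \<theta>)\<^sup>2) \<partial>M)"
  proof (rule integral_mono)
    show "integrable M (\<lambda>\<theta>. \<Sum>\<mu>=1..p. X \<mu> \<theta>)" using XI by auto
    show "integrable M (\<lambda>\<theta>. 1 + K / 2 - n / 2 * (\<Sum>\<mu>=1..p. (F \<mu> \<theta>)\<^sup>2))" using F2I by auto
    fix \<theta> assume \<theta>: "\<theta> \<in> space M"
    have "X \<mu> \<theta> \<le> \<omega> \<theta> \<mu> - n / 2 * (F \<mu> \<theta>)\<^sup>2 + (b \<mu> \<theta>)\<^sup>2 / (2 * n)" if \<mu>: "\<mu> \<in> {1..p}" for \<mu>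
    proof -
      \<comment> \<open>Young's inequality with weight \<open>n\<close>: the cross term takes half
        of the available \<open>n * (F \<mu> \<theta>)^2\<close>, so the other half
        survives.\<close>
      have "0 \<le> (n * F \<mu> \<theta> - b \<mu> \<theta>)\<^sup>2 / (2 * n)" using n by simp
      also have "\<dots> = n / 2 * (F \<mu> \<theta>)\<^sup>2 + (b \<mu> \<theta>)\<^sup>2 / (2 * n) - F \<mu> \<theta> * b \<mu> \<theta>"
        using n by (simp add: field_simps power2_eq_square)
      finally have "F \<mu> \<theta> * b \<mu> \<theta> \<le> n / 2 * (F \<mu> \<theta>)\<^sup>2 + (b \<mu> \<theta>)\<^sup>2 / (2 * n)" by simp
      moreover have "X \<mu> \<theta> = \<omega> \<theta> \<mu> - (\<omega> \<theta> \<mu>)\<^sup>2 - n * (F \<mu> \<theta>)\<^sup>2 + F \<mu> \<theta> * b \<mu> \<theta>"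
        unfolding X_def by (simp add: power2_eq_square algebra_simps)
      ultimately show ?thesis using zero_le_power2[of "\<omega> \<theta> \<mu>"] by linarith
    qed
    then have "(\<Sum>\<mu>=1..p. X \<mu> \<theta>) \<le> (\<Sum>\<mu>=1..p. \<omega> \<theta> \<mu> - n / 2 * (F \<mu> \<theta>)\<^sup>2 + (b \<mu> \<theta>)\<^sup>2 / (2 * n))"
      by (rule sum_mono)
    also have "\<dots> = 1 - n / 2 * (\<Sum>\<mu>=1..p. (F \<mu> \<theta>)\<^sup>2) + (\<Sum>\<mu>=1..p. (b \<mu> \<theta>)\<^sup>2) / (2 * n)"
      using \<omega>[OF \<theta>] unfolding sum.distrib sum_subtractf sum_distrib_left[symmetric] sum_divide_distrib[symmetric]
      by (simp add: bin_probability_def)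
    also have "(\<Sum>\<mu>=1..p. (b \<mu> \<theta>)\<^sup>2) / (2 * n) \<le> K / 2"
      using b[OF \<theta>] n by (simp add: field_simps)
    finally show "(\<Sum>\<mu>=1..p. X \<mu> \<theta>) \<le> 1 + K / 2 - n / 2 * (\<Sum>\<mu>=1..p. (F \<mu> \<theta>)\<^sup>2)" by simp
  qed
  also have "\<dots> = 1 + K / 2 - n / 2 * (\<integral>\<theta>. (\<Sum>\<mu>=1..p. (F \<mu> \<theta>)\<^sup>2) \<partial>M)"
    using F2I by (simp add: prob_space)
  finally show ?thesis using n unfolding F_def by (simp add: field_simps)
qed

definition bin_variance :: "nat \<Rightarrow> (nat \<Rightarrow> real) \<Rightarrow> (nat \<Rightarrow> real) \<Rightarrow> real" where
  "bin_variance p w g = bin_mean p w (\<lambda>\<mu>. (g \<mu>)\<^sup>2) - (bin_mean p w g)\<^sup>2"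

text \<open>Insert \<open>c = e = g\<close> and \<open>\<phi> (sqrt n * (x - \<kappa>))\<close>,
  with \<open>\<phi>\<close> the Stein solution, into the score identity. The outcome is Stein's
  equation with the random posterior variance in place of \<open>v\<close> and an additional
  \<open>b / sqrt n\<close>. The deviation from the exact equation is weighted by the sup norms of
  \<open>\<phi>'\<close> and \<open>\<phi>\<close>, which are the two constants in the
  bound.\<close>

lemma stein_bound:
  fixes \<omega> :: "'a \<Rightarrow> nat \<Rightarrow> real" and n v :: real
  assumes M: "prob_space M"
    and \<omega>m: "\<And>\<mu>. \<mu> \<in> {1..p} \<Longrightarrow> (\<lambda>\<theta>. \<omega> \<theta> \<mu>) \<in> borel_measurable M"
    and \<omega>: "\<And>\<theta>. \<theta> \<in> space M \<Longrightarrow> bin_probability p (\<omega> \<theta>)"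
    and n: "n > 0" and N: "(\<Sum>\<mu>=1..p. N \<mu>) = n"
    and si: "score_identity M p \<omega> N g b"
    and b: "\<And>\<theta>. \<theta> \<in> space M \<Longrightarrow> \<bar>b \<theta>\<bar> \<le> B"
    and v: "v > 0" and h: "\<And>x. \<bar>h x\<bar> \<le> 1" and hc: "continuous_on UNIV h"
  defines "W \<equiv> \<lambda>\<theta>. sqrt n * (bin_mean p (\<omega> \<theta>) g - bin_mean p N g / n)"
  shows "\<bar>(\<integral>\<theta>. h (W \<theta>) \<partial>M) - (\<integral>x. h x \<partial>normal_law 0 v)\<bar> \<le>
    4 / v * (\<integral>\<theta>. \<bar>bin_variance p (\<omega> \<theta>) g - v\<bar> \<partial>M) + 2 * sqrt (2 * pi * v) / v * (B / sqrt n)"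
proof -
  interpret prob_space M by fact
  note [measurable] = \<omega>m
  have [measurable]: "b \<in> borel_measurable M" using si by (simp add: score_identity_def)
  have B0: "B \<ge> 0" using b not_empty by (metis abs_ge_zero ex_in_conv order_trans)
  define m where "m = (\<integral>x. h x \<partial>normal_law 0 v)"
  obtain \<phi> \<phi>' where d: "\<And>x. (\<phi> has_real_derivative \<phi>' x) (at x)" and c': "continuous_on UNIV \<phi>'"
    and eq: "\<And>x. v * \<phi>' x - x * \<phi> x = h x - m"
    and b0: "\<And>x. \<bar>\<phi> x\<bar> \<le> 2 * sqrt (2 * pi * v) / v" and b1: "\<And>x. \<bar>\<phi>' x\<bar> \<le> 4 / v"
    using stein_solution[OF v h hc] unfolding m_def by blast
  have c: "continuous_on UNIV \<phi>" using d by (meson DERIV_isCont continuous_at_imp_continuous_on)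
  have [measurable]: "\<phi> \<in> borel_measurable borel" "\<phi>' \<in> borel_measurable borel" "h \<in> borel_measurable borel"
    using c c' hc by (auto intro: borel_measurable_continuous_onI)
  define V where "V \<theta> = bin_variance p (\<omega> \<theta>) g" for \<theta>
  define \<kappa> where "\<kappa> = bin_mean p N g / n"
  have Wm[measurable]: "W \<in> borel_measurable M" unfolding W_def bin_mean_def by measurable
  have Vm[measurable]: "V \<in> borel_measurable M" unfolding V_def bin_variance_def bin_mean_def by measurable
  define G where "G = (\<Sum>\<mu>=1..p. \<bar>g \<mu>\<bar>)"
  have G: "\<bar>g \<mu>\<bar> \<le> G" if "\<mu> \<in> {1..p}" for \<mu>
    using member_le_sum[of \<mu> "{1..p}" "\<lambda>\<mu>. \<bar>g \<mu>\<bar>"] that unfolding G_def by auto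
  have mb: "\<bar>bin_mean p (\<omega> \<theta>) g\<bar> \<le> G" if "\<theta> \<in> space M" for \<theta>
    by (rule bin_mean_abs_le[OF \<omega>[OF that] G])
  have Vb: "\<bar>V \<theta>\<bar> \<le> 2 * G\<^sup>2" if "\<theta> \<in> space M" for \<theta>
  proof -
    have "\<bar>bin_mean p (\<omega> \<theta>) (\<lambda>\<mu>. (g \<mu>)\<^sup>2)\<bar> \<le> G\<^sup>2"
    proof (rule bin_mean_abs_le[OF \<omega>[OF that]])
      fix \<mu> assume "\<mu> \<in> {1..p}"
      from power_mono[OF G[OF this] abs_ge_zero, of 2] show "\<bar>(g \<mu>)\<^sup>2\<bar> \<le> G\<^sup>2" by simp
    qed
    moreover have "\<bar>(bin_mean p (\<omega> \<theta>) g)\<^sup>2\<bar> \<le> G\<^sup>2"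
      using mb[OF that] power_mono[OF mb[OF that], of 2] by simp
    ultimately show ?thesis unfolding V_def bin_variance_def by linarith
  qed
  have Wb: "\<bar>W \<theta>\<bar> \<le> sqrt n * (G + \<bar>\<kappa>\<bar>)" if "\<theta> \<in> space M" for \<theta>
    unfolding W_def \<kappa>_def[symmetric] abs_mult using mb[OF that] n by (intro mult_mono) auto
  have id: "(\<integral>\<theta>. sqrt n * \<phi>' (W \<theta>) * V \<theta> + \<phi> (W \<theta>) * (- sqrt n * W \<theta> + b \<theta>) \<partial>M) = 0"
  proof -
    have "\<forall>x. ((\<lambda>x. \<phi> (sqrt n * (x - \<kappa>))) has_real_derivative sqrt n * \<phi>' (sqrt n * (x - \<kappa>))) (at x)"
    proof
      fix x
      have "((\<lambda>x. sqrt n * (x - \<kappa>)) has_real_derivative sqrt n) (at x)"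
        by (auto intro!: derivative_eq_intros)
      from DERIV_chain2[OF d this]
      show "((\<lambda>x. \<phi> (sqrt n * (x - \<kappa>))) has_real_derivative sqrt n * \<phi>' (sqrt n * (x - \<kappa>))) (at x)"
        by (simp add: mult.commute)
    qed
    moreover have "continuous_on UNIV (\<lambda>x. sqrt n * \<phi>' (sqrt n * (x - \<kappa>)))"
      by (intro continuous_intros continuous_on_compose2[OF c']) auto
    ultimately have "(\<integral>\<theta>. sqrt n * \<phi>' (sqrt n * (bin_mean p (\<omega> \<theta>) g - \<kappa>)) * (\<Sum>\<mu>=1..p. g \<mu> * (\<omega> \<theta> \<mu> * (g \<mu> - bin_mean p (\<omega> \<theta>) g)))
         + \<phi> (sqrt n * (bin_mean p (\<omega> \<theta>) g - \<kappa>)) * ((\<Sum>\<mu>=1..p. N \<mu> * (g \<mu> - bin_mean p (\<omega> \<theta>) g)) + b \<theta>) \<partial>M) = 0"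
      using si unfolding score_identity_def by fastforce
    moreover have "(\<Sum>\<mu>=1..p. g \<mu> * (\<omega> \<theta> \<mu> * (g \<mu> - bin_mean p (\<omega> \<theta>) g))) = V \<theta>" for \<theta>
    proof -
      have "(\<Sum>\<mu>=1..p. g \<mu> * (\<omega> \<theta> \<mu> * (g \<mu> - bin_mean p (\<omega> \<theta>) g))) =
          (\<Sum>\<mu>=1..p. \<omega> \<theta> \<mu> * (g \<mu>)\<^sup>2 - \<omega> \<theta> \<mu> * g \<mu> * bin_mean p (\<omega> \<theta>) g)"
        by (intro sum.cong) (auto simp: power2_eq_square algebra_simps)
      also have "\<dots> = V \<theta>"
        unfolding V_def bin_variance_def sum_subtractf sum_distrib_right[symmetric]
        by (simp add: bin_mean_def power2_eq_square)
      finally show ?thesis .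
    qed
    moreover have "(\<Sum>\<mu>=1..p. N \<mu> * (g \<mu> - bin_mean p (\<omega> \<theta>) g)) = - sqrt n * W \<theta>" for \<theta>
    proof -
      have "(\<Sum>\<mu>=1..p. N \<mu> * (g \<mu> - bin_mean p (\<omega> \<theta>) g)) = bin_mean p N g - n * bin_mean p (\<omega> \<theta>) g"
        unfolding right_diff_distrib sum_subtractf sum_distrib_right[symmetric] N by (simp add: bin_mean_def)
      also have "\<dots> = - (sqrt n * sqrt n) * (bin_mean p (\<omega> \<theta>) g - bin_mean p N g / n)"
        using n by (simp add: field_simps)
      finally show ?thesis unfolding W_def by simp
    qed
    ultimately show ?thesis unfolding W_def \<kappa>_def by simp
  qed
  have I1: "integrable M (\<lambda>\<theta>. \<phi>' (W \<theta>) * V \<theta>)"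
  proof (rule integrable_bounded[OF M, where B = "4 / v * (2 * G\<^sup>2)"])
    fix \<theta> assume "\<theta> \<in> space M"
    then show "\<bar>\<phi>' (W \<theta>) * V \<theta>\<bar> \<le> 4 / v * (2 * G\<^sup>2)"
      unfolding abs_mult using b1[of "W \<theta>"] Vb[of \<theta>] v by (intro mult_mono) auto
  qed measurable
  have I2: "integrable M (\<lambda>\<theta>. \<phi> (W \<theta>) * W \<theta>)"
  proof (rule integrable_bounded[OF M, where B = "2 * sqrt (2 * pi * v) / v * (sqrt n * (G + \<bar>\<kappa>\<bar>))"])
    fix \<theta> assume "\<theta> \<in> space M"
    then show "\<bar>\<phi> (W \<theta>) * W \<theta>\<bar> \<le> 2 * sqrt (2 * pi * v) / v * (sqrt n * (G + \<bar>\<kappa>\<bar>))"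
      unfolding abs_mult using b0[of "W \<theta>"] Wb[of \<theta>] v by (intro mult_mono) auto
  qed measurable
  have I3: "integrable M (\<lambda>\<theta>. \<phi> (W \<theta>) * b \<theta>)"
  proof (rule integrable_bounded[OF M, where B = "2 * sqrt (2 * pi * v) / v * B"])
    fix \<theta> assume "\<theta> \<in> space M"
    then show "\<bar>\<phi> (W \<theta>) * b \<theta>\<bar> \<le> 2 * sqrt (2 * pi * v) / v * B"
      unfolding abs_mult using b0[of "W \<theta>"] b[of \<theta>] v by (intro mult_mono) auto
  qed measurable
  have I4: "integrable M (\<lambda>\<theta>. \<phi>' (W \<theta>))"
    by (rule integrable_bounded[OF M _ b1]) measurable
  have I5: "integrable M (\<lambda>\<theta>. \<bar>V \<theta> - v\<bar>)"
    by (intro integrable_abs Bochner_Integration.integrable_diff integrable_bounded[OF M _ Vb]) auto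
  have I6: "integrable M (\<lambda>\<theta>. h (W \<theta>))"
    by (rule integrable_bounded[OF M _ h]) measurable
  have id': "(\<integral>\<theta>. \<phi>' (W \<theta>) * V \<theta> - \<phi> (W \<theta>) * W \<theta> + \<phi> (W \<theta>) * b \<theta> / sqrt n \<partial>M) = 0"
  proof -
    have "(\<integral>\<theta>. \<phi>' (W \<theta>) * V \<theta> - \<phi> (W \<theta>) * W \<theta> + \<phi> (W \<theta>) * b \<theta> / sqrt n \<partial>M)
      = (\<integral>\<theta>. (sqrt n * \<phi>' (W \<theta>) * V \<theta> + \<phi> (W \<theta>) * (- sqrt n * W \<theta> + b \<theta>)) / sqrt n \<partial>M)"
      using n by (intro Bochner_Integration.integral_cong) (auto simp: field_simps)
    then show ?thesis using id by simp
  qed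
  have "(\<integral>\<theta>. h (W \<theta>) \<partial>M) - m = (\<integral>\<theta>. h (W \<theta>) - m \<partial>M)"
    using I6 by (simp add: prob_space)
  also have "\<dots> = (\<integral>\<theta>. v * \<phi>' (W \<theta>) - \<phi> (W \<theta>) * W \<theta> \<partial>M)"
    unfolding eq[symmetric] by (simp add: mult.commute)
  \<comment> \<open>Subtracts the score identity, an integral equal to zero, so that the terms
    \<open>\<phi> (W \<theta>) * W \<theta>\<close> cancel and only \<open>V - v\<close> and
    \<open>b\<close> remain.\<close>
  also have "\<dots> = (\<integral>\<theta>. v * \<phi>' (W \<theta>) - \<phi> (W \<theta>) * W \<theta> \<partial>M)
      - (\<integral>\<theta>. \<phi>' (W \<theta>) * V \<theta> - \<phi> (W \<theta>) * W \<theta> + \<phi> (W \<theta>) * b \<theta> / sqrt n \<partial>M)"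
    unfolding id' by simp
  also have "\<dots> = (\<integral>\<theta>. - (\<phi>' (W \<theta>) * (V \<theta> - v)) - \<phi> (W \<theta>) * b \<theta> / sqrt n \<partial>M)"
    using I1 I2 I3 I4 by (subst Bochner_Integration.integral_diff[symmetric])
      (auto intro!: Bochner_Integration.integral_cong simp: algebra_simps)
  finally have diff: "(\<integral>\<theta>. h (W \<theta>) \<partial>M) - m =
      (\<integral>\<theta>. - (\<phi>' (W \<theta>) * (V \<theta> - v)) - \<phi> (W \<theta>) * b \<theta> / sqrt n \<partial>M)" .
  have "\<bar>(\<integral>\<theta>. h (W \<theta>) \<partial>M) - m\<bar> \<le> (\<integral>\<theta>. 4 / v * \<bar>V \<theta> - v\<bar> + 2 * sqrt (2 * pi * v) / v * (B / sqrt n) \<partial>M)"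
    unfolding diff
  proof (rule order_trans[OF integral_abs_bound], rule integral_mono)
    have "integrable M (\<lambda>\<theta>. \<phi>' (W \<theta>) * (V \<theta> - v))" using I1 I4 by (simp add: right_diff_distrib)
    then show "integrable M (\<lambda>\<theta>. \<bar>- (\<phi>' (W \<theta>) * (V \<theta> - v)) - \<phi> (W \<theta>) * b \<theta> / sqrt n\<bar>)" using I3 by auto
    show "integrable M (\<lambda>\<theta>. 4 / v * \<bar>V \<theta> - v\<bar> + 2 * sqrt (2 * pi * v) / v * (B / sqrt n))" using I5 by auto
    fix \<theta> assume \<theta>: "\<theta> \<in> space M"
    have "\<bar>\<phi>' (W \<theta>) * (V \<theta> - v)\<bar> \<le> 4 / v * \<bar>V \<theta> - v\<bar>"
      unfolding abs_mult by (intro mult_right_mono b1) auto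
    moreover have "\<bar>\<phi> (W \<theta>) * b \<theta>\<bar> \<le> 2 * sqrt (2 * pi * v) / v * B"
      unfolding abs_mult using b0[of "W \<theta>"] b[OF \<theta>] v by (intro mult_mono) auto
    then have "\<bar>\<phi> (W \<theta>) * b \<theta>\<bar> / sqrt n \<le> 2 * sqrt (2 * pi * v) / v * B / sqrt n"
      using n by (intro divide_right_mono) auto
    then have "\<bar>\<phi> (W \<theta>) * b \<theta> / sqrt n\<bar> \<le> 2 * sqrt (2 * pi * v) / v * (B / sqrt n)"
      using n by (simp add: abs_divide)
    ultimately show "\<bar>- (\<phi>' (W \<theta>) * (V \<theta> - v)) - \<phi> (W \<theta>) * b \<theta> / sqrt n\<bar>
        \<le> 4 / v * \<bar>V \<theta> - v\<bar> + 2 * sqrt (2 * pi * v) / v * (B / sqrt n)" by linarith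
  qed
  also have "\<dots> = 4 / v * (\<integral>\<theta>. \<bar>V \<theta> - v\<bar> \<partial>M) + 2 * sqrt (2 * pi * v) / v * (B / sqrt n)"
  proof -
    have "integrable M (\<lambda>\<theta>. 4 / v * \<bar>V \<theta> - v\<bar>)" using I5 by (rule integrable_mult_right)
    from Bochner_Integration.integral_add[OF this integrable_const] show ?thesis
      by (simp only: prob_space lebesgue_integral_const integral_mult_right_zero real_scaleR_def mult_1)
  qed
  finally show ?thesis unfolding V_def m_def .
qed

section \<open>Posteriors of histogram models\<close>

definition bin_count :: "nat \<Rightarrow> nat \<Rightarrow> (nat \<Rightarrow> real) \<Rightarrow> nat \<Rightarrow> real" where
  "bin_count p n X \<mu> = real (card {i \<in> {1..n}. bin_index p (X i) = \<mu>})"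

lemma sum_bin_count:
  assumes "p > 0"
  shows "(\<Sum>i=1..n. F (bin_index p (X i))) = (\<Sum>\<mu>=1..p. bin_count p n X \<mu> * F \<mu>)"
proof -
  have "(\<Sum>i=1..n. F (bin_index p (X i))) = (\<Sum>\<mu>=1..p. \<Sum>i\<in>{i \<in> {1..n}. bin_index p (X i) = \<mu>}. F (bin_index p (X i)))"
    using bin_index_range[OF assms] by (intro sum.group[symmetric]) auto
  also have "\<dots> = (\<Sum>\<mu>=1..p. bin_count p n X \<mu> * F \<mu>)"
    by (intro sum.cong) (auto simp: bin_count_def)
  finally show ?thesis .
qed

lemma bin_count_nonneg: "bin_count p n X \<mu> \<ge> 0" by (simp add: bin_count_def)

lemma bin_count_total: "p > 0 \<Longrightarrow> (\<Sum>\<mu>=1..p. bin_count p n X \<mu>) = real n"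
  using sum_bin_count[of p "\<lambda>_. 1" X n] by simp

text \<open>Lets the bin averages of an indicator function be replaced by the discrete indicator as
  direction, the two agreeing on \<open>{1..p}\<close> only.\<close>

lemma score_identity_cong:
  assumes "\<And>\<mu>. \<mu> \<in> {1..p} \<Longrightarrow> e \<mu> = e' \<mu>"
  shows "score_identity M p \<omega> N e b \<longleftrightarrow> score_identity M p \<omega> N e' b"
proof -
  have [simp]: "bin_mean p w e = bin_mean p w e'" for w
    unfolding bin_mean_def using assms by (intro sum.cong) auto
  have "(\<Sum>\<mu>=1..p. c \<mu> * (w \<mu> * (e \<mu> - bin_mean p w e'))) = (\<Sum>\<mu>=1..p. c \<mu> * (w \<mu> * (e' \<mu> - bin_mean p w e')))" for c w
    using assms by (intro sum.cong) auto
  moreover have "(\<Sum>\<mu>=1..p. N \<mu> * (e \<mu> - bin_mean p w e')) = (\<Sum>\<mu>=1..p. N \<mu> * (e' \<mu> - bin_mean p w e'))" for w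
    using assms by (intro sum.cong) auto
  ultimately show ?thesis unfolding score_identity_def by simp
qed

lemma bin_average_indicator:
  assumes "p > 0" "\<mu> \<in> {1..p}" "\<nu> \<in> {1..p}"
  shows "bin_average p (indicator (bin p \<mu>)) \<nu> = (if \<nu> = \<mu> then 1 else 0)"
proof -
  have "indicat_real (bin p \<nu>) x * indicat_real (bin p \<mu>) x = (if \<nu> = \<mu> then indicat_real (bin p \<mu>) x else 0)" for x
    using bin_subset[OF assms(1,2)] bin_subset[OF assms(1,3)] mem_bin_iff[OF assms(1) _ assms(2), of x]
      mem_bin_iff[OF assms(1) _ assms(3), of x] by (auto simp: indicator_def)
  then show ?thesis
    unfolding bin_average_def set_lebesgue_integral_def using assms by (simp add: measure_bin)
qed

lemma distr_PiM_translate: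
  assumes "finite I"
  shows "distr (Pi\<^sub>M I (\<lambda>_. lborel :: real measure)) (Pi\<^sub>M I (\<lambda>_. lborel)) (\<lambda>x. \<lambda>i\<in>I. x i + a i) = Pi\<^sub>M I (\<lambda>_. lborel)"
proof (rule measure_eqI)
  let ?L = "Pi\<^sub>M I (\<lambda>_. lborel :: real measure)"
  have T[measurable]: "(\<lambda>x. \<lambda>i\<in>I. x i + a i) \<in> ?L \<rightarrow>\<^sub>M ?L" by (intro measurable_restrict) measurable
  fix A assume "A \<in> sets (distr ?L ?L (\<lambda>x. \<lambda>i\<in>I. x i + a i))"
  then have [measurable]: "A \<in> sets ?L" by simp
  have "emeasure (distr ?L ?L (\<lambda>x. \<lambda>i\<in>I. x i + a i)) A
      = (\<integral>\<^sup>+x. indicator A x \<partial>distr ?L ?L (\<lambda>x. \<lambda>i\<in>I. x i + a i))" by simp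
  also have "\<dots> = (\<integral>\<^sup>+x. indicator A (\<lambda>i\<in>I. x i + a i) \<partial>?L)"
    by (rule nn_integral_distr[OF T]) simp
  also have "\<dots> = (\<integral>\<^sup>+x. indicator A (\<lambda>i\<in>I. a i + 1 * x i) \<partial>?L)"
    by (simp add: add.commute)
  also have "\<dots> = (\<integral>\<^sup>+x. indicator A x \<partial>?L)"
    using nn_integral_PiM_affine[OF assms, of "\<lambda>_. 1" "indicator A" a] by simp
  finally show "emeasure (distr ?L ?L (\<lambda>x. \<lambda>i\<in>I. x i + a i)) A = emeasure ?L A" by simp
qed simp

lemma prob_space_posterior:
  assumes m: "(\<lambda>\<theta>. ennreal (likelihood n X (dens \<theta>))) \<in> borel_measurable prior"
    and "evidence prior dens n X \<noteq> 0" "evidence prior dens n X \<noteq> \<infinity>"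
  shows "prob_space (posterior prior dens n X)"
proof
  have "emeasure (posterior prior dens n X) (space (posterior prior dens n X)) =
      (\<integral>\<^sup>+\<theta>. ennreal (likelihood n X (dens \<theta>)) / evidence prior dens n X \<partial>prior)"
    unfolding posterior_def using m
    by (auto simp: emeasure_density intro!: nn_integral_cong)
  also have "\<dots> = evidence prior dens n X / evidence prior dens n X"
    using m unfolding evidence_def by (rule nn_integral_divide)
  also have "\<dots> = 1" using assms by (simp add: ennreal_divide_self less_top)
  finally show "emeasure (posterior prior dens n X) (space (posterior prior dens n X)) = 1" .
qed

text \<open>Brings a posterior expectation back to the base measure with an explicit real density,
  where a change of variables can act.\<close>

lemma integral_posterior:
  fixes F :: "'a \<Rightarrow> real"
  assumes [measurable]: "F \<in> borel_measurable N" "d \<in> borel_measurable N"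
    and L[measurable]: "(\<lambda>\<theta>. likelihood n X (dens \<theta>)) \<in> borel_measurable N"
    and d0: "\<And>\<theta>. \<theta> \<in> space N \<Longrightarrow> d \<theta> \<ge> 0"
    and L0: "\<And>\<theta>. \<theta> \<in> space N \<Longrightarrow> likelihood n X (dens \<theta>) \<ge> 0"
    and Z: "evidence (density N (\<lambda>\<theta>. ennreal (d \<theta>))) dens n X \<noteq> 0" "evidence (density N (\<lambda>\<theta>. ennreal (d \<theta>))) dens n X \<noteq> \<infinity>"
  shows "(\<integral>\<theta>. F \<theta> \<partial>posterior (density N (\<lambda>\<theta>. ennreal (d \<theta>))) dens n X) =
    (\<integral>\<theta>. d \<theta> * likelihood n X (dens \<theta>) / enn2real (evidence (density N (\<lambda>\<theta>. ennreal (d \<theta>))) dens n X) * F \<theta> \<partial>N)"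
proof -
  let ?P = "density N (\<lambda>\<theta>. ennreal (d \<theta>))"
  define z where "z = enn2real (evidence ?P dens n X)"
  have z: "z > 0" "evidence ?P dens n X = ennreal z"
    using Z unfolding z_def by (auto simp: enn2real_positive_iff less_top[symmetric] zero_less_iff_neq_zero)
  have "posterior ?P dens n X = density N (\<lambda>\<theta>. ennreal (d \<theta>) * (ennreal (likelihood n X (dens \<theta>)) / evidence ?P dens n X))"
    unfolding posterior_def by (subst density_density_eq) auto
  also have "\<dots> = density N (\<lambda>\<theta>. ennreal (d \<theta> * likelihood n X (dens \<theta>) / z))"
    unfolding z(2) using z(1) d0 L0
    by (intro density_cong AE_I2) (auto simp: divide_ennreal ennreal_mult[symmetric])
  finally have "(\<integral>\<theta>. F \<theta> \<partial>posterior ?P dens n X) =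
      (\<integral>\<theta>. F \<theta> \<partial>density N (\<lambda>\<theta>. ennreal (d \<theta> * likelihood n X (dens \<theta>) / z)))" by simp
  also have "\<dots> = (\<integral>\<theta>. (d \<theta> * likelihood n X (dens \<theta>) / z) *\<^sub>R F \<theta> \<partial>N)"
    using z(1) d0 L0 by (intro integral_density) auto
  finally show ?thesis unfolding z_def by simp
qed

text \<open>A canonical point of each bin, at which functions that are constant on bins can be
  evaluated.\<close>

definition bin_midpoint :: "nat \<Rightarrow> nat \<Rightarrow> real" where
  "bin_midpoint p \<mu> = (2 * real \<mu> - 1) / (2 * real p)"

lemma bin_midpoint:
  assumes "p > 0" "\<mu> \<in> {1..p}"
  shows "bin_midpoint p \<mu> \<in> {0..1}" "bin_index p (bin_midpoint p \<mu>) = \<mu>"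
proof -
  have "bin_midpoint p \<mu> \<in> bin p \<mu>"
    using assms by (auto simp: bin_def bin_midpoint_def field_simps)
  then show "bin_midpoint p \<mu> \<in> {0..1}" "bin_index p (bin_midpoint p \<mu>) = \<mu>"
    using bin_subset[OF assms] mem_bin_iff[OF assms(1) _ assms(2)] by auto
qed

lemma bin_index_coarsen:
  assumes "q > 0" "x \<in> {0..1}" "y \<in> {0..1}" "bin_index (2 * q) x = bin_index (2 * q) y"
  shows "bin_index q x = bin_index q y"
  using bin_index_double[OF assms(1,2)] bin_index_double[OF assms(1,3)] assms(4)
    bin_index_range[OF assms(1), of x] bin_index_range[OF assms(1), of y] by auto

lemma bin_index_coarsen_dyadic:
  assumes x: "x \<in> {0..1}" and y: "y \<in> {0..1}" and "bin_index (2 ^ K) x = bin_index (2 ^ K) y" and "j \<le> K"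
  shows "bin_index (2 ^ j) x = bin_index (2 ^ j) y"
  using assms(4)
proof (induction rule: inc_induct)
  case (step j)
  then show ?case using bin_index_coarsen[of "2 ^ j" x y] x y by simp
qed (rule assms(3))

lemma haar_series_cong:
  assumes x: "x \<in> {0..1}" and y: "y \<in> {0..1}" and eq: "bin_index (2 ^ Suc J) x = bin_index (2 ^ Suc J) y"
  shows "haar_series J \<theta> x = haar_series J \<theta> y"
proof -
  have "haar j k x = haar j k y" if "j \<le> J" "k \<in> {1..2 ^ j}" for j k
  proof -
    have "bin_index (2 ^ j) x = bin_index (2 ^ j) y" "bin_index (2 ^ Suc j) x = bin_index (2 ^ Suc j) y"
      by (rule bin_index_coarsen_dyadic[OF x y eq]; use that in simp)+
    then show ?thesis using haar_eq[OF x that(2)] haar_eq[OF y that(2)] by simp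
  qed
  then show ?thesis unfolding haar_series_def haar_index_def by (intro sum.cong) auto
qed

text \<open>The softmax of the log-density values on the bins. The common bin length cancels between
  numerator and normaliser, so these are the probabilities that
  \<open>haar_density J \<theta>\<close> gives to the bins.\<close>

definition haar_bins :: "nat \<Rightarrow> (nat \<times> nat \<Rightarrow> real) \<Rightarrow> nat \<Rightarrow> real" where
  "haar_bins J \<theta> \<mu> = exp (haar_series J \<theta> (bin_midpoint (2 ^ Suc J) \<mu>))
     / (\<Sum>\<nu>=1..2 ^ Suc J. exp (haar_series J \<theta> (bin_midpoint (2 ^ Suc J) \<nu>)))"

lemma haar_series_midpoint:
  assumes "x \<in> {0..1}"
  shows "haar_series J \<theta> x = haar_series J \<theta> (bin_midpoint (2 ^ Suc J) (bin_index (2 ^ Suc J) x))"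
  by (rule haar_series_cong) (use assms bin_index_range[of "2 ^ Suc J" x] bin_midpoint[of "2 ^ Suc J"] in auto)

lemma haar_sum_pos: "(\<Sum>\<nu>=1..2 ^ Suc J. exp (haar_series J \<theta> (bin_midpoint (2 ^ Suc J) \<nu>))) > 0"
  by (intro sum_pos) auto

lemma bin_probability_haar_bins: "bin_probability (2 ^ Suc J) (haar_bins J \<theta>)"
  unfolding bin_probability_def haar_bins_def sum_divide_distrib[symmetric]
  using haar_sum_pos[of J \<theta>] by (simp add: divide_pos_pos del: power_Suc)

lemma haar_density_eq:
  assumes x: "x \<in> {0..1}"
  shows "haar_density J \<theta> x = real (2 ^ Suc J) * haar_bins J \<theta> (bin_index (2 ^ Suc J) x)"
proof -
  let ?p = "2 ^ Suc J :: nat"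
  define s where "s \<mu> = haar_series J \<theta> (bin_midpoint ?p \<mu>)" for \<mu>
  have ser: "haar_series J \<theta> y = s (bin_index ?p y)" if "y \<in> {0..1}" for y
    unfolding s_def by (rule haar_series_midpoint[OF that])
  have S: "(\<Sum>\<nu>=1..?p. exp (s \<nu>)) > 0" unfolding s_def by (rule haar_sum_pos)
  have "(LBINT y:{0..1}. exp (haar_series J \<theta> y)) = (\<integral>y. (\<Sum>\<mu>=1..?p. exp (s \<mu>) * indicat_real (bin ?p \<mu>) y) \<partial>lborel)"
    unfolding set_lebesgue_integral_def
  proof (intro Bochner_Integration.integral_cong)
    fix y show "indicat_real {0..1} y *\<^sub>R exp (haar_series J \<theta> y) = (\<Sum>\<mu>=1..?p. exp (s \<mu>) * indicat_real (bin ?p \<mu>) y)"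
    proof (cases "y \<in> {0..1}")
      case True
      then show ?thesis using ser[OF True] sum_indicator_bin[of ?p y "\<lambda>\<mu>. exp (s \<mu>)"] by simp
    next
      case False
      then have "y \<notin> bin ?p \<mu>" if "\<mu> \<in> {1..?p}" for \<mu> using bin_subset[of ?p \<mu>] that by auto
      then show ?thesis using False by (simp del: power_Suc)
    qed
  qed simp
  also have "\<dots> = (\<Sum>\<mu>=1..?p. exp (s \<mu>) * (1 / real ?p))"
    by (subst Bochner_Integration.integral_sum) (auto simp: emeasure_bin measure_bin simp del: power_Suc)
  finally have int: "(LBINT y:{0..1}. exp (haar_series J \<theta> y)) = (\<Sum>\<mu>=1..?p. exp (s \<mu>)) / real ?p"
    by (simp add: sum_divide_distrib del: power_Suc)
  show ?thesis
    unfolding haar_density_def haar_log_normaliser_def int haar_bins_def s_def[symmetric] ser[OF x]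
    using S by (simp add: exp_diff field_simps del: power_Suc)
qed

lemma likelihood_histogram:
  assumes "p > 0" "\<And>i. i \<in> {1..n} \<Longrightarrow> X i \<in> {0..1}"
    and "\<And>x. x \<in> {0..1} \<Longrightarrow> f x = real p * w (bin_index p x)"
  shows "likelihood n X f = (\<Prod>i=1..n. real p * w (bin_index p (X i)))"
  unfolding likelihood_def by (intro prod.cong refl assms(3)[OF assms(2)])

section \<open>The Haar series prior\<close>

lemma finite_haar_index[simp]: "finite (haar_index J)"
  by (simp add: haar_index_def)

lemma measurable_haar_series[measurable]:
  "(\<lambda>\<theta>. haar_series J \<theta> x) \<in> borel_measurable (Pi\<^sub>M (haar_index J) (\<lambda>_. lborel))"
proof -
  have eq: "haar_series J \<theta> x = (\<Sum>i\<in>haar_index J. \<theta> i * haar (fst i) (snd i) x)" for \<theta>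
    unfolding haar_series_def by (intro sum.cong) auto
  show ?thesis unfolding eq
    by (intro borel_measurable_sum borel_measurable_times borel_measurable_const)
       (use measurable_component_singleton[of _ "haar_index J" "\<lambda>_. lborel"] in simp)
qed

lemma measurable_haar_bins[measurable]:
  "(\<lambda>\<theta>. haar_bins J \<theta> \<mu>) \<in> borel_measurable (Pi\<^sub>M (haar_index J) (\<lambda>_. lborel))"
  unfolding haar_bins_def by measurable

text \<open>Translating \<open>\<theta>\<close> by \<open>t\<close> times the Haar coefficients of
  \<open>g\<close> realises the tilt by the bin averages of \<open>g\<close>. Lebesgue measure is
  invariant, so besides the likelihood only the factor \<open>exp (- H)\<close> changes, and its
  logarithmic derivative is at most the bound on \<open>H'\<close> times the coefficients weighted
  by \<open>1 / \<sigma> j\<close>.\<close>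

lemma haar_score_identity:
  fixes H :: "real \<Rightarrow> real" and \<sigma> :: "nat \<Rightarrow> real" and X :: "nat \<Rightarrow> real" and J n :: nat
  defines "p \<equiv> 2 ^ Suc J"
  defines "M \<equiv> posterior (haar_prior J H \<sigma>) (haar_density J) n X"
  assumes X: "\<And>i. i \<in> {1..n} \<Longrightarrow> X i \<in> {0..1}"
    and ev: "evidence (haar_prior J H \<sigma>) (haar_density J) n X \<noteq> \<infinity>"
    and \<sigma>: "\<And>j. j \<le> J \<Longrightarrow> \<sigma> j > 0"
    and H: "\<And>x. H differentiable (at x)" and Hb: "\<And>x. \<bar>deriv H x\<bar> \<le> B"
  shows "prob_space M" "sets M = sets (Pi\<^sub>M (haar_index J) (\<lambda>_. lborel))"
    and "set_integrable lborel {0..1} g \<Longrightarrow> \<exists>b. score_identity M p (haar_bins J) (bin_count p n X) (bin_average p g) b \<and>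
      (\<forall>\<theta>\<in>space M. \<bar>b \<theta>\<bar> \<le> B * (\<Sum>(j, k)\<in>haar_index J. \<bar>haar_coeff g (j, k)\<bar> / \<sigma> j))"
proof -
  let ?I = "haar_index J"
  let ?L = "Pi\<^sub>M ?I (\<lambda>_. lborel :: real measure)"
  have p0: "p > 0" by (simp add: p_def)
  define N where "N = bin_count p n X"
  define d where "d \<theta> = (\<Prod>(j, k)\<in>?I. exp (- H (\<theta> (j, k) / \<sigma> j)))" for \<theta>
  define lik where "lik \<theta> = (\<Prod>i=1..n. real p * haar_bins J \<theta> (bin_index p (X i)))" for \<theta>
  have Hd: "(H has_real_derivative deriv H x) (at x)" for x
    using H[of x] by (simp add: DERIV_deriv_iff_real_differentiable)
  have Hc: "continuous_on UNIV H" using Hd by (meson DERIV_isCont continuous_at_imp_continuous_on)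
  have [measurable]: "H \<in> borel_measurable borel" using Hc by (rule borel_measurable_continuous_onI)
  have comp[measurable]: "(\<lambda>\<theta>. \<theta> i) \<in> borel_measurable ?L" if "i \<in> ?I" for i
    using measurable_component_singleton[of i ?I "\<lambda>_. lborel"] that by simp
  have d_eq: "d \<theta> = exp (- (\<Sum>i\<in>?I. H (\<theta> i / \<sigma> (fst i))))" for \<theta>
    unfolding d_def by (subst sum_negf[symmetric], subst exp_sum) (auto intro!: prod.cong)
  have dm[measurable]: "d \<in> borel_measurable ?L" unfolding d_eq by measurable
  have lik: "likelihood n X (haar_density J \<theta>) = lik \<theta>" for \<theta>
    unfolding lik_def by (intro likelihood_histogram[OF p0 X]) (simp_all add: haar_density_eq p_def del: power_Suc)
  have likm[measurable]: "lik \<in> borel_measurable ?L" unfolding lik_def by measurable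
  have w: "bin_probability p (haar_bins J \<theta>)" for \<theta> unfolding p_def by (rule bin_probability_haar_bins)
  have wpos: "haar_bins J \<theta> (bin_index p x) > 0" for \<theta> x
    using w[of \<theta>] bin_index_range[OF p0, of x] by (simp add: bin_probability_def)
  have likpos: "lik \<theta> > 0" for \<theta> unfolding lik_def using wpos p0 by (intro prod_pos) auto
  have dpos: "d \<theta> > 0" for \<theta> unfolding d_eq by simp
  have prior: "haar_prior J H \<sigma> = density ?L (\<lambda>\<theta>. ennreal (d \<theta>))"
    unfolding haar_prior_def d_def ..
  interpret product_sigma_finite "\<lambda>_::nat \<times> nat. lborel :: real measure" by unfold_locales
  \<comment> \<open>Likelihood and prior density are strictly positive everywhere, so zero evidence
    would make the product Lebesgue measure null, against the unit cube.\<close>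
  have ev0: "evidence (haar_prior J H \<sigma>) (haar_density J) n X \<noteq> 0"
  proof
    assume "evidence (haar_prior J H \<sigma>) (haar_density J) n X = 0"
    then have "(\<integral>\<^sup>+\<theta>. ennreal (d \<theta>) * ennreal (lik \<theta>) \<partial>?L) = 0"
      unfolding evidence_def prior lik by (subst (asm) nn_integral_density) auto
    then have "AE \<theta> in ?L. ennreal (d \<theta>) * ennreal (lik \<theta>) = 0"
      by (subst (asm) nn_integral_0_iff_AE) auto
    moreover have "ennreal (d \<theta>) * ennreal (lik \<theta>) \<noteq> 0" for \<theta>
      using dpos[of \<theta>] likpos[of \<theta>] by (simp add: ennreal_eq_0_iff not_le)
    ultimately have "AE \<theta> in ?L. False" by simp
    then have "emeasure ?L (space ?L) = 0" by (simp add: eventually_False ae_filter_eq_bot_iff)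
    moreover have "emeasure ?L (\<Pi>\<^sub>E i\<in>?I. {0..1}) = 1"
      by (subst emeasure_PiM) auto
    moreover have "emeasure ?L (\<Pi>\<^sub>E i\<in>?I. {0..1}) \<le> emeasure ?L (space ?L)"
      by (rule emeasure_space)
    ultimately show False by simp
  qed
  show prob: "prob_space M"
    unfolding M_def using ev ev0 by (intro prob_space_posterior) (auto simp: lik prior)
  show sets: "sets M = sets ?L" unfolding M_def posterior_def prior by simp
  have space: "space M = space ?L" using sets by (rule sets_eq_imp_space_eq)
  define z where "z = enn2real (evidence (haar_prior J H \<sigma>) (haar_density J) n X)"
  have intM: "(\<integral>\<theta>. F \<theta> \<partial>M) = (\<integral>\<theta>. d \<theta> * lik \<theta> / z * F \<theta> \<partial>?L)" if "F \<in> borel_measurable ?L" for F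
    using integral_posterior[of F ?L d n X "haar_density J"] that ev ev0 dpos likpos
    unfolding M_def z_def prior lik by (auto simp: less_imp_le)
  show "\<exists>b. score_identity M p (haar_bins J) (bin_count p n X) (bin_average p g) b \<and>
      (\<forall>\<theta>\<in>space M. \<bar>b \<theta>\<bar> \<le> B * (\<Sum>(j, k)\<in>?I. \<bar>haar_coeff g (j, k)\<bar> / \<sigma> j))"
    if g: "set_integrable lborel {0..1} g"
  proof -
    define a where "a = haar_coeff g"
    define e where "e = bin_average p g"
    define \<tau> where "\<tau> t \<theta> = (\<lambda>i\<in>?I. \<theta> i + t * a i)" for t \<theta>
    define T where "T t \<theta> = tilt_normaliser p e t (haar_bins J \<theta>)" for t \<theta>
    have Tpos: "T t \<theta> > 0" for t \<theta>
      unfolding T_def tilt_normaliser_def using w[of \<theta>] p0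
      by (intro sum_pos) (auto simp: bin_probability_def)
    have \<tau>m[measurable]: "\<tau> t \<in> ?L \<rightarrow>\<^sub>M ?L" for t
      unfolding \<tau>_def by (intro measurable_restrict) measurable
    have ser: "haar_series J (\<tau> t \<theta>) x = haar_series J \<theta> x + t * (e (bin_index p x) - bin_average 1 g 1)"
      if "x \<in> {0..1}" for t \<theta> x
    proof -
      have "haar_series J (\<tau> t \<theta>) x = (\<Sum>(j, k)\<in>?I. \<theta> (j, k) * haar j k x + t * (a (j, k) * haar j k x))"
        unfolding haar_series_def \<tau>_def by (intro sum.cong) (auto simp: algebra_simps)
      also have "\<dots> = haar_series J \<theta> x + t * haar_series J a x"
        unfolding haar_series_def by (simp add: sum.distrib sum_distrib_left case_prod_beta)
      also have "haar_series J a x = e (bin_index p x) - bin_average 1 g 1"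
        unfolding a_def e_def p_def by (rule haar_expansion[OF g that])
      finally show ?thesis .
    qed
    have tilt: "haar_bins J (\<tau> t \<theta>) \<mu> = haar_bins J \<theta> \<mu> * exp (t * e \<mu> - ln (T t \<theta>))" if \<mu>: "\<mu> \<in> {1..p}" for t \<theta> \<mu>
    proof -
      define s where "s \<nu> = haar_series J \<theta> (bin_midpoint p \<nu>)" for \<nu>
      define S where "S = (\<Sum>\<nu>=1..p. exp (s \<nu>))"
      \<comment> \<open>The Haar expansion recovers \<open>g\<close> only up to its mean over
        \<open>[0, 1]\<close>; this leaves a common factor, which the normalisation of the bin
        probabilities cancels.\<close>
      define c where "c = exp (- (t * bin_average 1 g 1))"
      have S: "S > 0" unfolding S_def s_def p_def by (rule haar_sum_pos)
      have b\<theta>: "haar_bins J \<theta> \<nu> = exp (s \<nu>) / S" for \<nu>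
        unfolding haar_bins_def S_def s_def p_def ..
      have s': "exp (haar_series J (\<tau> t \<theta>) (bin_midpoint p \<nu>)) = c * (exp (s \<nu>) * exp (t * e \<nu>))" if "\<nu> \<in> {1..p}" for \<nu>
        using ser[OF bin_midpoint(1)[OF p0 that], of t \<theta>] bin_midpoint(2)[OF p0 that]
        unfolding s_def[symmetric] c_def by (simp add: algebra_simps flip: exp_add)
      have "(\<Sum>\<nu>=1..p. exp (haar_series J (\<tau> t \<theta>) (bin_midpoint p \<nu>))) = c * (S * T t \<theta>)"
      proof -
        have "S * T t \<theta> = (\<Sum>\<nu>=1..p. exp (s \<nu>) * exp (t * e \<nu>))"
          using S unfolding T_def tilt_normaliser_def b\<theta> by (simp add: sum_distrib_left)
        then show ?thesis using s' by (simp add: sum_distrib_left)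
      qed
      then have "haar_bins J (\<tau> t \<theta>) \<mu> = c * (exp (s \<mu>) * exp (t * e \<mu>)) / (c * (S * T t \<theta>))"
        using s'[OF \<mu>] unfolding haar_bins_def p_def[symmetric] by simp
      also have "\<dots> = exp (s \<mu>) * exp (t * e \<mu>) / (S * T t \<theta>)" by (simp add: c_def)
      also have "\<dots> = haar_bins J \<theta> \<mu> * exp (t * e \<mu> - ln (T t \<theta>))"
        unfolding b\<theta> using Tpos[of t \<theta>] by (simp add: exp_diff)
      finally show ?thesis .
    qed
    define lr where "lr t \<theta> = (\<Sum>i\<in>?I. H (\<theta> i / \<sigma> (fst i)) - H ((\<theta> i + t * a i) / \<sigma> (fst i)))" for t \<theta>
    define A where "A = (\<Sum>(j, k)\<in>?I. \<bar>a (j, k)\<bar> / \<sigma> j)"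
    have A_eq: "A = (\<Sum>i\<in>?I. \<bar>a i\<bar> / \<sigma> (fst i))" unfolding A_def by (intro sum.cong) auto
    define b where "b \<theta> = (\<Sum>i\<in>?I. - (deriv H (\<theta> i / \<sigma> (fst i)) * (a i / \<sigma> (fst i))))" for \<theta>
    have \<sigma>': "\<sigma> (fst i) > 0" if "i \<in> ?I" for i using that \<sigma> by (auto simp: haar_index_def)
    have d\<tau>: "d (\<tau> t \<theta>) = d \<theta> * exp (lr t \<theta>)" for t \<theta>
    proof -
      have "(\<Sum>i\<in>?I. H (\<tau> t \<theta> i / \<sigma> (fst i))) = (\<Sum>i\<in>?I. H ((\<theta> i + t * a i) / \<sigma> (fst i)))"
        unfolding \<tau>_def by (intro sum.cong) auto
      then show ?thesis unfolding d_eq lr_def by (simp add: sum_subtractf flip: exp_add)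
    qed
    have lik\<tau>: "lik (\<tau> t \<theta>) = lik \<theta> * exp (\<Sum>\<mu>=1..p. N \<mu> * (t * e \<mu> - ln (T t \<theta>)))" for t \<theta>
    proof -
      have "lik (\<tau> t \<theta>) = (\<Prod>i=1..n. (real p * haar_bins J \<theta> (bin_index p (X i))) * exp (t * e (bin_index p (X i)) - ln (T t \<theta>)))"
        unfolding lik_def using tilt[OF bin_index_range[OF p0]] by (intro prod.cong) auto
      also have "\<dots> = lik \<theta> * exp (\<Sum>i=1..n. t * e (bin_index p (X i)) - ln (T t \<theta>))"
        unfolding lik_def by (simp add: prod.distrib exp_sum)
      also have "(\<Sum>i=1..n. t * e (bin_index p (X i)) - ln (T t \<theta>)) = (\<Sum>\<mu>=1..p. N \<mu> * (t * e \<mu> - ln (T t \<theta>)))"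
        unfolding N_def by (rule sum_bin_count[OF p0])
      finally show ?thesis .
    qed
    have Tm[measurable]: "T t \<in> borel_measurable ?L" for t unfolding T_def tilt_normaliser_def by measurable
    have lrm: "lr t \<in> borel_measurable ?L" for t unfolding lr_def by measurable
    have bb: "\<bar>b \<theta>\<bar> \<le> B * A" for \<theta>
    proof -
      have "\<bar>b \<theta>\<bar> \<le> (\<Sum>i\<in>?I. \<bar>- (deriv H (\<theta> i / \<sigma> (fst i)) * (a i / \<sigma> (fst i)))\<bar>)"
        unfolding b_def by (rule sum_abs)
      also have "\<dots> \<le> (\<Sum>i\<in>?I. B * (\<bar>a i\<bar> / \<sigma> (fst i)))"
      proof (rule sum_mono)
        fix i assume "i \<in> ?I"
        from \<sigma>'[OF this] show "\<bar>- (deriv H (\<theta> i / \<sigma> (fst i)) * (a i / \<sigma> (fst i)))\<bar> \<le> B * (\<bar>a i\<bar> / \<sigma> (fst i))"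
          unfolding abs_minus_cancel abs_mult by (intro mult_mono Hb) (auto simp: abs_divide order_trans[OF abs_ge_zero Hb])
      qed
      finally show ?thesis unfolding A_eq by (simp add: sum_distrib_left)
    qed
    have HL: "\<bar>H x - H y\<bar> \<le> B * \<bar>x - y\<bar>" for x y
    proof -
      have "norm (H x - H y) \<le> B * norm (x - y)"
        by (rule field_differentiable_bound[of UNIV H "deriv H"]) (use Hd Hb in auto)
      then show ?thesis by simp
    qed
    have "score_identity M p (haar_bins J) N e b"
    proof (rule score_identityI[OF prob, where \<tau> = \<tau> and lr = lr and B = "B * A"])
      show "(\<lambda>\<theta>. haar_bins J \<theta> \<mu>) \<in> borel_measurable M" for \<mu>
        using measurable_cong_sets[OF sets refl] measurable_haar_bins by blast
      show "lr t \<in> borel_measurable M" for t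
        using measurable_cong_sets[OF sets refl] lrm by blast
      show "bin_probability p (haar_bins J \<theta>)" for \<theta> by (rule w)
      show "haar_bins J (\<tau> t \<theta>) \<mu> = haar_bins J \<theta> \<mu> * exp (t * e \<mu> - ln (tilt_normaliser p e t (haar_bins J \<theta>)))"
        if "\<mu> \<in> {1..p}" for t \<theta> \<mu> using tilt[OF that] unfolding T_def .
      show "lr 0 \<theta> = 0" for \<theta> by (simp add: lr_def)
      show "((\<lambda>t. lr t \<theta>) has_real_derivative b \<theta>) (at 0)" for \<theta>
        unfolding lr_def b_def
      proof (intro DERIV_sum)
        fix i assume "i \<in> ?I"
        have "((\<lambda>t. (\<theta> i + t * a i) / \<sigma> (fst i)) has_real_derivative a i / \<sigma> (fst i)) (at 0)"
          using \<sigma>'[OF \<open>i \<in> ?I\<close>] by (auto intro!: derivative_eq_intros)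
        from DERIV_diff[OF DERIV_const DERIV_chain2[OF Hd this]]
        show "((\<lambda>t. H (\<theta> i / \<sigma> (fst i)) - H ((\<theta> i + t * a i) / \<sigma> (fst i))) has_real_derivative
            - (deriv H (\<theta> i / \<sigma> (fst i)) * (a i / \<sigma> (fst i)))) (at 0)" by simp
      qed
      show "\<bar>lr t \<theta>\<bar> \<le> B * A * t" if t: "0 \<le> t" for t \<theta>
      proof -
        have "\<bar>lr t \<theta>\<bar> \<le> (\<Sum>i\<in>?I. \<bar>H (\<theta> i / \<sigma> (fst i)) - H ((\<theta> i + t * a i) / \<sigma> (fst i))\<bar>)"
          unfolding lr_def by (rule sum_abs)
        also have "\<dots> \<le> (\<Sum>i\<in>?I. B * (\<bar>a i\<bar> / \<sigma> (fst i)) * t)"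
        proof (rule sum_mono)
          fix i assume "i \<in> ?I"
          have "\<theta> i / \<sigma> (fst i) - (\<theta> i + t * a i) / \<sigma> (fst i) = - (t * a i / \<sigma> (fst i))"
            by (simp add: add_divide_distrib)
          then show "\<bar>H (\<theta> i / \<sigma> (fst i)) - H ((\<theta> i + t * a i) / \<sigma> (fst i))\<bar> \<le> B * (\<bar>a i\<bar> / \<sigma> (fst i)) * t"
            using HL[of "\<theta> i / \<sigma> (fst i)" "(\<theta> i + t * a i) / \<sigma> (fst i)"] \<sigma>'[OF \<open>i \<in> ?I\<close>] t
            by (simp add: abs_mult abs_divide mult.commute mult.left_commute)
        qed
        finally show ?thesis unfolding A_eq by (simp add: sum_distrib_left sum_distrib_right)
      qed
      show "(\<integral>\<theta>. F (\<tau> t \<theta>) * exp ((\<Sum>\<mu>=1..p. N \<mu> * (t * e \<mu> - ln (tilt_normaliser p e t (haar_bins J \<theta>)))) + lr t \<theta>) \<partial>M)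
        = (\<integral>\<theta>. F \<theta> \<partial>M)" if "F \<in> borel_measurable M" for F t
      proof -
        have [measurable]: "F \<in> borel_measurable ?L"
          using that measurable_cong_sets[OF sets refl] by blast
        note [measurable] = lrm
        have "(\<integral>\<theta>. F \<theta> \<partial>M) = (\<integral>\<theta>. d \<theta> * lik \<theta> / z * F \<theta> \<partial>?L)" by (rule intM) simp
        \<comment> \<open>Translation invariance of the product Lebesgue measure; the prior itself
          may have infinite mass.\<close>
        also have "\<dots> = (\<integral>\<theta>. d \<theta> * lik \<theta> / z * F \<theta> \<partial>distr ?L ?L (\<tau> t))"
          unfolding \<tau>_def by (subst distr_PiM_translate) auto
        also have "\<dots> = (\<integral>\<theta>. d (\<tau> t \<theta>) * lik (\<tau> t \<theta>) / z * F (\<tau> t \<theta>) \<partial>?L)"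
          by (rule integral_distr) measurable
        also have "\<dots> = (\<integral>\<theta>. d \<theta> * lik \<theta> / z * (F (\<tau> t \<theta>) * exp ((\<Sum>\<mu>=1..p. N \<mu> * (t * e \<mu> - ln (T t \<theta>))) + lr t \<theta>)) \<partial>?L)"
          unfolding d\<tau> lik\<tau> by (intro Bochner_Integration.integral_cong) (auto simp: exp_add algebra_simps)
        also have "\<dots> = (\<integral>\<theta>. F (\<tau> t \<theta>) * exp ((\<Sum>\<mu>=1..p. N \<mu> * (t * e \<mu> - ln (T t \<theta>))) + lr t \<theta>) \<partial>M)"
          by (rule intM[symmetric]) measurable
        finally show ?thesis unfolding T_def ..
      qed
    qed
    then show ?thesis using bb unfolding A_def a_def e_def N_def by blast
  qed
qed

section \<open>The Dirichlet prior\<close>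

text \<open>Adjoins a free last coordinate. The prior lives on the first \<open>p - 1\<close>
  coordinates, whereas the Gamma representation has \<open>p\<close> of them; the pair
  \<open>(g, y)\<close> stands for such a vector.\<close>

definition append_coord :: "nat \<Rightarrow> (nat \<Rightarrow> real) \<Rightarrow> real \<Rightarrow> nat \<Rightarrow> real" where
  "append_coord p g y \<mu> = (if \<mu> = p then y else g \<mu>)"

definition open_simplex :: "nat \<Rightarrow> (nat \<Rightarrow> real) set" where
  "open_simplex p = {w. \<forall>\<mu>\<in>{1..p}. bin_probs p w \<mu> > 0}"

lemma bin_probs_eq_append_coord: "bin_probs p w = append_coord p w (1 - (\<Sum>\<nu>=1..<p. w \<nu>))"
  by (auto simp: bin_probs_def append_coord_def fun_eq_iff)

lemma interval_split_last: "p > 0 \<Longrightarrow> {1..p} = insert p {1..<p}" for p :: nat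
  by auto

lemma sum_append_coord:
  assumes "p > 0"
  shows "(\<Sum>\<mu>=1..p. F \<mu> (append_coord p g y \<mu>)) = F p y + (\<Sum>\<mu>=1..<p. F \<mu> (g \<mu>))"
proof -
  have "(\<Sum>\<mu>\<in>{1..<p}. F \<mu> (append_coord p g y \<mu>)) = (\<Sum>\<mu>\<in>{1..<p}. F \<mu> (g \<mu>))"
    by (intro sum.cong) (auto simp: append_coord_def)
  then show ?thesis unfolding interval_split_last[OF assms] by (simp add: append_coord_def)
qed

lemma bin_probs_sum: "p > 0 \<Longrightarrow> (\<Sum>\<mu>=1..p. bin_probs p w \<mu>) = 1"
  unfolding bin_probs_eq_append_coord by (subst sum_append_coord[where F = "\<lambda>_ x. x"]) auto

lemma bin_probability_bin_probs: "p > 0 \<Longrightarrow> w \<in> open_simplex p \<Longrightarrow> bin_probability p (bin_probs p w)"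
  using bin_probs_sum[of p w] by (simp add: bin_probability_def open_simplex_def)

lemma measurable_coord:
  "\<nu> \<in> I \<Longrightarrow> (\<lambda>w. w \<nu>) \<in> borel_measurable (Pi\<^sub>M I (\<lambda>_. lborel :: real measure))"
  using measurable_component_singleton[of \<nu> I "\<lambda>_. lborel"] by simp

lemma measurable_bin_probs[measurable]:
  assumes "\<mu> \<in> {1..p}"
  shows "(\<lambda>w. bin_probs p w \<mu>) \<in> borel_measurable (Pi\<^sub>M {1..<p} (\<lambda>_. lborel))"
proof (cases "\<mu> = p")
  case False
  then have "\<mu> \<in> {1..<p}" using assms by auto
  from measurable_coord[OF this] show ?thesis using False by (simp add: bin_probs_def)
next
  case True
  have "(\<lambda>w. 1 - (\<Sum>\<nu>=1..<p. w \<nu>)) \<in> borel_measurable (Pi\<^sub>M {1..<p} (\<lambda>_. lborel :: real measure))"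
    by (intro borel_measurable_diff borel_measurable_const borel_measurable_sum measurable_coord)
  then show ?thesis using True by (simp add: bin_probs_def)
qed

lemma measurable_open_simplex[measurable]:
  "(\<lambda>w. w \<in> open_simplex p) \<in> measurable (Pi\<^sub>M {1..<p} (\<lambda>_. lborel)) (count_space UNIV)"
  unfolding open_simplex_def mem_Collect_eq by measurable

lemma measurable_append_coord:
  assumes "\<mu> \<in> {1..p}"
  shows "(\<lambda>x. append_coord p (fst x) (snd x) \<mu>) \<in> borel_measurable (Pi\<^sub>M {1..<p} (\<lambda>_. lborel) \<Otimes>\<^sub>M lborel)"
proof (cases "\<mu> = p")
  case False
  then have "\<mu> \<in> {1..<p}" using assms by auto
  then have "(\<lambda>x. fst x \<mu>) \<in> borel_measurable (Pi\<^sub>M {1..<p} (\<lambda>_. lborel :: real measure) \<Otimes>\<^sub>M lborel)"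
    by (intro measurable_compose[OF measurable_fst] measurable_coord)
  moreover have "(\<lambda>x. append_coord p (fst x) (snd x) \<mu>) = (\<lambda>x. fst x \<mu>)"
    using False by (simp add: append_coord_def)
  ultimately show ?thesis by (simp only:)
next
  case True
  then have "(\<lambda>x. append_coord p (fst x) (snd x) \<mu>) = snd" by (simp add: append_coord_def fun_eq_iff)
  then show ?thesis by simp
qed

declare One_nat_def [simp del]

text \<open>Polar coordinates with respect to the sum: a positive vector is its total
  \<open>r\<close> times a point of the simplex, with Jacobian \<open>r^(p-1)\<close>. Two Fubini
  exchanges replace a multidimensional change of variables: for fixed \<open>r\<close> the first
  \<open>p - 1\<close> coordinates are scaled by \<open>r\<close>, and for fixed \<open>g\<close>
  the total is shifted by the partial sum.\<close>

lemma simplex_polar: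
  fixes \<Psi> :: "(nat \<Rightarrow> real) \<times> real \<Rightarrow> ennreal"
  assumes p: "p > 0" and \<Psi>[measurable]: "\<Psi> \<in> borel_measurable (Pi\<^sub>M {1..<p} (\<lambda>_. lborel) \<Otimes>\<^sub>M lborel)"
  shows "(\<integral>\<^sup>+w. (\<integral>\<^sup>+r. indicator (open_simplex p) w * (indicator {0<..} r * (ennreal (r ^ (p - 1)) *
        \<Psi> (\<lambda>i\<in>{1..<p}. r * w i, r * (1 - (\<Sum>\<nu>=1..<p. w \<nu>))))) \<partial>lborel) \<partial>Pi\<^sub>M {1..<p} (\<lambda>_. lborel))
    = (\<integral>\<^sup>+g. (\<integral>\<^sup>+y. (if \<forall>\<mu>\<in>{1..p}. append_coord p g y \<mu> > 0 then \<Psi> (g, y) else 0) \<partial>lborel) \<partial>Pi\<^sub>M {1..<p} (\<lambda>_. lborel))"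
proof -
  let ?I = "{1..<p}"
  let ?L = "Pi\<^sub>M ?I (\<lambda>_. lborel :: real measure)"
  interpret product_sigma_finite "\<lambda>_::nat. lborel :: real measure" by unfold_locales
  interpret L: sigma_finite_measure ?L by (rule sigma_finite) simp
  interpret P: pair_sigma_finite ?L "lborel :: real measure" by unfold_locales
  have c1: "(\<lambda>x. fst x i) \<in> borel_measurable (?L \<Otimes>\<^sub>M lborel)" if "i \<in> ?I" for i
    by (intro measurable_compose[OF measurable_fst] measurable_coord that)
  define S where "S g = (\<Sum>\<nu>=1..<p. g \<nu>)" for g :: "nat \<Rightarrow> real"
  have Sm[measurable]: "S \<in> borel_measurable ?L" unfolding S_def by (intro borel_measurable_sum measurable_coord)
  \<comment> \<open>The integrand on the slice of total \<open>r\<close>, where the last coordinate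
    is the remainder \<open>r - S g\<close>.\<close>
  define h where "h r g = (if \<forall>\<mu>\<in>{1..p}. append_coord p g (r - S g) \<mu> > 0 then \<Psi> (g, r - S g) else 0)" for r g
  have hm: "(\<lambda>x. h (snd x) (fst x)) \<in> borel_measurable (?L \<Otimes>\<^sub>M lborel)"
  proof -
    have "(\<lambda>x. snd x - S (fst x)) \<in> borel_measurable (?L \<Otimes>\<^sub>M lborel)"
      by (intro borel_measurable_diff measurable_compose[OF measurable_fst Sm] measurable_snd'') simp
    then have s: "(\<lambda>x. (fst x, snd x - S (fst x))) \<in> ?L \<Otimes>\<^sub>M lborel \<rightarrow>\<^sub>M ?L \<Otimes>\<^sub>M lborel"
      by (intro measurable_Pair measurable_fst) simp
    have "(\<lambda>x. if \<forall>\<mu>\<in>{1..p}. append_coord p (fst x) (snd x) \<mu> > 0 then \<Psi> (fst x, snd x) else 0)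
        \<in> borel_measurable (?L \<Otimes>\<^sub>M lborel)"
    proof (intro measurable_If)
      show "(\<lambda>x. \<Psi> (fst x, snd x)) \<in> borel_measurable (?L \<Otimes>\<^sub>M lborel)" using \<Psi> by simp
      have "{x \<in> space (?L \<Otimes>\<^sub>M lborel). append_coord p (fst x) (snd x) \<mu> > 0} \<in> sets (?L \<Otimes>\<^sub>M lborel)" if "\<mu> \<in> {1..p}" for \<mu>
        using measurable_append_coord[OF that] by (intro borel_measurable_less borel_measurable_const)
      then show "{x \<in> space (?L \<Otimes>\<^sub>M lborel). \<forall>\<mu>\<in>{1..p}. append_coord p (fst x) (snd x) \<mu> > 0} \<in> sets (?L \<Otimes>\<^sub>M lborel)"
        by (intro sets.sets_Collect_finite_All) auto
    qed simp
    from measurable_compose[OF s this] show ?thesis unfolding h_def fst_conv snd_conv .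
  qed
  have hr[measurable]: "h r \<in> borel_measurable ?L" for r
    using measurable_compose[OF _ hm, of "\<lambda>g. (g, r)" ?L] by simp
  have scale: "(\<integral>\<^sup>+g. h r g \<partial>?L) = (\<integral>\<^sup>+w. indicator (open_simplex p) w * (ennreal (r ^ (p - 1)) *
        \<Psi> (\<lambda>i\<in>?I. r * w i, r * (1 - S w))) \<partial>?L)" if r: "r > 0" for r
  proof -
    have "(\<integral>\<^sup>+g. h r g \<partial>?L) = ennreal (\<Prod>i\<in>?I. r) * (\<integral>\<^sup>+w. h r (\<lambda>i\<in>?I. 0 + r * w i) \<partial>?L)"
      by (rule nn_integral_PiM_affine) (use r hr in auto)
    also have "\<dots> = (\<integral>\<^sup>+w. ennreal (r ^ (p - 1)) * h r (\<lambda>i\<in>?I. r * w i) \<partial>?L)"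
    proof -
      have "(\<lambda>w. \<lambda>i\<in>?I. r * w i) \<in> ?L \<rightarrow>\<^sub>M ?L"
        by (intro measurable_restrict) (use measurable_coord in simp)
      from measurable_compose[OF this hr[of r]] show ?thesis by (subst nn_integral_cmult) simp_all
    qed
    also have "\<dots> = (\<integral>\<^sup>+w. indicator (open_simplex p) w * (ennreal (r ^ (p - 1)) *
        \<Psi> (\<lambda>i\<in>?I. r * w i, r * (1 - S w))) \<partial>?L)"
    proof (rule nn_integral_cong)
      fix w
      have Sr: "S (\<lambda>i\<in>?I. r * w i) = r * S w" unfolding S_def sum_distrib_left by (intro sum.cong) auto
      then have diff: "r - S (\<lambda>i\<in>?I. r * w i) = r * (1 - S w)" by (simp add: algebra_simps)
      have ac: "append_coord p (\<lambda>i\<in>?I. r * w i) (r * (1 - S w)) \<mu> = r * bin_probs p w \<mu>" if "\<mu> \<in> {1..p}" for \<mu>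
        using that by (auto simp: append_coord_def bin_probs_def S_def)
      have "(\<forall>\<mu>\<in>{1..p}. append_coord p (\<lambda>i\<in>?I. r * w i) (r * (1 - S w)) \<mu> > 0) \<longleftrightarrow> w \<in> open_simplex p"
        unfolding open_simplex_def mem_Collect_eq
      proof (rule ball_cong[OF refl])
        fix \<mu> assume "\<mu> \<in> {1..p}"
        from ac[OF this] show "(append_coord p (\<lambda>i\<in>?I. r * w i) (r * (1 - S w)) \<mu> > 0) = (bin_probs p w \<mu> > 0)"
          using r by (simp add: zero_less_mult_iff)
      qed
      then show "ennreal (r ^ (p - 1)) * h r (\<lambda>i\<in>?I. r * w i) = indicator (open_simplex p) w * (ennreal (r ^ (p - 1)) *
        \<Psi> (\<lambda>i\<in>?I. r * w i, r * (1 - S w)))"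
        unfolding h_def diff by (simp add: indicator_def)
    qed
    finally show ?thesis .
  qed
  let ?f = "\<lambda>w r. indicator (open_simplex p) w * (indicator {0<..} r * (ennreal (r ^ (p - 1)) *
        \<Psi> (\<lambda>i\<in>?I. r * w i, r * (1 - S w))))"
  have fm: "(\<lambda>(w, r). ?f w r) \<in> borel_measurable (?L \<Otimes>\<^sub>M lborel)"
  proof -
    have m1: "(\<lambda>x. (\<lambda>i\<in>?I. snd x * fst x i, snd x * (1 - S (fst x)))) \<in> ?L \<Otimes>\<^sub>M lborel \<rightarrow>\<^sub>M ?L \<Otimes>\<^sub>M lborel"
      by (intro measurable_Pair measurable_restrict) (use c1 in simp_all)
    have "(\<lambda>x. \<Psi> (\<lambda>i\<in>?I. snd x * fst x i, snd x * (1 - S (fst x)))) \<in> borel_measurable (?L \<Otimes>\<^sub>M lborel)"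
      using measurable_compose[OF m1] by simp
    moreover have "(\<lambda>x. indicator (open_simplex p) (fst x) :: ennreal) \<in> borel_measurable (?L \<Otimes>\<^sub>M lborel)"
      unfolding indicator_def by measurable
    ultimately show ?thesis unfolding case_prod_beta by measurable
  qed
  have "(\<integral>\<^sup>+w. (\<integral>\<^sup>+r. ?f w r \<partial>lborel) \<partial>?L) = (\<integral>\<^sup>+r. (\<integral>\<^sup>+w. ?f w r \<partial>?L) \<partial>lborel)"
    by (rule P.Fubini'[symmetric, OF fm])
  also have "\<dots> = (\<integral>\<^sup>+r. (\<integral>\<^sup>+g. indicator {0<..} r * h r g \<partial>?L) \<partial>lborel)"
  proof (rule nn_integral_cong)
    fix r :: real
    show "(\<integral>\<^sup>+w. ?f w r \<partial>?L) = (\<integral>\<^sup>+g. indicator {0<..} r * h r g \<partial>?L)"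
      using scale[of r] by (cases "r > 0") simp_all
  qed
  also have "\<dots> = (\<integral>\<^sup>+g. (\<integral>\<^sup>+r. indicator {0<..} r * h r g \<partial>lborel) \<partial>?L)"
    using hm by (intro P.Fubini') (simp add: case_prod_beta)
  also have "\<dots> = (\<integral>\<^sup>+g. (\<integral>\<^sup>+y. (if \<forall>\<mu>\<in>{1..p}. append_coord p g y \<mu> > 0 then \<Psi> (g, y) else 0) \<partial>lborel) \<partial>?L)"
  proof (rule nn_integral_cong)
    fix g assume g: "g \<in> space ?L"
    have m: "(\<lambda>r. indicator {0<..} r * h r g) \<in> borel_measurable borel"
      using measurable_compose[OF _ hm, of "\<lambda>r. (g, r)" borel] g by simp
    have "(\<integral>\<^sup>+r. indicator {0<..} r * h r g \<partial>lborel) = (\<integral>\<^sup>+y. indicator {0<..} (S g + y) * h (S g + y) g \<partial>lborel)"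
      using nn_integral_real_affine[OF m, of 1 "S g"] by simp
    also have "\<dots> = (\<integral>\<^sup>+y. (if \<forall>\<mu>\<in>{1..p}. append_coord p g y \<mu> > 0 then \<Psi> (g, y) else 0) \<partial>lborel)"
    proof (rule nn_integral_cong)
      fix y
      \<comment> \<open>Positivity of all coordinates forces a positive total, so the indicator of
        \<open>{0<..}\<close> is 1 wherever \<open>h\<close> is nonzero.\<close>
      have "0 < S g + y" if pos: "\<forall>\<mu>\<in>{1..p}. append_coord p g y \<mu> > 0"
      proof -
        have "0 < append_coord p g y p" using pos p by simp
        then have "0 < y" by (simp add: append_coord_def)
        moreover have "0 < g \<nu>" if "\<nu> \<in> ?I" for \<nu>
          using pos[rule_format, of \<nu>] that by (simp add: append_coord_def)
        then have "0 \<le> S g" unfolding S_def by (intro sum_nonneg) (simp add: less_imp_le)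
        ultimately show ?thesis by simp
      qed
      then show "indicator {0<..} (S g + y) * h (S g + y) g = (if \<forall>\<mu>\<in>{1..p}. append_coord p g y \<mu> > 0 then \<Psi> (g, y) else 0)"
        unfolding h_def by (auto simp: indicator_def)
    qed
    finally show "(\<integral>\<^sup>+r. indicator {0<..} r * h r g \<partial>lborel) = \<dots>" .
  qed
  finally show ?thesis unfolding S_def .
qed

lemma nn_integral_gamma_rate:
  assumes "A > 0" "T > 0"
  shows "(\<integral>\<^sup>+r. indicator {0<..} r * ennreal (r powr (A - 1) * exp (- (r * T))) \<partial>lborel) = ennreal (Gamma A * T powr (- A))"
proof -
  define f where "f = (\<lambda>t::real. ennreal (indicator {0..} t * t powr (A - 1) / exp t))"
  have [measurable]: "f \<in> borel_measurable borel" unfolding f_def by measurable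
  have "ennreal (Gamma A) = (\<integral>\<^sup>+t. f t \<partial>lborel)"
    unfolding f_def by (rule Gamma_conv_nn_integral_real[OF assms(1)])
  also have "\<dots> = ennreal T * (\<integral>\<^sup>+r. f (0 + T * r) \<partial>lborel)"
    using assms by (subst nn_integral_real_affine[of f T 0]) auto
  also have "\<dots> = ennreal T * (\<integral>\<^sup>+r. ennreal (T powr (A - 1)) * (indicator {0<..} r * ennreal (r powr (A - 1) * exp (- (r * T)))) \<partial>lborel)"
  proof (intro arg_cong2[where f = "(*)"] refl nn_integral_cong)
    fix r :: real
    show "f (0 + T * r) = ennreal (T powr (A - 1)) * (indicator {0<..} r * ennreal (r powr (A - 1) * exp (- (r * T))))"
    proof (cases "r > 0")
      case True
      then show ?thesis using assms unfolding f_def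
        by (simp add: powr_mult ennreal_mult[symmetric] exp_minus field_simps)
    next
      case False
      \<comment> \<open>The closed half-line of the Gamma integral and the open one here differ at
        0, where \<open>0 powr (A - 1)\<close> is 0 by convention.\<close>
      then have "r = 0 \<or> T * r < 0" using assms by (auto simp: mult_less_0_iff not_less)
      then show ?thesis using False unfolding f_def by auto
    qed
  qed
  also have "\<dots> = ennreal T * (ennreal (T powr (A - 1)) * (\<integral>\<^sup>+r. indicator {0<..} r * ennreal (r powr (A - 1) * exp (- (r * T))) \<partial>lborel))"
    by (subst nn_integral_cmult) auto
  also have "\<dots> = ennreal (T powr A) * (\<integral>\<^sup>+r. indicator {0<..} r * ennreal (r powr (A - 1) * exp (- (r * T))) \<partial>lborel)"
    using assms by (simp add: mult.assoc[symmetric] ennreal_mult[symmetric] powr_mult_base)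
  finally have eq: "ennreal (Gamma A) = ennreal (T powr A) * (\<integral>\<^sup>+r. indicator {0<..} r * ennreal (r powr (A - 1) * exp (- (r * T))) \<partial>lborel)" .
  have "ennreal (Gamma A * T powr (- A)) = ennreal (T powr (- A)) * ennreal (Gamma A)"
    using assms by (simp add: ennreal_mult[symmetric] mult.commute Gamma_real_pos less_imp_le)
  also have "\<dots> = ennreal (T powr (- A) * T powr A) * (\<integral>\<^sup>+r. indicator {0<..} r * ennreal (r powr (A - 1) * exp (- (r * T))) \<partial>lborel)"
    unfolding eq using assms by (simp add: ennreal_mult mult.assoc)
  also have "T powr (- A) * T powr A = 1" using assms by (simp flip: powr_add)
  finally show ?thesis by simp
qed

lemma append_coord_scale:
  assumes "\<mu> \<in> {1..p}"
  shows "append_coord p (\<lambda>i\<in>{1..<p}. r * w i) (r * (1 - (\<Sum>\<nu>=1..<p. w \<nu>))) \<mu> = r * bin_probs p w \<mu>"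
  using assms by (auto simp: append_coord_def bin_probs_def)

text \<open>Dirichlet variables are normalised independent Gamma variables with shapes
  \<open>\<alpha> \<mu>\<close>. Changing the rates from 1 to \<open>c \<mu>\<close> amounts to
  rescaling coordinates, which leaves the integral of a function of the rescaled and normalised
  vector unchanged (\<open>scaling\<close>), while polar coordinates turn both sides into integrals
  over the simplex (\<open>polar\<close>). The second and third claims are finiteness and positivity
  of the multivariate Beta function.\<close>

lemma simplex_tilt:
  fixes G :: "(nat \<Rightarrow> real) \<Rightarrow> ennreal" and c \<alpha> :: "nat \<Rightarrow> real"
  assumes p: "p > 0" and \<alpha>: "\<And>\<mu>. \<mu> \<in> {1..p} \<Longrightarrow> \<alpha> \<mu> > 0" and c: "\<And>\<mu>. \<mu> \<in> {1..p} \<Longrightarrow> c \<mu> > 0"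
    and G[measurable]: "G \<in> borel_measurable (Pi\<^sub>M {1..<p} (\<lambda>_. lborel))"
  defines "D \<equiv> \<lambda>w. \<Prod>\<mu>=1..p. bin_probs p w \<mu> powr (\<alpha> \<mu> - 1)"
    and "A \<equiv> \<Sum>\<mu>=1..p. \<alpha> \<mu>"
    and "T \<equiv> \<lambda>w. \<Sum>\<mu>=1..p. c \<mu> * bin_probs p w \<mu>"
  shows "(\<integral>\<^sup>+w. indicator (open_simplex p) w * (ennreal (D w * ((\<Prod>\<mu>=1..p. c \<mu> powr \<alpha> \<mu>) * T w powr (- A))) *
      G (\<lambda>i\<in>{1..<p}. c i * w i / T w)) \<partial>Pi\<^sub>M {1..<p} (\<lambda>_. lborel))
    = (\<integral>\<^sup>+w. indicator (open_simplex p) w * (ennreal (D w) * G w) \<partial>Pi\<^sub>M {1..<p} (\<lambda>_. lborel))"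
    and "(\<integral>\<^sup>+w. indicator (open_simplex p) w * ennreal (D w) \<partial>Pi\<^sub>M {1..<p} (\<lambda>_. lborel)) \<noteq> \<infinity>"
    and "(\<integral>\<^sup>+w. indicator (open_simplex p) w * ennreal (D w) \<partial>Pi\<^sub>M {1..<p} (\<lambda>_. lborel)) \<noteq> 0"
proof -
  let ?I = "{1..<p}"
  let ?L = "Pi\<^sub>M ?I (\<lambda>_. lborel :: real measure)"
  interpret product_sigma_finite "\<lambda>_::nat. lborel :: real measure" by unfold_locales
  have A: "A > 0" unfolding A_def using p \<alpha> by (intro sum_pos) auto
  have mx: "(\<lambda>x. fst x i) \<in> borel_measurable (?L \<Otimes>\<^sub>M lborel)" if "i \<in> ?I" for i
    by (intro measurable_compose[OF measurable_fst] measurable_coord that)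
  \<comment> \<open>Product of Gamma densities with rates \<open>c \<mu>\<close>, without the
    constants \<open>1 / Gamma (\<alpha> \<mu>)\<close>. The powers of \<open>c \<mu>\<close> are
    kept so that the total mass does not depend on \<open>c\<close>.\<close>
  define U where "U c x = (\<Prod>\<mu>=1..p. c \<mu> powr \<alpha> \<mu> * (x \<mu> powr (\<alpha> \<mu> - 1) * exp (- (c \<mu> * x \<mu>))))" for c x :: "nat \<Rightarrow> real"
  \<comment> \<open>\<open>G\<close> is evaluated at the vector with entries
    \<open>c i * x i\<close> divided by their sum, which rescaling to rate 1 turns into the plain
    normalised vector.\<close>
  define \<Psi> where "\<Psi> c G z = ennreal (U c (append_coord p (fst z) (snd z))) *
      G (\<lambda>i\<in>?I. c i * fst z i / (\<Sum>\<mu>=1..p. c \<mu> * append_coord p (fst z) (snd z) \<mu>))"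
    for c and G :: "(nat \<Rightarrow> real) \<Rightarrow> ennreal" and z :: "(nat \<Rightarrow> real) \<times> real"
  have Um: "(\<lambda>z. U c (append_coord p (fst z) (snd z))) \<in> borel_measurable (?L \<Otimes>\<^sub>M lborel)" for c
    unfolding U_def using measurable_append_coord by measurable
  have \<Psi>m: "\<Psi> c G \<in> borel_measurable (?L \<Otimes>\<^sub>M lborel)" if G: "G \<in> borel_measurable ?L" for c G
  proof -
    have "(\<lambda>z. \<lambda>i\<in>?I. c i * fst z i / (\<Sum>\<mu>=1..p. c \<mu> * append_coord p (fst z) (snd z) \<mu>)) \<in> ?L \<Otimes>\<^sub>M lborel \<rightarrow>\<^sub>M ?L"
    proof (rule measurable_restrict)
      fix i assume i: "i \<in> ?I"
      have "(\<lambda>z. c i * fst z i / (\<Sum>\<mu>=1..p. c \<mu> * append_coord p (fst z) (snd z) \<mu>)) \<in> borel_measurable (?L \<Otimes>\<^sub>M lborel)"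
        by (intro borel_measurable_divide borel_measurable_times borel_measurable_const borel_measurable_sum
            measurable_append_coord mx i)
      then show "(\<lambda>z. c i * fst z i / (\<Sum>\<mu>=1..p. c \<mu> * append_coord p (fst z) (snd z) \<mu>)) \<in> ?L \<Otimes>\<^sub>M lborel \<rightarrow>\<^sub>M lborel"
        by simp
    qed
    from measurable_compose[OF this G] Um show ?thesis
      unfolding \<Psi>_def by (intro borel_measurable_times_ennreal measurable_compose[OF Um measurable_ennreal])
  qed
  define K where "K c G = (\<integral>\<^sup>+g. (\<integral>\<^sup>+y. (if \<forall>\<mu>\<in>{1..p}. append_coord p g y \<mu> > 0 then \<Psi> c G (g, y) else 0) \<partial>lborel) \<partial>?L)" for c G
  have polar: "K c G = ennreal (Gamma A) * (\<integral>\<^sup>+w. indicator (open_simplex p) w *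
      (ennreal (D w * ((\<Prod>\<mu>=1..p. c \<mu> powr \<alpha> \<mu>) * (\<Sum>\<mu>=1..p. c \<mu> * bin_probs p w \<mu>) powr (- A))) *
      G (\<lambda>i\<in>?I. c i * w i / (\<Sum>\<mu>=1..p. c \<mu> * bin_probs p w \<mu>))) \<partial>?L)"
    if c: "\<And>\<mu>. \<mu> \<in> {1..p} \<Longrightarrow> c \<mu> > 0" and G: "G \<in> borel_measurable ?L" for c G
  proof -
    define T where "T w = (\<Sum>\<mu>=1..p. c \<mu> * bin_probs p w \<mu>)" for w
    have Tm: "T \<in> borel_measurable ?L" unfolding T_def
      by (intro borel_measurable_sum borel_measurable_times borel_measurable_const measurable_bin_probs)
    define R where "R w = indicator (open_simplex p) w *
      (ennreal (D w * ((\<Prod>\<mu>=1..p. c \<mu> powr \<alpha> \<mu>) * T w powr (- A))) * G (\<lambda>i\<in>?I. c i * w i / T w))" for w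
    have Rm: "R \<in> borel_measurable ?L"
    proof -
      have "(\<lambda>w. \<lambda>i\<in>?I. c i * w i / T w) \<in> ?L \<rightarrow>\<^sub>M ?L"
        by (intro measurable_restrict) (use Tm measurable_coord in \<open>simp add: borel_measurable_divide\<close>)
      from measurable_compose[OF this G] have 1: "(\<lambda>w. G (\<lambda>i\<in>?I. c i * w i / T w)) \<in> borel_measurable ?L" .
      have 2: "(\<lambda>w. D w * ((\<Prod>\<mu>=1..p. c \<mu> powr \<alpha> \<mu>) * T w powr (- A))) \<in> borel_measurable ?L"
        unfolding D_def
        by (intro borel_measurable_times borel_measurable_prod powr_real_measurable borel_measurable_const Tm measurable_bin_probs)
      have 3: "(\<lambda>w. indicator (open_simplex p) w :: ennreal) \<in> borel_measurable ?L"
        unfolding indicator_def by measurable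
      show ?thesis unfolding R_def using 1 2 3 by measurable
    qed
    have "K c G = (\<integral>\<^sup>+w. (\<integral>\<^sup>+r. indicator (open_simplex p) w * (indicator {0<..} r * (ennreal (r ^ (p - 1)) *
        \<Psi> c G (\<lambda>i\<in>?I. r * w i, r * (1 - (\<Sum>\<nu>=1..<p. w \<nu>))))) \<partial>lborel) \<partial>?L)"
      unfolding K_def by (rule simplex_polar[OF p \<Psi>m[OF G], symmetric])
    also have "\<dots> = (\<integral>\<^sup>+w. ennreal (Gamma A) * R w \<partial>?L)"
    proof (rule nn_integral_cong)
      fix w
      show "(\<integral>\<^sup>+r. indicator (open_simplex p) w * (indicator {0<..} r * (ennreal (r ^ (p - 1)) *
        \<Psi> c G (\<lambda>i\<in>?I. r * w i, r * (1 - (\<Sum>\<nu>=1..<p. w \<nu>))))) \<partial>lborel) = ennreal (Gamma A) * R w"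
      proof (cases "w \<in> open_simplex p")
        case True
        then have b: "bin_probs p w \<mu> > 0" if "\<mu> \<in> {1..p}" for \<mu> using that by (simp add: open_simplex_def)
        have T: "T w > 0" unfolding T_def using b c p by (intro sum_pos) auto
        define g where "g = G (\<lambda>i\<in>?I. c i * w i / T w)"
        define k where "k = D w * (\<Prod>\<mu>=1..p. c \<mu> powr \<alpha> \<mu>)"
        have k: "k \<ge> 0" unfolding k_def D_def using c by (intro mult_nonneg_nonneg prod_nonneg) auto
        have pt: "indicator {0<..} r * (ennreal (r ^ (p - 1)) * \<Psi> c G (\<lambda>i\<in>?I. r * w i, r * (1 - (\<Sum>\<nu>=1..<p. w \<nu>))))
            = ennreal k * g * (indicator {0<..} r * ennreal (r powr (A - 1) * exp (- (r * T w))))" for r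
        proof (cases "r > 0")
          case r: True
          have "U c (append_coord p (\<lambda>i\<in>?I. r * w i) (r * (1 - (\<Sum>\<nu>=1..<p. w \<nu>))))
              = (\<Prod>\<mu>=1..p. c \<mu> powr \<alpha> \<mu> * ((r powr (\<alpha> \<mu> - 1) * bin_probs p w \<mu> powr (\<alpha> \<mu> - 1)) * exp (- (r * (c \<mu> * bin_probs p w \<mu>)))))"
            unfolding U_def
          proof (rule prod.cong[OF refl])
            fix \<mu> assume \<mu>: "\<mu> \<in> {1..p}"
            show "c \<mu> powr \<alpha> \<mu> * (append_coord p (\<lambda>i\<in>?I. r * w i) (r * (1 - (\<Sum>\<nu>=1..<p. w \<nu>))) \<mu> powr (\<alpha> \<mu> - 1) *
                exp (- (c \<mu> * append_coord p (\<lambda>i\<in>?I. r * w i) (r * (1 - (\<Sum>\<nu>=1..<p. w \<nu>))) \<mu>)))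
              = c \<mu> powr \<alpha> \<mu> * ((r powr (\<alpha> \<mu> - 1) * bin_probs p w \<mu> powr (\<alpha> \<mu> - 1)) * exp (- (r * (c \<mu> * bin_probs p w \<mu>))))"
              unfolding append_coord_scale[OF \<mu>] using r b[OF \<mu>] by (simp add: powr_mult mult.left_commute)
          qed
          also have "\<dots> = (\<Prod>\<mu>=1..p. c \<mu> powr \<alpha> \<mu>) * (((\<Prod>\<mu>=1..p. r powr (\<alpha> \<mu> - 1)) * D w) * exp (- (r * T w)))"
            unfolding D_def T_def prod.distrib exp_sum[symmetric, OF finite_atLeastAtMost] sum_negf sum_distrib_left[symmetric] ..
          also have "(\<Prod>\<mu>=1..p. r powr (\<alpha> \<mu> - 1)) = r powr (A - real p)"
            using r by (simp add: powr_sum[symmetric] A_def sum_subtractf)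
          also have "(\<Prod>\<mu>=1..p. c \<mu> powr \<alpha> \<mu>) * ((r powr (A - real p) * D w) * exp (- (r * T w)))
              = k * (r powr (A - real p) * exp (- (r * T w)))" unfolding k_def by simp
          finally have U: "U c (append_coord p (\<lambda>i\<in>?I. r * w i) (r * (1 - (\<Sum>\<nu>=1..<p. w \<nu>))))
              = k * (r powr (A - real p) * exp (- (r * T w)))" .
          have "(\<Sum>\<mu>=1..p. c \<mu> * append_coord p (\<lambda>i\<in>?I. r * w i) (r * (1 - (\<Sum>\<nu>=1..<p. w \<nu>))) \<mu>) = r * T w"
            unfolding T_def sum_distrib_left by (intro sum.cong refl) (simp only: append_coord_scale mult.left_commute)
          then have Garg: "(\<lambda>i\<in>?I. c i * (\<lambda>i\<in>?I. r * w i) i / (\<Sum>\<mu>=1..p. c \<mu> * append_coord p (\<lambda>i\<in>?I. r * w i) (r * (1 - (\<Sum>\<nu>=1..<p. w \<nu>))) \<mu>))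
              = (\<lambda>i\<in>?I. c i * w i / T w)"
            using r by (intro restrict_ext) simp
          \<comment> \<open>The Jacobian lifts the exponent \<open>A - p\<close> to
            \<open>A - 1\<close>, leaving a Gamma integral in \<open>r\<close> with shape
            \<open>A\<close> and rate \<open>T w\<close>.\<close>
          have "r ^ (p - 1) * (k * (r powr (A - real p) * exp (- (r * T w)))) = k * (r powr (A - 1) * exp (- (r * T w)))"
          proof -
            have "r ^ (p - 1) = r powr (real p - 1)" using r p by (simp add: powr_realpow[symmetric] of_nat_diff)
            then show ?thesis using r by (simp flip: powr_add)
          qed
          then have "ennreal (r ^ (p - 1)) * ennreal (k * (r powr (A - real p) * exp (- (r * T w)))) =
              ennreal k * ennreal (r powr (A - 1) * exp (- (r * T w)))"
            using r k by (simp flip: ennreal_mult)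
          then show ?thesis using r unfolding \<Psi>_def fst_conv snd_conv U Garg g_def
            by (simp add: mult.assoc[symmetric]) (simp add: mult_ac)
        qed simp
        have "(\<integral>\<^sup>+r. indicator (open_simplex p) w * (indicator {0<..} r * (ennreal (r ^ (p - 1)) *
          \<Psi> c G (\<lambda>i\<in>?I. r * w i, r * (1 - (\<Sum>\<nu>=1..<p. w \<nu>))))) \<partial>lborel)
          = ennreal k * g * (\<integral>\<^sup>+r. indicator {0<..} r * ennreal (r powr (A - 1) * exp (- (r * T w))) \<partial>lborel)"
          unfolding pt using True by (simp add: nn_integral_cmult)
        also have "\<dots> = ennreal k * g * ennreal (Gamma A * T w powr (- A))"
          unfolding nn_integral_gamma_rate[OF A T] ..
        also have "\<dots> = ennreal (Gamma A) * R w"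
        proof -
          have "D w * ((\<Prod>\<mu>=1..p. c \<mu> powr \<alpha> \<mu>) * T w powr (- A)) = k * T w powr (- A)" by (simp add: k_def)
          then have "R w = ennreal k * ennreal (T w powr (- A)) * g"
            using True k unfolding R_def g_def by (simp only: ennreal_mult powr_ge_zero) (simp add: mult.assoc)
          moreover have "ennreal (Gamma A * T w powr (- A)) = ennreal (Gamma A) * ennreal (T w powr (- A))"
            using Gamma_real_pos[OF A] by (intro ennreal_mult) auto
          ultimately show ?thesis by (simp add: mult_ac)
        qed
        finally show ?thesis .
      next
        case False
        then show ?thesis by (simp add: R_def)
      qed
    qed
    also have "\<dots> = ennreal (Gamma A) * (\<integral>\<^sup>+w. R w \<partial>?L)" using Rm by (rule nn_integral_cmult)
    finally show ?thesis unfolding R_def T_def .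
  qed
  \<comment> \<open>Each coordinate is multiplied by its own \<open>c \<mu>\<close>:
    \<open>p - 1\<close> Jacobian factors come from the product space, the last one,
    \<open>c p\<close>, from the separate integral over \<open>y\<close>.\<close>
  have scaling: "K c G = K (\<lambda>_. 1) G" if c: "\<And>\<mu>. \<mu> \<in> {1..p} \<Longrightarrow> c \<mu> > 0" and G: "G \<in> borel_measurable ?L" for c G
  proof -
    define u where "u z = (if \<forall>\<mu>\<in>{1..p}. append_coord p (fst z) (snd z) \<mu> > 0 then \<Psi> (\<lambda>_. 1) G z else 0)" for z
    have um[measurable]: "u \<in> borel_measurable (?L \<Otimes>\<^sub>M lborel)"
    proof -
      have "{x \<in> space (?L \<Otimes>\<^sub>M lborel). append_coord p (fst x) (snd x) \<mu> > 0} \<in> sets (?L \<Otimes>\<^sub>M lborel)" if "\<mu> \<in> {1..p}" for \<mu>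
        using measurable_append_coord[OF that] by (intro borel_measurable_less borel_measurable_const)
      then have "{x \<in> space (?L \<Otimes>\<^sub>M lborel). \<forall>\<mu>\<in>{1..p}. append_coord p (fst x) (snd x) \<mu> > 0} \<in> sets (?L \<Otimes>\<^sub>M lborel)"
        by (intro sets.sets_Collect_finite_All) auto
      then show ?thesis unfolding u_def by (intro measurable_If \<Psi>m[OF G]) simp_all
    qed
    have cp: "c p > 0" using c p by simp
    have cI: "c i > 0" if "i \<in> ?I" for i using c that by simp
    define S where "S g = (\<lambda>i\<in>?I. 0 + c i * g i)" for g :: "nat \<Rightarrow> real"
    have Sm: "S \<in> ?L \<rightarrow>\<^sub>M ?L" unfolding S_def
      by (intro measurable_restrict) (use measurable_coord in \<open>simp add: borel_measurable_times\<close>)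
    have "K (\<lambda>_. 1) G = (\<integral>\<^sup>+g. (\<integral>\<^sup>+y. u (g, y) \<partial>lborel) \<partial>?L)"
      unfolding K_def u_def by simp
    also have "\<dots> = ennreal (\<Prod>i\<in>?I. c i) * (\<integral>\<^sup>+g. (\<integral>\<^sup>+y. u (S g, y) \<partial>lborel) \<partial>?L)"
      unfolding S_def by (intro nn_integral_PiM_affine cI) simp_all
    also have "\<dots> = ennreal (\<Prod>i\<in>?I. c i) * (\<integral>\<^sup>+g. ennreal (c p) * (\<integral>\<^sup>+y. u (S g, c p * y) \<partial>lborel) \<partial>?L)"
    proof (intro arg_cong2[where f = "(*)"] refl nn_integral_cong)
      fix g assume "g \<in> space ?L"
      then have "(\<lambda>y. u (S g, y)) \<in> borel_measurable borel"
        using measurable_compose[OF measurable_Pair1'[of "S g" ?L lborel] um] measurable_space[OF Sm] by simp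
      from nn_integral_real_affine[OF this, of "c p" 0] show "(\<integral>\<^sup>+y. u (S g, y) \<partial>lborel) = ennreal (c p) * (\<integral>\<^sup>+y. u (S g, c p * y) \<partial>lborel)"
        using cp by simp
    qed
    also have "\<dots> = (\<integral>\<^sup>+g. (\<integral>\<^sup>+y. ennreal (\<Prod>i\<in>?I. c i) * (ennreal (c p) * u (S g, c p * y)) \<partial>lborel) \<partial>?L)"
    proof -
      have "(\<lambda>z. (S (fst z), c p * snd z)) \<in> ?L \<Otimes>\<^sub>M lborel \<rightarrow>\<^sub>M ?L \<Otimes>\<^sub>M lborel"
        using measurable_compose[OF measurable_fst Sm] by (intro measurable_Pair) simp_all
      from measurable_compose[OF this um] have m2[measurable]: "(\<lambda>z. u (S (fst z), c p * snd z)) \<in> borel_measurable (?L \<Otimes>\<^sub>M lborel)" .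
      have m1: "(\<lambda>y. u (S g, c p * y)) \<in> borel_measurable lborel" if "g \<in> space ?L" for g
        using measurable_compose[OF measurable_Pair1'[OF that] m2] by simp
      have m3: "(\<lambda>g. \<integral>\<^sup>+y. u (S g, c p * y) \<partial>lborel) \<in> borel_measurable ?L"
        using lborel.borel_measurable_nn_integral_fst[OF m2] by simp
      have "(\<integral>\<^sup>+y. ennreal (\<Prod>i\<in>?I. c i) * (ennreal (c p) * u (S g, c p * y)) \<partial>lborel) =
          ennreal (\<Prod>i\<in>?I. c i) * (ennreal (c p) * (\<integral>\<^sup>+y. u (S g, c p * y) \<partial>lborel))" if "g \<in> space ?L" for g
        using m1[OF that] by (simp add: nn_integral_cmult)
      then have "(\<integral>\<^sup>+g. (\<integral>\<^sup>+y. ennreal (\<Prod>i\<in>?I. c i) * (ennreal (c p) * u (S g, c p * y)) \<partial>lborel) \<partial>?L)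
          = (\<integral>\<^sup>+g. ennreal (\<Prod>i\<in>?I. c i) * (ennreal (c p) * (\<integral>\<^sup>+y. u (S g, c p * y) \<partial>lborel)) \<partial>?L)"
        by (intro nn_integral_cong) simp
      also have "\<dots> = ennreal (\<Prod>i\<in>?I. c i) * (\<integral>\<^sup>+g. ennreal (c p) * (\<integral>\<^sup>+y. u (S g, c p * y) \<partial>lborel) \<partial>?L)"
        using m3 by (intro nn_integral_cmult) simp
      finally show ?thesis by simp
    qed
    also have "\<dots> = K c G"
      unfolding K_def
    proof (intro nn_integral_cong)
      fix g y
      have x: "append_coord p (S g) (c p * y) \<mu> = c \<mu> * append_coord p g y \<mu>" if "\<mu> \<in> {1..p}" for \<mu>
        using that by (auto simp: append_coord_def S_def)
      have pos: "(\<forall>\<mu>\<in>{1..p}. append_coord p (S g) (c p * y) \<mu> > 0) \<longleftrightarrow> (\<forall>\<mu>\<in>{1..p}. append_coord p g y \<mu> > 0)"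
      proof (rule ball_cong[OF refl])
        fix \<mu> assume "\<mu> \<in> {1..p}"
        with c[OF this] show "(append_coord p (S g) (c p * y) \<mu> > 0) = (append_coord p g y \<mu> > 0)"
          by (simp add: x zero_less_mult_iff)
      qed
      show "ennreal (\<Prod>i\<in>?I. c i) * (ennreal (c p) * u (S g, c p * y)) =
          (if \<forall>\<mu>\<in>{1..p}. append_coord p g y \<mu> > 0 then \<Psi> c G (g, y) else 0)"
      proof (cases "\<forall>\<mu>\<in>{1..p}. append_coord p g y \<mu> > 0")
        case True
        have "(\<Sum>\<mu>=1..p. 1 * append_coord p (S g) (c p * y) \<mu>) = (\<Sum>\<mu>=1..p. c \<mu> * append_coord p g y \<mu>)"
          by (intro sum.cong refl) (simp add: x)
        then have Garg: "(\<lambda>i\<in>?I. 1 * S g i / (\<Sum>\<mu>=1..p. 1 * append_coord p (S g) (c p * y) \<mu>)) =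
            (\<lambda>i\<in>?I. c i * g i / (\<Sum>\<mu>=1..p. c \<mu> * append_coord p g y \<mu>))"
          by (intro restrict_ext) (simp add: S_def)
        have U1: "U (\<lambda>_. 1) (append_coord p (S g) (c p * y)) \<ge> 0" unfolding U_def by (intro prod_nonneg) auto
        have "(\<Prod>i\<in>?I. c i) * c p * U (\<lambda>_. 1) (append_coord p (S g) (c p * y)) =
            (\<Prod>\<mu>=1..p. c \<mu>) * U (\<lambda>_. 1) (append_coord p (S g) (c p * y))"
          unfolding interval_split_last[OF p] by simp
        also have "\<dots> = U c (append_coord p g y)"
          unfolding U_def prod.distrib[symmetric]
        proof (rule prod.cong[OF refl])
          fix \<mu> assume \<mu>: "\<mu> \<in> {1..p}"
          have "c \<mu> * c \<mu> powr (\<alpha> \<mu> - 1) = c \<mu> powr \<alpha> \<mu>"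
            using c[OF \<mu>] by (simp add: powr_mult_base less_imp_le)
          then show "c \<mu> * (1 powr \<alpha> \<mu> * (append_coord p (S g) (c p * y) \<mu> powr (\<alpha> \<mu> - 1) * exp (- (1 * append_coord p (S g) (c p * y) \<mu>))))
            = c \<mu> powr \<alpha> \<mu> * (append_coord p g y \<mu> powr (\<alpha> \<mu> - 1) * exp (- (c \<mu> * append_coord p g y \<mu>)))"
            unfolding x[OF \<mu>] using c[OF \<mu>] True \<mu> by (simp add: powr_mult less_imp_le)
        qed
        finally have Ueq: "(\<Prod>i\<in>?I. c i) * c p * U (\<lambda>_. 1) (append_coord p (S g) (c p * y)) = U c (append_coord p g y)" .
        have "0 \<le> (\<Prod>i\<in>?I. c i)" using cI by (intro prod_nonneg) (simp add: less_imp_le)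
        then have "ennreal (\<Prod>i\<in>?I. c i) * (ennreal (c p) * ennreal (U (\<lambda>_. 1) (append_coord p (S g) (c p * y)))) =
            ennreal (U c (append_coord p g y))"
          using cp U1 unfolding Ueq[symmetric] by (simp only: ennreal_mult[symmetric] less_imp_le mult_nonneg_nonneg mult.assoc)
        then show ?thesis using True pos unfolding u_def \<Psi>_def fst_conv snd_conv Garg
          by (simp add: mult.assoc[symmetric])
      next
        case False
        then show ?thesis using pos unfolding u_def fst_conv snd_conv by (simp only: if_False mult_zero_right)
      qed
    qed
    finally show ?thesis ..
  qed
  have b1: "(\<Sum>\<mu>=1..p. 1 * bin_probs p w \<mu>) = 1" for w using bin_probs_sum[OF p, of w] by simp
  have Dm: "(\<lambda>w. ennreal (D w)) \<in> borel_measurable ?L"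
    unfolding D_def by (intro measurable_compose[OF _ measurable_ennreal] borel_measurable_prod powr_real_measurable borel_measurable_const borel_measurable_diff measurable_bin_probs)
  have polar1: "K (\<lambda>_. 1) G = ennreal (Gamma A) * (\<integral>\<^sup>+w. indicator (open_simplex p) w * (ennreal (D w) * G w) \<partial>?L)"
    if "G \<in> borel_measurable ?L" for G
  proof -
    have "K (\<lambda>_. 1) G = ennreal (Gamma A) * (\<integral>\<^sup>+w. indicator (open_simplex p) w * (ennreal (D w) * G (\<lambda>i\<in>?I. w i)) \<partial>?L)"
      using polar[of "\<lambda>_. 1" G] that unfolding b1 by simp
    also have "(\<integral>\<^sup>+w. indicator (open_simplex p) w * (ennreal (D w) * G (\<lambda>i\<in>?I. w i)) \<partial>?L) =
        (\<integral>\<^sup>+w. indicator (open_simplex p) w * (ennreal (D w) * G w) \<partial>?L)"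
      by (intro nn_integral_cong) (simp add: space_PiM PiE_restrict)
    finally show ?thesis .
  qed
  \<comment> \<open>Cancellation in \<open>ennreal\<close> asks for a factor that is neither zero
    nor infinite.\<close>
  have \<Gamma>: "ennreal (Gamma A) \<noteq> 0" "ennreal (Gamma A) \<noteq> \<infinity>" using Gamma_real_pos[OF A] by auto
  show "(\<integral>\<^sup>+w. indicator (open_simplex p) w * (ennreal (D w * ((\<Prod>\<mu>=1..p. c \<mu> powr \<alpha> \<mu>) * T w powr (- A))) *
      G (\<lambda>i\<in>{1..<p}. c i * w i / T w)) \<partial>?L)
    = (\<integral>\<^sup>+w. indicator (open_simplex p) w * (ennreal (D w) * G w) \<partial>?L)"
    using polar[OF c G] scaling[OF c G] polar1[OF G] \<Gamma> unfolding T_def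
    by (simp add: ennreal_mult_cancel_left)
  \<comment> \<open>With \<open>G = 1\<close> the integrand is a product over coordinates, so the
    integral splits into one-dimensional Gamma integrals.\<close>
  have "K (\<lambda>_. 1) (\<lambda>_. 1) = (\<Prod>\<mu>=1..p. ennreal (Gamma (\<alpha> \<mu>)))"
  proof -
    define f where "f \<mu> x = indicator {0<..} x * ennreal (x powr (\<alpha> \<mu> - 1) * exp (- (x * 1)))" for \<mu> :: nat and x :: real
    have fm[measurable]: "f \<mu> \<in> borel_measurable borel" for \<mu> unfolding f_def by measurable
    have fint: "(\<integral>\<^sup>+x. f \<mu> x \<partial>lborel) = ennreal (Gamma (\<alpha> \<mu>))" if "\<mu> \<in> {1..p}" for \<mu>
      unfolding f_def using nn_integral_gamma_rate[OF \<alpha>[OF that], of 1] by simp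
    have "(if \<forall>\<mu>\<in>{1..p}. append_coord p g y \<mu> > 0 then \<Psi> (\<lambda>_. 1) (\<lambda>_. 1) (g, y) else 0) = (\<Prod>\<mu>\<in>?I. f \<mu> (g \<mu>)) * f p y" for g y
    proof -
      have "(if \<forall>\<mu>\<in>{1..p}. append_coord p g y \<mu> > 0 then \<Psi> (\<lambda>_. 1) (\<lambda>_. 1) (g, y) else 0) = (\<Prod>\<mu>=1..p. f \<mu> (append_coord p g y \<mu>))"
      proof (cases "\<forall>\<mu>\<in>{1..p}. append_coord p g y \<mu> > 0")
        case True
        then have "(\<Prod>\<mu>=1..p. f \<mu> (append_coord p g y \<mu>)) = (\<Prod>\<mu>=1..p. ennreal (append_coord p g y \<mu> powr (\<alpha> \<mu> - 1) * exp (- append_coord p g y \<mu>)))"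
          by (intro prod.cong) (auto simp: f_def)
        also have "\<dots> = \<Psi> (\<lambda>_. 1) (\<lambda>_. 1) (g, y)" unfolding \<Psi>_def U_def by (subst prod_ennreal) auto
        finally show ?thesis using True by simp
      next
        case False
        then obtain \<mu> where "\<mu> \<in> {1..p}" "f \<mu> (append_coord p g y \<mu>) = 0" by (auto simp: f_def)
        then have "(\<Prod>\<mu>=1..p. f \<mu> (append_coord p g y \<mu>)) = 0" by (intro prod_zero) auto
        then show ?thesis using False by (simp only: if_False)
      qed
      also have "\<dots> = f p y * (\<Prod>\<mu>\<in>?I. f \<mu> (g \<mu>))"
      proof -
        have "(\<Prod>\<mu>\<in>?I. f \<mu> (append_coord p g y \<mu>)) = (\<Prod>\<mu>\<in>?I. f \<mu> (g \<mu>))"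
          by (intro prod.cong) (auto simp: append_coord_def)
        then show ?thesis unfolding interval_split_last[OF p] by (simp add: append_coord_def)
      qed
      finally show ?thesis by (simp add: mult.commute)
    qed
    then have "K (\<lambda>_. 1) (\<lambda>_. 1) = (\<integral>\<^sup>+g. (\<integral>\<^sup>+y. (\<Prod>\<mu>\<in>?I. f \<mu> (g \<mu>)) * f p y \<partial>lborel) \<partial>?L)" unfolding K_def by simp
    also have "\<dots> = (\<integral>\<^sup>+g. (\<Prod>\<mu>\<in>?I. f \<mu> (g \<mu>)) * ennreal (Gamma (\<alpha> p)) \<partial>?L)"
      using fint[of p] p by (simp add: nn_integral_cmult)
    also have "\<dots> = (\<integral>\<^sup>+g. (\<Prod>\<mu>\<in>?I. f \<mu> (g \<mu>)) \<partial>?L) * ennreal (Gamma (\<alpha> p))"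
      by (intro nn_integral_multc borel_measurable_prod_ennreal measurable_compose[OF measurable_coord fm])
    also have "(\<integral>\<^sup>+g. (\<Prod>\<mu>\<in>?I. f \<mu> (g \<mu>)) \<partial>?L) = (\<Prod>\<mu>\<in>?I. \<integral>\<^sup>+x. f \<mu> x \<partial>lborel)"
      by (rule product_nn_integral_prod) simp_all
    also have "\<dots> = (\<Prod>\<mu>\<in>?I. ennreal (Gamma (\<alpha> \<mu>)))" by (intro prod.cong refl fint) auto
    finally show ?thesis unfolding interval_split_last[OF p] by (simp add: mult.commute)
  qed
  also have "\<dots> = ennreal (\<Prod>\<mu>=1..p. Gamma (\<alpha> \<mu>))"
    using \<alpha> by (intro prod_ennreal) (simp add: Gamma_real_pos less_imp_le)
  finally have "ennreal (Gamma A) * (\<integral>\<^sup>+w. indicator (open_simplex p) w * ennreal (D w) \<partial>?L) = ennreal (\<Prod>\<mu>=1..p. Gamma (\<alpha> \<mu>))"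
    using polar1[of "\<lambda>_. 1"] by simp
  moreover have "(\<Prod>\<mu>=1..p. Gamma (\<alpha> \<mu>)) > 0" using \<alpha> by (intro prod_pos) (auto intro: Gamma_real_pos)
  ultimately show "(\<integral>\<^sup>+w. indicator (open_simplex p) w * ennreal (D w) \<partial>?L) \<noteq> \<infinity>"
    "(\<integral>\<^sup>+w. indicator (open_simplex p) w * ennreal (D w) \<partial>?L) \<noteq> 0"
    using \<Gamma> by (auto simp: ennreal_mult_top ennreal_eq_0_iff)
qed

text \<open>The uniform weights off the simplex, a posterior null set, are a junk value that makes this a bin
  probability everywhere.\<close>

definition simplex_bins :: "nat \<Rightarrow> (nat \<Rightarrow> real) \<Rightarrow> nat \<Rightarrow> real" where
  "simplex_bins p w \<mu> = (if w \<in> open_simplex p then bin_probs p w \<mu> else 1 / real p)"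

lemma bin_probability_simplex_bins: "p > 0 \<Longrightarrow> bin_probability p (simplex_bins p w)"
  using bin_probability_bin_probs[of p w]
  by (cases "w \<in> open_simplex p") (auto simp: simplex_bins_def bin_probability_def)

lemma measurable_simplex_bins:
  "\<mu> \<in> {1..p} \<Longrightarrow> (\<lambda>w. simplex_bins p w \<mu>) \<in> borel_measurable (Pi\<^sub>M {1..<p} (\<lambda>_. lborel))"
  unfolding simplex_bins_def by (intro measurable_If measurable_bin_probs) simp_all

lemma bin_probs_restrict:
  assumes p: "p > 0" and w: "bin_probability p w"
  shows "\<mu> \<in> {1..p} \<Longrightarrow> bin_probs p (\<lambda>i\<in>{1..<p}. w i) \<mu> = w \<mu>"
    "(\<lambda>i\<in>{1..<p}. w i) \<in> open_simplex p"
proof -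
  have "w p + (\<Sum>\<nu>=1..<p. w \<nu>) = 1"
    using w unfolding bin_probability_def interval_split_last[OF p] by simp
  moreover have "(\<Sum>\<nu>=1..<p. (\<lambda>i\<in>{1..<p}. w i) \<nu>) = (\<Sum>\<nu>=1..<p. w \<nu>)" by (intro sum.cong) auto
  ultimately have *: "bin_probs p (\<lambda>i\<in>{1..<p}. w i) \<mu> = w \<mu>" if "\<mu> \<in> {1..p}" for \<mu>
    using that by (auto simp: bin_probs_def)
  then show "\<mu> \<in> {1..p} \<Longrightarrow> bin_probs p (\<lambda>i\<in>{1..<p}. w i) \<mu> = w \<mu>" .
  show "(\<lambda>i\<in>{1..<p}. w i) \<in> open_simplex p"
    unfolding open_simplex_def using * w by (simp add: bin_probability_def)
qed

lemma hist_density_eq: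
  "p > 0 \<Longrightarrow> x \<in> {0..1} \<Longrightarrow> hist_density p w x = real p * bin_probs p w (bin_index p x)"
  unfolding hist_density_def by (subst sum_indicator_bin) auto

text \<open>By conjugacy the posterior has exponents \<open>\<alpha> \<mu> - 1\<close> with
  \<open>\<alpha> \<mu> = m \<mu> + N \<mu>\<close>, so \<open>simplex_tilt\<close> with
  \<open>c \<mu> = exp (t * e \<mu>)\<close> describes the tilt. The \<open>- 1\<close> is swallowed
  by the Jacobian of the tilt, which is why the prior score looks like the likelihood score with
  \<open>m\<close> in place of the counts.\<close>

lemma dirichlet_score_identity:
  fixes m :: "nat \<Rightarrow> real" and X :: "nat \<Rightarrow> real" and p n :: nat
  assumes p: "p > 0" and X: "\<And>i. i \<in> {1..n} \<Longrightarrow> X i \<in> {0..1}" and m: "\<And>\<mu>. \<mu> \<in> {1..p} \<Longrightarrow> m \<mu> > 0"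
  defines "M \<equiv> posterior (dirichlet_prior p m) (hist_density p) n X"
  shows "prob_space M" "sets M = sets (Pi\<^sub>M {1..<p} (\<lambda>_. lborel))" "AE w in M. w \<in> open_simplex p"
    and "evidence (dirichlet_prior p m) (hist_density p) n X \<noteq> \<infinity>"
    and "score_identity M p (simplex_bins p) (bin_count p n X) e
      (\<lambda>w. \<Sum>\<mu>=1..p. m \<mu> * (e \<mu> - bin_mean p (simplex_bins p w) e))"
proof -
  let ?L = "Pi\<^sub>M {1..<p} (\<lambda>_. lborel :: real measure)"
  define N where "N = bin_count p n X"
  define \<alpha> where "\<alpha> \<mu> = m \<mu> + N \<mu>" for \<mu>
  have N0: "N \<mu> \<ge> 0" for \<mu> unfolding N_def by (rule bin_count_nonneg)
  have \<alpha>: "\<alpha> \<mu> > 0" if "\<mu> \<in> {1..p}" for \<mu> using m[OF that] N0[of \<mu>] by (simp add: \<alpha>_def)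
  define D where "D w = (\<Prod>\<mu>=1..p. bin_probs p w \<mu> powr (\<alpha> \<mu> - 1))" for w
  define P where "P w = (\<Prod>\<mu>=1..p. bin_probs p w \<mu> powr (m \<mu> - 1))" for w
  define lik where "lik w = (\<Prod>i=1..n. real p * bin_probs p w (bin_index p (X i)))" for w
  have P0: "P w \<ge> 0" and D0: "D w \<ge> 0" for w unfolding P_def D_def by (intro prod_nonneg; simp)+
  have lik: "likelihood n X (hist_density p w) = lik w" for w
    unfolding lik_def by (intro likelihood_histogram[OF p X] hist_density_eq[OF p])
  have Dm: "D \<in> borel_measurable ?L" and Pm: "P \<in> borel_measurable ?L"
    unfolding D_def P_def
    by (intro borel_measurable_prod powr_real_measurable borel_measurable_const borel_measurable_diff measurable_bin_probs; assumption)+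
  have likm: "lik \<in> borel_measurable ?L"
    unfolding lik_def by (intro borel_measurable_prod borel_measurable_times borel_measurable_const measurable_bin_probs bin_index_range p)
  note [measurable] = Dm Pm likm
  have Sm[measurable]: "(\<lambda>w. indicator (open_simplex p) w :: ennreal) \<in> borel_measurable ?L"
    unfolding indicator_def by measurable
  have bpos: "bin_probs p w \<mu> > 0" if "w \<in> open_simplex p" "\<mu> \<in> {1..p}" for w \<mu>
    using that by (simp add: open_simplex_def)
  \<comment> \<open>Conjugacy: the likelihood contributes a factor \<open>p\<close> per observation
    and raises each bin probability to the power of its count.\<close>
  have Plik: "P w * lik w = D w * real p ^ n" and lik0: "lik w \<ge> 0" if w: "w \<in> open_simplex p" for w
  proof -
    note b = bpos[OF w]
    have "(\<Prod>i=1..n. bin_probs p w (bin_index p (X i))) = exp (\<Sum>i=1..n. ln (bin_probs p w (bin_index p (X i))))"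
      using b[OF bin_index_range[OF p]] by (simp add: exp_sum)
    also have "(\<Sum>i=1..n. ln (bin_probs p w (bin_index p (X i)))) = (\<Sum>\<mu>=1..p. N \<mu> * ln (bin_probs p w \<mu>))"
      unfolding N_def by (rule sum_bin_count[OF p])
    also have "exp \<dots> = (\<Prod>\<mu>=1..p. bin_probs p w \<mu> powr N \<mu>)"
      unfolding exp_sum[OF finite_atLeastAtMost] using b by (intro prod.cong refl) (force simp: powr_def)
    finally have "lik w = real p ^ n * (\<Prod>\<mu>=1..p. bin_probs p w \<mu> powr N \<mu>)"
      unfolding lik_def by (simp add: prod.distrib)
    moreover have "P w * (\<Prod>\<mu>=1..p. bin_probs p w \<mu> powr N \<mu>) = D w"
      unfolding P_def D_def prod.distrib[symmetric] \<alpha>_def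
      by (intro prod.cong refl) (simp add: powr_add[symmetric] add_diff_eq algebra_simps)
    ultimately show "P w * lik w = D w * real p ^ n" by (simp add: mult.commute mult.left_commute)
    show "lik w \<ge> 0" unfolding lik_def using b[OF bin_index_range[OF p]] by (intro prod_nonneg) (auto simp: less_imp_le)
  qed
  define Ev where "Ev = evidence (dirichlet_prior p m) (hist_density p) n X"
  have prior: "dirichlet_prior p m = density ?L (\<lambda>w. indicator (open_simplex p) w * ennreal (P w))"
    unfolding dirichlet_prior_def open_simplex_def P_def ..
  have I: "(\<integral>\<^sup>+w. indicator (open_simplex p) w * ennreal (D w) \<partial>?L) \<noteq> \<infinity>"
    "(\<integral>\<^sup>+w. indicator (open_simplex p) w * ennreal (D w) \<partial>?L) \<noteq> 0"
    unfolding D_def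
    by (rule simplex_tilt(2)[OF p \<alpha>, where c = "\<lambda>_. 1" and G = "\<lambda>_. 1"]; simp)
       (rule simplex_tilt(3)[OF p \<alpha>, where c = "\<lambda>_. 1" and G = "\<lambda>_. 1"]; simp)
  have Ev: "Ev = ennreal (real p ^ n) * (\<integral>\<^sup>+w. indicator (open_simplex p) w * ennreal (D w) \<partial>?L)"
  proof -
    have "Ev = (\<integral>\<^sup>+w. indicator (open_simplex p) w * ennreal (P w) * ennreal (lik w) \<partial>?L)"
      unfolding Ev_def evidence_def prior lik by (subst nn_integral_density) auto
    also have "\<dots> = (\<integral>\<^sup>+w. ennreal (real p ^ n) * (indicator (open_simplex p) w * ennreal (D w)) \<partial>?L)"
    proof (rule nn_integral_cong)
      fix w show "indicator (open_simplex p) w * ennreal (P w) * ennreal (lik w) =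
          ennreal (real p ^ n) * (indicator (open_simplex p) w * ennreal (D w))"
        using Plik[of w] lik0[of w] P0[of w] D0[of w]
        by (cases "w \<in> open_simplex p") (simp_all add: ennreal_mult[symmetric] mult.commute)
    qed
    also have "\<dots> = ennreal (real p ^ n) * (\<integral>\<^sup>+w. indicator (open_simplex p) w * ennreal (D w) \<partial>?L)"
      by (intro nn_integral_cmult) measurable
    finally show ?thesis .
  qed
  have pn: "ennreal (real p ^ n) \<noteq> 0"
  proof -
    have "0 < real p ^ n" using p by simp
    then show ?thesis unfolding ennreal_eq_0_iff not_le .
  qed
  have Ev0: "Ev \<noteq> 0" "Ev \<noteq> \<infinity>" 
    unfolding Ev using I pn by (simp_all add: ennreal_mult_eq_top_iff del: ennreal_eq_0_iff)
  then show "evidence (dirichlet_prior p m) (hist_density p) n X \<noteq> \<infinity>" by (simp add: Ev_def)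
  show prob: "prob_space M"
    unfolding M_def using Ev0 unfolding Ev_def by (intro prob_space_posterior) (auto simp: lik prior)
  show sets: "sets M = sets ?L" unfolding M_def posterior_def prior by simp
  have space: "space M = space ?L" using sets by (rule sets_eq_imp_space_eq)
  define \<kappa> where "\<kappa> = ennreal (real p ^ n) / Ev"
  have M: "M = density ?L (\<lambda>w. indicator (open_simplex p) w * ennreal (D w) * \<kappa>)"
  proof -
    have "M = density ?L (\<lambda>w. indicator (open_simplex p) w * ennreal (P w) * (ennreal (lik w) / Ev))"
      unfolding M_def posterior_def prior lik Ev_def[unfolded prior, symmetric] by (subst density_density_eq) auto
    also have "\<dots> = density ?L (\<lambda>w. indicator (open_simplex p) w * ennreal (D w) * \<kappa>)"
    proof (intro density_cong AE_I2)
      fix w show "indicator (open_simplex p) w * ennreal (P w) * (ennreal (lik w) / Ev) =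
          indicator (open_simplex p) w * ennreal (D w) * \<kappa>"
        unfolding \<kappa>_def ennreal_times_divide
        using Plik[of w] lik0[of w] P0[of w] D0[of w]
        by (cases "w \<in> open_simplex p") (simp_all add: ennreal_mult[symmetric])
    qed measurable
    finally show ?thesis .
  qed
  show AE: "AE w in M. w \<in> open_simplex p"
    unfolding M by (subst AE_density) (auto simp: indicator_def split: if_splits)
  have nnM: "(\<integral>\<^sup>+w. F w \<partial>M) = \<kappa> * (\<integral>\<^sup>+w. indicator (open_simplex p) w * (ennreal (D w) * F w) \<partial>?L)"
    if [measurable]: "F \<in> borel_measurable ?L" for F
  proof -
    have "(\<integral>\<^sup>+w. F w \<partial>M) = (\<integral>\<^sup>+w. \<kappa> * (indicator (open_simplex p) w * (ennreal (D w) * F w)) \<partial>?L)"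
      unfolding M by (subst nn_integral_density) (auto simp: mult_ac)
    also have "\<dots> = \<kappa> * (\<integral>\<^sup>+w. indicator (open_simplex p) w * (ennreal (D w) * F w) \<partial>?L)"
      by (intro nn_integral_cmult) measurable
    finally show ?thesis .
  qed
  define \<omega> where "\<omega> = simplex_bins p"
  have \<omega>: "bin_probability p (\<omega> w)" for w unfolding \<omega>_def by (rule bin_probability_simplex_bins[OF p])
  define T where "T t w = tilt_normaliser p e t (\<omega> w)" for t w
  have Tpos: "T t w > 0" for t w
    unfolding T_def tilt_normaliser_def using \<omega>[of w] p
    by (intro sum_pos) (auto simp: bin_probability_def)
  \<comment> \<open>The tilted probabilities. The flow \<open>\<tau>\<close> stores the first
    \<open>p - 1\<close> of them, and \<open>bin_probs\<close> recovers the last because they sum to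
    1.\<close>
  define tl where "tl t w \<mu> = \<omega> w \<mu> * exp (t * e \<mu> - ln (T t w))" for t w \<mu>
  have tl: "bin_probability p (tl t w)" for t w
    unfolding bin_probability_def
  proof
    show "\<forall>\<mu>\<in>{1..p}. 0 < tl t w \<mu>" using \<omega>[of w] by (simp add: tl_def bin_probability_def)
    have "(\<Sum>\<mu>=1..p. tl t w \<mu>) = (\<Sum>\<mu>=1..p. \<omega> w \<mu> * exp (t * e \<mu>)) / T t w"
      unfolding tl_def sum_divide_distrib using Tpos[of t w] by (intro sum.cong refl) (simp add: exp_diff)
    then show "(\<Sum>\<mu>=1..p. tl t w \<mu>) = 1" using Tpos[of t w] by (simp add: T_def tilt_normaliser_def)
  qed
  define \<tau> where "\<tau> t w = (\<lambda>i\<in>{1..<p}. tl t w i)" for t w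
  have \<tau>: "\<omega> (\<tau> t w) \<mu> = tl t w \<mu>" if "\<mu> \<in> {1..p}" for t w \<mu>
    unfolding \<omega>_def \<tau>_def simplex_bins_def using bin_probs_restrict[OF p tl[of t w]] that by simp
  have \<omega>m: "(\<lambda>w. \<omega> w \<mu>) \<in> borel_measurable ?L" if "\<mu> \<in> {1..p}" for \<mu>
    unfolding \<omega>_def using that by (rule measurable_simplex_bins)
  have Tm: "T t \<in> borel_measurable ?L" for t
    unfolding T_def tilt_normaliser_def by (intro borel_measurable_sum borel_measurable_times \<omega>m borel_measurable_const)
  have \<tau>m: "\<tau> t \<in> ?L \<rightarrow>\<^sub>M ?L" for t
    unfolding \<tau>_def
  proof (rule measurable_restrict)
    fix i assume "i \<in> {1..<p}"
    then have i: "i \<in> {1..p}" by auto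
    note [measurable] = Tm \<omega>m[OF i]
    show "(\<lambda>w. tl t w i) \<in> ?L \<rightarrow>\<^sub>M lborel" unfolding tl_def by simp
  qed
  define lr where "lr t w = (\<Sum>\<mu>=1..p. m \<mu> * (t * e \<mu> - ln (T t w)))" for t w
  have lrm: "lr t \<in> borel_measurable ?L" for t
    using Tm unfolding lr_def by measurable
  \<comment> \<open>Likelihood and prior changes together; on the simplex this is the weight that
    \<open>simplex_tilt\<close> attaches to the tilt.\<close>
  define W where "W t w = exp ((\<Sum>\<mu>=1..p. N \<mu> * (t * e \<mu> - ln (T t w))) + lr t w)" for t w
  have Wm: "W t \<in> borel_measurable ?L" for t using Tm lrm unfolding W_def by measurable
  have tilt_inv: "(\<integral>\<^sup>+w. ennreal (W t w) * G (\<tau> t w) \<partial>M) = (\<integral>\<^sup>+w. G w \<partial>M)" if G: "G \<in> borel_measurable ?L" for G t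
  proof -
    let ?c = "\<lambda>\<mu>. exp (t * e \<mu>)"
    let ?T = "\<lambda>w. \<Sum>\<mu>=1..p. ?c \<mu> * bin_probs p w \<mu>"
    have "(\<lambda>w. ennreal (W t w) * G (\<tau> t w)) \<in> borel_measurable ?L"
      using Wm measurable_compose[OF \<tau>m G] by measurable
    then have "(\<integral>\<^sup>+w. ennreal (W t w) * G (\<tau> t w) \<partial>M) =
        \<kappa> * (\<integral>\<^sup>+w. indicator (open_simplex p) w * (ennreal (D w) * (ennreal (W t w) * G (\<tau> t w))) \<partial>?L)"
      by (rule nnM)
    also have "(\<integral>\<^sup>+w. indicator (open_simplex p) w * (ennreal (D w) * (ennreal (W t w) * G (\<tau> t w))) \<partial>?L) =
      (\<integral>\<^sup>+w. indicator (open_simplex p) w * (ennreal (D w * ((\<Prod>\<mu>=1..p. ?c \<mu> powr \<alpha> \<mu>) * ?T w powr (- (\<Sum>\<mu>=1..p. \<alpha> \<mu>)))) *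
      G (\<lambda>i\<in>{1..<p}. ?c i * w i / ?T w)) \<partial>?L)"
    proof (rule nn_integral_cong)
      fix w
      show "indicator (open_simplex p) w * (ennreal (D w) * (ennreal (W t w) * G (\<tau> t w))) =
        indicator (open_simplex p) w * (ennreal (D w * ((\<Prod>\<mu>=1..p. ?c \<mu> powr \<alpha> \<mu>) * ?T w powr (- (\<Sum>\<mu>=1..p. \<alpha> \<mu>)))) *
        G (\<lambda>i\<in>{1..<p}. ?c i * w i / ?T w))"
      proof (cases "w \<in> open_simplex p")
        case True
        then have \<omega>w: "\<omega> w = bin_probs p w" by (simp add: \<omega>_def simplex_bins_def fun_eq_iff)
        have T: "?T w = T t w" unfolding T_def tilt_normaliser_def \<omega>w by (simp add: mult.commute)
        have "W t w = exp (\<Sum>\<mu>=1..p. \<alpha> \<mu> * (t * e \<mu> - ln (T t w)))"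
          unfolding W_def lr_def sum.distrib[symmetric] \<alpha>_def by (simp add: algebra_simps)
        also have "\<dots> = exp (\<Sum>\<mu>=1..p. \<alpha> \<mu> * (t * e \<mu>)) * exp (- (\<Sum>\<mu>=1..p. \<alpha> \<mu>) * ln (T t w))"
          unfolding exp_add[symmetric] right_diff_distrib sum_subtractf sum_distrib_right[symmetric] by simp
        also have "exp (\<Sum>\<mu>=1..p. \<alpha> \<mu> * (t * e \<mu>)) = (\<Prod>\<mu>=1..p. ?c \<mu> powr \<alpha> \<mu>)"
          unfolding exp_sum[OF finite_atLeastAtMost] by (intro prod.cong refl) (simp add: powr_def)
        also have "exp (- (\<Sum>\<mu>=1..p. \<alpha> \<mu>) * ln (T t w)) = ?T w powr (- (\<Sum>\<mu>=1..p. \<alpha> \<mu>))"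
          unfolding T using Tpos[of t w] by (simp add: powr_def)
        finally have W: "W t w = (\<Prod>\<mu>=1..p. ?c \<mu> powr \<alpha> \<mu>) * ?T w powr (- (\<Sum>\<mu>=1..p. \<alpha> \<mu>))" .
        have \<tau>w: "\<tau> t w = (\<lambda>i\<in>{1..<p}. ?c i * w i / ?T w)"
          unfolding \<tau>_def T
        proof (rule restrict_ext)
          fix i assume "i \<in> {1..<p}"
          then show "tl t w i = ?c i * w i / T t w"
            using Tpos[of t w] unfolding tl_def \<omega>w by (simp add: exp_diff bin_probs_def)
        qed
        have "ennreal (D w) * (ennreal (W t w) * G (\<tau> t w)) = ennreal (D w * W t w) * G (\<tau> t w)"
          using D0[of w] by (simp add: ennreal_mult mult.assoc W_def)
        then show ?thesis unfolding \<tau>w W by (simp only:)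
      next
        case False then show ?thesis by simp
      qed
    qed
    also have "\<dots> = (\<integral>\<^sup>+w. indicator (open_simplex p) w * (ennreal (D w) * G w) \<partial>?L)"
      unfolding D_def by (rule simplex_tilt(1)[OF p \<alpha> _ G]) simp_all
    also have "\<kappa> * \<dots> = (\<integral>\<^sup>+w. G w \<partial>M)" using nnM[OF G] ..
    finally show ?thesis .
  qed
  have cong: "measurable M N' = measurable ?L N'" for N' using measurable_cong_sets[OF sets refl] .
  \<comment> \<open>\<open>tilt_inv\<close> concerns nonnegative integrands; restated as an equality
    of measures it covers the signed functions of \<open>score_identityI\<close>.\<close>
  have distr: "distr (density M (\<lambda>w. ennreal (W t w))) M (\<tau> t) = M" for t
  proof (rule measure_eqI)
    have \<tau>M: "\<tau> t \<in> density M (\<lambda>w. ennreal (W t w)) \<rightarrow>\<^sub>M M" using \<tau>m measurable_cong_sets[OF sets sets] by simp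
    have WM: "(\<lambda>w. ennreal (W t w)) \<in> borel_measurable M"
      unfolding cong by (rule measurable_compose[OF Wm measurable_ennreal])
    fix B assume "B \<in> sets (distr (density M (\<lambda>w. ennreal (W t w))) M (\<tau> t))"
    then have B: "B \<in> sets M" by simp
    then have iB: "indicator B \<in> borel_measurable ?L" using sets by simp
    have "emeasure (distr (density M (\<lambda>w. ennreal (W t w))) M (\<tau> t)) B =
        (\<integral>\<^sup>+w. indicator B w \<partial>distr (density M (\<lambda>w. ennreal (W t w))) M (\<tau> t))" using B by simp
    also have "\<dots> = (\<integral>\<^sup>+w. indicator B (\<tau> t w) \<partial>density M (\<lambda>w. ennreal (W t w)))"
      using B by (intro nn_integral_distr \<tau>M) simp
    also have "\<dots> = (\<integral>\<^sup>+w. ennreal (W t w) * indicator B (\<tau> t w) \<partial>M)"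
      by (intro nn_integral_density WM) (unfold cong, rule measurable_compose[OF \<tau>m iB])
    also have "\<dots> = emeasure M B" using tilt_inv[OF iB] B by simp
    finally show "emeasure (distr (density M (\<lambda>w. ennreal (W t w))) M (\<tau> t)) B = emeasure M B" .
  qed simp
  define E where "E = (\<Sum>\<mu>=1..p. \<bar>e \<mu>\<bar>)"
  have E: "\<bar>e \<mu>\<bar> \<le> E" if "\<mu> \<in> {1..p}" for \<mu>
    using member_le_sum[of \<mu> "{1..p}" "\<lambda>\<mu>. \<bar>e \<mu>\<bar>"] that unfolding E_def by auto
  show "score_identity M p (simplex_bins p) (bin_count p n X) e
      (\<lambda>w. \<Sum>\<mu>=1..p. m \<mu> * (e \<mu> - bin_mean p (simplex_bins p w) e))"
    unfolding \<omega>_def[symmetric] N_def[symmetric]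
  proof (rule score_identityI[OF prob, where \<tau> = \<tau> and lr = lr and B = "\<Sum>\<mu>=1..p. m \<mu> * (2 * E)"])
    show "(\<lambda>w. \<omega> w \<mu>) \<in> borel_measurable M" if "\<mu> \<in> {1..p}" for \<mu>
      unfolding cong by (rule \<omega>m[OF that])
    show "bin_probability p (\<omega> w)" for w by (rule \<omega>)
    show "\<omega> (\<tau> t w) \<mu> = \<omega> w \<mu> * exp (t * e \<mu> - ln (tilt_normaliser p e t (\<omega> w)))" if "\<mu> \<in> {1..p}" for t w \<mu>
      using \<tau>[OF that] unfolding tl_def T_def .
    show "lr t \<in> borel_measurable M" for t unfolding cong by (rule lrm)
    have T0: "T 0 w = 1" for w using \<omega>[of w] by (simp add: T_def tilt_normaliser_def bin_probability_def)
    then show "lr 0 w = 0" for w by (simp add: lr_def)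
    show "((\<lambda>t. lr t w) has_real_derivative (\<Sum>\<mu>=1..p. m \<mu> * (e \<mu> - bin_mean p (\<omega> w) e))) (at 0)" for w
    proof -
      have "((\<lambda>t. T t w) has_real_derivative bin_mean p (\<omega> w) e) (at 0)"
        unfolding T_def tilt_normaliser_def bin_mean_def by (auto intro!: derivative_eq_intros sum.cong)
      from DERIV_chain2[OF DERIV_ln this] have
        "((\<lambda>t. ln (T t w)) has_real_derivative bin_mean p (\<omega> w) e) (at 0)"
        unfolding T0 by simp
      from DERIV_diff[OF DERIV_cmult_right[OF DERIV_ident] this]
      have "((\<lambda>t. t * e \<mu> - ln (T t w)) has_real_derivative e \<mu> - bin_mean p (\<omega> w) e) (at 0)" for \<mu> by simp
      then show ?thesis unfolding lr_def by (intro DERIV_sum DERIV_cmult)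
    qed
    show "\<bar>lr t w\<bar> \<le> (\<Sum>\<mu>=1..p. m \<mu> * (2 * E)) * t" if t: "0 \<le> t" for t w
    proof -
      have "\<bar>lr t w\<bar> \<le> (\<Sum>\<mu>=1..p. \<bar>m \<mu> * (t * e \<mu> - ln (T t w))\<bar>)" unfolding lr_def by (rule sum_abs)
      also have "\<dots> \<le> (\<Sum>\<mu>=1..p. m \<mu> * (2 * E) * t)"
      proof (rule sum_mono)
        fix \<mu> assume \<mu>: "\<mu> \<in> {1..p}"
        have "\<bar>t * e \<mu>\<bar> \<le> t * E" using E[OF \<mu>] t by (simp add: abs_mult mult_left_mono)
        moreover have "\<bar>ln (T t w)\<bar> \<le> t * E"
          unfolding T_def by (rule tilt_normaliser_bounds(2)[OF \<omega> E t])
        ultimately have "\<bar>t * e \<mu> - ln (T t w)\<bar> \<le> 2 * E * t" by (simp add: algebra_simps)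
        then have "m \<mu> * \<bar>t * e \<mu> - ln (T t w)\<bar> \<le> m \<mu> * (2 * E * t)" using m[OF \<mu>] by (intro mult_left_mono) auto
        then show "\<bar>m \<mu> * (t * e \<mu> - ln (T t w))\<bar> \<le> m \<mu> * (2 * E) * t"
          using m[OF \<mu>] by (simp add: abs_mult mult.assoc)
      qed
      finally show ?thesis by (simp add: sum_distrib_right)
    qed
    show "(\<integral>w. F (\<tau> t w) * exp ((\<Sum>\<mu>=1..p. N \<mu> * (t * e \<mu> - ln (tilt_normaliser p e t (\<omega> w)))) + lr t w) \<partial>M)
        = (\<integral>w. F w \<partial>M)" if F: "F \<in> borel_measurable M" for F t
    proof -
      have \<tau>M: "\<tau> t \<in> M \<rightarrow>\<^sub>M M" using \<tau>m measurable_cong_sets[OF sets sets] by simp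
      have "(\<integral>w. F w \<partial>M) = (\<integral>w. F w \<partial>distr (density M (\<lambda>w. ennreal (W t w))) M (\<tau> t))" unfolding distr ..
      also have "\<dots> = (\<integral>w. F (\<tau> t w) \<partial>density M (\<lambda>w. ennreal (W t w)))"
        using \<tau>M F by (intro integral_distr) simp_all
      also have "\<dots> = (\<integral>w. W t w *\<^sub>R F (\<tau> t w) \<partial>M)"
        by (intro integral_density measurable_compose[OF \<tau>M F]) (unfold cong, rule Wm, simp add: W_def)
      finally show ?thesis unfolding W_def T_def by (simp add: mult.commute)
    qed
  qed
qed

declare One_nat_def [simp]

section \<open>Smooth integral functionals\<close>

lemma step_function_integral:
  assumes p: "p > 0"
  shows "set_integrable lborel {0..1} (\<lambda>x. c (bin_index p x) :: real)"
    and "(LBINT x:{0..1}. c (bin_index p x)) = (\<Sum>\<mu>=1..p. c \<mu>) / real p"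
proof -
  have eq: "indicat_real {0..1} x *\<^sub>R c (bin_index p x) = (\<Sum>\<mu>=1..p. c \<mu> * indicat_real (bin p \<mu>) x)" for x
  proof (cases "x \<in> {0..1}")
    case True then show ?thesis using sum_indicator_bin[OF p True, of c] by simp
  next
    case False
    then have "x \<notin> bin p \<mu>" if "\<mu> \<in> {1..p}" for \<mu> using bin_subset[OF p that] by auto
    then show ?thesis using False by simp
  qed
  show "set_integrable lborel {0..1} (\<lambda>x. c (bin_index p x))"
    unfolding set_integrable_def eq
    by (intro Bochner_Integration.integrable_sum integrable_mult_right) (auto simp: emeasure_bin[OF p])
  show "(LBINT x:{0..1}. c (bin_index p x)) = (\<Sum>\<mu>=1..p. c \<mu>) / real p"
    unfolding set_lebesgue_integral_def eq
    by (subst Bochner_Integration.integral_sum) (auto simp: emeasure_bin[OF p] measure_bin[OF p] sum_divide_distrib)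
qed

lemma set_integrable_bounded_mult:
  fixes f g :: "real \<Rightarrow> real"
  assumes f: "set_integrable lborel A f" and g: "set_borel_measurable lborel A g"
    and B: "\<And>x. x \<in> A \<Longrightarrow> \<bar>g x\<bar> \<le> B" and A: "A \<in> sets borel"
  shows "set_integrable lborel A (\<lambda>x. f x * g x)"
  unfolding set_integrable_def
proof (rule Bochner_Integration.integrable_bound)
  show "integrable lborel (\<lambda>x. B * (indicat_real A x *\<^sub>R f x))"
    using f unfolding set_integrable_def by (rule integrable_mult_right)
  have "(\<lambda>x. (indicat_real A x *\<^sub>R f x) * (indicat_real A x *\<^sub>R g x)) \<in> borel_measurable lborel"
    using f g unfolding set_integrable_def set_borel_measurable_def by (intro borel_measurable_times) auto
  moreover have "(\<lambda>x. (indicat_real A x *\<^sub>R f x) * (indicat_real A x *\<^sub>R g x)) = (\<lambda>x. indicat_real A x *\<^sub>R (f x * g x))"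
    by (auto simp: indicator_def)
  ultimately show "(\<lambda>x. indicat_real A x *\<^sub>R (f x * g x)) \<in> borel_measurable lborel" by simp
  show "AE x in lborel. norm (indicat_real A x *\<^sub>R (f x * g x)) \<le> norm (B * (indicat_real A x *\<^sub>R f x))"
  proof (intro AE_I2)
    fix x show "norm (indicat_real A x *\<^sub>R (f x * g x)) \<le> norm (B * (indicat_real A x *\<^sub>R f x))"
    proof (cases "x \<in> A")
      case True
      have "\<bar>f x\<bar> * \<bar>g x\<bar> \<le> B * \<bar>f x\<bar>"
        using mult_right_mono[OF B[OF True] abs_ge_zero[of "f x"]] by (simp add: mult.commute)
      also have "\<dots> \<le> \<bar>B\<bar> * \<bar>f x\<bar>" by (intro mult_right_mono) auto
      finally show ?thesis using True by (simp add: abs_mult)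
    qed simp
  qed
qed

lemma holder_continuous_on:
  fixes f :: "real \<Rightarrow> real"
  assumes "a > 0" "\<And>x y. x \<in> A \<Longrightarrow> y \<in> A \<Longrightarrow> \<bar>f x - f y\<bar> \<le> L * \<bar>x - y\<bar> powr a"
  shows "continuous_on A f"
  unfolding continuous_on_def
proof
  fix x assume x: "x \<in> A"
  have "((\<lambda>y. L * \<bar>y - x\<bar> powr a) \<longlongrightarrow> L * \<bar>x - x\<bar> powr a) (at x within A)"
    using assms(1) by (intro tendsto_intros tendsto_powr') auto
  then have "((\<lambda>y. L * \<bar>y - x\<bar> powr a) \<longlongrightarrow> 0) (at x within A)" using assms(1) by simp
  then have "((\<lambda>y. f y - f x) \<longlongrightarrow> 0) (at x within A)"
    by (rule Lim_null_comparison[rotated]) (use assms(2) x in \<open>auto simp: eventually_at_filter\<close>)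
  then show "(f \<longlongrightarrow> f x) (at x within A)" by (simp add: LIM_zero_iff)
qed

text \<open>\<open>L0\<close> is an explicit Hoelder constant of \<open>f0\<close>. The Hoelder
  condition on \<open>T'\<close> is taken at values \<open>f0 z\<close>, the form that yields
  Hoelder continuity of the composite \<open>T' x (f0 x)\<close>.\<close>

locale smooth_functional =
  fixes f0 :: "real \<Rightarrow> real" and T T' T'' :: "real \<Rightarrow> real \<Rightarrow> real"
    and s \<gamma> C \<eta> L0 c_lo :: real
  assumes s: "1/2 < s" "s \<le> 1" and \<gamma>: "\<gamma> > 1/2" and C: "C > 0" and \<eta>: "\<eta> > 0"
    and L0: "L0 \<ge> 0" "\<And>x y. x \<in> {0..1} \<Longrightarrow> y \<in> {0..1} \<Longrightarrow> \<bar>f0 x - f0 y\<bar> \<le> L0 * \<bar>x - y\<bar> powr s"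
    and f0_int: "(LBINT x:{0..1}. f0 x) = 1"
    and c_lo: "0 < c_lo" "\<And>x. x \<in> {0..1} \<Longrightarrow> c_lo \<le> f0 x"
    and T_cont: "continuous_on ({0..1} \<times> UNIV) (\<lambda>(x, u). T x u)"
    and T': "\<And>x u. x \<in> {0..1} \<Longrightarrow> (T x has_real_derivative T' x u) (at u)"
    and T'': "\<And>x u. x \<in> {0..1} \<Longrightarrow> (T' x has_real_derivative T'' x u) (at u)"
    and T_holder: "\<And>x y z. x \<in> {0..1} \<Longrightarrow> y \<in> {0..1} \<Longrightarrow> z \<in> {0..1} \<Longrightarrow>
        \<bar>T' x (f0 z) - T' y (f0 z)\<bar> \<le> C * \<bar>x - y\<bar> powr \<gamma>"
    and T_bound: "\<And>x u. x \<in> {0..1} \<Longrightarrow> u \<in> {Inf (f0 ` {0..1}) - \<eta> <..< Sup (f0 ` {0..1}) + \<eta>} \<Longrightarrow>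
        \<bar>T x u\<bar> \<le> C \<and> \<bar>T' x u\<bar> \<le> C \<and> \<bar>T'' x u\<bar> \<le> C"
begin

definition score :: "real \<Rightarrow> real" where "score x = T' x (f0 x)"
definition smoothness :: real where "smoothness = min s \<gamma>"
text \<open>The first summand accounts for the direct dependence of \<open>T'\<close> on
  \<open>x\<close>, the second for the dependence through \<open>f0\<close>, by the bound
  \<open>C\<close> on \<open>T''\<close>.\<close>

definition score_holder :: real where "score_holder = C + C * L0"
definition true_bins :: "nat \<Rightarrow> nat \<Rightarrow> real" where "true_bins p \<mu> = (LBINT x:bin p \<mu>. f0 x)"

lemma smoothness: "1/2 < smoothness" "smoothness \<le> 1" "smoothness \<le> s" "smoothness \<le> \<gamma>"
  using s \<gamma> by (auto simp: smoothness_def)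

lemma score_holder_pos: "score_holder > 0" using C L0 by (simp add: score_holder_def add_pos_nonneg)

lemma f0_continuous: "continuous_on {0..1} f0"
  by (rule holder_continuous_on[OF _ L0(2)]) (use s in auto)

lemma f0_range:
  assumes "x \<in> {0..1}"
  shows "Inf (f0 ` {0..1}) \<le> f0 x" "f0 x \<le> Sup (f0 ` {0..1})"
proof -
  have "compact (f0 ` {0..1})" by (intro compact_continuous_image f0_continuous compact_Icc)
  then have "bdd_above (f0 ` {0..1})" "bdd_below (f0 ` {0..1})"
    by (auto intro: bounded_imp_bdd_above bounded_imp_bdd_below compact_imp_bounded)
  then show "Inf (f0 ` {0..1}) \<le> f0 x" "f0 x \<le> Sup (f0 ` {0..1})"
    using assms by (auto intro: cInf_lower cSup_upper)
qed

lemma near_range: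
  assumes "x \<in> {0..1}" "\<bar>u - f0 x\<bar> < \<eta>"
  shows "u \<in> {Inf (f0 ` {0..1}) - \<eta> <..< Sup (f0 ` {0..1}) + \<eta>}"
  using f0_range[OF assms(1)] assms(2) by auto

lemma T'_lipschitz:
  assumes x: "x \<in> {0..1}"
    and u: "u \<in> {Inf (f0 ` {0..1}) - \<eta> <..< Sup (f0 ` {0..1}) + \<eta>}"
    and w: "w \<in> {Inf (f0 ` {0..1}) - \<eta> <..< Sup (f0 ` {0..1}) + \<eta>}"
  shows "\<bar>T' x u - T' x w\<bar> \<le> C * \<bar>u - w\<bar>"
proof -
  have "norm (T' x u - T' x w) \<le> C * norm (u - w)"
    by (rule field_differentiable_bound[of "{Inf (f0 ` {0..1}) - \<eta> <..< Sup (f0 ` {0..1}) + \<eta>}" "T' x" "T'' x"])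
       (use T''[OF x] T_bound[OF x] u w in \<open>auto intro: has_field_derivative_at_within\<close>)
  then show ?thesis by simp
qed

text \<open>\<open>T''\<close> is bounded but possibly discontinuous, so the mean value inequality
  replaces an integral remainder: \<open>T x w - score x * w\<close> has a derivative of size at
  most \<open>C * \<bar>u - f0 x\<bar>\<close> on the segment. This gives \<open>C\<close> instead
  of \<open>C / 2\<close>.\<close>

lemma taylor:
  assumes x: "x \<in> {0..1}" and u: "\<bar>u - f0 x\<bar> < \<eta>"
  shows "\<bar>T x u - T x (f0 x) - score x * (u - f0 x)\<bar> \<le> C * (u - f0 x)\<^sup>2"
proof -
  define D where "D w = T x w - score x * w" for w
  have d: "(D has_real_derivative T' x w - score x) (at w)" for w
    unfolding D_def by (auto intro!: derivative_eq_intros T'[OF x])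
  have "norm (D u - D (f0 x)) \<le> (C * \<bar>u - f0 x\<bar>) * norm (u - f0 x)"
  proof (rule field_differentiable_bound[of "closed_segment u (f0 x)" D "\<lambda>w. T' x w - score x"])
    fix w assume w: "w \<in> closed_segment u (f0 x)"
    then have wl: "\<bar>w - f0 x\<bar> \<le> \<bar>u - f0 x\<bar>" by (auto simp: closed_segment_eq_real_ivl split: if_splits)
    then have "\<bar>T' x w - T' x (f0 x)\<bar> \<le> C * \<bar>w - f0 x\<bar>"
      using u \<eta> by (intro T'_lipschitz x near_range[OF x]) auto
    also have "\<dots> \<le> C * \<bar>u - f0 x\<bar>" using wl C by (intro mult_left_mono) auto
    finally show "norm (T' x w - score x) \<le> C * \<bar>u - f0 x\<bar>" by (simp add: score_def)
  qed (auto intro: has_field_derivative_at_within[OF d])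
  moreover have "D u - D (f0 x) = T x u - T x (f0 x) - score x * (u - f0 x)"
    by (simp add: D_def algebra_simps)
  ultimately show ?thesis by (simp add: power2_eq_square abs_mult_self mult.assoc)
qed

lemma score_bound: "x \<in> {0..1} \<Longrightarrow> \<bar>score x\<bar> \<le> C"
  unfolding score_def using T_bound[of x "f0 x"] near_range[of x "f0 x"] \<eta> by auto

lemma powr_le_smoothness:
  assumes "x \<in> {0..1}" "y \<in> {0..1}" "smoothness \<le> b"
  shows "\<bar>x - y\<bar> powr b \<le> \<bar>x - y\<bar> powr smoothness"
  using assms by (intro powr_mono') auto

text \<open>The difference passes through \<open>T' y (f0 x)\<close>. Distances in
  \<open>[0, 1]\<close> are at most 1, so both Hoelder exponents may be lowered to their
  minimum.\<close>

lemma score_holder: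
  assumes x: "x \<in> {0..1}" and y: "y \<in> {0..1}"
  shows "\<bar>score x - score y\<bar> \<le> score_holder * \<bar>x - y\<bar> powr smoothness"
proof -
  have "\<bar>T' x (f0 x) - T' y (f0 x)\<bar> \<le> C * \<bar>x - y\<bar> powr \<gamma>" by (rule T_holder[OF x y x])
  also have "\<dots> \<le> C * \<bar>x - y\<bar> powr smoothness"
    using C powr_le_smoothness[OF x y smoothness(4)] by (intro mult_left_mono) auto
  finally have 1: "\<bar>T' x (f0 x) - T' y (f0 x)\<bar> \<le> C * \<bar>x - y\<bar> powr smoothness" .
  have "f0 x \<in> {Inf (f0 ` {0..1}) - \<eta> <..< Sup (f0 ` {0..1}) + \<eta>}" "f0 y \<in> {Inf (f0 ` {0..1}) - \<eta> <..< Sup (f0 ` {0..1}) + \<eta>}"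
    using near_range[OF x, of "f0 x"] near_range[OF y, of "f0 y"] \<eta> by auto
  then have "\<bar>T' y (f0 x) - T' y (f0 y)\<bar> \<le> C * \<bar>f0 x - f0 y\<bar>" by (rule T'_lipschitz[OF y])
  also have "\<dots> \<le> C * (L0 * \<bar>x - y\<bar> powr s)" using C L0(2)[OF x y] by (intro mult_left_mono) auto
  also have "\<dots> \<le> C * (L0 * \<bar>x - y\<bar> powr smoothness)"
    using C L0(1) powr_le_smoothness[OF x y smoothness(3)] by (intro mult_left_mono) auto
  finally show ?thesis using 1 unfolding score_def score_holder_def by (simp add: distrib_right)
qed

lemma score_continuous: "continuous_on {0..1} score"
  by (rule holder_continuous_on[OF _ score_holder]) (use smoothness in auto)

lemma set_integrable_score: "set_integrable lborel {0..1} score"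
  by (rule borel_integrable_atLeastAtMost'[OF score_continuous])

lemma set_integrable_f0: "set_integrable lborel {0..1} f0"
  by (rule borel_integrable_atLeastAtMost'[OF f0_continuous])

lemma dist_in_bin:
  assumes "p > 0" "x \<in> bin p \<mu>" "y \<in> bin p \<mu>"
  shows "\<bar>x - y\<bar> \<le> 1 / real p"
proof -
  have "(real \<mu> - 1) / real p \<le> z \<and> z \<le> real \<mu> / real p" if "z \<in> bin p \<mu>" for z
    using that assms(1) by (auto simp: bin_def split: if_splits)
  from this[OF assms(2)] this[OF assms(3)] show ?thesis by (auto simp: diff_divide_distrib abs_le_iff)
qed

lemma bin_average_close:
  assumes p: "p > 0" and x: "x \<in> {0..1}" and f: "set_integrable lborel {0..1} f" and a: "a > 0" and L: "L \<ge> 0"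
    and h: "\<And>x y. x \<in> {0..1} \<Longrightarrow> y \<in> {0..1} \<Longrightarrow> \<bar>f x - f y\<bar> \<le> L * \<bar>x - y\<bar> powr a"
  shows "\<bar>bin_average p f (bin_index p x) - f x\<bar> \<le> L * real p powr (- a)"
proof (rule bin_average_bound)
  let ?\<mu> = "bin_index p x"
  have \<mu>: "?\<mu> \<in> {1..p}" by (rule bin_index_range[OF p])
  have xb: "x \<in> bin p ?\<mu>" using mem_bin_iff[OF p x \<mu>] by simp
  show "set_integrable lborel (bin p ?\<mu>) f" by (rule set_integrable_bin[OF f p \<mu>])
  fix y assume y: "y \<in> bin p ?\<mu>"
  have "\<bar>f y - f x\<bar> \<le> L * \<bar>y - x\<bar> powr a" using h[of y x] y x bin_subset[OF p \<mu>] by auto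
  also have "\<dots> \<le> L * (1 / real p) powr a"
    using dist_in_bin[OF p y xb] a L by (intro mult_left_mono powr_mono2) auto
  also have "(1 / real p) powr a = real p powr (- a)" by (simp add: powr_minus_divide powr_divide)
  finally show "\<bar>f y - f x\<bar> \<le> L * real p powr (- a)" .
qed (rule p)

lemma f0_bin_close:
  assumes "p > 0" "x \<in> {0..1}"
  shows "\<bar>real p * true_bins p (bin_index p x) - f0 x\<bar> \<le> L0 * real p powr (- s)"
  using bin_average_close[OF assms set_integrable_f0 _ L0(1,2)] s
  unfolding bin_average_def true_bins_def by auto

lemma score_bin_close:
  assumes "p > 0" "x \<in> {0..1}"
  shows "\<bar>bin_average p score (bin_index p x) - score x\<bar> \<le> score_holder * real p powr (- smoothness)"
  using bin_average_close[OF assms set_integrable_score _ _ score_holder] smoothness score_holder_pos by auto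

lemma score_average_bound:
  assumes "p > 0" "\<mu> \<in> {1..p}"
  shows "\<bar>bin_average p score \<mu>\<bar> \<le> C"
proof -
  have "\<bar>bin_average p score \<mu> - 0\<bar> \<le> C"
    using bin_subset[OF assms] score_bound
    by (intro bin_average_bound set_integrable_bin[OF set_integrable_score] assms) auto
  then show ?thesis by simp
qed

lemma bin_probability_true_bins:
  assumes p: "p > 0"
  shows "bin_probability p (true_bins p)"
  unfolding bin_probability_def
proof
  show "\<forall>\<mu>\<in>{1..p}. 0 < true_bins p \<mu>"
  proof
    fix \<mu> assume \<mu>: "\<mu> \<in> {1..p}"
    have "(LBINT x:bin p \<mu>. c_lo) \<le> true_bins p \<mu>"
      unfolding true_bins_def
    proof (rule set_integral_mono)
      show "set_integrable lborel (bin p \<mu>) (\<lambda>_. c_lo)"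
        unfolding set_integrable_def using emeasure_bin[OF p, of \<mu>] by simp
    qed (use bin_subset[OF p \<mu>] c_lo set_integrable_bin[OF set_integrable_f0 p \<mu>] in auto)
    moreover have "(LBINT x:bin p \<mu>. c_lo) = c_lo / real p"
      using emeasure_bin[OF p, of \<mu>] measure_bin[OF p, of \<mu>] p by (subst set_integral_const) auto
    ultimately have "0 < true_bins p \<mu>" if "\<not> c_lo / real p \<le> 0" using that by linarith
    then show "0 < true_bins p \<mu>" using c_lo(1) p by (simp add: divide_le_0_iff)
  qed
  show "(\<Sum>\<mu>=1..p. true_bins p \<mu>) = 1"
    using integral_split_bins[OF set_integrable_f0 p] f0_int by (simp add: true_bins_def)
qed

lemma integral_step_times:
  fixes c :: "nat \<Rightarrow> real"
  assumes p: "p > 0" and f: "set_integrable lborel {0..1} f"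
  shows "(LBINT x:{0..1}. c (bin_index p x) * f x) = (\<Sum>\<mu>=1..p. c \<mu> * (LBINT x:bin p \<mu>. f x))"
    and "set_integrable lborel {0..1} (\<lambda>x. c (bin_index p x) * f x)"
proof -
  have m: "set_borel_measurable lborel {0..1} (\<lambda>x. c (bin_index p x))"
    using step_function_integral(1)[OF p, of c] by (auto simp: set_integrable_def set_borel_measurable_def)
  have b: "\<bar>c (bin_index p x)\<bar> \<le> (\<Sum>\<mu>=1..p. \<bar>c \<mu>\<bar>)" for x
    using member_le_sum[of "bin_index p x" "{1..p}" "\<lambda>\<mu>. \<bar>c \<mu>\<bar>"] bin_index_range[OF p, of x] by auto
  show i: "set_integrable lborel {0..1} (\<lambda>x. c (bin_index p x) * f x)"
    using set_integrable_bounded_mult[OF f m b] by (simp add: mult.commute)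
  have "(LBINT x:{0..1}. c (bin_index p x) * f x) = (\<Sum>\<mu>=1..p. LBINT x:bin p \<mu>. c (bin_index p x) * f x)"
    by (rule integral_split_bins[OF i p])
  also have "\<dots> = (\<Sum>\<mu>=1..p. c \<mu> * (LBINT x:bin p \<mu>. f x))"
  proof (rule sum.cong[OF refl])
    fix \<mu> assume \<mu>: "\<mu> \<in> {1..p}"
    have "(LBINT x:bin p \<mu>. c (bin_index p x) * f x) = (LBINT x:bin p \<mu>. c \<mu> * f x)"
      using mem_bin_iff[OF p _ \<mu>] bin_subset[OF p \<mu>] by (intro set_lebesgue_integral_cong) auto
    then show "(LBINT x:bin p \<mu>. c (bin_index p x) * f x) = c \<mu> * (LBINT x:bin p \<mu>. f x)" by simp
  qed
  finally show "(LBINT x:{0..1}. c (bin_index p x) * f x) = (\<Sum>\<mu>=1..p. c \<mu> * (LBINT x:bin p \<mu>. f x))" .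
qed

lemma integral_density_law:
  fixes h :: "real \<Rightarrow> real"
  assumes h: "h \<in> borel_measurable (restrict_space lborel {0..1})"
  shows "(\<integral>x. h x \<partial>density_law f0) = (LBINT x:{0..1}. h x * f0 x)"
proof -
  have f0m: "f0 \<in> borel_measurable (restrict_space lborel {0..1})"
    using set_integrable_f0 unfolding set_integrable_def by (subst borel_measurable_restrict_space_iff) auto
  have "(\<integral>x. h x \<partial>density_law f0) = (\<integral>x. f0 x *\<^sub>R h x \<partial>restrict_space lborel {0..1})"
    unfolding density_law_def using f0m h c_lo
    by (intro integral_density) (auto simp: space_restrict_space intro!: AE_I2 order_trans[OF less_imp_le[OF c_lo(1)] c_lo(2)])
  also have "\<dots> = (LBINT x:{0..1}. h x * f0 x)"
    unfolding set_lebesgue_integral_def by (subst integral_restrict_space) (auto simp: mult_ac)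
  finally show ?thesis .
qed

end

text \<open>Arithmetic-geometric mean inequality with a free weight. Being linear in the sum of
  squares it can be integrated as it stands; \<open>\<delta>\<close> is eventually set to
  \<open>1 / ln n\<close>.\<close>

lemma sum_abs_le_sum_squares:
  fixes x :: "nat \<Rightarrow> real"
  assumes "\<delta> > 0" "p > 0"
  shows "(\<Sum>\<mu>=1..p. \<bar>x \<mu>\<bar>) \<le> \<delta> / 2 + real p * (\<Sum>\<mu>=1..p. (x \<mu>)\<^sup>2) / (2 * \<delta>)"
proof -
  have "\<bar>y\<bar> \<le> \<delta> / (2 * real p) + real p * y\<^sup>2 / (2 * \<delta>)" for y :: real
  proof -
    have "0 \<le> (real p * \<bar>y\<bar> - \<delta>)\<^sup>2 / (2 * real p * \<delta>)" using assms by simp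
    also have "\<dots> = real p * y\<^sup>2 / (2 * \<delta>) + \<delta> / (2 * real p) - \<bar>y\<bar>"
      using assms by (simp add: power2_diff power_mult_distrib field_simps power2_eq_square)
    finally show ?thesis by simp
  qed
  then have "(\<Sum>\<mu>=1..p. \<bar>x \<mu>\<bar>) \<le> (\<Sum>\<mu>=1..p. \<delta> / (2 * real p) + real p * (x \<mu>)\<^sup>2 / (2 * \<delta>))"
    by (intro sum_mono)
  also have "\<dots> = \<delta> / 2 + real p * (\<Sum>\<mu>=1..p. (x \<mu>)\<^sup>2) / (2 * \<delta>)"
    using assms by (simp add: sum.distrib sum_distrib_left sum_divide_distrib)
  finally show ?thesis .
qed

lemma two_square_bound: "(x + y)\<^sup>2 \<le> 2 * x\<^sup>2 + 2 * y\<^sup>2" for x y :: real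
  using sum_squares_bound[of x y] by (simp add: power2_sum)

context smooth_functional
begin

abbreviation score_bins :: "nat \<Rightarrow> nat \<Rightarrow> real" where
  "score_bins p \<equiv> bin_average p score"

text \<open>\<open>sqrt n\<close> times the change of the empirical mean when the score is replaced
  by its bin averages.\<close>

definition centring_error :: "nat \<Rightarrow> nat \<Rightarrow> (nat \<Rightarrow> real) \<Rightarrow> real" where
  "centring_error p n X = (\<Sum>i=1..n. score_bins p (bin_index p (X i)) - score (X i)) / sqrt (real n)"

text \<open>Multiplied by \<open>p\<close> this is the squared \<open>L^2\<close> distance between
  the histograms with bin probabilities \<open>w\<close> and \<open>true_bins p\<close>.\<close>

definition bin_distance :: "nat \<Rightarrow> (nat \<Rightarrow> real) \<Rightarrow> real" where
  "bin_distance p w = (\<Sum>\<mu>=1..p. (w \<mu> - true_bins p \<mu>)\<^sup>2)"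

lemma score_measurable: "score \<in> borel_measurable (restrict_space lborel {0..1})"
  using set_integrable_score unfolding set_integrable_def by (subst borel_measurable_restrict_space_iff) auto

lemma set_borel_measurable_f0: "set_borel_measurable lborel {0..1} f0"
  using set_integrable_f0 by (auto simp: set_integrable_def set_borel_measurable_def)

lemma f0_bound: obtains B where "\<And>x. x \<in> {0..1} \<Longrightarrow> \<bar>f0 x\<bar> \<le> B"
proof -
  have "bounded (f0 ` {0..1})"
    by (intro compact_imp_bounded compact_continuous_image f0_continuous compact_Icc)
  then obtain B where "\<forall>y\<in>f0 ` {0..1}. norm y \<le> B" unfolding bounded_iff by blast
  then show ?thesis by (intro that[of B]) auto
qed

lemma set_integrable_mult_f0:
  assumes "set_integrable lborel {0..1} h"
  shows "set_integrable lborel {0..1} (\<lambda>x. h x * f0 x)"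
proof -
  obtain B where "\<And>x. x \<in> {0..1} \<Longrightarrow> \<bar>f0 x\<bar> \<le> B" using f0_bound by blast
  then show ?thesis by (intro set_integrable_bounded_mult[OF assms set_borel_measurable_f0]) auto
qed

section \<open>The functional at histogram densities\<close>

lemma T_step_integrable:
  assumes p: "p > 0" and f: "\<And>x. x \<in> {0..1} \<Longrightarrow> f x = c (bin_index p x)"
  shows "set_integrable lborel {0..1} (\<lambda>x. T x (f x))"
    and "int_functional T f = (\<Sum>\<mu>=1..p. LBINT x:bin p \<mu>. T x (c \<mu>))"
proof -
  have int: "set_integrable lborel (bin p \<mu>) (\<lambda>x. T x (c \<mu>))" if "\<mu> \<in> {1..p}" for \<mu>
  proof -
    have "continuous_on {0..1} (\<lambda>x. case (x, c \<mu>) of (x, u) \<Rightarrow> T x u)"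
      by (rule continuous_on_compose2[OF T_cont]) (auto intro!: continuous_intros)
    then have "continuous_on {0..1} (\<lambda>x. T x (c \<mu>))" by simp
    from set_integrable_bin[OF borel_integrable_atLeastAtMost'[OF this] p that] show ?thesis .
  qed
  have eq: "indicat_real {0..1} x *\<^sub>R T x (f x) = (\<Sum>\<mu>=1..p. indicat_real (bin p \<mu>) x *\<^sub>R T x (c \<mu>))" for x
  proof (cases "x \<in> {0..1}")
    case True
    then show ?thesis using sum_indicator_bin[OF p True, of "\<lambda>\<mu>. T x (c \<mu>)"] f by (simp add: mult.commute)
  next
    case False
    then have "x \<notin> bin p \<mu>" if "\<mu> \<in> {1..p}" for \<mu> using bin_subset[OF p that] by auto
    then show ?thesis using False by simp
  qed
  show "set_integrable lborel {0..1} (\<lambda>x. T x (f x))"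
    unfolding set_integrable_def eq using int unfolding set_integrable_def by (intro Bochner_Integration.integrable_sum)
  show "int_functional T f = (\<Sum>\<mu>=1..p. LBINT x:bin p \<mu>. T x (c \<mu>))"
    unfolding int_functional_def set_lebesgue_integral_def eq using int unfolding set_integrable_def
    by (intro Bochner_Integration.integral_sum)
qed

text \<open>Joint measurability of \<open>T\<close> follows from its continuity, and integrating out
  \<open>x\<close> over a bin preserves measurability in the parameter.\<close>

lemma measurable_int_functional:
  assumes p: "p > 0" and c: "\<And>\<mu>. \<mu> \<in> {1..p} \<Longrightarrow> (\<lambda>\<theta>. c \<theta> \<mu>) \<in> borel_measurable M"
    and f: "\<And>\<theta> x. \<theta> \<in> space M \<Longrightarrow> x \<in> {0..1} \<Longrightarrow> dens \<theta> x = c \<theta> (bin_index p x)"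
  shows "(\<lambda>\<theta>. int_functional T (dens \<theta>)) \<in> borel_measurable M"
proof -
  have "(\<lambda>\<theta>. LBINT x:bin p \<mu>. T x (c \<theta> \<mu>)) \<in> borel_measurable M" if \<mu>: "\<mu> \<in> {1..p}" for \<mu>
  proof -
    \<comment> \<open>\<open>T\<close> is arbitrary for \<open>x\<close> outside
      \<open>[0, 1]\<close>; extension by 0 gives a Borel function on the whole plane.\<close>
    define F where "F z = indicator ({0..1} \<times> UNIV) z *\<^sub>R (case z of (x, u) \<Rightarrow> T x u)" for z :: "real \<times> real"
    have Fm: "F \<in> borel_measurable borel"
      unfolding F_def by (intro borel_measurable_continuous_on_indicator T_cont) (auto intro!: borel_closed closed_Times)
    have cm: "(\<lambda>z. c (fst z) \<mu>) \<in> borel_measurable (M \<Otimes>\<^sub>M lborel)"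
      using measurable_compose[OF measurable_fst c[OF \<mu>]] .
    have "(\<lambda>z. (snd z, c (fst z) \<mu>)) \<in> M \<Otimes>\<^sub>M lborel \<rightarrow>\<^sub>M borel \<Otimes>\<^sub>M borel"
      using cm by (intro measurable_Pair) simp_all
    from measurable_compose[OF this] Fm have m: "(\<lambda>z. F (snd z, c (fst z) \<mu>)) \<in> borel_measurable (M \<Otimes>\<^sub>M lborel)"
      by (simp add: borel_prod)
    have i: "(\<lambda>z. indicat_real (bin p \<mu>) (snd z)) \<in> borel_measurable (M \<Otimes>\<^sub>M lborel)"
      by (intro measurable_compose[OF measurable_snd borel_measurable_indicator]) simp
    have "(\<lambda>z. indicat_real (bin p \<mu>) (snd z) *\<^sub>R F (snd z, c (fst z) \<mu>)) \<in> borel_measurable (M \<Otimes>\<^sub>M lborel)"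
      using m i by (intro borel_measurable_scaleR)
    then have "(\<lambda>\<theta>. \<integral>x. indicat_real (bin p \<mu>) x *\<^sub>R F (x, c \<theta> \<mu>) \<partial>lborel) \<in> borel_measurable M"
      by (intro lborel.borel_measurable_lebesgue_integral) (simp add: case_prod_beta)
    moreover have "indicat_real (bin p \<mu>) x *\<^sub>R F (x, c \<theta> \<mu>) = indicat_real (bin p \<mu>) x *\<^sub>R T x (c \<theta> \<mu>)" for \<theta> x
      using bin_subset[OF p \<mu>] by (auto simp: F_def indicator_def)
    ultimately show ?thesis unfolding set_lebesgue_integral_def by (simp only:)
  qed
  then have "(\<lambda>\<theta>. \<Sum>\<mu>=1..p. LBINT x:bin p \<mu>. T x (c \<theta> \<mu>)) \<in> borel_measurable M" by (rule borel_measurable_sum)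
  moreover have "int_functional T (dens \<theta>) = (\<Sum>\<mu>=1..p. LBINT x:bin p \<mu>. T x (c \<theta> \<mu>))" if "\<theta> \<in> space M" for \<theta>
    by (rule T_step_integrable(2)[OF p, where c = "c \<theta>"]) (rule f[OF that])
  ultimately show ?thesis by (simp only: measurable_cong[of M "\<lambda>\<theta>. int_functional T (dens \<theta>)"])
qed

text \<open>As \<open>f\<close> is constant on bins, the linear term pairs it with the bin averages
  of the score without error, and the matching term for \<open>f0\<close> cancels against the
  expectation in the centring. Replacing the empirical mean of the score by that of its bin averages
  costs \<open>centring_error\<close>. The quadratic Taylor remainder is left; it is available
  because \<open>bias\<close> and \<open>near\<close> keep \<open>f\<close> within
  \<open>\<eta>\<close> of \<open>f0\<close>.\<close>

lemma functional_expansion: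
  assumes p: "p > 0" and n: "n > 0" and X: "\<And>i. i \<in> {1..n} \<Longrightarrow> X i \<in> {0..1}"
    and f: "\<And>x. x \<in> {0..1} \<Longrightarrow> f x = real p * w (bin_index p x)"
    and bias: "L0 * real p powr (- s) \<le> \<eta> / 2"
    and near: "\<And>\<mu>. \<mu> \<in> {1..p} \<Longrightarrow> real p * \<bar>w \<mu> - true_bins p \<mu>\<bar> < \<eta> / 2"
  shows "\<bar>sqrt (real n) * (int_functional T f - efficient_centring T T' f0 n X)
      - sqrt (real n) * (bin_mean p w (score_bins p) - bin_mean p (bin_count p n X) (score_bins p) / real n)\<bar>
    \<le> \<bar>centring_error p n X\<bar> + sqrt (real n) * (C * (2 * real p * bin_distance p w + 2 * (L0 * real p powr (- s))\<^sup>2))"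
proof -
  define \<epsilon> where "\<epsilon> = L0 * real p powr (- s)"
  define r where "r \<mu> = C * (2 * (real p * (w \<mu> - true_bins p \<mu>))\<^sup>2 + 2 * \<epsilon>\<^sup>2)" for \<mu>
  define R where "R x = T x (f x) - T x (f0 x) - score x * (f x - f0 x)" for x
  \<comment> \<open>The deviation of \<open>f\<close> from \<open>f0\<close> splits into a part
    constant on bins, which depends on \<open>w\<close>, and a deterministic bias of size at most
    \<open>\<epsilon>\<close>.\<close>
  have fdiff: "\<bar>f x - f0 x - real p * (w (bin_index p x) - true_bins p (bin_index p x))\<bar> \<le> \<epsilon>" if "x \<in> {0..1}" for x
    using f0_bin_close[OF p that] f[OF that] unfolding \<epsilon>_def by (simp add: algebra_simps)
  have Rb: "\<bar>R x\<bar> \<le> r (bin_index p x)" if x: "x \<in> {0..1}" for x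
  proof -
    define u where "u = real p * (w (bin_index p x) - true_bins p (bin_index p x))"
    define e where "e = f x - f0 x - u"
    have e: "\<bar>e\<bar> \<le> \<epsilon>" using fdiff[OF x] by (simp add: e_def u_def)
    have "\<bar>u\<bar> < \<eta> / 2" using near[OF bin_index_range[OF p, of x]] by (simp add: u_def abs_mult)
    then have "\<bar>f x - f0 x\<bar> < \<eta>" using e bias unfolding e_def \<epsilon>_def by linarith
    then have "\<bar>R x\<bar> \<le> C * (f x - f0 x)\<^sup>2" unfolding R_def by (rule taylor[OF x])
    also have "(f x - f0 x)\<^sup>2 \<le> 2 * u\<^sup>2 + 2 * e\<^sup>2"
      using two_square_bound[of u e] by (simp add: e_def)
    also have "e\<^sup>2 \<le> \<epsilon>\<^sup>2" using power_mono[OF e, of 2] by simp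
    finally show ?thesis unfolding r_def u_def using C by simp
  qed
  have fi: "set_integrable lborel {0..1} (\<lambda>x. f x * h x)" "(LBINT x:{0..1}. f x * h x) = (\<Sum>\<mu>=1..p. real p * w \<mu> * (LBINT x:bin p \<mu>. h x))"
    if h: "set_integrable lborel {0..1} h" for h
  proof -
    note st = integral_step_times[OF p h, of "\<lambda>\<mu>. real p * w \<mu>"]
    show "set_integrable lborel {0..1} (\<lambda>x. f x * h x)"
      using st(2) by (rule set_integrable_cong[THEN iffD2, rotated -1]) (use f in auto)
    have "(LBINT x:{0..1}. f x * h x) = (LBINT x:{0..1}. real p * w (bin_index p x) * h x)"
      using f by (intro set_lebesgue_integral_cong) auto
    then show "(LBINT x:{0..1}. f x * h x) = (\<Sum>\<mu>=1..p. real p * w \<mu> * (LBINT x:bin p \<mu>. h x))"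
      using st(1) by simp
  qed
  have sf: "set_integrable lborel {0..1} (\<lambda>x. score x * f x)" and sf0: "set_integrable lborel {0..1} (\<lambda>x. score x * f0 x)"
    using fi(1)[OF set_integrable_score] set_integrable_mult_f0[OF set_integrable_score] by (simp_all add: mult.commute)
  have Tf: "set_integrable lborel {0..1} (\<lambda>x. T x (f x))"
    by (rule T_step_integrable(1)[OF p, where c = "\<lambda>\<mu>. real p * w \<mu>"]) (rule f)
  have Tf0: "set_integrable lborel {0..1} (\<lambda>x. T x (f0 x))"
  proof (rule borel_integrable_atLeastAtMost')
    have "continuous_on {0..1} (\<lambda>x. case (x, f0 x) of (x, u) \<Rightarrow> T x u)"
      by (rule continuous_on_compose2[OF T_cont]) (auto intro!: continuous_intros f0_continuous)
    then show "continuous_on {0..1} (\<lambda>x. T x (f0 x))" by simp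
  qed
  have sfe: "(LBINT x:{0..1}. score x * f x) = bin_mean p w (score_bins p)"
    using fi(2)[OF set_integrable_score] by (simp add: bin_mean_def bin_average_def mult_ac)
  have Reqn: "(LBINT x:{0..1}. R x) = int_functional T f - int_functional T f0 -
      (bin_mean p w (score_bins p) - (LBINT x:{0..1}. score x * f0 x))"
    and Rint: "set_integrable lborel {0..1} R"
  proof -
    have R: "R = (\<lambda>x. (T x (f x) - T x (f0 x)) - (score x * f x - score x * f0 x))"
      by (auto simp: R_def algebra_simps)
    show "set_integrable lborel {0..1} R" unfolding R by (intro set_integral_diff Tf Tf0 sf sf0)
    show "(LBINT x:{0..1}. R x) = int_functional T f - int_functional T f0 -
      (bin_mean p w (score_bins p) - (LBINT x:{0..1}. score x * f0 x))"
      unfolding R int_functional_def sfe[symmetric]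
      by (simp add: set_integral_diff Tf Tf0 sf sf0)
  qed
  have RB: "\<bar>LBINT x:{0..1}. R x\<bar> \<le> C * (2 * real p * bin_distance p w + 2 * \<epsilon>\<^sup>2)"
  proof -
    have "\<bar>LBINT x:{0..1}. R x\<bar> \<le> (LBINT x:{0..1}. \<bar>R x\<bar>)"
      using set_integral_norm_bound[OF Rint] by simp
    also have "\<dots> \<le> (LBINT x:{0..1}. r (bin_index p x))"
      using Rint Rb by (intro set_integral_mono step_function_integral(1)[OF p] set_integrable_abs) auto
    also have "\<dots> = (\<Sum>\<mu>=1..p. r \<mu>) / real p" by (rule step_function_integral(2)[OF p])
    also have "(\<Sum>\<mu>=1..p. r \<mu>) = C * (2 * (real p)\<^sup>2 * bin_distance p w + real p * (2 * \<epsilon>\<^sup>2))"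
      unfolding r_def bin_distance_def by (simp add: sum.distrib power_mult_distrib mult.assoc flip: sum_distrib_left)
    also have "\<dots> / real p = C * (2 * real p * bin_distance p w + 2 * \<epsilon>\<^sup>2)"
      using p by (simp add: field_simps power2_eq_square)
    finally show ?thesis .
  qed
  have cent: "efficient_centring T T' f0 n X = int_functional T f0 +
      ((\<Sum>i=1..n. score (X i)) / real n - (LBINT x:{0..1}. score x * f0 x))"
    unfolding efficient_centring_def score_def[symmetric] by (simp add: integral_density_law[OF score_measurable])
  have N: "bin_mean p (bin_count p n X) (score_bins p) = (\<Sum>i=1..n. score_bins p (bin_index p (X i)))"
    unfolding bin_mean_def by (rule sum_bin_count[OF p, symmetric])
  have ce: "centring_error p n X = sqrt (real n) * ((\<Sum>i=1..n. score_bins p (bin_index p (X i))) / real n - (\<Sum>i=1..n. score (X i)) / real n)"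
  proof -
    have "y / sqrt (real n) = sqrt (real n) * (y / real n)" for y
    proof -
      have "r * (y / (r * r)) = y / r" if "r > 0" for r :: real using that by simp
      from this[of "sqrt (real n)"] show ?thesis using n by simp
    qed
    then show ?thesis unfolding centring_error_def sum_subtractf by (simp only: right_diff_distrib diff_divide_distrib)
  qed
  have "sqrt (real n) * (int_functional T f - efficient_centring T T' f0 n X)
      - sqrt (real n) * (bin_mean p w (score_bins p) - bin_mean p (bin_count p n X) (score_bins p) / real n)
    = centring_error p n X + sqrt (real n) * (LBINT x:{0..1}. R x)"
    unfolding Reqn cent N ce by (simp add: algebra_simps)
  moreover have "\<bar>sqrt (real n) * (LBINT x:{0..1}. R x)\<bar> \<le> sqrt (real n) * (C * (2 * real p * bin_distance p w + 2 * \<epsilon>\<^sup>2))"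
    unfolding abs_mult using RB by (simp add: mult_left_mono)
  ultimately show ?thesis unfolding \<epsilon>_def by linarith
qed

section \<open>The histogram variance and the efficient variance\<close>

lemma score_sq_integrable: "set_integrable lborel {0..1} (\<lambda>x. (score x)\<^sup>2)"
  by (rule borel_integrable_atLeastAtMost') (intro continuous_intros score_continuous)

lemma efficient_variance_eq:
  "efficient_variance T' f0 = (LBINT x:{0..1}. (score x)\<^sup>2 * f0 x) - (LBINT x:{0..1}. score x * f0 x)\<^sup>2"
proof -
  define m where "m = (LBINT x:{0..1}. score x * f0 x)"
  have 1: "set_integrable lborel {0..1} (\<lambda>x. (score x)\<^sup>2 * f0 x)" "set_integrable lborel {0..1} (\<lambda>x. score x * f0 x)"
    by (intro set_integrable_mult_f0 score_sq_integrable set_integrable_score)+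
  have "efficient_variance T' f0 = (LBINT x:{0..1}. (score x - m)\<^sup>2 * f0 x)"
    unfolding efficient_variance_def m_def score_def ..
  also have "\<dots> = (LBINT x:{0..1}. ((score x)\<^sup>2 * f0 x - 2 * m * (score x * f0 x)) + m\<^sup>2 * f0 x)"
    by (simp add: power2_eq_square algebra_simps)
  also have "\<dots> = (LBINT x:{0..1}. (score x)\<^sup>2 * f0 x) - 2 * m * m + m\<^sup>2 * 1"
  proof -
    have i: "set_integrable lborel {0..1} (\<lambda>x. 2 * m * (score x * f0 x))" "set_integrable lborel {0..1} (\<lambda>x. m\<^sup>2 * f0 x)"
      using 1(2) set_integrable_f0 by (auto intro!: set_integrable_mult_right)
    show ?thesis
      by (subst set_integral_add(2)[OF set_integral_diff(1)[OF 1(1) i(1)] i(2)],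
          subst set_integral_diff(2)[OF 1(1) i(1)])
         (simp only: set_integral_mult_right m_def[symmetric] f0_int)
  qed
  finally show ?thesis unfolding m_def by (simp add: power2_eq_square)
qed

text \<open>Of the factor 3, one \<open>C^2\<close> comes from the mean of squares and two from the
  square of the mean. In the factor 4, each of these contributes \<open>2 * C\<close> when bin
  averages of the score replace the score itself.\<close>

lemma variance_close:
  assumes p: "p > 0" and w: "bin_probability p w"
  shows "\<bar>bin_variance p w (score_bins p) - efficient_variance T' f0\<bar> \<le>
    3 * C\<^sup>2 * (\<Sum>\<mu>=1..p. \<bar>w \<mu> - true_bins p \<mu>\<bar>) + 4 * C * (score_holder * real p powr (- smoothness))"
proof -
  define D where "D = (\<Sum>\<mu>=1..p. \<bar>w \<mu> - true_bins p \<mu>\<bar>)"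
  define \<epsilon> where "\<epsilon> = score_holder * real p powr (- smoothness)"
  have w0: "bin_probability p (true_bins p)" by (rule bin_probability_true_bins[OF p])
  have diff: "\<bar>bin_mean p w h - bin_mean p (true_bins p) h\<bar> \<le> B * D" if "\<And>\<mu>. \<mu> \<in> {1..p} \<Longrightarrow> \<bar>h \<mu>\<bar> \<le> B" for h B
  proof -
    have "\<bar>bin_mean p w h - bin_mean p (true_bins p) h\<bar> = \<bar>\<Sum>\<mu>=1..p. (w \<mu> - true_bins p \<mu>) * h \<mu>\<bar>"
      by (simp add: bin_mean_def sum_subtractf left_diff_distrib)
    also have "\<dots> \<le> (\<Sum>\<mu>=1..p. \<bar>(w \<mu> - true_bins p \<mu>) * h \<mu>\<bar>)" by (rule sum_abs)
    also have "\<dots> \<le> (\<Sum>\<mu>=1..p. B * \<bar>w \<mu> - true_bins p \<mu>\<bar>)"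
      using that by (intro sum_mono) (simp add: abs_mult mult.commute mult_right_mono)
    finally show ?thesis by (simp add: D_def sum_distrib_left)
  qed
  have sqb: "\<bar>(score_bins p \<mu>)\<^sup>2\<bar> \<le> C\<^sup>2" if "\<mu> \<in> {1..p}" for \<mu>
    using power_mono[OF score_average_bound[OF p that] abs_ge_zero, of 2] by simp
  have sq: "\<bar>x\<^sup>2 - y\<^sup>2\<bar> \<le> 2 * C * \<bar>x - y\<bar>" if "\<bar>x\<bar> \<le> C" "\<bar>y\<bar> \<le> C" for x y :: real
  proof -
    have "x\<^sup>2 - y\<^sup>2 = (x + y) * (x - y)" by (simp add: power2_eq_square algebra_simps)
    then have "\<bar>x\<^sup>2 - y\<^sup>2\<bar> = \<bar>x + y\<bar> * \<bar>x - y\<bar>" by (simp add: abs_mult)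
    also have "\<dots> \<le> 2 * C * \<bar>x - y\<bar>" using that by (intro mult_right_mono) linarith+
    finally show ?thesis .
  qed
  define a1 b1 a0 b0 where "a1 = bin_mean p w (\<lambda>\<mu>. (score_bins p \<mu>)\<^sup>2)" and "b1 = bin_mean p w (score_bins p)"
    and "a0 = bin_mean p (true_bins p) (\<lambda>\<mu>. (score_bins p \<mu>)\<^sup>2)" and "b0 = bin_mean p (true_bins p) (score_bins p)"
  define a b where "a = (LBINT x:{0..1}. (score x)\<^sup>2 * f0 x)" and "b = (LBINT x:{0..1}. score x * f0 x)"
  have 1: "\<bar>a1 - a0\<bar> \<le> C\<^sup>2 * D" unfolding a1_def a0_def by (rule diff[OF sqb])
  have "\<bar>b1 - b0\<bar> \<le> C * D" unfolding b1_def b0_def by (rule diff[OF score_average_bound[OF p]])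
  moreover have bb: "\<bar>b1\<bar> \<le> C" "\<bar>b0\<bar> \<le> C"
    unfolding b1_def b0_def by (rule bin_mean_abs_le[OF w score_average_bound[OF p]] bin_mean_abs_le[OF w0 score_average_bound[OF p]]; assumption)+
  ultimately have 2: "\<bar>b1\<^sup>2 - b0\<^sup>2\<bar> \<le> 2 * C * (C * D)"
    using sq[OF bb] C by (meson mult_left_mono order_trans less_imp_le mult_pos_pos zero_less_numeral)
  have smooth: "\<bar>bin_mean p (true_bins p) k - (LBINT x:{0..1}. h x * f0 x)\<bar> \<le> B"
    if h: "set_integrable lborel {0..1} h" and B: "\<And>x. x \<in> {0..1} \<Longrightarrow> \<bar>k (bin_index p x) - h x\<bar> \<le> B" for h k B
  proof -
    have k: "set_integrable lborel {0..1} (\<lambda>x. k (bin_index p x) * f0 x)"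
      "(LBINT x:{0..1}. k (bin_index p x) * f0 x) = bin_mean p (true_bins p) k"
      using integral_step_times[OF p set_integrable_f0, of k] by (simp_all add: bin_mean_def true_bins_def mult.commute)
    note hf = set_integrable_mult_f0[OF h]
    have "bin_mean p (true_bins p) k - (LBINT x:{0..1}. h x * f0 x) = (LBINT x:{0..1}. k (bin_index p x) * f0 x - h x * f0 x)"
      using k hf by (simp add: set_integral_diff)
    then have "\<bar>bin_mean p (true_bins p) k - (LBINT x:{0..1}. h x * f0 x)\<bar> \<le> (LBINT x:{0..1}. \<bar>k (bin_index p x) * f0 x - h x * f0 x\<bar>)"
      using set_integral_norm_bound[OF set_integral_diff(1)[OF k(1) hf]] by simp
    also have "\<dots> \<le> (LBINT x:{0..1}. B * f0 x)"
    proof (rule set_integral_mono)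
      show "set_integrable lborel {0..1} (\<lambda>x. \<bar>k (bin_index p x) * f0 x - h x * f0 x\<bar>)"
        by (intro set_integrable_abs set_integral_diff k hf)
      show "set_integrable lborel {0..1} (\<lambda>x. B * f0 x)" using set_integrable_f0 by (auto intro!: set_integrable_mult_right)
      fix x :: real assume x: "x \<in> {0..1}"
      have "f0 x \<ge> 0" using c_lo(2)[OF x] c_lo(1) by simp
      then show "\<bar>k (bin_index p x) * f0 x - h x * f0 x\<bar> \<le> B * f0 x"
        using mult_right_mono[OF B[OF x], of "f0 x"] by (simp add: left_diff_distrib[symmetric] abs_mult)
    qed
    also have "\<dots> = B" using f0_int by simp
    finally show ?thesis .
  qed
  have 3: "\<bar>b0 - b\<bar> \<le> \<epsilon>"
    unfolding b0_def b_def \<epsilon>_def by (rule smooth[OF set_integrable_score score_bin_close[OF p]])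
  have "\<bar>b\<bar> \<le> C"
  proof -
    have "\<bar>b\<bar> \<le> (LBINT x:{0..1}. \<bar>score x * f0 x\<bar>)"
      unfolding b_def using set_integral_norm_bound[OF set_integrable_mult_f0[OF set_integrable_score]] by simp
    also have "\<dots> \<le> (LBINT x:{0..1}. C * f0 x)"
    proof (rule set_integral_mono)
      show "set_integrable lborel {0..1} (\<lambda>x. \<bar>score x * f0 x\<bar>)"
        by (intro set_integrable_abs set_integrable_mult_f0 set_integrable_score)
      show "set_integrable lborel {0..1} (\<lambda>x. C * f0 x)" using set_integrable_f0 by (auto intro!: set_integrable_mult_right)
      fix x :: real assume x: "x \<in> {0..1}"
      have "f0 x \<ge> 0" using c_lo(2)[OF x] c_lo(1) by simp
      then show "\<bar>score x * f0 x\<bar> \<le> C * f0 x"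
        using mult_right_mono[OF score_bound[OF x], of "f0 x"] by (simp add: abs_mult)
    qed
    also have "\<dots> = C" using f0_int by simp
    finally show ?thesis .
  qed
  then have 4: "\<bar>b0\<^sup>2 - b\<^sup>2\<bar> \<le> 2 * C * \<epsilon>"
    using sq[OF bb(2)] 3 C by (meson mult_left_mono order_trans less_imp_le mult_pos_pos zero_less_numeral)
  have 5: "\<bar>a0 - a\<bar> \<le> 2 * C * \<epsilon>"
    unfolding a0_def a_def
  proof (rule smooth[OF score_sq_integrable])
    fix x :: real assume x: "x \<in> {0..1}"
    have "\<bar>(score_bins p (bin_index p x))\<^sup>2 - (score x)\<^sup>2\<bar> \<le> 2 * C * \<bar>score_bins p (bin_index p x) - score x\<bar>"
      by (rule sq[OF score_average_bound[OF p bin_index_range[OF p]] score_bound[OF x]])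
    also have "\<dots> \<le> 2 * C * \<epsilon>" unfolding \<epsilon>_def using score_bin_close[OF p x] C by (intro mult_left_mono) auto
    finally show "\<bar>(score_bins p (bin_index p x))\<^sup>2 - (score x)\<^sup>2\<bar> \<le> 2 * C * \<epsilon>" .
  qed
  have "bin_variance p w (score_bins p) - efficient_variance T' f0 = (a1 - a0) - (b1\<^sup>2 - b0\<^sup>2) + (a0 - a) - (b0\<^sup>2 - b\<^sup>2)"
    unfolding bin_variance_def efficient_variance_eq a1_def a0_def b1_def b0_def a_def b_def by simp
  then have "\<bar>bin_variance p w (score_bins p) - efficient_variance T' f0\<bar> \<le> C\<^sup>2 * D + 2 * C * (C * D) + 2 * C * \<epsilon> + 2 * C * \<epsilon>"
    using 1 2 4 5 by linarith
  also have "\<dots> = 3 * C\<^sup>2 * D + 4 * C * \<epsilon>" by (simp add: power2_eq_square algebra_simps)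
  finally show ?thesis unfolding D_def \<epsilon>_def .
qed

text \<open>For a fixed test function the error is that of replacing the functional by its
  linearisation \<open>W\<close>, plus that of the normal approximation of \<open>W\<close>. Apart
  from the prior term, both are controlled by affine functions of the squared distance
  \<open>V\<close>, whose posterior mean is at most \<open>U\<close>. In \<open>U\<close>, the part
  \<open>2 * (2 + K)\<close> stems from the posterior around the empirical frequencies, the rest
  from the frequencies around the truth.\<close>

lemma d_BL_posterior_bound:
  fixes \<omega> :: "'a \<Rightarrow> nat \<Rightarrow> real"
  assumes M: "prob_space M"
    and \<omega>m: "\<And>\<mu>. \<mu> \<in> {1..p} \<Longrightarrow> (\<lambda>\<theta>. \<omega> \<theta> \<mu>) \<in> borel_measurable M"
    and \<omega>: "\<And>\<theta>. \<theta> \<in> space M \<Longrightarrow> bin_probability p (\<omega> \<theta>)"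
    and dens: "AE \<theta> in M. \<forall>x\<in>{0..1}. dens \<theta> x = real p * \<omega> \<theta> (bin_index p x)"
    and Zm: "(\<lambda>\<theta>. int_functional T (dens \<theta>)) \<in> borel_measurable M"
    and n: "n > 0" and p: "p > 0" and X: "\<And>i. i \<in> {1..n} \<Longrightarrow> X i \<in> {0..1}"
    and si1: "\<And>\<mu>. \<mu> \<in> {1..p} \<Longrightarrow> score_identity M p \<omega> (bin_count p n X) (\<lambda>\<nu>. if \<nu> = \<mu> then 1 else 0) (b1 \<mu>)"
    and b1: "\<And>\<theta>. \<theta> \<in> space M \<Longrightarrow> (\<Sum>\<mu>=1..p. (b1 \<mu> \<theta>)\<^sup>2) \<le> K * real n"
    and si2: "score_identity M p \<omega> (bin_count p n X) (score_bins p) b2"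
    and b2: "\<And>\<theta>. \<theta> \<in> space M \<Longrightarrow> \<bar>b2 \<theta>\<bar> \<le> B"
    and bias: "L0 * real p powr (- s) \<le> \<eta> / 2" and \<delta>: "\<delta> > 0"
    and v: "v = efficient_variance T' f0" "v > 0"
  defines "U \<equiv> (4 + 2 * K + 2 * (real n * bin_distance p (\<lambda>\<mu>. bin_count p n X \<mu> / real n))) / real n"
  shows "\<bar>d_BL (distr M borel (\<lambda>\<theta>. sqrt (real n) * (int_functional T (dens \<theta>) - efficient_centring T T' f0 n X))) (normal_law 0 v)\<bar> \<le>
    (8 * (real p)\<^sup>2 / \<eta>\<^sup>2 + sqrt (real n) * (C * (2 * real p))) * U + \<bar>centring_error p n X\<bar>
    + sqrt (real n) * (C * (2 * (L0 * real p powr (- s))\<^sup>2))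
    + 4 / v * (3 * C\<^sup>2 * (\<delta> / 2 + real p * U / (2 * \<delta>)) + 4 * C * (score_holder * real p powr (- smoothness)))
    + 2 * sqrt (2 * pi * v) / v * (B / sqrt (real n))"
proof (rule d_BL_le)
  fix h :: "real \<Rightarrow> real" assume h: "\<And>x. \<bar>h x\<bar> \<le> 1" and hL: "\<And>x y. \<bar>h x - h y\<bar> \<le> \<bar>x - y\<bar>"
  interpret prob_space M by fact
  define N where "N = bin_count p n X"
  define Q where "Q = \<bar>centring_error p n X\<bar>"
  define e2 where "e2 = (L0 * real p powr (- s))\<^sup>2"
  define V where "V \<theta> = bin_distance p (\<omega> \<theta>)" for \<theta>
  define Z where "Z \<theta> = sqrt (real n) * (int_functional T (dens \<theta>) - efficient_centring T T' f0 n X)" for \<theta>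
  define W where "W \<theta> = sqrt (real n) * (bin_mean p (\<omega> \<theta>) (score_bins p) - bin_mean p N (score_bins p) / real n)" for \<theta>
  have hc: "continuous_on UNIV h"
    unfolding continuous_on_iff dist_real_def using hL by (meson order_le_less_trans)
  have hm: "h \<in> borel_measurable borel" using hc by (rule borel_measurable_continuous_onI)
  have Zm': "Z \<in> borel_measurable M" unfolding Z_def using Zm by measurable
  have Wm: "W \<in> borel_measurable M"
    unfolding W_def bin_mean_def
    by (intro borel_measurable_times borel_measurable_diff borel_measurable_sum borel_measurable_const \<omega>m)
  have Vm: "V \<in> borel_measurable M"
    unfolding V_def bin_distance_def
    by (intro borel_measurable_sum borel_measurable_power borel_measurable_diff borel_measurable_const \<omega>m)
  have w01: "0 \<le> \<omega> \<theta> \<mu> \<and> \<omega> \<theta> \<mu> \<le> 1" if "\<theta> \<in> space M" "\<mu> \<in> {1..p}" for \<theta> \<mu>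
    using \<omega>[OF that(1)] bin_probability_le_one[OF \<omega>[OF that(1)] that(2)] that(2) by (auto simp: bin_probability_def less_imp_le)
  have t01: "0 \<le> true_bins p \<mu> \<and> true_bins p \<mu> \<le> 1" if "\<mu> \<in> {1..p}" for \<mu>
    using bin_probability_true_bins[OF p] bin_probability_le_one[OF bin_probability_true_bins[OF p] that] that
    by (auto simp: bin_probability_def less_imp_le)
  have V0: "V \<theta> \<ge> 0" for \<theta> unfolding V_def bin_distance_def by (intro sum_nonneg) auto
  have VI: "integrable M V"
    unfolding V_def bin_distance_def
  proof (intro Bochner_Integration.integrable_sum integrable_bounded[OF M, where B = 1])
    fix \<mu> assume \<mu>: "\<mu> \<in> {1..p}"
    show "(\<lambda>\<theta>. (\<omega> \<theta> \<mu> - true_bins p \<mu>)\<^sup>2) \<in> borel_measurable M"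
      by (intro borel_measurable_power borel_measurable_diff borel_measurable_const \<omega>m \<mu>)
    fix \<theta> assume "\<theta> \<in> space M"
    then have "\<bar>\<omega> \<theta> \<mu> - true_bins p \<mu>\<bar> \<le> 1" using w01[of \<theta> \<mu>] t01[OF \<mu>] \<mu> by (simp add: abs_le_iff)
    from power_le_one[OF abs_ge_zero this, of 2] show "\<bar>(\<omega> \<theta> \<mu> - true_bins p \<mu>)\<^sup>2\<bar> \<le> 1" by simp
  qed
  have EV: "(\<integral>\<theta>. V \<theta> \<partial>M) \<le> U"
  proof -
    define F where "F \<theta> = (\<Sum>\<mu>=1..p. (\<omega> \<theta> \<mu> - N \<mu> / real n)\<^sup>2)" for \<theta>
    have NI: "\<bar>N \<mu> / real n\<bar> \<le> 1" if "\<mu> \<in> {1..p}" for \<mu>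
      using member_le_sum[of \<mu> "{1..p}" N] that bin_count_nonneg[of p n X] bin_count_total[OF p, of n X] n
      unfolding N_def by simp
    have FI: "integrable M F"
      unfolding F_def
    proof (intro Bochner_Integration.integrable_sum integrable_bounded[OF M, where B = 4])
      fix \<mu> assume \<mu>: "\<mu> \<in> {1..p}"
      show "(\<lambda>\<theta>. (\<omega> \<theta> \<mu> - N \<mu> / real n)\<^sup>2) \<in> borel_measurable M"
        by (intro borel_measurable_power borel_measurable_diff borel_measurable_const \<omega>m \<mu>)
      fix \<theta> assume "\<theta> \<in> space M"
      then have "\<bar>\<omega> \<theta> \<mu> - N \<mu> / real n\<bar> \<le> 2"
        using w01[of \<theta> \<mu>] NI[OF \<mu>] \<mu> abs_triangle_ineq4[of "\<omega> \<theta> \<mu>" "N \<mu> / real n"] by linarith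
      from power_mono[OF this abs_ge_zero, of 2] show "\<bar>(\<omega> \<theta> \<mu> - N \<mu> / real n)\<^sup>2\<bar> \<le> 4" by simp
    qed
    have "(\<integral>\<theta>. F \<theta> \<partial>M) \<le> (2 + K) / real n"
      unfolding F_def
    proof (rule posterior_second_moment[OF M \<omega>m \<omega>])
      show "(\<Sum>\<mu>=1..p. N \<mu>) = real n" unfolding N_def by (rule bin_count_total[OF p])
      show "N \<mu> \<ge> 0" for \<mu> unfolding N_def by (rule bin_count_nonneg)
    qed (use n si1 b1 in \<open>simp_all add: N_def\<close>)
    have "V \<theta> \<le> 2 * F \<theta> + 2 * bin_distance p (\<lambda>\<mu>. N \<mu> / real n)" for \<theta>
    proof -
      have "V \<theta> \<le> (\<Sum>\<mu>=1..p. 2 * (\<omega> \<theta> \<mu> - N \<mu> / real n)\<^sup>2 + 2 * (N \<mu> / real n - true_bins p \<mu>)\<^sup>2)"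
        unfolding V_def bin_distance_def
      proof (rule sum_mono)
        fix \<mu>
        show "(\<omega> \<theta> \<mu> - true_bins p \<mu>)\<^sup>2 \<le> 2 * (\<omega> \<theta> \<mu> - N \<mu> / real n)\<^sup>2 + 2 * (N \<mu> / real n - true_bins p \<mu>)\<^sup>2"
          using two_square_bound[of "\<omega> \<theta> \<mu> - N \<mu> / real n" "N \<mu> / real n - true_bins p \<mu>"] by simp
      qed
      then show ?thesis unfolding F_def bin_distance_def by (simp add: sum.distrib sum_distrib_left)
    qed
    then have "(\<integral>\<theta>. V \<theta> \<partial>M) \<le> (\<integral>\<theta>. 2 * F \<theta> + 2 * bin_distance p (\<lambda>\<mu>. N \<mu> / real n) \<partial>M)"
      using VI FI by (intro integral_mono) auto
    also have "\<dots> = 2 * (\<integral>\<theta>. F \<theta> \<partial>M) + 2 * bin_distance p (\<lambda>\<mu>. N \<mu> / real n)"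
      using FI by (simp add: prob_space)
    also have "\<dots> \<le> 2 * ((2 + K) / real n) + 2 * bin_distance p (\<lambda>\<mu>. N \<mu> / real n)"
      using \<open>(\<integral>\<theta>. F \<theta> \<partial>M) \<le> (2 + K) / real n\<close>
      by (intro add_right_mono mult_left_mono) auto
    also have "\<dots> = U" using n unfolding U_def N_def[symmetric] by (simp add: field_simps)
    finally show ?thesis .
  qed
  have hZ: "integrable M (\<lambda>\<theta>. h (Z \<theta>))" "integrable M (\<lambda>\<theta>. h (W \<theta>))"
    using measurable_compose[OF Zm' hm] measurable_compose[OF Wm hm] h by (auto intro: integrable_bounded[OF M])
  \<comment> \<open>If some bin probability deviates by \<open>\<eta> / (2 * p)\<close> or more,
    then \<open>V\<close> is at least \<open>\<eta>^2 / (4 * p^2)\<close> and \<open>k1 * V\<close>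
    at least 2, the trivial bound for a difference of two values of \<open>h\<close>.\<close>
  define k1 where "k1 = 8 * (real p)\<^sup>2 / \<eta>\<^sup>2"
  define k2 where "k2 = sqrt (real n) * (C * (2 * real p))"
  define k3 where "k3 = Q + sqrt (real n) * (C * (2 * e2))"
  have k: "k1 \<ge> 0" "k2 \<ge> 0" "k3 \<ge> 0" using C by (auto simp: k1_def k2_def k3_def Q_def e2_def)
  have pt: "\<bar>h (Z \<theta>) - h (W \<theta>)\<bar> \<le> (k1 + k2) * V \<theta> + k3"
    if f: "\<forall>x\<in>{0..1}. dens \<theta> x = real p * \<omega> \<theta> (bin_index p x)" for \<theta>
  proof (cases "\<forall>\<mu>\<in>{1..p}. real p * \<bar>\<omega> \<theta> \<mu> - true_bins p \<mu>\<bar> < \<eta> / 2")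
    case True
    have "\<bar>Z \<theta> - W \<theta>\<bar> \<le> Q + sqrt (real n) * (C * (2 * real p * V \<theta> + 2 * e2))"
      unfolding Z_def W_def Q_def V_def e2_def N_def
      by (rule functional_expansion[OF p n X _ bias]) (use f True in auto)
    also have "\<dots> = k2 * V \<theta> + k3" unfolding k2_def k3_def by (simp add: algebra_simps)
    finally have "\<bar>h (Z \<theta>) - h (W \<theta>)\<bar> \<le> k2 * V \<theta> + k3" using hL[of "Z \<theta>" "W \<theta>"] by linarith
    moreover have "0 \<le> k1 * V \<theta>" using k V0 by simp
    ultimately show ?thesis by (simp add: distrib_right)
  next
    case False
    then obtain \<mu> where \<mu>: "\<mu> \<in> {1..p}" "\<eta> / 2 \<le> real p * \<bar>\<omega> \<theta> \<mu> - true_bins p \<mu>\<bar>" by (auto simp: not_less)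
    have "(\<eta> / 2)\<^sup>2 \<le> (real p * \<bar>\<omega> \<theta> \<mu> - true_bins p \<mu>\<bar>)\<^sup>2" using \<mu>(2) \<eta> by (intro power_mono) auto
    also have "\<dots> = (real p)\<^sup>2 * (\<omega> \<theta> \<mu> - true_bins p \<mu>)\<^sup>2" by (simp add: power_mult_distrib)
    also have "\<dots> \<le> (real p)\<^sup>2 * V \<theta>"
      unfolding V_def bin_distance_def using \<mu>(1) by (intro mult_left_mono member_le_sum) auto
    finally have "\<eta>\<^sup>2 \<le> 4 * (real p)\<^sup>2 * V \<theta>" by (simp add: power_divide)
    then have "2 \<le> k1 * V \<theta>" using \<eta> unfolding k1_def by (simp add: field_simps)
    moreover have "\<bar>h (Z \<theta>) - h (W \<theta>)\<bar> \<le> 2" using h[of "Z \<theta>"] h[of "W \<theta>"] by linarith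
    moreover have "0 \<le> k2 * V \<theta>" using k V0 by simp
    ultimately show ?thesis using k(3) unfolding distrib_right by linarith
  qed
  have 1: "\<bar>(\<integral>\<theta>. h (Z \<theta>) \<partial>M) - (\<integral>\<theta>. h (W \<theta>) \<partial>M)\<bar> \<le> (k1 + k2) * U + k3"
  proof -
    have "\<bar>(\<integral>\<theta>. h (Z \<theta>) \<partial>M) - (\<integral>\<theta>. h (W \<theta>) \<partial>M)\<bar> = \<bar>\<integral>\<theta>. h (Z \<theta>) - h (W \<theta>) \<partial>M\<bar>" using hZ by simp
    also have "\<dots> \<le> (\<integral>\<theta>. \<bar>h (Z \<theta>) - h (W \<theta>)\<bar> \<partial>M)" by (rule integral_abs_bound)
    also have "\<dots> \<le> (\<integral>\<theta>. (k1 + k2) * V \<theta> + k3 \<partial>M)"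
      using hZ VI dens pt by (intro integral_mono_AE) auto
    also have "\<dots> = (k1 + k2) * (\<integral>\<theta>. V \<theta> \<partial>M) + k3" using VI by (simp add: prob_space)
    also have "\<dots> \<le> (k1 + k2) * U + k3" using EV k by (intro add_right_mono mult_left_mono) auto
    finally show ?thesis .
  qed
  have 2: "\<bar>(\<integral>\<theta>. h (W \<theta>) \<partial>M) - (\<integral>x. h x \<partial>normal_law 0 v)\<bar> \<le>
    4 / v * (\<integral>\<theta>. \<bar>bin_variance p (\<omega> \<theta>) (score_bins p) - v\<bar> \<partial>M) + 2 * sqrt (2 * pi * v) / v * (B / sqrt (real n))"
    unfolding W_def
  proof (rule stein_bound[OF M \<omega>m \<omega> _ _ _ b2 v(2) h hc])
    show "(\<Sum>\<mu>=1..p. N \<mu>) = real n" unfolding N_def by (rule bin_count_total[OF p])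
    show "score_identity M p \<omega> N (score_bins p) b2" unfolding N_def by (rule si2)
  qed (use n in simp_all)
  define k4 where "k4 = 4 * C * (score_holder * real p powr (- smoothness))"
  have 3: "(\<integral>\<theta>. \<bar>bin_variance p (\<omega> \<theta>) (score_bins p) - v\<bar> \<partial>M) \<le> 3 * C\<^sup>2 * (\<delta> / 2 + real p * U / (2 * \<delta>)) + k4"
  proof -
    have ptv: "\<bar>bin_variance p (\<omega> \<theta>) (score_bins p) - v\<bar> \<le> 3 * C\<^sup>2 * (\<delta> / 2 + real p * V \<theta> / (2 * \<delta>)) + k4"
      if "\<theta> \<in> space M" for \<theta>
    proof -
      have "\<bar>bin_variance p (\<omega> \<theta>) (score_bins p) - v\<bar> \<le> 3 * C\<^sup>2 * (\<Sum>\<mu>=1..p. \<bar>\<omega> \<theta> \<mu> - true_bins p \<mu>\<bar>) + k4"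
        unfolding v(1) k4_def by (rule variance_close[OF p \<omega>[OF that]])
      also have "\<dots> \<le> 3 * C\<^sup>2 * (\<delta> / 2 + real p * V \<theta> / (2 * \<delta>)) + k4"
        unfolding V_def bin_distance_def
        by (intro add_right_mono mult_left_mono sum_abs_le_sum_squares[OF \<delta> p]) simp
      finally show ?thesis .
    qed
    have bm: "(\<lambda>\<theta>. \<bar>bin_variance p (\<omega> \<theta>) (score_bins p) - v\<bar>) \<in> borel_measurable M"
      unfolding bin_variance_def bin_mean_def
      by (intro borel_measurable_abs borel_measurable_diff borel_measurable_power borel_measurable_sum borel_measurable_times borel_measurable_const \<omega>m)
    have rI: "integrable M (\<lambda>\<theta>. 3 * C\<^sup>2 * (\<delta> / 2 + real p * V \<theta> / (2 * \<delta>)) + k4)"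
      using VI by auto
    have "(\<integral>\<theta>. \<bar>bin_variance p (\<omega> \<theta>) (score_bins p) - v\<bar> \<partial>M) \<le> (\<integral>\<theta>. 3 * C\<^sup>2 * (\<delta> / 2 + real p * V \<theta> / (2 * \<delta>)) + k4 \<partial>M)"
    proof (rule integral_mono[OF _ rI ptv])
      show "integrable M (\<lambda>\<theta>. \<bar>bin_variance p (\<omega> \<theta>) (score_bins p) - v\<bar>)"
        by (rule Bochner_Integration.integrable_bound[OF rI bm]) (use ptv in \<open>auto intro!: AE_I2 order_trans[OF _ abs_ge_self]\<close>)
    qed
    also have "\<dots> = 3 * C\<^sup>2 * (\<delta> / 2 + real p * (\<integral>\<theta>. V \<theta> \<partial>M) / (2 * \<delta>)) + k4"
      using VI by (simp add: prob_space)
    also have "\<dots> \<le> 3 * C\<^sup>2 * (\<delta> / 2 + real p * U / (2 * \<delta>)) + k4"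
      using EV \<delta> by (intro add_right_mono mult_left_mono add_left_mono divide_right_mono) auto
    finally show ?thesis .
  qed
  have "4 / v * (\<integral>\<theta>. \<bar>bin_variance p (\<omega> \<theta>) (score_bins p) - v\<bar> \<partial>M) \<le> 4 / v * (3 * C\<^sup>2 * (\<delta> / 2 + real p * U / (2 * \<delta>)) + k4)"
    using 3 v by (intro mult_left_mono) auto
  with 1 2 have "\<bar>(\<integral>\<theta>. h (Z \<theta>) \<partial>M) - (\<integral>x. h x \<partial>normal_law 0 v)\<bar> \<le> (k1 + k2) * U + k3
      + 4 / v * (3 * C\<^sup>2 * (\<delta> / 2 + real p * U / (2 * \<delta>)) + k4) + 2 * sqrt (2 * pi * v) / v * (B / sqrt (real n))"
    by linarith
  moreover have "(\<integral>x. h x \<partial>distr M borel Z) = (\<integral>\<theta>. h (Z \<theta>) \<partial>M)"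
    by (rule integral_distr[OF Zm' hm])
  ultimately show "\<bar>(\<integral>x. h x \<partial>distr M borel (\<lambda>\<theta>. sqrt (real n) * (int_functional T (dens \<theta>) - efficient_centring T T' f0 n X))) - (\<integral>x. h x \<partial>normal_law 0 v)\<bar> \<le>
    (8 * (real p)\<^sup>2 / \<eta>\<^sup>2 + sqrt (real n) * (C * (2 * real p))) * U + \<bar>centring_error p n X\<bar>
    + sqrt (real n) * (C * (2 * (L0 * real p powr (- s))\<^sup>2))
    + 4 / v * (3 * C\<^sup>2 * (\<delta> / 2 + real p * U / (2 * \<delta>)) + 4 * C * (score_holder * real p powr (- smoothness)))
    + 2 * sqrt (2 * pi * v) / v * (B / sqrt (real n))"
    unfolding Z_def k1_def k2_def k3_def k4_def Q_def e2_def by linarith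
qed

section \<open>Second moments of the data under the true density\<close>

lemma prob_space_density_law: "prob_space (density_law f0)"
proof
  have f0m: "f0 \<in> borel_measurable (restrict_space lborel {0..1})"
    using set_integrable_f0 unfolding set_integrable_def by (subst borel_measurable_restrict_space_iff) auto
  have "emeasure (density_law f0) (space (density_law f0)) = (\<integral>\<^sup>+x. ennreal (f0 x) \<partial>restrict_space lborel {0..1})"
    unfolding density_law_def using f0m sets.top[of "restrict_space lborel {0..1::real}"]
    by (subst emeasure_density) (auto intro!: nn_integral_cong simp: space_restrict_space)
  also have "\<dots> = (\<integral>\<^sup>+x. ennreal (indicat_real {0..1} x *\<^sub>R f0 x) \<partial>lborel)"
    by (subst nn_integral_restrict_space) (auto intro!: nn_integral_cong simp: indicator_def)
  also have "\<dots> = ennreal (LBINT x:{0..1}. f0 x)"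
    unfolding set_lebesgue_integral_def using set_integrable_f0 c_lo unfolding set_integrable_def
    by (intro nn_integral_eq_integral) (auto simp: indicator_def intro!: AE_I2 order_trans[OF less_imp_le[OF c_lo(1)] c_lo(2)])
  finally show "emeasure (density_law f0) (space (density_law f0)) = 1" using f0_int by simp
qed

lemma space_density_law: "space (density_law f0) = {0..1}"
  by (simp add: density_law_def space_restrict_space)

lemma measurable_density_law: "borel_measurable (density_law f0) = borel_measurable (restrict_space lborel {0..1})"
  unfolding density_law_def by (rule measurable_cong_sets) auto

lemma prob_space_sample_law: "prob_space (sample_law f0 n)"
  unfolding sample_law_def by (intro prob_space_PiM prob_space_density_law)

lemma space_sample_law: "X \<in> space (sample_law f0 n) \<Longrightarrow> i \<in> {1..n} \<Longrightarrow> X i \<in> {0..1}"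
  unfolding sample_law_def space_PiM using space_density_law by auto

lemma step_measurable:
  fixes c :: "nat \<Rightarrow> real"
  assumes "p > 0"
  shows "(\<lambda>x. c (bin_index p x)) \<in> borel_measurable (density_law f0)"
  unfolding measurable_density_law using step_function_integral(1)[OF assms, of c] unfolding set_integrable_def
  by (subst borel_measurable_restrict_space_iff) auto

lemma integral_step_density_law:
  fixes c :: "nat \<Rightarrow> real"
  assumes p: "p > 0"
  shows "(\<integral>x. c (bin_index p x) \<partial>density_law f0) = bin_mean p (true_bins p) c"
  using integral_density_law[OF step_measurable[OF p, unfolded measurable_density_law]] integral_step_times(1)[OF p set_integrable_f0]
  by (simp add: bin_mean_def true_bins_def mult.commute)

text \<open>The counts are sums of independent indicators, so the expectation is the sum over bins
  of the Bernoulli variances, each at most the bin probability. This is why the bound 1 is free of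
  \<open>p\<close>.\<close>

lemma expectation_empirical_distance:
  assumes p: "p > 0" and n: "n > 0"
  shows "integrable (sample_law f0 n) (\<lambda>X. real n * bin_distance p (\<lambda>\<mu>. bin_count p n X \<mu> / real n))"
    and "(\<integral>X. real n * bin_distance p (\<lambda>\<mu>. bin_count p n X \<mu> / real n) \<partial>sample_law f0 n) \<le> 1"
proof -
  let ?P = "sample_law f0 n"
  interpret D: prob_space "density_law f0" by (rule prob_space_density_law)
  define h where "h \<mu> x = (if bin_index p x = \<mu> then 1 else 0) - true_bins p \<mu>" for \<mu> x
  have w0: "bin_probability p (true_bins p)" by (rule bin_probability_true_bins[OF p])
  have t01: "0 \<le> true_bins p \<mu> \<and> true_bins p \<mu> \<le> 1" if "\<mu> \<in> {1..p}" for \<mu>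
    using w0 bin_probability_le_one[OF w0 that] that by (auto simp: bin_probability_def less_imp_le)
  have hm: "h \<mu> \<in> borel_measurable (density_law f0)" for \<mu>
    unfolding h_def by (rule step_measurable[OF p, of "\<lambda>\<nu>. (if \<nu> = \<mu> then 1 else 0) - true_bins p \<mu>"])
  have pick: "bin_mean p w (\<lambda>\<nu>. if \<nu> = \<mu> then a else b) = b * (\<Sum>\<nu>=1..p. w \<nu>) + (a - b) * w \<mu>" if "\<mu> \<in> {1..p}" for \<mu> w a b
  proof -
    have "bin_mean p w (\<lambda>\<nu>. if \<nu> = \<mu> then a else b) = (\<Sum>\<nu>=1..p. b * w \<nu> + (if \<nu> = \<mu> then (a - b) * w \<nu> else 0))"
      unfolding bin_mean_def by (intro sum.cong) (auto simp: algebra_simps)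
    then show ?thesis using that by (simp add: sum.distrib sum_distrib_left)
  qed
  have sum1: "(\<Sum>\<nu>=1..p. true_bins p \<nu>) = 1" using w0 by (simp add: bin_probability_def)
  have h0: "(\<integral>x. h \<mu> x \<partial>density_law f0) = 0" if \<mu>: "\<mu> \<in> {1..p}" for \<mu>
  proof -
    have "(\<integral>x. h \<mu> x \<partial>density_law f0) = bin_mean p (true_bins p) (\<lambda>\<nu>. if \<nu> = \<mu> then 1 - true_bins p \<mu> else - true_bins p \<mu>)"
      unfolding integral_step_density_law[OF p, symmetric] h_def by (intro Bochner_Integration.integral_cong) auto
    then show ?thesis unfolding pick[OF \<mu>] sum1 by simp
  qed
  have h2: "(\<integral>x. (h \<mu> x)\<^sup>2 \<partial>density_law f0) \<le> true_bins p \<mu>" if \<mu>: "\<mu> \<in> {1..p}" for \<mu>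
  proof -
    have "(\<integral>x. (h \<mu> x)\<^sup>2 \<partial>density_law f0) = bin_mean p (true_bins p) (\<lambda>\<nu>. if \<nu> = \<mu> then (1 - true_bins p \<mu>)\<^sup>2 else (true_bins p \<mu>)\<^sup>2)"
      unfolding integral_step_density_law[OF p, symmetric] h_def by (intro Bochner_Integration.integral_cong) auto
    also have "\<dots> = true_bins p \<mu> - (true_bins p \<mu>)\<^sup>2" unfolding pick[OF \<mu>] sum1 by (simp add: power2_eq_square algebra_simps)
    finally show ?thesis by simp
  qed
  have hb: "\<bar>h \<mu> x\<bar> \<le> 1" if "\<mu> \<in> {1..p}" for \<mu> x using t01[OF that] by (auto simp: h_def)
  have E: "(\<integral>X. (\<Sum>i\<in>{1..n}. h \<mu> (X i))\<^sup>2 \<partial>?P) = real n * (\<integral>x. (h \<mu> x)\<^sup>2 \<partial>density_law f0)"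
    and I: "integrable ?P (\<lambda>X. (\<Sum>i\<in>{1..n}. h \<mu> (X i))\<^sup>2)" if "\<mu> \<in> {1..p}" for \<mu>
    using expectation_square_sum_PiM[OF prob_space_density_law, of "{1..n}" "h \<mu>" 1] hm hb[OF that] h0[OF that]
    unfolding sample_law_def by auto
  have eq: "real n * bin_distance p (\<lambda>\<mu>. bin_count p n X \<mu> / real n) = (\<Sum>\<mu>=1..p. (\<Sum>i\<in>{1..n}. h \<mu> (X i))\<^sup>2) / real n" for X
  proof -
    have "(\<Sum>i=1..n. h \<mu> (X i)) = real n * (bin_count p n X \<mu> / real n - true_bins p \<mu>)" if "\<mu> \<in> {1..p}" for \<mu>
    proof -
      have "(\<Sum>i=1..n. if bin_index p (X i) = \<mu> then 1 else 0 :: real) = bin_count p n X \<mu>"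
        unfolding bin_count_def by (subst sum.inter_filter[symmetric]) auto
      then show ?thesis using n unfolding h_def by (simp add: sum_subtractf field_simps)
    qed
    then have "(\<Sum>\<mu>=1..p. (\<Sum>i\<in>{1..n}. h \<mu> (X i))\<^sup>2) = (\<Sum>\<mu>=1..p. (real n)\<^sup>2 * (bin_count p n X \<mu> / real n - true_bins p \<mu>)\<^sup>2)"
      by (intro sum.cong refl) (simp add: power_mult_distrib)
    also have "\<dots> = (real n)\<^sup>2 * bin_distance p (\<lambda>\<mu>. bin_count p n X \<mu> / real n)"
      unfolding bin_distance_def by (simp add: sum_distrib_left)
    finally show ?thesis using n by (simp add: power2_eq_square)
  qed
  show "integrable ?P (\<lambda>X. real n * bin_distance p (\<lambda>\<mu>. bin_count p n X \<mu> / real n))"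
    unfolding eq by (intro integrable_divide_zero Bochner_Integration.integrable_sum I)
  have "(\<integral>X. real n * bin_distance p (\<lambda>\<mu>. bin_count p n X \<mu> / real n) \<partial>?P) =
      (\<Sum>\<mu>=1..p. real n * (\<integral>x. (h \<mu> x)\<^sup>2 \<partial>density_law f0)) / real n"
    unfolding eq using I E by (simp add: Bochner_Integration.integral_sum)
  also have "\<dots> = (\<Sum>\<mu>=1..p. \<integral>x. (h \<mu> x)\<^sup>2 \<partial>density_law f0)" using n by (simp flip: sum_distrib_left)
  also have "\<dots> \<le> (\<Sum>\<mu>=1..p. true_bins p \<mu>)" by (intro sum_mono h2)
  also have "\<dots> = 1" by (rule sum1)
  finally show "(\<integral>X. real n * bin_distance p (\<lambda>\<mu>. bin_count p n X \<mu> / real n) \<partial>?P) \<le> 1" .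
qed

text \<open>Variance plus squared mean. One summand has variance at most \<open>e1^2\<close>. The
  mean gains an extra factor \<open>e0\<close>: the discretisation error of the score integrates to
  zero over each bin, so a bin-constant approximation of \<open>f0\<close> may be subtracted from
  \<open>f0\<close>. The gain matters because the mean is multiplied by
  \<open>sqrt n\<close>.\<close>

lemma expectation_centring_error:
  assumes p: "p > 0" and n: "n > 0"
  defines "e1 \<equiv> score_holder * real p powr (- smoothness)" and "e0 \<equiv> L0 * real p powr (- s)"
  shows "integrable (sample_law f0 n) (\<lambda>X. (centring_error p n X)\<^sup>2)"
    and "(\<integral>X. (centring_error p n X)\<^sup>2 \<partial>sample_law f0 n) \<le> 2 * e1\<^sup>2 + 2 * real n * (e1 * e0)\<^sup>2"
proof -
  let ?P = "sample_law f0 n"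
  interpret D: prob_space "density_law f0" by (rule prob_space_density_law)
  interpret P: prob_space ?P by (rule prob_space_sample_law)
  define k where "k x = score_bins p (bin_index p x) - score x" for x
  have km: "k \<in> borel_measurable (density_law f0)"
    unfolding k_def using step_measurable[OF p] score_measurable[folded measurable_density_law]
    by (intro borel_measurable_diff)
  have kb: "\<bar>k x\<bar> \<le> e1" if "x \<in> {0..1}" for x
    unfolding k_def e1_def by (rule score_bin_close[OF p that])
  have e1: "e1 \<ge> 0" using score_holder_pos by (simp add: e1_def)
  have e0: "e0 \<ge> 0" using L0(1) by (simp add: e0_def)
  define m where "m = (\<integral>x. k x \<partial>density_law f0)"
  have kI: "integrable (density_law f0) k"
    by (rule integrable_bounded[OF prob_space_density_law km, of e1]) (use kb space_density_law in auto)
  have mb: "\<bar>m\<bar> \<le> e1 * e0"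
  proof -
    have ki: "set_integrable lborel {0..1} k"
      unfolding k_def by (intro set_integral_diff step_function_integral(1)[OF p] set_integrable_score)
    have k0: "(LBINT x:bin p \<mu>. k x) = 0" if \<mu>: "\<mu> \<in> {1..p}" for \<mu>
    proof -
      have "(LBINT x:bin p \<mu>. k x) = (LBINT x:bin p \<mu>. score_bins p \<mu> - score x)"
        using mem_bin_iff[OF p _ \<mu>] bin_subset[OF p \<mu>] unfolding k_def by (intro set_lebesgue_integral_cong) auto
      also have "\<dots> = (LBINT x:bin p \<mu>. score_bins p \<mu>) - (LBINT x:bin p \<mu>. score x)"
        using emeasure_bin[OF p, of \<mu>]
        by (intro set_integral_diff set_integrable_bin[OF set_integrable_score p \<mu>]) (simp add: set_integrable_def)
      also have "(LBINT x:bin p \<mu>. score_bins p \<mu>) = score_bins p \<mu> / real p"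
        using emeasure_bin[OF p, of \<mu>] measure_bin[OF p, of \<mu>] p by (subst set_integral_const) auto
      finally show ?thesis using p by (simp add: bin_average_def)
    qed
    have st: "(LBINT x:{0..1}. (real p * true_bins p (bin_index p x)) * k x) = 0"
      "set_integrable lborel {0..1} (\<lambda>x. (real p * true_bins p (bin_index p x)) * k x)"
      using integral_step_times[OF p ki, of "\<lambda>\<mu>. real p * true_bins p \<mu>"] k0 by simp_all
    have kf: "set_integrable lborel {0..1} (\<lambda>x. k x * f0 x)" by (rule set_integrable_mult_f0[OF ki])
    have "m = (LBINT x:{0..1}. k x * f0 x)"
      unfolding m_def using km by (intro integral_density_law) (simp add: measurable_density_law)
    also have "\<dots> = (LBINT x:{0..1}. k x * f0 x) - (LBINT x:{0..1}. (real p * true_bins p (bin_index p x)) * k x)"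
      unfolding st by simp
    also have "\<dots> = (LBINT x:{0..1}. k x * f0 x - (real p * true_bins p (bin_index p x)) * k x)"
      by (rule set_integral_diff(2)[OF kf st(2), symmetric])
    finally have m: "m = (LBINT x:{0..1}. k x * f0 x - (real p * true_bins p (bin_index p x)) * k x)" .
    have di: "set_integrable lborel {0..1} (\<lambda>x. k x * f0 x - (real p * true_bins p (bin_index p x)) * k x)"
      by (rule set_integral_diff(1)[OF kf st(2)])
    have "\<bar>m\<bar> \<le> (LBINT x:{0..1}. \<bar>k x * f0 x - (real p * true_bins p (bin_index p x)) * k x\<bar>)"
      unfolding m using set_integral_norm_bound[OF di] by simp
    also have "\<dots> \<le> (LBINT x:{0..1::real}. e1 * e0)"
    proof (rule set_integral_mono)
      show "set_integrable lborel {0..1} (\<lambda>x. \<bar>k x * f0 x - (real p * true_bins p (bin_index p x)) * k x\<bar>)"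
        by (intro set_integrable_abs di)
      show "set_integrable lborel {0..1} (\<lambda>_::real. e1 * e0)" by (simp add: set_integrable_def)
      fix x :: real assume x: "x \<in> {0..1}"
      have "\<bar>k x * f0 x - (real p * true_bins p (bin_index p x)) * k x\<bar> = \<bar>k x\<bar> * \<bar>real p * true_bins p (bin_index p x) - f0 x\<bar>"
        by (simp add: abs_mult[symmetric] algebra_simps)
      also have "\<dots> \<le> e1 * e0"
        using kb[OF x] f0_bin_close[OF p x] e1 unfolding e0_def by (intro mult_mono) auto
      finally show "\<bar>k x * f0 x - (real p * true_bins p (bin_index p x)) * k x\<bar> \<le> e1 * e0" .
    qed
    also have "\<dots> = e1 * e0" by (subst set_integral_const) auto
    finally show ?thesis .
  qed
  define h where "h x = k x - m" for x
  have hm: "h \<in> borel_measurable (density_law f0)" unfolding h_def using km by measurable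
  have hb: "\<bar>h x\<bar> \<le> e1 + \<bar>m\<bar>" if "x \<in> space (density_law f0)" for x
    using kb[of x] that space_density_law unfolding h_def by auto
  have h0: "(\<integral>x. h x \<partial>density_law f0) = 0" unfolding h_def using kI by (simp add: m_def D.prob_space)
  note sq = expectation_square_sum_PiM[OF prob_space_density_law _ hm hb h0, of "{1..n}", folded sample_law_def]
  have k2: "integrable (density_law f0) (\<lambda>x. (k x)\<^sup>2)"
  proof (rule integrable_bounded[OF prob_space_density_law, where B = "e1\<^sup>2"])
    show "(\<lambda>x. (k x)\<^sup>2) \<in> borel_measurable (density_law f0)" using km by measurable
    show "\<bar>(k x)\<^sup>2\<bar> \<le> e1\<^sup>2" if "x \<in> space (density_law f0)" for x
      using power_mono[OF kb abs_ge_zero, of x 2] that space_density_law by simp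
  qed
  have h2: "(\<integral>x. (h x)\<^sup>2 \<partial>density_law f0) \<le> e1\<^sup>2"
  proof -
    have "(\<integral>x. (h x)\<^sup>2 \<partial>density_law f0) = (\<integral>x. (k x)\<^sup>2 - 2 * m * k x + m\<^sup>2 \<partial>density_law f0)"
      unfolding h_def by (simp add: power2_diff algebra_simps)
    also have "\<dots> = (\<integral>x. (k x)\<^sup>2 \<partial>density_law f0) - 2 * m * m + m\<^sup>2"
      using k2 kI by (simp add: D.prob_space m_def)
    also have "\<dots> \<le> (\<integral>x. (k x)\<^sup>2 \<partial>density_law f0)" by (simp add: power2_eq_square)
    also have "\<dots> \<le> (\<integral>x. e1\<^sup>2 \<partial>density_law f0)"
      using k2 power_mono[OF kb abs_ge_zero, of _ 2] space_density_law by (intro integral_mono) auto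
    also have "\<dots> = e1\<^sup>2" by (simp add: D.prob_space)
    finally show ?thesis .
  qed
  have ce: "centring_error p n X = (\<Sum>i\<in>{1..n}. h (X i)) / sqrt (real n) + sqrt (real n) * m" for X
  proof -
    have "(\<Sum>i\<in>{1..n}. h (X i)) = (\<Sum>i\<in>{1..n}. k (X i)) - real n * m" by (simp add: h_def sum_subtractf)
    then have "(\<Sum>i\<in>{1..n}. h (X i)) / sqrt (real n) = (\<Sum>i\<in>{1..n}. k (X i)) / sqrt (real n) - (real n / sqrt (real n)) * m"
      by (simp add: diff_divide_distrib)
    then show ?thesis unfolding centring_error_def k_def by (simp add: real_div_sqrt)
  qed
  have le: "(centring_error p n X)\<^sup>2 \<le> 2 / real n * (\<Sum>i\<in>{1..n}. h (X i))\<^sup>2 + 2 * real n * m\<^sup>2" for X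
    unfolding ce using two_square_bound[of "(\<Sum>i\<in>{1..n}. h (X i)) / sqrt (real n)" "sqrt (real n) * m"] n
    by (simp add: power_divide power_mult_distrib)
  have rI: "integrable ?P (\<lambda>X. 2 / real n * (\<Sum>i\<in>{1..n}. h (X i))\<^sup>2 + 2 * real n * m\<^sup>2)"
    using sq(2) by simp
  have cm: "(\<lambda>X. (centring_error p n X)\<^sup>2) \<in> borel_measurable ?P"
  proof -
    have "(\<lambda>X. h (X i)) \<in> borel_measurable ?P" if "i \<in> {1..n}" for i
      unfolding sample_law_def by (rule measurable_compose[OF measurable_component_singleton[OF that] hm])
    then show ?thesis unfolding ce
      by (intro borel_measurable_power borel_measurable_add borel_measurable_divide borel_measurable_sum borel_measurable_const)
  qed
  show cI: "integrable ?P (\<lambda>X. (centring_error p n X)\<^sup>2)"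
    by (rule Bochner_Integration.integrable_bound[OF rI cm]) (use le in \<open>auto intro!: AE_I2 order_trans[OF _ abs_ge_self]\<close>)
  have "(\<integral>X. (centring_error p n X)\<^sup>2 \<partial>?P) \<le> (\<integral>X. 2 / real n * (\<Sum>i\<in>{1..n}. h (X i))\<^sup>2 + 2 * real n * m\<^sup>2 \<partial>?P)"
    by (rule integral_mono[OF cI rI le])
  also have "\<dots> = 2 / real n * (real n * (\<integral>x. (h x)\<^sup>2 \<partial>density_law f0)) + 2 * real n * m\<^sup>2"
    using sq by (simp add: P.prob_space)
  also have "\<dots> = 2 * (\<integral>x. (h x)\<^sup>2 \<partial>density_law f0) + 2 * real n * m\<^sup>2" using n by simp
  also have "\<dots> \<le> 2 * e1\<^sup>2 + 2 * real n * (e1 * e0)\<^sup>2"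
    using h2 power_mono[OF mb abs_ge_zero, of 2] by (intro add_mono mult_left_mono) auto
  finally show "(\<integral>X. (centring_error p n X)\<^sup>2 \<partial>?P) \<le> 2 * e1\<^sup>2 + 2 * real n * (e1 * e0)\<^sup>2" .
qed

end

section \<open>Rates\<close>

text \<open>The choice of \<open>p\<close> in multiplied-out form and up to a factor 2;
  \<open>ln n \<ge> 1\<close> keeps away from the sample sizes where the quotient
  degenerates.\<close>

definition bin_grid :: "(nat \<Rightarrow> nat) \<Rightarrow> bool" where
  "bin_grid p \<longleftrightarrow> (\<forall>\<^sub>F n in sequentially. ln (real n) \<ge> 1 \<and> p n > 0 \<and>
     real (p n) * (ln (real n))\<^sup>2 \<le> sqrt (real n) \<and> sqrt (real n) \<le> 2 * real (p n) * (ln (real n))\<^sup>2)"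

lemma bin_gridI:
  assumes "\<forall>\<^sub>F n in sequentially. p n = 2 ^ (J n + 1) \<and>
           real (p n) \<le> sqrt (real n) / (ln (real n))\<^sup>2 \<and>
           (\<forall>i. 2 ^ i \<le> sqrt (real n) / (ln (real n))\<^sup>2 \<longrightarrow> 2 ^ i \<le> p n)"
  shows "bin_grid p"
proof -
  have "\<forall>\<^sub>F n in sequentially. ln (real n) \<ge> 1" by real_asymp
  with assms show ?thesis unfolding bin_grid_def
  proof eventually_elim
    case (elim n)
    have l: "(ln (real n))\<^sup>2 > 0" using elim by simp
    \<comment> \<open>Maximality, applied to the next power of two \<open>2 * p\<close>, gives the
      lower bound on \<open>p\<close>.\<close>
    have "\<not> 2 ^ (J n + 2) \<le> p n" using elim by simp
    then have "\<not> 2 ^ (J n + 2) \<le> sqrt (real n) / (ln (real n))\<^sup>2" using elim by blast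
    then have "sqrt (real n) / (ln (real n))\<^sup>2 \<le> 2 * real (p n)" using elim by simp
    then have "sqrt (real n) \<le> 2 * real (p n) * (ln (real n))\<^sup>2" using l by (simp only: pos_divide_le_eq)
    moreover have "real (p n) * (ln (real n))\<^sup>2 \<le> sqrt (real n)" 
    proof -
      have "real (p n) \<le> sqrt (real n) / (ln (real n))\<^sup>2" using elim by blast
      then show ?thesis by (simp only: pos_le_divide_eq[OF l])
    qed
    moreover have "p n > 0" using elim by simp
    ultimately show ?case using elim by blast
  qed
qed

text \<open>One limit for all deterministic error terms: since \<open>p\<close> is at least
  \<open>sqrt n / (2 * (ln n)^2)\<close>, the resulting exponent
  \<open>\<beta> - \<kappa> / 2\<close> of \<open>n\<close> is negative and beats every power of the
  logarithm.\<close>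

lemma bin_grid_powr:
  assumes p: "bin_grid p" and \<kappa>: "\<kappa> > 0" "\<kappa> > 2 * \<beta>"
  shows "(\<lambda>n. (ln (real n))\<^sup>2 * real n powr \<beta> * real (p n) powr (- \<kappa>)) \<longlonglongrightarrow> 0"
proof (rule tendsto_sandwich[OF _ _ tendsto_const])
  let ?u = "\<lambda>n. (ln (real n))\<^sup>2 * real n powr \<beta> * (sqrt (real n) / (2 * (ln (real n))\<^sup>2)) powr (- \<kappa>)"
  have "\<beta> - \<kappa> / 2 < 0" using \<kappa> by simp
  then show "?u \<longlonglongrightarrow> 0" using \<kappa> by real_asymp
  show "\<forall>\<^sub>F n in sequentially. 0 \<le> (ln (real n))\<^sup>2 * real n powr \<beta> * real (p n) powr (- \<kappa>)" by simp
  have "\<forall>\<^sub>F n in sequentially. n > 0" by (rule eventually_gt_at_top)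
  with p[unfolded bin_grid_def]
  show "\<forall>\<^sub>F n in sequentially. (ln (real n))\<^sup>2 * real n powr \<beta> * real (p n) powr (- \<kappa>) \<le> ?u n"
  proof eventually_elim
    case (elim n)
    have "sqrt (real n) / (2 * (ln (real n))\<^sup>2) \<le> real (p n)"
    proof -
      have "0 < ln (real n)" using elim by linarith
      then have "0 < 2 * (ln (real n))\<^sup>2" by (intro mult_pos_pos zero_less_power) auto
      then show ?thesis using elim by (simp only: pos_divide_le_eq) (simp add: mult_ac)
    qed
    moreover have "0 < sqrt (real n) / (2 * (ln (real n))\<^sup>2)"
    proof -
      have "0 < ln (real n)" using elim by linarith
      then show ?thesis using elim by (intro divide_pos_pos mult_pos_pos zero_less_power) auto
    qed
    ultimately have "real (p n) powr (- \<kappa>) \<le> (sqrt (real n) / (2 * (ln (real n))\<^sup>2)) powr (- \<kappa>)"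
      using \<kappa> by (intro powr_mono2') auto
    then show ?case by (intro mult_left_mono) auto
  qed
qed

context smooth_functional
begin

text \<open>The interface between the two priors and the rate computation: \<open>K\<close> controls
  the prior scores in all bin directions together, \<open>B\<close> the one in the direction of the
  score. The density formula is asked almost everywhere because a Dirichlet parameter may lie off
  the simplex.\<close>

definition regular_posterior ::
    "nat \<Rightarrow> nat \<Rightarrow> (nat \<Rightarrow> real) \<Rightarrow> 'a measure \<Rightarrow> ('a \<Rightarrow> real \<Rightarrow> real) \<Rightarrow> real \<Rightarrow> real \<Rightarrow> bool" where
  "regular_posterior p n X M dens K B \<longleftrightarrow> prob_space M \<and> (\<lambda>\<theta>. int_functional T (dens \<theta>)) \<in> borel_measurable M \<and>
    (\<exists>\<omega> b1 b2. (\<forall>\<mu>\<in>{1..p}. (\<lambda>\<theta>. \<omega> \<theta> \<mu>) \<in> borel_measurable M) \<and> (\<forall>\<theta>\<in>space M. bin_probability p (\<omega> \<theta>)) \<and>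
      (AE \<theta> in M. \<forall>x\<in>{0..1}. dens \<theta> x = real p * \<omega> \<theta> (bin_index p x)) \<and>
      (\<forall>\<mu>\<in>{1..p}. score_identity M p \<omega> (bin_count p n X) (\<lambda>\<nu>. if \<nu> = \<mu> then 1 else 0) (b1 \<mu>)) \<and>
      (\<forall>\<theta>\<in>space M. (\<Sum>\<mu>=1..p. (b1 \<mu> \<theta>)\<^sup>2) \<le> K * real n) \<and>
      score_identity M p \<omega> (bin_count p n X) (score_bins p) b2 \<and> (\<forall>\<theta>\<in>space M. \<bar>b2 \<theta>\<bar> \<le> B))"

text \<open>Each term of the bound on \<open>d_BL\<close>, multiplied by \<open>ln n\<close>, is
  compared with a random envelope \<open>R\<close> that is affine in the empirical distance and in
  the squared centring error and has bounded expectation. Samples with infinite evidence form the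
  exceptional set.\<close>

lemma bvm_rate:
  fixes prior :: "nat \<Rightarrow> 'a measure" and dens :: "nat \<Rightarrow> 'a \<Rightarrow> real \<Rightarrow> real"
  assumes p: "bin_grid p" and v: "v = efficient_variance T' f0" "v > 0"
    and ill: "posterior_well_defined f0 prior dens"
    and K: "K \<ge> 0"
    and reg: "\<forall>\<^sub>F n in sequentially. \<forall>X\<in>space (sample_law f0 n). evidence (prior n) (dens n) n X \<noteq> \<infinity> \<longrightarrow>
      regular_posterior (p n) n X (posterior (prior n) (dens n) n X) (dens n) K (G * sqrt (real n) / ln (real n))"
  shows "big_Op (sample_law f0) (\<lambda>n X. d_BL (posterior_law (prior n) (dens n) n X
      (\<lambda>f. sqrt (real n) * (int_functional T f - efficient_centring T T' f0 n X))) (normal_law 0 v)) (\<lambda>n. 1 / ln (real n))"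
proof (rule big_OpI_expectation)
  define Lg where "Lg = score_holder"
  define a where "a = smoothness"
  define cv where "cv = 2 * sqrt (2 * pi * v) / v"
  \<comment> \<open>\<open>A1\<close> gathers the coefficients of
    \<open>Y = 4 + 2 * K + 2 * S\<close>; \<open>A0\<close> takes their share of the constant part
    of \<open>Y\<close> together with all terms free of \<open>Y\<close>. The matching is done when
    the seven bounds are added.\<close>
  define A1 where "A1 = 8 / \<eta>\<^sup>2 + 2 * C + 4 / v * (3 * C\<^sup>2 / 2)"
  define A0 where "A0 = A1 * (4 + 2 * K) + 1 + 2 * C * L0\<^sup>2 + 4 / v * (3 * C\<^sup>2 / 2) + 4 / v * (4 * C * Lg) + cv * \<bar>G\<bar>"
  define S where "S n X = real n * bin_distance (p n) (\<lambda>\<mu>. bin_count (p n) n X \<mu> / real n)" for n X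
  define R where "R n X = A0 + 2 * A1 * S n X + (ln (real n))\<^sup>2 * (centring_error (p n) n X)\<^sup>2" for n X
  have A1: "A1 \<ge> 0" unfolding A1_def using C v by (intro add_nonneg_nonneg) auto
  have Lg: "Lg \<ge> 0" using score_holder_pos by (simp add: Lg_def)
  have cv: "cv \<ge> 0" using v by (simp add: cv_def)
  have A0: "A0 \<ge> 0" unfolding A0_def using A1 K C v Lg cv by (intro add_nonneg_nonneg mult_nonneg_nonneg) auto
  have S0: "S n X \<ge> 0" for n X
    unfolding S_def bin_distance_def by (intro mult_nonneg_nonneg sum_nonneg) auto
  show "{X \<in> space (sample_law f0 n). evidence (prior n) (dens n) n X = \<infinity>} \<subseteq> space (sample_law f0 n)" for n by auto
  show "(\<lambda>n. outer_prob (sample_law f0 n) {X \<in> space (sample_law f0 n). evidence (prior n) (dens n) n X = \<infinity>}) \<longlonglongrightarrow> 0"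
    using ill by (simp add: posterior_well_defined_def)
  show "\<forall>\<^sub>F n in sequentially. prob_space (sample_law f0 n)" by (simp add: prob_space_sample_law)
  have small: "\<forall>\<^sub>F n in sequentially. (ln (real n))\<^sup>2 * real n powr \<beta> * real (p n) powr (- \<kappa>) \<le> \<epsilon>"
    if "\<kappa> > 0" "\<kappa> > 2 * \<beta>" "\<epsilon> > 0" for \<kappa> \<beta> \<epsilon>
    using order_tendstoD(2)[OF bin_grid_powr[OF p that(1,2)] that(3)] by eventually_elim simp
  have as: "a > 1/2" "s > 1/2" using smoothness s by (auto simp: a_def)
  \<comment> \<open>In order: variance and squared mean of the centring error, bias below
    \<open>\<eta> / 2\<close>, quadratic bias, discretisation of the variance. The second and fourth
    rest on \<open>a + s > 1\<close> and \<open>2 * s > 1\<close>.\<close>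
  have small1: "\<forall>\<^sub>F n in sequentially. (ln (real n))\<^sup>2 * real n powr 0 * real (p n) powr (- (2 * a)) \<le> 1"
    "\<forall>\<^sub>F n in sequentially. (ln (real n))\<^sup>2 * real n powr 1 * real (p n) powr (- (2 * (a + s))) \<le> 1"
    "\<forall>\<^sub>F n in sequentially. (ln (real n))\<^sup>2 * real n powr 0 * real (p n) powr (- s) \<le> \<eta> / (2 * (L0 + 1))"
    "\<forall>\<^sub>F n in sequentially. (ln (real n))\<^sup>2 * real n powr (1/2) * real (p n) powr (- (2 * s)) \<le> 1"
    "\<forall>\<^sub>F n in sequentially. (ln (real n))\<^sup>2 * real n powr 0 * real (p n) powr (- a) \<le> 1"
    by (rule small; use as \<eta> L0(1) in simp)+
  have n0: "\<forall>\<^sub>F n in sequentially. n > 0" by (rule eventually_gt_at_top)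
  have sq: "(real q powr b)\<^sup>2 = real q powr (2 * b)" for q b by (simp add: powr_add[symmetric] power2_eq_square)
  show "\<forall>\<^sub>F n in sequentially. integrable (sample_law f0 n) (R n) \<and>
      (\<integral>X. R n X \<partial>sample_law f0 n) \<le> A0 + 2 * A1 + (2 * Lg\<^sup>2 + 2 * (Lg\<^sup>2 * L0\<^sup>2)) \<and> (\<forall>X\<in>space (sample_law f0 n). 0 \<le> R n X)"
    using p[unfolded bin_grid_def] n0 small1(1,2)
  proof eventually_elim
    case (elim n)
    interpret P: prob_space "sample_law f0 n" by (rule prob_space_sample_law)
    let ?l2 = "(ln (real n))\<^sup>2"
    define e1 where "e1 = Lg * real (p n) powr (- a)"
    define e0 where "e0 = L0 * real (p n) powr (- s)"
    have pn: "p n > 0" and n: "n > 0" using elim by auto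
    have h1: "?l2 * real (p n) powr (- (2 * a)) \<le> 1" using elim as n by simp
    have h2: "?l2 * real n * real (p n) powr (- (2 * (a + s))) \<le> 1" using elim as n by simp
    note S1 = expectation_empirical_distance[OF pn n, folded S_def]
    note Q1 = expectation_centring_error[OF pn n, folded Lg_def a_def, folded e1_def e0_def]
    have int: "integrable (sample_law f0 n) (R n)" unfolding R_def using S1(1) Q1(1) by auto
    have "(\<integral>X. R n X \<partial>sample_law f0 n) = A0 + 2 * A1 * (\<integral>X. S n X \<partial>sample_law f0 n)
        + ?l2 * (\<integral>X. (centring_error (p n) n X)\<^sup>2 \<partial>sample_law f0 n)"
      unfolding R_def using S1(1) Q1(1) by (simp add: P.prob_space)
    also have "\<dots> \<le> A0 + 2 * A1 * 1 + ?l2 * (2 * e1\<^sup>2 + 2 * real n * (e1 * e0)\<^sup>2)"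
      using S1(2) Q1(2) A1 by (intro add_mono mult_left_mono) auto
    also have "?l2 * (2 * e1\<^sup>2 + 2 * real n * (e1 * e0)\<^sup>2) \<le> 2 * Lg\<^sup>2 + 2 * (Lg\<^sup>2 * L0\<^sup>2)"
    proof -
      have "e1\<^sup>2 = Lg\<^sup>2 * real (p n) powr (- (2 * a))" unfolding e1_def by (simp add: power_mult_distrib sq)
      then have "?l2 * e1\<^sup>2 = Lg\<^sup>2 * (?l2 * real (p n) powr (- (2 * a)))" by simp
      also have "\<dots> \<le> Lg\<^sup>2 * 1" using h1 by (intro mult_left_mono) auto
      finally have 1: "?l2 * e1\<^sup>2 \<le> Lg\<^sup>2" by simp
      have "(e1 * e0)\<^sup>2 = Lg\<^sup>2 * L0\<^sup>2 * real (p n) powr (- (2 * (a + s)))"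
        unfolding e1_def e0_def by (simp add: power_mult_distrib sq powr_add[symmetric] mult_ac)
      then have "?l2 * real n * (e1 * e0)\<^sup>2 = Lg\<^sup>2 * L0\<^sup>2 * (?l2 * real n * real (p n) powr (- (2 * (a + s))))" by simp
      also have "\<dots> \<le> Lg\<^sup>2 * L0\<^sup>2 * 1" using h2 by (intro mult_left_mono) auto
      finally have 2: "?l2 * real n * (e1 * e0)\<^sup>2 \<le> Lg\<^sup>2 * L0\<^sup>2" by simp
      show ?thesis using 1 2 by (simp add: algebra_simps)
    qed
    finally have "(\<integral>X. R n X \<partial>sample_law f0 n) \<le> A0 + 2 * A1 + (2 * Lg\<^sup>2 + 2 * (Lg\<^sup>2 * L0\<^sup>2))" by simp
    moreover have "0 \<le> R n X" for X
      unfolding R_def using A0 A1 S0 by (intro add_nonneg_nonneg mult_nonneg_nonneg) auto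
    ultimately show ?case using int by blast
  qed
  show "\<forall>\<^sub>F n in sequentially. 1 / ln (real n) > 0 \<and> (\<forall>X\<in>space (sample_law f0 n) - {X \<in> space (sample_law f0 n). evidence (prior n) (dens n) n X = \<infinity>}.
      \<bar>d_BL (posterior_law (prior n) (dens n) n X (\<lambda>f. sqrt (real n) * (int_functional T f - efficient_centring T T' f0 n X))) (normal_law 0 v)\<bar> \<le> R n X * (1 / ln (real n)))"
    using p[unfolded bin_grid_def] n0 reg small1(3,4,5)
  proof eventually_elim
    case (elim n)
    define l where "l = ln (real n)"
    define P where "P = real (p n)"
    define r where "r = sqrt (real n)"
    have l1: "l \<ge> 1" using elim by (simp add: l_def)
    then have l: "l \<ge> 1" "l > 0" by linarith+
    have pn: "p n > 0" and n: "n > 0" and Pr: "P * l\<^sup>2 \<le> r"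
      using elim by (auto simp: l_def P_def r_def)
    have P: "P \<ge> 1" using pn by (simp add: P_def)
    have r: "r > 0" "r * r = real n" "r \<ge> 1" using n by (auto simp: r_def)
    have l2: "l\<^sup>2 \<ge> 1" using l by simp
    have ll2: "l \<le> l\<^sup>2" using l by (simp add: power2_eq_square)
    have g1: "l\<^sup>2 * P powr (- s) \<le> \<eta> / (2 * (L0 + 1))" using elim as L0(1) \<eta> n by (simp add: l_def P_def)
    have g2: "l\<^sup>2 * r * P powr (- (2 * s)) \<le> 1" using elim as n by (simp add: l_def P_def r_def powr_half_sqrt)
    have g3: "l\<^sup>2 * P powr (- a) \<le> 1" using elim as n by (simp add: l_def P_def)
    have bias: "L0 * real (p n) powr (- s) \<le> \<eta> / 2"
    proof -
      have "1 * P powr (- s) \<le> l\<^sup>2 * P powr (- s)" using l2 by (intro mult_right_mono) auto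
      then have "P powr (- s) \<le> \<eta> / (2 * (L0 + 1))" using g1 by simp
      then have "(L0 + 1) * P powr (- s) \<le> (L0 + 1) * (\<eta> / (2 * (L0 + 1)))" using L0(1) by (intro mult_left_mono) auto
      also have "\<dots> = \<eta> / 2" using L0(1) by (simp add: field_simps)
      finally have "(L0 + 1) * P powr (- s) \<le> \<eta> / 2" .
      moreover have "L0 * P powr (- s) \<le> (L0 + 1) * P powr (- s)" by (intro mult_right_mono) auto
      ultimately show ?thesis unfolding P_def by linarith
    qed
    show ?case
    proof (intro conjI ballI)
      show "1 / ln (real n) > 0" using l by (simp add: l_def)
      fix X assume X: "X \<in> space (sample_law f0 n) - {X \<in> space (sample_law f0 n). evidence (prior n) (dens n) n X = \<infinity>}"
      define M where "M = posterior (prior n) (dens n) n X"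
      have "regular_posterior (p n) n X M (dens n) K (G * sqrt (real n) / ln (real n))"
        unfolding M_def using elim X by blast
      then obtain \<omega> b1 b2 where M: "prob_space M" and Tm: "(\<lambda>\<theta>. int_functional T (dens n \<theta>)) \<in> borel_measurable M"
        and \<omega>m: "\<And>\<mu>. \<mu> \<in> {1..p n} \<Longrightarrow> (\<lambda>\<theta>. \<omega> \<theta> \<mu>) \<in> borel_measurable M"
        and \<omega>: "\<And>\<theta>. \<theta> \<in> space M \<Longrightarrow> bin_probability (p n) (\<omega> \<theta>)"
        and ae: "AE \<theta> in M. \<forall>x\<in>{0..1}. dens n \<theta> x = real (p n) * \<omega> \<theta> (bin_index (p n) x)"
        and si1: "\<And>\<mu>. \<mu> \<in> {1..p n} \<Longrightarrow> score_identity M (p n) \<omega> (bin_count (p n) n X) (\<lambda>\<nu>. if \<nu> = \<mu> then 1 else 0) (b1 \<mu>)"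
        and b1: "\<And>\<theta>. \<theta> \<in> space M \<Longrightarrow> (\<Sum>\<mu>=1..p n. (b1 \<mu> \<theta>)\<^sup>2) \<le> K * real n"
        and si2: "score_identity M (p n) \<omega> (bin_count (p n) n X) (score_bins (p n)) b2"
        and b2: "\<And>\<theta>. \<theta> \<in> space M \<Longrightarrow> \<bar>b2 \<theta>\<bar> \<le> G * sqrt (real n) / ln (real n)"
        unfolding regular_posterior_def by blast
      define Q where "Q = \<bar>centring_error (p n) n X\<bar>"
      define Y where "Y = 4 + 2 * K + 2 * S n X"
      have Y: "Y \<ge> 0" using K S0 by (simp add: Y_def)
      let ?\<Delta> = "\<bar>d_BL (posterior_law (prior n) (dens n) n X (\<lambda>f. sqrt (real n) * (int_functional T f - efficient_centring T T' f0 n X))) (normal_law 0 v)\<bar>"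
      define t1 where "t1 = 8 * P\<^sup>2 / \<eta>\<^sup>2 * (Y / real n)"
      define t2 where "t2 = r * (C * (2 * P)) * (Y / real n)"
      define t4 where "t4 = r * (C * (2 * (L0 * P powr (- s))\<^sup>2))"
      define t5 where "t5 = 4 / v * (3 * C\<^sup>2 * ((1 / l) / 2 + P * (Y / real n) / (2 * (1 / l))))"
      define t6 where "t6 = 4 / v * (4 * C * (Lg * P powr (- a)))"
      define t7 where "t7 = cv * (G * r / l / r)"
      \<comment> \<open>The free parameter \<open>\<delta>\<close> is set to \<open>1 / l\<close>:
        its own contribution is then of the target order, and the companion term grows by a mere
        factor \<open>l\<close>.\<close>
      have "?\<Delta> \<le> (8 * P\<^sup>2 / \<eta>\<^sup>2 + r * (C * (2 * P))) * (Y / real n) + Q + r * (C * (2 * (L0 * P powr (- s))\<^sup>2))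
        + 4 / v * (3 * C\<^sup>2 * ((1 / l) / 2 + P * (Y / real n) / (2 * (1 / l))) + 4 * C * (Lg * P powr (- a)))
        + cv * (G * r / l / r)"
        unfolding posterior_law_def M_def[symmetric] P_def r_def Y_def S_def Q_def Lg_def a_def cv_def l_def
        by (rule d_BL_posterior_bound[OF M \<omega>m \<omega> ae Tm n pn _ si1 b1 si2 b2 bias _ v])
           (use X space_sample_law l in \<open>auto simp: l_def\<close>)
      also have "\<dots> = t1 + t2 + Q + t4 + t5 + t6 + t7"
        unfolding t1_def t2_def t4_def t5_def t6_def t7_def by (simp only: distrib_left distrib_right add_ac)
      finally have \<Delta>: "?\<Delta> \<le> t1 + t2 + Q + t4 + t5 + t6 + t7" .
      have PP: "l * P\<^sup>2 \<le> real n"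
      proof -
        have "l * P\<^sup>2 \<le> l\<^sup>2 * P\<^sup>2 * l\<^sup>2" using ll2 l2 mult_left_mono[OF l2, of "l\<^sup>2 * P\<^sup>2"] mult_right_mono[OF ll2, of "P\<^sup>2"] by simp
        also have "\<dots> = (P * l\<^sup>2) * (P * l\<^sup>2)" by (simp add: power2_eq_square)
        also have "\<dots> \<le> r * r" using Pr P r by (intro mult_mono) auto
        finally show ?thesis using r by simp
      qed
      have rP: "l\<^sup>2 * (r * P) \<le> real n"
        using mult_left_mono[OF Pr, of r] r by (simp add: mult_ac)
      have h1: "l * t1 \<le> 8 / \<eta>\<^sup>2 * Y"
      proof -
        have "l * t1 = 8 / \<eta>\<^sup>2 * Y * (l * P\<^sup>2 / real n)" by (simp add: t1_def)
        also have "\<dots> \<le> 8 / \<eta>\<^sup>2 * Y * 1" using PP n Y by (intro mult_left_mono) auto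
        finally show ?thesis by simp
      qed
      have h2: "l * t2 \<le> 2 * C * Y"
      proof -
        have "l * (r * P) \<le> l\<^sup>2 * (r * P)" using ll2 r P by (intro mult_right_mono) auto
        then have "l * (r * P) \<le> real n" using rP by linarith
        then have "2 * C * Y * (l * (r * P) / real n) \<le> 2 * C * Y * 1" using n Y C by (intro mult_left_mono) auto
        then show ?thesis by (simp add: t2_def mult_ac)
      qed
      \<comment> \<open>Trades the first power of the centring error for its square, whose
        expectation is the one that has been bounded.\<close>
      have h3: "l * Q \<le> 1 + l\<^sup>2 * (centring_error (p n) n X)\<^sup>2"
      proof -
        have "2 * (l * Q) \<le> (l * Q)\<^sup>2 + 1" using sum_squares_bound[of "l * Q" 1] by simp
        moreover have "(l * Q)\<^sup>2 = l\<^sup>2 * (centring_error (p n) n X)\<^sup>2" by (simp add: Q_def power_mult_distrib)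
        moreover have "0 \<le> (l * Q)\<^sup>2" by simp
        ultimately show ?thesis by linarith
      qed
      have h4: "l * t4 \<le> 2 * C * L0\<^sup>2"
      proof -
        have "l * t4 = 2 * C * L0\<^sup>2 * (l * r * P powr (- (2 * s)))"
          unfolding t4_def P_def by (simp add: power_mult_distrib sq)
        also have "\<dots> \<le> 2 * C * L0\<^sup>2 * 1"
        proof (intro mult_left_mono)
          have "l * r * P powr (- (2 * s)) \<le> l\<^sup>2 * r * P powr (- (2 * s))" using ll2 r by (intro mult_right_mono) auto
          then show "l * r * P powr (- (2 * s)) \<le> 1" using g2 by linarith
        qed (use C in auto)
        finally show ?thesis by simp
      qed
      have h5: "l * t5 \<le> 4 / v * (3 * C\<^sup>2 / 2) + 4 / v * (3 * C\<^sup>2 / 2) * Y"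
      proof -
        have "l\<^sup>2 * P \<le> real n"
        proof -
          have "l\<^sup>2 * (1 * P) \<le> l\<^sup>2 * (r * P)" using r P by (intro mult_left_mono mult_right_mono) auto
          then show ?thesis using rP by linarith
        qed
        then have "4 / v * (3 * C\<^sup>2 / 2) * Y * (l\<^sup>2 * P / real n) \<le> 4 / v * (3 * C\<^sup>2 / 2) * Y * 1"
          using n Y v by (intro mult_left_mono) auto
        moreover have "l * t5 = 4 / v * (3 * C\<^sup>2 / 2) + 4 / v * (3 * C\<^sup>2 / 2) * Y * (l\<^sup>2 * P / real n)"
        proof -
          have "l * ((1 / l) / 2 + P * (Y / real n) / (2 * (1 / l))) = 1 / 2 + Y * (l\<^sup>2 * P / real n) / 2"
            using l by (simp add: field_simps power2_eq_square)
          moreover have "l * t5 = 4 / v * (3 * C\<^sup>2 * (l * ((1 / l) / 2 + P * (Y / real n) / (2 * (1 / l)))))"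
            unfolding t5_def by simp
          ultimately show ?thesis by (simp add: distrib_left)
        qed
        ultimately show ?thesis by simp
      qed
      have h6: "l * t6 \<le> 4 / v * (4 * C * Lg)"
      proof -
        have "l * P powr (- a) \<le> l\<^sup>2 * P powr (- a)" using ll2 by (intro mult_right_mono) auto
        then have "4 / v * (4 * C * Lg) * (l * P powr (- a)) \<le> 4 / v * (4 * C * Lg) * 1"
          using g3 C Lg v by (intro mult_left_mono) auto
        then show ?thesis by (simp add: t6_def mult_ac)
      qed
      have h7: "l * t7 \<le> cv * \<bar>G\<bar>"
      proof -
        have "l * t7 = cv * G" using l r by (simp add: t7_def)
        then show ?thesis using cv by (simp add: mult_left_mono)
      qed
      have "l * ?\<Delta> \<le> l * (t1 + t2 + Q + t4 + t5 + t6 + t7)" using \<Delta> l by (intro mult_left_mono) auto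
      also have "\<dots> = l * t1 + l * t2 + l * Q + l * t4 + l * t5 + l * t6 + l * t7" by (simp add: distrib_left)
      also have "\<dots> \<le> 8 / \<eta>\<^sup>2 * Y + 2 * C * Y + (1 + l\<^sup>2 * (centring_error (p n) n X)\<^sup>2) + 2 * C * L0\<^sup>2
          + (4 / v * (3 * C\<^sup>2 / 2) + 4 / v * (3 * C\<^sup>2 / 2) * Y) + 4 / v * (4 * C * Lg) + cv * \<bar>G\<bar>"
        by (intro add_mono h1 h2 h3 h4 h5 h6 h7)
      also have "\<dots> = R n X"
      proof -
        have "x * Y + y * Y + (1 + q) + u + (w + w * Y) + z + t =
          ((x + y + w) * (4 + 2 * K) + 1 + u + w + z + t) + 2 * (x + y + w) * S n X + q" for x y w q u z t :: real
          by (simp add: Y_def algebra_simps)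
        then show ?thesis unfolding R_def A0_def A1_def l_def by blast
      qed
      finally have "l * ?\<Delta> \<le> R n X" .
      then show "?\<Delta> \<le> R n X * (1 / ln (real n))"
        using l by (simp add: l_def[symmetric] field_simps)
    qed
  qed
qed

text \<open>The prior score sums \<open>J + 1 \<le> l\<close> levels, each at most
  \<open>c / \<tau> \<le> c * sqrt p * l^2\<close>, with \<open>c\<close> a bound for the level sums
  of coefficients. For a bin indicator \<open>c = 1 / sqrt p\<close>, which gives
  \<open>B * l^3\<close>, and \<open>p\<close> squares of this stay below \<open>B^2 * n\<close>.
  For the score \<open>c\<close> is a constant, and \<open>p * l^8 \<le> n\<close> turns
  \<open>sqrt p * l^3\<close> into at most \<open>sqrt n / l\<close>.\<close>

lemma haar_regular_posterior:
  fixes J n :: nat and H :: "real \<Rightarrow> real" and \<sigma> :: "nat \<Rightarrow> real"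
  defines "p \<equiv> 2 ^ Suc J" and "l \<equiv> ln (real n)"
  assumes X: "\<And>i. i \<in> {1..n} \<Longrightarrow> X i \<in> {0..1}"
    and ev: "evidence (haar_prior J H \<sigma>) (haar_density J) n X \<noteq> \<infinity>"
    and H: "\<And>x. H differentiable (at x)" and B: "\<And>x. \<bar>deriv H x\<bar> \<le> B"
    and \<sigma>: "\<tau> > 0" "\<And>j. j \<le> J \<Longrightarrow> \<tau> \<le> \<sigma> j" "1 / \<tau> \<le> sqrt (real p) * l\<^sup>2"
    and l: "l \<ge> 1" "real p * l\<^sup>2 \<le> sqrt (real n)" "real (J + 1) \<le> l" "l ^ 6 \<le> sqrt (real n)"
  shows "regular_posterior p n X (posterior (haar_prior J H \<sigma>) (haar_density J) n X) (haar_density J)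
    (B\<^sup>2) (B * score_holder * sqrt (real n) / l)"
proof -
  define M where "M = posterior (haar_prior J H \<sigma>) (haar_density J) n X"
  have p: "p > 0" by (simp add: p_def)
  have B0: "B \<ge> 0" using B[of 0] by linarith
  have \<sigma>': "\<sigma> j > 0" if "j \<le> J" for j using \<sigma>(1) \<sigma>(2)[OF that] by linarith
  have hs: "prob_space M" "sets M = sets (Pi\<^sub>M (haar_index J) (\<lambda>_. lborel))"
    unfolding M_def by (rule haar_score_identity[OF _ ev _ H B]; (rule X | rule \<sigma>'); assumption)+
  have ident: "\<exists>b. score_identity M p (haar_bins J) (bin_count p n X) (bin_average p g) b \<and>
      (\<forall>\<theta>\<in>space M. \<bar>b \<theta>\<bar> \<le> B * (\<Sum>(j, k)\<in>haar_index J. \<bar>haar_coeff g (j, k)\<bar> / \<sigma> j))"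
    if "set_integrable lborel {0..1} g" for g
    unfolding M_def p_def by (rule haar_score_identity(3)[OF _ ev _ H B that]; (rule X | rule \<sigma>'); assumption)
  have bound: "B * (\<Sum>(j, k)\<in>haar_index J. \<bar>haar_coeff g (j, k)\<bar> / \<sigma> j) \<le> B * (l * (c * (sqrt (real p) * l\<^sup>2)))"
    if c: "c \<ge> 0" and level: "\<And>j. j \<le> J \<Longrightarrow> (\<Sum>k=1..2 ^ j. \<bar>haar_coeff g (j, k)\<bar>) \<le> c" for g c
  proof -
    have "(\<Sum>(j, k)\<in>haar_index J. \<bar>haar_coeff g (j, k)\<bar> / \<sigma> j) = (\<Sum>j\<le>J. (\<Sum>k=1..2 ^ j. \<bar>haar_coeff g (j, k)\<bar>) / \<sigma> j)"
      unfolding haar_index_def by (subst sum.Sigma[symmetric]) (auto simp: sum_divide_distrib)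
    also have "\<dots> \<le> (\<Sum>j\<le>J. c * (sqrt (real p) * l\<^sup>2))"
    proof (rule sum_mono)
      fix j assume j: "j \<in> {..J}"
      have "(\<Sum>k=1..2 ^ j. \<bar>haar_coeff g (j, k)\<bar>) / \<sigma> j \<le> c / \<tau>"
        using level[of j] \<sigma>(1) \<sigma>(2)[of j] j c by (intro frac_le) auto
      also have "\<dots> = c * (1 / \<tau>)" by simp
      also have "\<dots> \<le> c * (sqrt (real p) * l\<^sup>2)" using \<sigma>(3) c by (rule mult_left_mono)
      finally show "(\<Sum>k=1..2 ^ j. \<bar>haar_coeff g (j, k)\<bar>) / \<sigma> j \<le> c * (sqrt (real p) * l\<^sup>2)" .
    qed
    also have "\<dots> = real (J + 1) * (c * (sqrt (real p) * l\<^sup>2))" by simp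
    also have "\<dots> \<le> l * (c * (sqrt (real p) * l\<^sup>2))" using l(3) c by (intro mult_right_mono) auto
    finally show ?thesis using B0 by (rule mult_left_mono)
  qed
  have r2: "sqrt (real n) * sqrt (real n) = real n" by simp
  have "\<exists>b. score_identity M p (haar_bins J) (bin_count p n X) (\<lambda>\<nu>. if \<nu> = \<mu> then 1 else 0) b \<and>
      (\<forall>\<theta>\<in>space M. \<bar>b \<theta>\<bar> \<le> B * l ^ 3)" if \<mu>: "\<mu> \<in> {1..p}" for \<mu>
  proof -
    let ?g = "indicat_real (bin p \<mu>)"
    have gi: "set_integrable lborel {0..1} ?g"
      unfolding set_integrable_def
      by (rule integrable_mult_indicator) (auto simp: emeasure_bin[OF p])
    obtain b where b: "score_identity M p (haar_bins J) (bin_count p n X) (bin_average p ?g) b"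
      "\<forall>\<theta>\<in>space M. \<bar>b \<theta>\<bar> \<le> B * (\<Sum>(j, k)\<in>haar_index J. \<bar>haar_coeff ?g (j, k)\<bar> / \<sigma> j)"
      using ident[OF gi] by blast
    have total: "(LBINT x:{0..1}. ?g x) = 1 / real p"
    proof -
      have "indicat_real {0..1} x *\<^sub>R ?g x = ?g x" for x using bin_subset[OF p \<mu>] by (auto simp: indicator_def)
      then have "(LBINT x:{0..1}. ?g x) = (LBINT x. ?g x)" unfolding set_lebesgue_integral_def by (simp only:)
      then show ?thesis by (simp add: measure_bin[OF p])
    qed
    have "B * (\<Sum>(j, k)\<in>haar_index J. \<bar>haar_coeff ?g (j, k)\<bar> / \<sigma> j) \<le> B * (l * (1 / sqrt (real p) * (sqrt (real p) * l\<^sup>2)))"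
    proof (rule bound)
      fix j assume j: "j \<le> J"
      have "(\<Sum>k=1..2 ^ j. \<bar>haar_coeff ?g (j, k)\<bar>) \<le> sqrt (2 ^ j) * (1 / real p)"
        using haar_coeff_sum_nonneg[OF gi, of j] total by simp
      also have "\<dots> \<le> sqrt (real p) * (1 / real p)"
      proof (intro mult_right_mono real_sqrt_le_mono)
        have "(2::real) ^ j \<le> 2 ^ Suc J" using j by (intro power_increasing) auto
        then show "(2::real) ^ j \<le> real p" by (simp add: p_def)
      qed simp
      also have "\<dots> = 1 / sqrt (real p)" using p by (simp add: real_div_sqrt field_simps)
      finally show "(\<Sum>k=1..2 ^ j. \<bar>haar_coeff ?g (j, k)\<bar>) \<le> 1 / sqrt (real p)" .
    qed simp
    also have "\<dots> = B * l ^ 3" using p by (simp add: power3_eq_cube power2_eq_square)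
    finally have "\<forall>\<theta>\<in>space M. \<bar>b \<theta>\<bar> \<le> B * l ^ 3" using b(2) by force
    moreover have "score_identity M p (haar_bins J) (bin_count p n X) (\<lambda>\<nu>. if \<nu> = \<mu> then 1 else 0) b"
      using b(1) score_identity_cong[of p "bin_average p ?g" "\<lambda>\<nu>. if \<nu> = \<mu> then 1 else 0"] bin_average_indicator[OF p \<mu>]
      by blast
    ultimately show ?thesis by blast
  qed
  then obtain b1 where b1: "\<And>\<mu>. \<mu> \<in> {1..p} \<Longrightarrow> score_identity M p (haar_bins J) (bin_count p n X) (\<lambda>\<nu>. if \<nu> = \<mu> then 1 else 0) (b1 \<mu>)"
    "\<And>\<mu> \<theta>. \<mu> \<in> {1..p} \<Longrightarrow> \<theta> \<in> space M \<Longrightarrow> \<bar>b1 \<mu> \<theta>\<bar> \<le> B * l ^ 3" by metis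
  have b1': "(\<Sum>\<mu>=1..p. (b1 \<mu> \<theta>)\<^sup>2) \<le> B\<^sup>2 * real n" if "\<theta> \<in> space M" for \<theta>
  proof -
    have "(\<Sum>\<mu>=1..p. (b1 \<mu> \<theta>)\<^sup>2) \<le> (\<Sum>\<mu>=1..p. (B * l ^ 3)\<^sup>2)"
    proof (rule sum_mono)
      fix \<mu> assume "\<mu> \<in> {1..p}"
      from power_mono[OF b1(2)[OF this that] abs_ge_zero, of 2] show "(b1 \<mu> \<theta>)\<^sup>2 \<le> (B * l ^ 3)\<^sup>2" by simp
    qed
    also have "\<dots> = B\<^sup>2 * ((real p * l\<^sup>2) * l ^ 4)"
    proof -
      have "(l ^ 3)\<^sup>2 = l\<^sup>2 * l ^ 4" by (simp flip: power_mult power_add)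
      then show ?thesis by (simp add: power_mult_distrib)
    qed
    also have "\<dots> \<le> B\<^sup>2 * (sqrt (real n) * sqrt (real n))"
    proof (intro mult_left_mono mult_mono l(2))
      have "l ^ 4 \<le> l ^ 6" using l(1) by (intro power_increasing) auto
      then show "l ^ 4 \<le> sqrt (real n)" using l(4) by linarith
    qed auto
    finally show ?thesis unfolding r2 .
  qed
  obtain b2 where b2: "score_identity M p (haar_bins J) (bin_count p n X) (score_bins p) b2"
    "\<forall>\<theta>\<in>space M. \<bar>b2 \<theta>\<bar> \<le> B * (\<Sum>(j, k)\<in>haar_index J. \<bar>haar_coeff score (j, k)\<bar> / \<sigma> j)"
    using ident[OF set_integrable_score] by blast
  have "B * (\<Sum>(j, k)\<in>haar_index J. \<bar>haar_coeff score (j, k)\<bar> / \<sigma> j) \<le> B * (l * (score_holder * (sqrt (real p) * l\<^sup>2)))"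
    using score_holder_pos smoothness
    by (intro bound haar_coeff_sum_holder[OF set_integrable_score _ _ score_holder]) auto
  also have "\<dots> = B * score_holder * (sqrt (real p) * l ^ 3)" by (simp add: power3_eq_cube power2_eq_square)
  also have "\<dots> \<le> B * score_holder * (sqrt (real n) / l)"
  proof (intro mult_left_mono)
    have "real p * l ^ 8 \<le> sqrt (real n) * sqrt (real n)"
    proof -
      have "real p * l ^ 8 = (real p * l\<^sup>2) * l ^ 6" by (simp flip: power_add)
      also have "\<dots> \<le> sqrt (real n) * sqrt (real n)" using l by (intro mult_mono) auto
      finally show ?thesis .
    qed
    then have "sqrt (real p * l ^ 8) \<le> sqrt (real n)" by (simp add: real_sqrt_le_iff)
    moreover have "sqrt (real p * l ^ 8) = sqrt (real p) * l ^ 4"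
    proof -
      have "sqrt (l ^ 8) = l ^ 4" using l(1) by (intro real_sqrt_unique) (auto simp flip: power_mult)
      then show ?thesis by (simp add: real_sqrt_mult)
    qed
    moreover have "sqrt (real p) * l ^ 4 = (sqrt (real p) * l ^ 3) * l" by (simp add: power3_eq_cube power4_eq_xxxx)
    ultimately show "sqrt (real p) * l ^ 3 \<le> sqrt (real n) / l" using l(1) by (simp add: pos_le_divide_eq)
  qed (use B0 score_holder_pos in auto)
  finally have b2': "\<forall>\<theta>\<in>space M. \<bar>b2 \<theta>\<bar> \<le> B * score_holder * sqrt (real n) / l" using b2(2) by force
  have cong: "measurable M N = measurable (Pi\<^sub>M (haar_index J) (\<lambda>_. lborel)) N" for N
    using measurable_cong_sets[OF hs(2) refl] .
  have wm: "(\<lambda>\<theta>. haar_bins J \<theta> \<mu>) \<in> borel_measurable M" for \<mu> unfolding cong by (rule measurable_haar_bins)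
  have dens: "haar_density J \<theta> x = real p * haar_bins J \<theta> (bin_index p x)" if "x \<in> {0..1}" for \<theta> x
    unfolding p_def by (rule haar_density_eq[OF that])
  have "(\<lambda>\<theta>. int_functional T (haar_density J \<theta>)) \<in> borel_measurable M"
    by (rule measurable_int_functional[OF p, where c = "\<lambda>\<theta> \<mu>. real p * haar_bins J \<theta> \<mu>"]) (use wm dens in auto)
  moreover have "bin_probability p (haar_bins J \<theta>)" for \<theta> unfolding p_def by (rule bin_probability_haar_bins)
  ultimately show ?thesis
    unfolding M_def[symmetric] regular_posterior_def
    using hs(1) wm dens b1(1) b1' b2(1) b2' by blast
qed

text \<open>In the direction of bin \<open>\<mu>\<close> the prior score is \<open>m \<mu>\<close>
  minus the sum of all \<open>m\<close> times \<open>w \<mu>\<close>; as \<open>w^2 \<le> w\<close>,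
  the squares add up to order \<open>p^2\<close>, which is at most \<open>n\<close>. In the
  direction of the score, \<open>p\<close> bounded terms give order \<open>p\<close>, at most
  \<open>sqrt n / l\<close>.\<close>

lemma dirichlet_regular_posterior:
  fixes p n :: nat and m :: "nat \<Rightarrow> real"
  defines "l \<equiv> ln (real n)"
  assumes X: "\<And>i. i \<in> {1..n} \<Longrightarrow> X i \<in> {0..1}" and p: "p > 0"
    and m: "\<And>\<mu>. \<mu> \<in> {1..p} \<Longrightarrow> 0 < m \<mu> \<and> m \<mu> \<le> A"
    and l: "l \<ge> 1" "real p * l\<^sup>2 \<le> sqrt (real n)"
  shows "regular_posterior p n X (posterior (dirichlet_prior p m) (hist_density p) n X) (hist_density p)
    (4 * A\<^sup>2) (2 * A * C * sqrt (real n) / l)"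
proof -
  define M where "M = posterior (dirichlet_prior p m) (hist_density p) n X"
  have m0: "m \<mu> > 0" if "\<mu> \<in> {1..p}" for \<mu> using m[OF that] by simp
  have A0: "A \<ge> 0" using m[of 1] p by force
  have ds: "prob_space M" "sets M = sets (Pi\<^sub>M {1..<p} (\<lambda>_. lborel))" "AE w in M. w \<in> open_simplex p"
    unfolding M_def by (rule dirichlet_score_identity[OF p]; (rule X | rule m0); assumption)+
  define \<omega> where "\<omega> = simplex_bins p"
  define b where "b e w = (\<Sum>\<mu>=1..p. m \<mu> * (e \<mu> - bin_mean p (\<omega> w) e))" for e w
  have \<omega>: "bin_probability p (\<omega> w)" for w unfolding \<omega>_def by (rule bin_probability_simplex_bins[OF p])
  have si: "score_identity M p \<omega> (bin_count p n X) e (b e)" for e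
    unfolding b_def \<omega>_def M_def by (rule dirichlet_score_identity(5)[OF p]; (rule X | rule m0); assumption)
  have p1: "real p \<ge> 1" using p by simp
  have pl: "real p * l \<le> sqrt (real n)"
  proof -
    have "real p * l \<le> real p * l\<^sup>2" using l(1) by (intro mult_left_mono) (auto simp: power2_eq_square)
    then show ?thesis using l(2) by linarith
  qed
  have pr: "real p \<le> sqrt (real n)"
  proof -
    have "real p * 1 \<le> real p * l" using l(1) by (intro mult_left_mono) auto
    then show ?thesis using pl by linarith
  qed
  have b1: "(\<Sum>\<mu>=1..p. (b (\<lambda>\<nu>. if \<nu> = \<mu> then 1 else 0) w)\<^sup>2) \<le> 4 * A\<^sup>2 * real n" for w
  proof -
    have w: "0 \<le> \<omega> w \<mu>" "\<omega> w \<mu> \<le> 1" if "\<mu> \<in> {1..p}" for \<mu>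
      using \<omega>[of w] bin_probability_le_one[OF \<omega> that] that by (auto simp: bin_probability_def less_imp_le)
    have "(b (\<lambda>\<nu>. if \<nu> = \<mu> then 1 else 0) w)\<^sup>2 \<le> 2 * A\<^sup>2 + 2 * (A * real p)\<^sup>2 * \<omega> w \<mu>" if \<mu>: "\<mu> \<in> {1..p}" for \<mu>
    proof -
      let ?e = "\<lambda>\<nu>. if \<nu> = \<mu> then 1 else 0 :: real"
      have pick: "(\<Sum>\<nu>=1..p. f \<nu> * ?e \<nu>) = f \<mu>" for f :: "nat \<Rightarrow> real"
      proof -
        have "(\<Sum>\<nu>=1..p. f \<nu> * ?e \<nu>) = (\<Sum>\<nu>=1..p. if \<nu> = \<mu> then f \<nu> else 0)" by (intro sum.cong) auto
        then show ?thesis using \<mu> by simp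
      qed
      have "b ?e w = (\<Sum>\<nu>=1..p. m \<nu> * ?e \<nu>) - (\<Sum>\<nu>=1..p. m \<nu>) * bin_mean p (\<omega> w) ?e"
        unfolding b_def by (simp only: right_diff_distrib sum_subtractf sum_distrib_right)
      then have be: "b ?e w = m \<mu> + - ((\<Sum>\<nu>=1..p. m \<nu>) * \<omega> w \<mu>)" unfolding bin_mean_def pick by simp
      have ms: "0 \<le> (\<Sum>\<nu>=1..p. m \<nu>)" "(\<Sum>\<nu>=1..p. m \<nu>) \<le> A * real p"
        using m sum_mono[of "{1..p}" m "\<lambda>_. A"] by (auto intro!: sum_nonneg simp: less_imp_le mult.commute)
      have "(b ?e w)\<^sup>2 \<le> 2 * (m \<mu>)\<^sup>2 + 2 * (- ((\<Sum>\<nu>=1..p. m \<nu>) * \<omega> w \<mu>))\<^sup>2"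
        unfolding be by (rule two_square_bound)
      also have "\<dots> = 2 * (m \<mu>)\<^sup>2 + 2 * ((\<Sum>\<nu>=1..p. m \<nu>)\<^sup>2 * (\<omega> w \<mu>)\<^sup>2)" by (simp add: power_mult_distrib)
      also have "\<dots> \<le> 2 * A\<^sup>2 + 2 * ((A * real p)\<^sup>2 * \<omega> w \<mu>)"
      proof (intro add_mono mult_left_mono mult_mono power_mono)
        show "(\<omega> w \<mu>)\<^sup>2 \<le> \<omega> w \<mu>" using w[OF \<mu>] by (simp add: power2_eq_square mult_left_le)
      qed (use m[OF \<mu>] ms w[OF \<mu>] in auto)
      finally show ?thesis by (simp add: mult.assoc)
    qed
    then have "(\<Sum>\<mu>=1..p. (b (\<lambda>\<nu>. if \<nu> = \<mu> then 1 else 0) w)\<^sup>2) \<le> (\<Sum>\<mu>=1..p. 2 * A\<^sup>2 + 2 * (A * real p)\<^sup>2 * \<omega> w \<mu>)"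
      by (rule sum_mono)
    also have "\<dots> = real p * (2 * A\<^sup>2) + 2 * (A * real p)\<^sup>2"
      using \<omega>[of w] by (simp add: sum.distrib bin_probability_def flip: sum_distrib_left)
    also have "\<dots> \<le> 4 * A\<^sup>2 * (real p * real p)"
    proof -
      have "real p * (2 * A\<^sup>2) \<le> real p * (2 * A\<^sup>2) * real p" using p1 by (intro mult_left_mono[of 1 "real p", simplified]) auto
      then show ?thesis by (simp add: power2_eq_square algebra_simps)
    qed
    also have "\<dots> \<le> 4 * A\<^sup>2 * (sqrt (real n) * sqrt (real n))"
      using pr by (intro mult_left_mono mult_mono) auto
    finally show ?thesis by simp
  qed
  have b2: "\<bar>b (score_bins p) w\<bar> \<le> 2 * A * C * sqrt (real n) / l" for w
  proof -
    have "\<bar>b (score_bins p) w\<bar> \<le> (\<Sum>\<mu>=1..p. \<bar>m \<mu> * (score_bins p \<mu> - bin_mean p (\<omega> w) (score_bins p))\<bar>)"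
      unfolding b_def by (rule sum_abs)
    also have "\<dots> \<le> (\<Sum>\<mu>=1..p. A * (2 * C))"
    proof (rule sum_mono)
      fix \<mu> assume \<mu>: "\<mu> \<in> {1..p}"
      have "\<bar>bin_mean p (\<omega> w) (score_bins p)\<bar> \<le> C" by (rule bin_mean_abs_le[OF \<omega> score_average_bound[OF p]])
      then have "\<bar>score_bins p \<mu> - bin_mean p (\<omega> w) (score_bins p)\<bar> \<le> 2 * C"
        using score_average_bound[OF p \<mu>] by linarith
      then show "\<bar>m \<mu> * (score_bins p \<mu> - bin_mean p (\<omega> w) (score_bins p))\<bar> \<le> A * (2 * C)"
        unfolding abs_mult using m[OF \<mu>] by (intro mult_mono) auto
    qed
    also have "\<dots> = 2 * A * C * (real p * l) / l" using l(1) by simp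
    also have "\<dots> \<le> 2 * A * C * sqrt (real n) / l"
      using pl A0 C l(1) by (intro divide_right_mono mult_left_mono) auto
    finally show ?thesis .
  qed
  have cong: "measurable M N = measurable (Pi\<^sub>M {1..<p} (\<lambda>_. lborel)) N" for N
    using measurable_cong_sets[OF ds(2) refl] .
  have wm: "(\<lambda>w. \<omega> w \<mu>) \<in> borel_measurable M" if "\<mu> \<in> {1..p}" for \<mu>
    unfolding cong \<omega>_def by (rule measurable_simplex_bins[OF that])
  have bpm: "(\<lambda>w. real p * bin_probs p w \<mu>) \<in> borel_measurable M" if "\<mu> \<in> {1..p}" for \<mu>
    unfolding cong by (intro borel_measurable_times borel_measurable_const measurable_bin_probs that)
  have "(\<lambda>w. int_functional T (hist_density p w)) \<in> borel_measurable M"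
    by (rule measurable_int_functional[OF p, where c = "\<lambda>w \<mu>. real p * bin_probs p w \<mu>"])
       (rule bpm, assumption, rule hist_density_eq[OF p])
  moreover have "AE w in M. \<forall>x\<in>{0..1}. hist_density p w x = real p * \<omega> w (bin_index p x)"
    using ds(3) by eventually_elim (simp add: hist_density_eq[OF p] \<omega>_def simplex_bins_def)
  ultimately show ?thesis
    unfolding M_def[symmetric] regular_posterior_def
    using ds(1) wm \<omega> si b1 b2
    by (intro conjI exI[of _ \<omega>] exI[of _ "\<lambda>\<mu>. b (\<lambda>\<nu>. if \<nu> = \<mu> then 1 else 0)"] exI[of _ "b (score_bins p)"] ballI) auto
qed

end

text \<open>The conditions on \<open>p\<close> are imposed eventually: near \<open>n = 55\<close>
  the quotient \<open>sqrt n / (ln n)^2\<close> is below 1, and no \<open>p\<close> of the required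
  form exists.\<close>

theorem corollary5:
  fixes f0 :: "real \<Rightarrow> real" and T T' T'' :: "real \<Rightarrow> real \<Rightarrow> real"
    and s \<gamma> c_lo c_hi C \<eta> :: real
    and p J :: "nat \<Rightarrow> nat"
    and \<Psi>0 :: "nat \<Rightarrow> (nat \<Rightarrow> real) \<Rightarrow> real" and v :: real
    and Z :: "nat \<Rightarrow> (nat \<Rightarrow> real) \<Rightarrow> (real \<Rightarrow> real) \<Rightarrow> real"
  assumes "1/2 < s" "s \<le> 1" "f0 \<in> holder_class s"
    and "(LBINT x:{0..1}. f0 x) = 1"
    and "0 < c_lo" "0 < c_hi" "\<And>x. x \<in> {0..1} \<Longrightarrow> c_lo \<le> f0 x \<and> f0 x \<le> c_hi"
    and "continuous_on ({0..1} \<times> UNIV) (\<lambda>(x, u). T x u)"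
    and "\<And>x u. x \<in> {0..1} \<Longrightarrow> (T x has_real_derivative T' x u) (at u)"
    and "\<And>x u. x \<in> {0..1} \<Longrightarrow> (T' x has_real_derivative T'' x u) (at u)"
    and "C > 0" "\<eta> > 0" "\<gamma> > 1/2"
    and "\<And>x y u. x \<in> {0..1} \<Longrightarrow> y \<in> {0..1} \<Longrightarrow>
           u \<in> {Inf (f0 ` {0..1}) - \<eta> <..< Sup (f0 ` {0..1}) + \<eta>} \<Longrightarrow>
           max \<bar>T' x u - T' y u\<bar> \<bar>T x u - T y u\<bar> \<le> C * \<bar>x - y\<bar> powr \<gamma>"
    and "\<And>x u. x \<in> {0..1} \<Longrightarrow>
           u \<in> {Inf (f0 ` {0..1}) - \<eta> <..< Sup (f0 ` {0..1}) + \<eta>} \<Longrightarrow>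
           max \<bar>T x u\<bar> (max \<bar>T' x u\<bar> \<bar>T'' x u\<bar>) \<le> C"
    and "\<Psi>0 = efficient_centring T T' f0"
    and "v = efficient_variance T' f0" "v > 0"
    and "\<forall>\<^sub>F n in sequentially. p n = 2 ^ (J n + 1) \<and>
           real (p n) \<le> sqrt (real n) / (ln (real n))\<^sup>2 \<and>
           (\<forall>i. 2 ^ i \<le> sqrt (real n) / (ln (real n))\<^sup>2 \<longrightarrow> 2 ^ i \<le> p n)"
    and "\<And>n X f. Z n X f = sqrt (real n) * (int_functional T f - \<Psi>0 n X)"
  shows
    "(\<forall>(H :: real \<Rightarrow> real) (\<sigma> :: nat \<Rightarrow> nat \<Rightarrow> real).
        let \<sigma>min = (\<lambda>n. Min (\<sigma> n ` {..J n}));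
            prior = (\<lambda>n. haar_prior (J n) H (\<sigma> n));
            dens = (\<lambda>n. haar_density (J n));
            \<Delta> = (\<lambda>n X. d_BL (posterior_law (prior n) (dens n) n X (Z n X)) (normal_law 0 v))
        in (\<forall>n. \<forall>j\<in>{..J n}. \<sigma> n j > 0) \<and>
           (\<forall>x. H differentiable (at x)) \<and> bounded (range (deriv H)) \<and>
           (\<lambda>n. 1 / (sqrt (real (p n)) * (ln (real n))\<^sup>2)) \<in> o(\<sigma>min) \<and>
           posterior_well_defined f0 prior dens
           \<longrightarrow>
           big_Op (sample_law f0) \<Delta>
             (\<lambda>n. real (p n) powr (- min s \<gamma>) * sqrt (real (p n) * ln (real n))
                + real (p n) * ln (real n) / sqrt (real n)
                + sqrt (real n) * real (p n) powr (- 2 * s)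
                + sqrt (real n) * real (p n) powr (- (s + \<gamma>))
                + inverse (\<sigma>min n) * sqrt (real (p n) / real n)) \<and>
           big_Op (sample_law f0) \<Delta> (\<lambda>n. 1 / ln (real n)) \<and>
           small_op (sample_law f0) \<Delta> (\<lambda>_. 1) \<and>
           bvm_phenomenon f0 prior dens (\<lambda>n. int_functional T) \<Psi>0 v)
     \<and>
     (\<forall>(m :: nat \<Rightarrow> nat \<Rightarrow> real).
        let prior = (\<lambda>n. dirichlet_prior (p n) (m n));
            dens = (\<lambda>n. hist_density (p n));
            \<Delta> = (\<lambda>n X. d_BL (posterior_law (prior n) (dens n) n X (Z n X)) (normal_law 0 v))
        in (\<forall>n. \<forall>\<mu>\<in>{1..p n}. m n \<mu> > 0) \<and>
           (\<lambda>n. Max ((\<lambda>\<mu>. \<bar>m n \<mu>\<bar>) ` {1..p n})) \<in> O(\<lambda>_. 1)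
           \<longrightarrow>
           big_Op (sample_law f0) \<Delta>
             (\<lambda>n. real (p n) powr (- min s \<gamma>) * sqrt (real (p n) * ln (real n))
                + real (p n) * ln (real n) / sqrt (real n)
                + sqrt (real n) * real (p n) powr (- 2 * s)
                + sqrt (real n) * real (p n) powr (- (s + \<gamma>))) \<and>
           big_Op (sample_law f0) \<Delta> (\<lambda>n. 1 / ln (real n)) \<and>
           small_op (sample_law f0) \<Delta> (\<lambda>_. 1) \<and>
           bvm_phenomenon f0 prior dens (\<lambda>n. int_functional T) \<Psi>0 v)"
proof -
  note f0_holder = assms(3) and f0_bounds = assms(7) and T_holder = assms(14) and T_bound = assms(15)
  obtain L where L: "\<forall>x\<in>{0..1}. \<forall>y\<in>{0..1}. \<bar>f0 x - f0 y\<bar> \<le> L * \<bar>x - y\<bar> powr s"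
    using f0_holder unfolding holder_class_def by blast
  \<comment> \<open>The class provides a constant of unspecified sign, while the locale asks for a
    nonnegative one.\<close>
  have L': "\<bar>f0 x - f0 y\<bar> \<le> \<bar>L\<bar> * \<bar>x - y\<bar> powr s" if "x \<in> {0..1}" "y \<in> {0..1}" for x y
  proof -
    have "L * \<bar>x - y\<bar> powr s \<le> \<bar>L\<bar> * \<bar>x - y\<bar> powr s" by (intro mult_right_mono) auto
    then show ?thesis using L that by force
  qed
  have range: "f0 z \<in> {Inf (f0 ` {0..1}) - \<eta> <..< Sup (f0 ` {0..1}) + \<eta>}" if z: "z \<in> {0..1}" for z
  proof -
    have "bdd_below (f0 ` {0..1})" "bdd_above (f0 ` {0..1})"
      using f0_bounds by (auto intro!: bdd_belowI2[of _ c_lo] bdd_aboveI2[of _ _ c_hi])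
    then have "Inf (f0 ` {0..1}) \<le> f0 z" "f0 z \<le> Sup (f0 ` {0..1})"
      using z by (auto intro: cInf_lower cSup_upper)
    then show ?thesis using \<open>\<eta> > 0\<close> by auto
  qed
  interpret smooth_functional f0 T T' T'' s \<gamma> C \<eta> "\<bar>L\<bar>" c_lo
  proof
    show "\<bar>T' x (f0 z) - T' y (f0 z)\<bar> \<le> C * \<bar>x - y\<bar> powr \<gamma>"
      if "x \<in> {0..1}" "y \<in> {0..1}" "z \<in> {0..1}" for x y z
      using T_holder[OF that(1,2) range[OF that(3)]] by simp
    show "\<bar>T x u\<bar> \<le> C \<and> \<bar>T' x u\<bar> \<le> C \<and> \<bar>T'' x u\<bar> \<le> C"
      if "x \<in> {0..1}" "u \<in> {Inf (f0 ` {0..1}) - \<eta> <..< Sup (f0 ` {0..1}) + \<eta>}" for x u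
      using T_bound[OF that] by simp
  qed (use assms L' in auto)
  note p = assms(19)
  have grid: "bin_grid p" by (rule bin_gridI[OF p])
  have Z: "Z n X = (\<lambda>f. sqrt (real n) * (int_functional T f - efficient_centring T T' f0 n X))" for n X
    using assms(16,20) by (simp add: fun_eq_iff)
  \<comment> \<open>From the lower half of the grid condition: the second summand of the stated rate
    dominates \<open>1 / ln n\<close> up to the factor 2.\<close>
  have log_rate: "\<forall>\<^sub>F n in sequentially. 0 \<le> 1 / ln (real n) \<and>
      1 / ln (real n) \<le> 2 * (real (p n) * ln (real n) / sqrt (real n))"
    using grid[unfolded bin_grid_def]
  proof eventually_elim
    case (elim n)
    have l: "ln (real n) > 0" using elim by linarith
    have "real n > 1" using l by (cases "n = 0") (auto simp: ln_gt_zero_iff)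
    then have r: "sqrt (real n) > 0" by simp
    have "sqrt (real n) \<le> 2 * (real (p n) * ln (real n)) * ln (real n)" using elim by (simp add: power2_eq_square mult_ac)
    then show ?case using l r by (simp add: field_simps)
  qed
  \<comment> \<open>Shared by both priors: the remaining summands of the stated rates are
    nonnegative, so it suffices that \<open>\<rho>\<close> dominates
    \<open>p * ln n / sqrt n\<close>.\<close>
  have consequences: "big_Op (sample_law f0) \<Delta> \<rho> \<and> big_Op (sample_law f0) \<Delta> (\<lambda>n. 1 / ln (real n)) \<and>
      small_op (sample_law f0) \<Delta> (\<lambda>_. 1)"
    if rate: "big_Op (sample_law f0) \<Delta> (\<lambda>n. 1 / ln (real n))"
      and \<rho>: "\<And>n. real (p n) * ln (real n) / sqrt (real n) \<le> \<rho> n" for \<Delta> \<rho>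
  proof (intro conjI rate)
    show "big_Op (sample_law f0) \<Delta> \<rho>"
    proof (rule big_Op_weaken[OF rate, where c = 2])
      show "\<forall>\<^sub>F n in sequentially. 0 \<le> 1 / ln (real n) \<and> 1 / ln (real n) \<le> 2 * \<rho> n"
        using log_rate
      proof eventually_elim
        case (elim n)
        then show ?case using \<rho>[of n] by linarith
      qed
    qed simp
    have "(\<lambda>n. 1 / ln (real n)) \<longlonglongrightarrow> 0" by real_asymp
    then show "small_op (sample_law f0) \<Delta> (\<lambda>_. 1)" by (rule small_op_of_big_Op[OF rate])
  qed
  have log6: "\<forall>\<^sub>F n in sequentially. ln (real n) ^ 6 \<le> sqrt (real n)" by real_asymp
  have bvm: "bvm_phenomenon f0 prior dens (\<lambda>n. int_functional T) \<Psi>0 v"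
    if "small_op (sample_law f0) (\<lambda>n X. d_BL (posterior_law (prior n) (dens n) n X (Z n X)) (normal_law 0 v)) (\<lambda>_. 1)"
    for prior :: "nat \<Rightarrow> 'b measure" and dens
    using that unfolding bvm_phenomenon_def Z assms(16) .
  have haar: "big_Op (sample_law f0) (\<lambda>n X. d_BL (posterior_law (haar_prior (J n) H (\<sigma> n)) (haar_density (J n)) n X (Z n X)) (normal_law 0 v))
      (\<lambda>n. 1 / ln (real n))"
    if \<sigma>: "\<forall>n. \<forall>j\<in>{..J n}. \<sigma> n j > 0" and H: "\<forall>x. H differentiable (at x)" and dH: "bounded (range (deriv H))"
      and small: "(\<lambda>n. 1 / (sqrt (real (p n)) * (ln (real n))\<^sup>2)) \<in> o(\<lambda>n. Min (\<sigma> n ` {..J n}))"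
      and ill: "posterior_well_defined f0 (\<lambda>n. haar_prior (J n) H (\<sigma> n)) (\<lambda>n. haar_density (J n))"
    for H :: "real \<Rightarrow> real" and \<sigma> :: "nat \<Rightarrow> nat \<Rightarrow> real"
  proof -
    obtain B where B: "\<And>x. \<bar>deriv H x\<bar> \<le> B"
      using dH unfolding bounded_iff by auto
    show ?thesis
    unfolding Z
  proof (rule bvm_rate[OF grid assms(17,18) ill, where K = "B\<^sup>2" and G = "B * score_holder"])
    show "0 \<le> B\<^sup>2" by simp
    have "\<forall>\<^sub>F n in sequentially. norm (1 / (sqrt (real (p n)) * (ln (real n))\<^sup>2)) \<le> 1 * norm (Min (\<sigma> n ` {..J n}))"
      by (rule landau_o.smallD[OF small]) simp
    then show "\<forall>\<^sub>F n in sequentially. \<forall>X\<in>space (sample_law f0 n). evidence (haar_prior (J n) H (\<sigma> n)) (haar_density (J n)) n X \<noteq> \<infinity> \<longrightarrow>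
      regular_posterior (p n) n X (posterior (haar_prior (J n) H (\<sigma> n)) (haar_density (J n)) n X) (haar_density (J n)) (B\<^sup>2)
        (B * score_holder * sqrt (real n) / ln (real n))"
      using grid[unfolded bin_grid_def] p log6
    proof eventually_elim
      case (elim n)
      define l where "l = ln (real n)"
      define \<tau> where "\<tau> = Min (\<sigma> n ` {..J n})"
      have pn: "p n = 2 ^ Suc (J n)" using elim by simp
      have l: "l \<ge> 1" "real (p n) * l\<^sup>2 \<le> sqrt (real n)" "l ^ 6 \<le> sqrt (real n)" and p0: "p n > 0"
        using elim by (auto simp: l_def)
      have "\<tau> \<in> \<sigma> n ` {..J n}" unfolding \<tau>_def by (intro Min_in) auto
      then have \<tau>: "\<tau> > 0" using \<sigma> by auto
      have \<tau>le: "\<tau> \<le> \<sigma> n j" if "j \<le> J n" for j unfolding \<tau>_def using that by (intro Min_le) auto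
      define q where "q = sqrt (real (p n)) * l\<^sup>2"
      have q: "q > 0" using p0 l(1) by (simp add: q_def)
      \<comment> \<open>This is the little-o condition on the smallest scale, used with the constant
        1.\<close>
      have "1 / q \<le> \<tau>" using elim \<tau> q by (simp add: q_def l_def \<tau>_def[symmetric])
      then have \<tau>q: "1 / \<tau> \<le> q" using \<tau> q by (simp add: field_simps)
      \<comment> \<open>The number of levels is logarithmic:
        \<open>2^(J + 1) = p \<le> sqrt n\<close>, and \<open>ln 2\<close> exceeds one half.\<close>
      have J: "real (J n + 1) \<le> l"
      proof -
        have n: "n > 0" using l(1) by (cases "n = 0") (auto simp: l_def)
        have "real (p n) * 1 \<le> real (p n) * l\<^sup>2" using l(1) by (intro mult_left_mono) auto
        then have "real (p n) \<le> sqrt (real n)" using l(2) by linarith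
        then have "ln (real (p n)) \<le> ln (sqrt (real n))" using p0 n by simp
        also have "\<dots> = l / 2" using n by (simp add: l_def ln_sqrt)
        also have "ln (real (p n)) = real (J n + 1) * ln 2"
          using ln_realpow[of 2 "Suc (J n)"] by (simp add: pn del: power_Suc)
        finally have "real (J n + 1) * ln 2 \<le> l / 2" .
        moreover have "real (J n + 1) * (1 / 2) \<le> real (J n + 1) * ln 2"
          using ln2_ge_two_thirds by (intro mult_left_mono) auto
        ultimately have "real (J n + 1) * (1 / 2) \<le> l / 2" by (rule order_trans[rotated])
        then show ?thesis by simp
      qed
      show ?case
      proof (intro ballI impI)
        fix X assume X: "X \<in> space (sample_law f0 n)"
          and ev: "evidence (haar_prior (J n) H (\<sigma> n)) (haar_density (J n)) n X \<noteq> \<infinity>"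
        show "regular_posterior (p n) n X (posterior (haar_prior (J n) H (\<sigma> n)) (haar_density (J n)) n X) (haar_density (J n)) (B\<^sup>2)
          (B * score_holder * sqrt (real n) / ln (real n))"
          unfolding pn
        proof (rule haar_regular_posterior[OF space_sample_law[OF X] ev _ B \<tau> \<tau>le])
          show "H differentiable at x" for x using H by simp
          show "1 / \<tau> \<le> sqrt (real (2 ^ Suc (J n))) * (ln (real n))\<^sup>2"
            using \<tau>q unfolding q_def pn l_def .
        qed (use l J in \<open>simp_all only: pn l_def\<close>)
      qed
    qed
  qed
  qed
  have dirichlet: "big_Op (sample_law f0) (\<lambda>n X. d_BL (posterior_law (dirichlet_prior (p n) (m n)) (hist_density (p n)) n X (Z n X)) (normal_law 0 v))
      (\<lambda>n. 1 / ln (real n))"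
    if m: "\<forall>n. \<forall>\<mu>\<in>{1..p n}. m n \<mu> > 0" and mO: "(\<lambda>n. Max ((\<lambda>\<mu>. \<bar>m n \<mu>\<bar>) ` {1..p n})) \<in> O(\<lambda>_. 1)"
    for m :: "nat \<Rightarrow> nat \<Rightarrow> real"
    unfolding Z
  proof -
    obtain A where "\<forall>\<^sub>F n in sequentially. norm (Max ((\<lambda>\<mu>. \<bar>m n \<mu>\<bar>) ` {1..p n})) \<le> A * norm (1 :: real)"
      using landau_o.bigE[OF mO] by blast
    with grid[unfolded bin_grid_def]
    have good: "\<forall>\<^sub>F n in sequentially. \<forall>X\<in>space (sample_law f0 n).
      evidence (dirichlet_prior (p n) (m n)) (hist_density (p n)) n X \<noteq> \<infinity> \<and>
      regular_posterior (p n) n X (posterior (dirichlet_prior (p n) (m n)) (hist_density (p n)) n X) (hist_density (p n)) (4 * A\<^sup>2)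
        (2 * A * C * sqrt (real n) / ln (real n))"
    proof eventually_elim
      case (elim n)
      have p0: "p n > 0" using elim by simp
      have mA: "0 < m n \<mu> \<and> m n \<mu> \<le> A" if "\<mu> \<in> {1..p n}" for \<mu>
      proof -
        have "\<bar>m n \<mu>\<bar> \<le> Max ((\<lambda>\<mu>. \<bar>m n \<mu>\<bar>) ` {1..p n})" using that by (intro Max_ge) auto
        also have "\<dots> \<le> norm (Max ((\<lambda>\<mu>. \<bar>m n \<mu>\<bar>) ` {1..p n}))" unfolding real_norm_def by (rule abs_ge_self)
        also have "\<dots> \<le> A * norm (1 :: real)" using elim by blast
        finally have "m n \<mu> \<le> A" by simp
        then show ?thesis using m that by blast
      qed
      show ?case
      proof (intro ballI conjI)
        fix X assume X: "X \<in> space (sample_law f0 n)"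
        show "evidence (dirichlet_prior (p n) (m n)) (hist_density (p n)) n X \<noteq> \<infinity>"
          using mA by (intro dirichlet_score_identity(4)[OF p0 space_sample_law[OF X]]) auto
        show "regular_posterior (p n) n X (posterior (dirichlet_prior (p n) (m n)) (hist_density (p n)) n X) (hist_density (p n)) (4 * A\<^sup>2)
          (2 * A * C * sqrt (real n) / ln (real n))"
          using elim by (intro dirichlet_regular_posterior[OF space_sample_law[OF X] p0 mA]) auto
      qed
    qed
    show "big_Op (sample_law f0) (\<lambda>n X. d_BL (posterior_law (dirichlet_prior (p n) (m n)) (hist_density (p n)) n X
        (\<lambda>f. sqrt (real n) * (int_functional T f - efficient_centring T T' f0 n X))) (normal_law 0 v)) (\<lambda>n. 1 / ln (real n))"
    proof (rule bvm_rate[OF grid assms(17,18), where K = "4 * A\<^sup>2" and G = "2 * A * C"])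
      \<comment> \<open>For large \<open>n\<close> the Dirichlet evidence is finite at every sample,
        so the exceptional set is empty.\<close>
      show "posterior_well_defined f0 (\<lambda>n. dirichlet_prior (p n) (m n)) (\<lambda>n. hist_density (p n))"
        unfolding posterior_well_defined_def
      proof (rule tendsto_eventually)
        show "\<forall>\<^sub>F n in sequentially. outer_prob (sample_law f0 n)
          {X \<in> space (sample_law f0 n). evidence (dirichlet_prior (p n) (m n)) (hist_density (p n)) n X = \<infinity>} = 0"
          using good
        proof eventually_elim
          case (elim n)
          have empty: "outer_prob (sample_law f0 n) {} = 0"
            using outer_prob_le[of "{}" "sample_law f0 n" "{}"] outer_prob_nonneg[of "{}" "sample_law f0 n"] by simp
          have "{X \<in> space (sample_law f0 n). evidence (dirichlet_prior (p n) (m n)) (hist_density (p n)) n X = \<infinity>} = {}"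
            using elim by blast
          then show ?case using empty by (simp only:)
        qed
      qed
    qed (use good in \<open>auto elim: eventually_mono\<close>)
  qed
  show ?thesis
  proof (intro conjI allI; unfold Let_def; intro impI)
    fix H :: "real \<Rightarrow> real" and \<sigma> :: "nat \<Rightarrow> nat \<Rightarrow> real"
    assume hyp: "(\<forall>n. \<forall>j\<in>{..J n}. \<sigma> n j > 0) \<and> (\<forall>x. H differentiable (at x)) \<and> bounded (range (deriv H)) \<and>
       (\<lambda>n. 1 / (sqrt (real (p n)) * (ln (real n))\<^sup>2)) \<in> o(\<lambda>n. Min (\<sigma> n ` {..J n})) \<and>
       posterior_well_defined f0 (\<lambda>n. haar_prior (J n) H (\<sigma> n)) (\<lambda>n. haar_density (J n))"
    let ?\<Delta> = "\<lambda>n X. d_BL (posterior_law (haar_prior (J n) H (\<sigma> n)) (haar_density (J n)) n X (Z n X)) (normal_law 0 v)"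
    let ?\<rho> = "\<lambda>n. real (p n) powr (- min s \<gamma>) * sqrt (real (p n) * ln (real n))
                + real (p n) * ln (real n) / sqrt (real n)
                + sqrt (real n) * real (p n) powr (- 2 * s)
                + sqrt (real n) * real (p n) powr (- (s + \<gamma>))
                + inverse (Min (\<sigma> n ` {..J n})) * sqrt (real (p n) / real n)"
    have rate: "big_Op (sample_law f0) ?\<Delta> (\<lambda>n. 1 / ln (real n))" using hyp by (intro haar) blast+
    have "real (p n) * ln (real n) / sqrt (real n) \<le> ?\<rho> n" for n
    proof -
      have "Min (\<sigma> n ` {..J n}) \<in> \<sigma> n ` {..J n}" by (intro Min_in) auto
      then have "0 < Min (\<sigma> n ` {..J n})" using hyp by auto
      then have "0 \<le> inverse (Min (\<sigma> n ` {..J n})) * sqrt (real (p n) / real n)"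
        by (intro mult_nonneg_nonneg) (simp_all only: inverse_nonnegative_iff_nonnegative less_imp_le, simp)
      \<comment> \<open>\<open>sqrt\<close> preserves signs on the reals, so the sign of
        \<open>ln (real n)\<close> counts; it is nonnegative from 1 on, and \<open>n = 0\<close> is
        looked at separately.\<close>
      moreover have "0 \<le> real (p n) powr (- min s \<gamma>) * sqrt (real (p n) * ln (real n))"
        by (cases "n = 0") auto
      moreover have "0 \<le> sqrt (real n) * real (p n) powr (- 2 * s)" "0 \<le> sqrt (real n) * real (p n) powr (- (s + \<gamma>))" by simp_all
      ultimately show ?thesis by linarith
    qed
    note c = consequences[OF rate this]
    then have "bvm_phenomenon f0 (\<lambda>n. haar_prior (J n) H (\<sigma> n)) (\<lambda>n. haar_density (J n)) (\<lambda>n. int_functional T) \<Psi>0 v"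
      by (intro bvm) blast
    with c show "big_Op (sample_law f0) ?\<Delta> ?\<rho> \<and> big_Op (sample_law f0) ?\<Delta> (\<lambda>n. 1 / ln (real n)) \<and>
      small_op (sample_law f0) ?\<Delta> (\<lambda>_. 1) \<and>
      bvm_phenomenon f0 (\<lambda>n. haar_prior (J n) H (\<sigma> n)) (\<lambda>n. haar_density (J n)) (\<lambda>n. int_functional T) \<Psi>0 v"
      by blast
  next
    fix m :: "nat \<Rightarrow> nat \<Rightarrow> real"
    assume hyp: "(\<forall>n. \<forall>\<mu>\<in>{1..p n}. m n \<mu> > 0) \<and> (\<lambda>n. Max ((\<lambda>\<mu>. \<bar>m n \<mu>\<bar>) ` {1..p n})) \<in> O(\<lambda>_. 1)"
    let ?\<Delta> = "\<lambda>n X. d_BL (posterior_law (dirichlet_prior (p n) (m n)) (hist_density (p n)) n X (Z n X)) (normal_law 0 v)"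
    let ?\<rho> = "\<lambda>n. real (p n) powr (- min s \<gamma>) * sqrt (real (p n) * ln (real n))
                + real (p n) * ln (real n) / sqrt (real n)
                + sqrt (real n) * real (p n) powr (- 2 * s)
                + sqrt (real n) * real (p n) powr (- (s + \<gamma>))"
    have rate: "big_Op (sample_law f0) ?\<Delta> (\<lambda>n. 1 / ln (real n))" using hyp by (intro dirichlet) blast+
    have "real (p n) * ln (real n) / sqrt (real n) \<le> ?\<rho> n" for n
    proof -
      have "0 \<le> real (p n) powr (- min s \<gamma>) * sqrt (real (p n) * ln (real n))"
        by (cases "n = 0") auto
      moreover have "0 \<le> sqrt (real n) * real (p n) powr (- 2 * s)" "0 \<le> sqrt (real n) * real (p n) powr (- (s + \<gamma>))" by simp_all
      ultimately show ?thesis by linarith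
    qed
    note c = consequences[OF rate this]
    then have "bvm_phenomenon f0 (\<lambda>n. dirichlet_prior (p n) (m n)) (\<lambda>n. hist_density (p n)) (\<lambda>n. int_functional T) \<Psi>0 v"
      by (intro bvm) blast
    with c show "big_Op (sample_law f0) ?\<Delta> ?\<rho> \<and> big_Op (sample_law f0) ?\<Delta> (\<lambda>n. 1 / ln (real n)) \<and>
      small_op (sample_law f0) ?\<Delta> (\<lambda>_. 1) \<and>
      bvm_phenomenon f0 (\<lambda>n. dirichlet_prior (p n) (m n)) (\<lambda>n. hist_density (p n)) (\<lambda>n. int_functional T) \<Psi>0 v"
      by blast
  qed
qed

end
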